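(* Let $(\beta_p)_{p\ge 2}$ be real numbers with $\sum_{p\ge2}2^p\beta_p^2<\infty$, and let $\xi(u)=\sum_{p\ge 2}\beta_p^2u^p$. Let $\mu\in M[0,1]$ and $$\Gamma_\mu(u)=\mathbb E\,(\partial_x\Phi_\mu(M(u),u))^2\exp W_\mu(u),\quad u\in[0,1].$$ Then $\Gamma_\mu$ is differentiable on $[0,1]$ and $\Gamma_\mu'$ is continuous, with $$\Gamma_\mu'(u)=\xi''(u)\,\mathbb E\,(\partial_x^2\Phi_\mu(M(u),u))^2\exp W_\mu(u).$$ Moreover, for $u\in[0,1)$, $$\lim_{h\to0+}\frac{\Gamma_\mu'(u+h)-\Gamma_\mu'(u)}h=\gamma_{1,\mu}(u)-\mu([0,u])\,\gamma_{2,\mu}(u),$$ and for $u\in(0,1]$, $$\lim_{h\to0-}\frac{\Gamma_\mu'(u+h)-\Gamma_\mu'(u)}h=\gamma_{1,\mu}(u)-\mu([0,u))\,\gamma_{2,\mu}(u),$$ where $$\gamma_{1,\mu}(u)=\xi'''(u)\,\mathbb E(\partial_x^2\Phi_\mu(M(u),u))^2\exp W_\mu(u)+\xi''(u)^2\,\mathbb E(\partial_x^3\Phi_\mu(M(u),u))^2\exp W_\mu(u),$$ $$\gamma_{2,\mu}(u)=2\xi''(u)^2\,\mathbb E(\partial_x^2\Phi_\mu(M(u),u))^3\exp W_\mu(u).$$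
   Context: $M[0,1]$ is the set of Borel probability measures on $[0,1]$ with the metric $d(\mu,\mu')=\int_0^1|\mu([0,u])-\mu'([0,u])|\,du$; $M_d[0,1]\subset M[0,1]$ is the subset of measures with finitely many atoms (and nothing else). Parisi PDE solution. For $\mu\in M_d[0,1]$ with atoms $0\le q_1<\dots<q_{k+1}\le 1$ ($k\ge0$), put $m_p=\mu([0,q_p])$ for $1\le p\le k+1$, $m_0=0$, $q_0=0$, $q_{k+2}=1$. Define $\Phi_\mu:\mathbb R\times[0,1]\to\mathbb R$ by $\Phi_\mu(x,u)=\log\cosh x+\frac12(\xi'(1)-\xi'(u))$ for $q_{k+1}\le u\le1$ and recursively, for $p=k,k-1,\dots,0$ and $q_p\le u<q_{p+1}$, $$\Phi_\mu(x,u)=\frac1{m_p}\log\mathbb E\exp m_p\Phi_\mu\big(x+z\sqrt{\xi'(q_{p+1})-\xi'(u)},\,q_{p+1}\big),$$ $z$ a standard Gaussian, where for $m_p=0$ the right side means $\mathbb E\,\Phi_\mu(x+z\sqrt{\xi'(q_{p+1})-\xi'(u)},q_{p+1})$. (This solves $\partial_u\Phi_\mu=-\frac{\xi''(u)}2(\partial_x^2\Phi_\mu+\mu([0,u])(\partial_x\Phi_\mu)^2)$ with $\Phi_\mu(x,1)=\log\cosh x$.) The map $\mu\mapsto\Phi_\mu$ is known to be Lipschitz from $(M_d[0,1],d)$ to $C(\mathbb R\times[0,1])$ with the uniform distance, and $\Phi_\mu$ for general $\mu\in M[0,1]$ is defined by continuous extension. All $x$-derivatives $\partial_x^j\Phi_\mu$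 exist and are continuous on $\mathbb R\times[0,1]$. Let $B=(B(t))_{t\ge0}$ be a standard Brownian motion (started at $0$), $M(u)=B(\xi'(u))$ for $u\in[0,1]$, and $$W_\mu(u)=\int_{[0,u]}\big(\Phi_\mu(M(u),u)-\Phi_\mu(M(t),t)\big)\,d\mu(t),\quad u\in[0,1].$$ Derivatives at the endpoints of $[0,1]$ are one-sided. *)

theory Defs
  imports "HOL-Probability.Probability"
begin

definition mixture :: "(nat \<Rightarrow> real) \<Rightarrow> real \<Rightarrow> real" where
  "mixture \<beta> u = (\<Sum>p. (\<beta> (p + 2))\<^sup>2 * u ^ (p + 2))"

definition unit_measures :: "real measure set" where
  "unit_measures = {\<mu>. prob_space \<mu> \<and> sets \<mu> = sets borel \<and> measure \<mu> {0..1} = 1}"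

definition discrete_unit_measures :: "real measure set" where
  "discrete_unit_measures =
     {\<mu> \<in> unit_measures. \<exists>S. finite S \<and> S \<subseteq> {0..1} \<and> measure \<mu> S = 1}"

definition cdf_dist :: "real measure \<Rightarrow> real measure \<Rightarrow> real" where
  "cdf_dist \<mu> \<nu> = (LINT u:{0..1}|lborel. \<bar>measure \<mu> {0..u} - measure \<nu> {0..u}\<bar>)"

definition atoms :: "real measure \<Rightarrow> real set" where
  "atoms \<mu> = {q. measure \<mu> {q} > 0}"

text \<open>For discrete \<open>\<mu>\<close> with \<open>k + 1\<close> atoms, \<open>atom \<mu> p\<close> and \<open>atom_cdf \<mu> p\<close> are
  \<open>q\<^sub>p\<close> and \<open>m\<^sub>p\<close>, with the conventions \<open>q\<^sub>0 = 0\<close> (not an atom in general), \<open>m\<^sub>0 = 0\<close>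
  and \<open>q\<^sub>p = 1\<close> beyond the last atom.\<close>

definition atom :: "real measure \<Rightarrow> nat \<Rightarrow> real" where
  "atom \<mu> p = (if p = 0 then 0
     else if p \<le> card (atoms \<mu>) then sorted_list_of_set (atoms \<mu>) ! (p - 1) else 1)"

definition atom_cdf :: "real measure \<Rightarrow> nat \<Rightarrow> real" where
  "atom_cdf \<mu> p = (if p = 0 then 0 else measure \<mu> {0..atom \<mu> p})"

definition gaussian_step :: "real \<Rightarrow> real \<Rightarrow> (real \<Rightarrow> real) \<Rightarrow> real \<Rightarrow> real" where
  "gaussian_step m v f x =
     (if m = 0 then (LINT z|std_normal_distribution. f (x + z * sqrt v))
      else ln (LINT z|std_normal_distribution. exp (m * f (x + z * sqrt v))) / m)"

text \<open>\<open>parisi_layer \<xi> \<mu> p\<close> is the formula valid for \<open>q\<^sub>p \<le> u < q\<^sub>p\<^sub>+\<^sub>1\<close>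
  (for \<open>q\<^sub>p \<le> u \<le> 1\<close> if \<open>q\<^sub>p\<close> is the last atom).\<close>

function parisi_layer ::
  "(real \<Rightarrow> real) \<Rightarrow> real measure \<Rightarrow> nat \<Rightarrow> real \<Rightarrow> real \<Rightarrow> real" where
  "parisi_layer \<xi> \<mu> p x u =
     (if card (atoms \<mu>) \<le> p then ln (cosh x) + (deriv \<xi> 1 - deriv \<xi> u) / 2
      else gaussian_step (atom_cdf \<mu> p) (deriv \<xi> (atom \<mu> (Suc p)) - deriv \<xi> u)
             (\<lambda>y. parisi_layer \<xi> \<mu> (Suc p) y (atom \<mu> (Suc p))) x)"
  by pat_completeness auto
termination
  by (relation "Wellfounded.measure (\<lambda>(\<xi>, \<mu>, p, x, u). card (atoms \<mu>) - p)") auto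

declare parisi_layer.simps [simp del]

text \<open>The number of atoms in \<open>[0, u]\<close> is the \<open>p\<close> with \<open>q\<^sub>p \<le> u < q\<^sub>p\<^sub>+\<^sub>1\<close>.\<close>

definition parisi_discrete :: "(real \<Rightarrow> real) \<Rightarrow> real measure \<Rightarrow> real \<times> real \<Rightarrow> real" where
  "parisi_discrete \<xi> \<mu> = (\<lambda>(x, u). parisi_layer \<xi> \<mu> (card {q \<in> atoms \<mu>. q \<le> u}) x u)"

text \<open>The continuous extension to all of \<^const>\<open>unit_measures\<close>: the uniform limit along discrete
  \<open>\<nu>\<close> with \<open>cdf_dist \<nu> \<mu> \<rightarrow> 0\<close>. Extensionality only fixes the irrelevant values off
  \<open>\<real> \<times> [0, 1]\<close>, so that the limit is unique as a total function.\<close>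

definition parisi_solution :: "(real \<Rightarrow> real) \<Rightarrow> real measure \<Rightarrow> real \<times> real \<Rightarrow> real" where
  "parisi_solution \<xi> \<mu> = (THE \<Phi>. \<Phi> \<in> extensional (UNIV \<times> {0..1}) \<and>
     uniform_limit (UNIV \<times> {0..1}) (parisi_discrete \<xi>) \<Phi>
       (inf (filtercomap (\<lambda>\<nu>. cdf_dist \<nu> \<mu>) (nhds 0)) (principal discrete_unit_measures)))"

definition parisi_dx :: "nat \<Rightarrow> (real \<Rightarrow> real) \<Rightarrow> real measure \<Rightarrow> real \<Rightarrow> real \<Rightarrow> real" where
  "parisi_dx j \<xi> \<mu> x u = (deriv ^^ j) (\<lambda>y. parisi_solution \<xi> \<mu> (y, u)) x"

text \<open>All paths, not just almost all, are required to be continuous: the underlying space need not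
  be complete, and functionals of the whole path have to be measurable.\<close>

locale brownian_motion = prob_space P for P :: "'a measure" +
  fixes B :: "real \<Rightarrow> 'a \<Rightarrow> real"
  assumes random_variable_B: "0 \<le> t \<Longrightarrow> random_variable borel (B t)"
    and start_zero: "AE \<omega> in P. B 0 \<omega> = 0"
    and normal_increments: "0 \<le> s \<Longrightarrow> s < t \<Longrightarrow>
      distributed P lborel (\<lambda>\<omega>. B t \<omega> - B s \<omega>) (normal_density 0 (sqrt (t - s)))"
    and indep_increments: "0 \<le> \<tau> 0 \<Longrightarrow> (\<And>i. i < n \<Longrightarrow> \<tau> i \<le> \<tau> (Suc i)) \<Longrightarrow>
      indep_vars (\<lambda>_. borel) (\<lambda>i \<omega>. B (\<tau> (Suc i)) \<omega> - B (\<tau> i) \<omega>) {..<n :: nat}"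
    and continuous_paths: "\<omega> \<in> space P \<Longrightarrow> continuous_on {0..} (\<lambda>t. B t \<omega>)"

definition time_changed ::
  "(real \<Rightarrow> real) \<Rightarrow> (real \<Rightarrow> 'a \<Rightarrow> real) \<Rightarrow> real \<Rightarrow> 'a \<Rightarrow> real" where
  "time_changed \<xi> B u \<omega> = B (deriv \<xi> u) \<omega>"

definition parisi_weight ::
  "(real \<Rightarrow> real) \<Rightarrow> real measure \<Rightarrow> (real \<Rightarrow> 'a \<Rightarrow> real) \<Rightarrow> real \<Rightarrow> 'a \<Rightarrow> real" where
  "parisi_weight \<xi> \<mu> B u \<omega> = (LINT t:{0..u}|\<mu>.
     parisi_solution \<xi> \<mu> (time_changed \<xi> B u \<omega>, u)
     - parisi_solution \<xi> \<mu> (time_changed \<xi> B t \<omega>, t))"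

text \<open>\<open>parisi_moment j n\<close> is \<open>E (\<partial>\<^sub>x\<^sup>j \<Phi>\<^sub>\<mu>(M(u), u))\<^sup>n exp W\<^sub>\<mu>(u)\<close>.\<close>

definition parisi_moment :: "nat \<Rightarrow> nat \<Rightarrow> (real \<Rightarrow> real) \<Rightarrow> real measure \<Rightarrow>
    'a measure \<Rightarrow> (real \<Rightarrow> 'a \<Rightarrow> real) \<Rightarrow> real \<Rightarrow> real" where
  "parisi_moment j n \<xi> \<mu> P B u = (LINT \<omega>|P.
     (parisi_dx j \<xi> \<mu> (time_changed \<xi> B u \<omega>) u) ^ n * exp (parisi_weight \<xi> \<mu> B u \<omega>))"

definition parisi_Gamma :: "(real \<Rightarrow> real) \<Rightarrow> real measure \<Rightarrow>
    'a measure \<Rightarrow> (real \<Rightarrow> 'a \<Rightarrow> real) \<Rightarrow> real \<Rightarrow> real" where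
  "parisi_Gamma \<xi> \<mu> P B u = parisi_moment 1 2 \<xi> \<mu> P B u"

definition parisi_gamma1 :: "(real \<Rightarrow> real) \<Rightarrow> real measure \<Rightarrow>
    'a measure \<Rightarrow> (real \<Rightarrow> 'a \<Rightarrow> real) \<Rightarrow> real \<Rightarrow> real" where
  "parisi_gamma1 \<xi> \<mu> P B u =
     (deriv ^^ 3) \<xi> u * parisi_moment 2 2 \<xi> \<mu> P B u
     + ((deriv ^^ 2) \<xi> u)\<^sup>2 * parisi_moment 3 2 \<xi> \<mu> P B u"

definition parisi_gamma2 :: "(real \<Rightarrow> real) \<Rightarrow> real measure \<Rightarrow>
    'a measure \<Rightarrow> (real \<Rightarrow> 'a \<Rightarrow> real) \<Rightarrow> real \<Rightarrow> real" where
  "parisi_gamma2 \<xi> \<mu> P B u = 2 * ((deriv ^^ 2) \<xi> u)\<^sup>2 * parisi_moment 2 3 \<xi> \<mu> P B u"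

end

theory Submission
  imports Defs
begin

text \<open>
  For a measure \<open>\<nu>\<close> with finitely many atoms, none of them between \<open>s\<close> and \<open>t\<close>, the function \<open>\<Phi>(\<cdot>, s)\<close> arises
  from \<open>\<Phi>(\<cdot>, t)\<close> by one Gaussian step with parameter \<open>m = \<nu>([0, s])\<close>, and \<open>exp W\<close> is the corresponding change of
  measure: \<open>E F(M(t)) exp W(t) = E (V F)(M(s)) exp W(s)\<close>, where \<open>V\<close> is the Gaussian mean tilted by
  \<open>exp (m \<Phi>(\<cdot>, t))\<close>. Since \<open>\<partial>\<^sub>x \<Phi>(\<cdot>, s) = V \<partial>\<^sub>x \<Phi>(\<cdot>, t)\<close> and \<open>\<partial>\<^sub>x\<^sup>2 \<Phi>(\<cdot>, s) = V \<partial>\<^sub>x\<^sup>2 \<Phi>(\<cdot>, t) + m Var \<partial>\<^sub>x \<Phi>(\<cdot>, t)\<close>, with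
  the variance under \<open>V\<close>, the increments of \<open>E (\<partial>\<^sub>x \<Phi>)\<^sup>2 exp W\<close> and \<open>E (\<partial>\<^sub>x\<^sup>2 \<Phi>)\<^sup>2 exp W\<close> come from tilted variances. For a
  small step \<open>v = \<xi>'(t) - \<xi>'(s)\<close> these contribute \<open>v (\<partial>\<^sub>x\<^sup>2 \<Phi>)\<^sup>2\<close> and \<open>v ((\<partial>\<^sub>x\<^sup>3 \<Phi>)\<^sup>2 - 2 m (\<partial>\<^sub>x\<^sup>2 \<Phi>)\<^sup>3)\<close> up to \<open>O(v \<surd>v)\<close>; neither
  stochastic calculus nor the Parisi equation is needed. Summing up gives integral formulas for discrete measures.

  Four derivatives of \<open>\<Phi>\<^sub>\<nu>\<close> are bounded uniformly in \<open>\<nu>\<close>, so by interpolation the uniform convergence of \<open>\<Phi>\<^sub>\<nu>\<close>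
  carries over to three derivatives, and the integral formulas pass to the limit along the images of \<open>\<mu>\<close> under
  rounding down to a grid. They yield the one-sided derivatives because the moments are continuous and
  \<open>u \<mapsto> \<mu>([0, u])\<close> has one-sided limits.
\<close>

section \<open>Gaussian means of functions of exponential growth\<close>

text \<open>\<open>exp W\<close> acts as a change of measure because on an interval without atoms
  \<open>W\<close> grows by exactly \<open>m\<close> times the increment of \<open>\<Phi>\<close>
  along the path, and one Gaussian step says that \<open>exp (m * \<Phi>)\<close>, averaged over the
  increment of the path, is \<open>exp (m * \<Phi>)\<close> at the earlier time. The cubic term is
  the cross term of a square: \<open>\<partial>\<^sub>x\<^sup>2 \<Phi>\<close> changes by
  \<open>m\<close> times a variance close to
  \<open>v (\<partial>\<^sub>x\<^sup>2 \<Phi>)\<^sup>2\<close>, and squaring doubles it. The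
  obstacle is uniformity in the number of atoms: a loss at every layer would accumulate without
  bound. Hence the bounds are imposed on combinations of derivatives that a step averages exactly,
  and only changes of weight are charged. Since \<open>\<Phi>\<close> for general
  \<open>\<mu>\<close> is given by a definite description, Lipschitz dependence of
  \<open>\<Phi>\<close> on the measure has to be proved too, to show that the description denotes.
  At the finitely many possible jump times of a discrete measure only continuity of the moments is
  used; differentiability there is recovered, one-sidedly, from the limiting integral
  formulas.\<close>

abbreviation gauss :: "real measure" where
  "gauss \<equiv> std_normal_distribution"

interpretation gauss: prob_space gauss
  using prob_space_normal_density by simp

text \<open>This class is closed under sums, products and affine substitutions, contains
  \<open>exp (m * F)\<close> for \<open>F\<close> of linear growth, and consists of functions
  integrable under \<open>gauss\<close>. So integrability and differentiation under the integral are
  settled once for all integrands below.\<close>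

definition exp_growth :: "(real \<Rightarrow> real) \<Rightarrow> bool" where
  "exp_growth F \<longleftrightarrow> F \<in> borel_measurable borel \<and> (\<exists>A c. 0 \<le> A \<and> 0 \<le> c \<and> (\<forall>x. \<bar>F x\<bar> \<le> A * exp (c * \<bar>x\<bar>)))"

lemma exp_growthI:
  assumes "F \<in> borel_measurable borel" "\<And>x. \<bar>F x\<bar> \<le> A * exp (c * \<bar>x\<bar>)"
  shows "exp_growth F"
proof -
  have "\<bar>F x\<bar> \<le> \<bar>A\<bar> * exp (\<bar>c\<bar> * \<bar>x\<bar>)" for x
  proof -
    have "A * exp (c * \<bar>x\<bar>) \<le> \<bar>A\<bar> * exp (c * \<bar>x\<bar>)" by (intro mult_right_mono) auto
    also have "\<dots> \<le> \<bar>A\<bar> * exp (\<bar>c\<bar> * \<bar>x\<bar>)"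
      by (intro mult_left_mono) (auto intro: mult_right_mono)
    finally show ?thesis using assms(2)[of x] by linarith
  qed
  then show ?thesis unfolding exp_growth_def using assms(1)
    by (intro conjI exI[of _ "\<bar>A\<bar>"] exI[of _ "\<bar>c\<bar>"]) auto
qed

lemma exp_growth_measurable [measurable_dest]: "exp_growth F \<Longrightarrow> F \<in> borel_measurable borel"
  by (simp add: exp_growth_def)

lemma exp_growth_bounded:
  "F \<in> borel_measurable borel \<Longrightarrow> (\<And>x. \<bar>F x\<bar> \<le> A) \<Longrightarrow> exp_growth F"
  by (rule exp_growthI[of _ A 0]) auto

lemma exp_growth_const [simp]: "exp_growth (\<lambda>_. a)"
  by (rule exp_growth_bounded[of _ "\<bar>a\<bar>"]) auto

lemma exp_growth_mult:
  assumes "exp_growth F" "exp_growth G"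
  shows "exp_growth (\<lambda>x. F x * G x)"
proof -
  from assms obtain A c B d where 1: "0 \<le> A" "0 \<le> c" "\<And>x. \<bar>F x\<bar> \<le> A * exp (c * \<bar>x\<bar>)"
    and 2: "0 \<le> B" "0 \<le> d" "\<And>x. \<bar>G x\<bar> \<le> B * exp (d * \<bar>x\<bar>)"
    unfolding exp_growth_def by metis
  show ?thesis
  proof (rule exp_growthI[of _ "A * B" "c + d"])
    show "(\<lambda>x. F x * G x) \<in> borel_measurable borel" using assms by measurable
    show "\<bar>F x * G x\<bar> \<le> A * B * exp ((c + d) * \<bar>x\<bar>)" for x
      using mult_mono[OF 1(3)[of x] 2(3)[of x]] 1(1) 2(1)
      by (simp only: abs_mult exp_add distrib_right) (simp add: mult_ac)
  qed
qed

lemma exp_growth_add: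
  assumes "exp_growth F" "exp_growth G"
  shows "exp_growth (\<lambda>x. F x + G x)"
proof -
  from assms obtain A c B d where 1: "0 \<le> A" "0 \<le> c" "\<And>x. \<bar>F x\<bar> \<le> A * exp (c * \<bar>x\<bar>)"
    and 2: "0 \<le> B" "0 \<le> d" "\<And>x. \<bar>G x\<bar> \<le> B * exp (d * \<bar>x\<bar>)"
    unfolding exp_growth_def by metis
  show ?thesis
  proof (rule exp_growthI[of _ "A + B" "c + d"])
    show "(\<lambda>x. F x + G x) \<in> borel_measurable borel" using assms by measurable
    fix x
    have "A * exp (c * \<bar>x\<bar>) \<le> A * exp ((c + d) * \<bar>x\<bar>)" "B * exp (d * \<bar>x\<bar>) \<le> B * exp ((c + d) * \<bar>x\<bar>)"
      using 1 2 by (auto intro!: mult_left_mono mult_right_mono)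
    then show "\<bar>F x + G x\<bar> \<le> (A + B) * exp ((c + d) * \<bar>x\<bar>)"
      using 1(3)[of x] 2(3)[of x] abs_triangle_ineq[of "F x" "G x"] unfolding distrib_right by linarith
  qed
qed

lemma exp_growth_uminus: "exp_growth F \<Longrightarrow> exp_growth (\<lambda>x. - F x)"
  using exp_growth_mult[of "\<lambda>_. -1" F] by simp

lemma exp_growth_diff: "exp_growth F \<Longrightarrow> exp_growth G \<Longrightarrow> exp_growth (\<lambda>x. F x - G x)"
  using exp_growth_add[of F "\<lambda>x. - G x"] exp_growth_uminus[of G] by simp

lemma exp_growth_power: "exp_growth F \<Longrightarrow> exp_growth (\<lambda>x. F x ^ n)"
  by (induction n) (auto intro: exp_growth_mult)

lemma exp_growth_abs_exp: "exp_growth (\<lambda>x. exp (c * \<bar>x\<bar>))"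
  by (rule exp_growthI[of _ 1 c]) auto

lemma exp_growth_ident: "exp_growth (\<lambda>x. x)"
proof (rule exp_growthI[of _ 1 1])
  show "\<bar>x\<bar> \<le> 1 * exp (1 * \<bar>x\<bar>)" for x :: real
    using exp_ge_add_one_self[of "\<bar>x\<bar>"] by (simp del: exp_ge_add_one_self)
qed auto

lemma exp_growth_affine:
  assumes "exp_growth F"
  shows "exp_growth (\<lambda>z. F (x + z * s))"
proof -
  from assms obtain A c where 1: "0 \<le> A" "0 \<le> c" "\<And>x. \<bar>F x\<bar> \<le> A * exp (c * \<bar>x\<bar>)"
    unfolding exp_growth_def by metis
  show ?thesis
  proof (rule exp_growthI[of _ "A * exp (c * \<bar>x\<bar>)" "c * \<bar>s\<bar>"])
    note [measurable] = exp_growth_measurable[OF assms]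
    show "(\<lambda>z. F (x + z * s)) \<in> borel_measurable borel" by measurable
    fix z
    have "\<bar>x + z * s\<bar> \<le> \<bar>x\<bar> + \<bar>s\<bar> * \<bar>z\<bar>"
      using abs_triangle_ineq[of x "z * s"] by (simp add: abs_mult mult.commute)
    then have "c * \<bar>x + z * s\<bar> \<le> c * \<bar>x\<bar> + c * \<bar>s\<bar> * \<bar>z\<bar>"
      using mult_left_mono[OF _ 1(2)] by (fastforce simp: distrib_left mult.assoc)
    then have "A * exp (c * \<bar>x + z * s\<bar>) \<le> A * exp (c * \<bar>x\<bar> + c * \<bar>s\<bar> * \<bar>z\<bar>)"
      using 1 by (intro mult_left_mono) auto
    then show "\<bar>F (x + z * s)\<bar> \<le> A * exp (c * \<bar>x\<bar>) * exp (c * \<bar>s\<bar> * \<bar>z\<bar>)"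
      using 1(3)[of "x + z * s"] by (simp add: exp_add mult.assoc)
  qed
qed

lemma exp_growth_exp:
  assumes "exp_growth F" "\<And>x. \<bar>F x\<bar> \<le> a + b * \<bar>x\<bar>"
  shows "exp_growth (\<lambda>x. exp (m * F x))"
proof (rule exp_growthI[of _ "exp (\<bar>m\<bar> * a)" "\<bar>m\<bar> * b"])
  show "(\<lambda>x. exp (m * F x)) \<in> borel_measurable borel" using assms by measurable
  fix x
  have "m * F x \<le> \<bar>m\<bar> * \<bar>F x\<bar>" by (simp add: abs_mult[symmetric])
  also have "\<dots> \<le> \<bar>m\<bar> * (a + b * \<bar>x\<bar>)" by (intro mult_left_mono assms) auto
  finally show "\<bar>exp (m * F x)\<bar> \<le> exp (\<bar>m\<bar> * a) * exp (\<bar>m\<bar> * b * \<bar>x\<bar>)"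
    by (simp add: mult_exp_exp algebra_simps)
qed

text \<open>Completing the square: an exponential tilt of the standard normal law is a normal law
  with shifted mean.\<close>

lemma normal_density_exp_shift:
  "std_normal_density z * exp (c * z) = exp (c\<^sup>2 / 2) * normal_density c 1 z"
  by (simp add: normal_density_def mult_exp_exp power2_eq_square field_simps)

lemma integrable_gauss_exp: "integrable gauss (\<lambda>z. exp (c * z))"
proof -
  have "integrable lborel (\<lambda>z. std_normal_density z * exp (c * z))"
    unfolding normal_density_exp_shift by (intro integrable_mult_right) auto
  then show ?thesis by (subst integrable_density) auto
qed

lemma integral_gauss_exp: "(LINT z|gauss. exp (c * z)) = exp (c\<^sup>2 / 2)"
proof -
  have "(LINT z|gauss. exp (c * z)) = (LINT z|lborel. std_normal_density z * exp (c * z))"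
    by (subst integral_density) auto
  then show ?thesis unfolding normal_density_exp_shift by simp
qed

lemma integrable_gauss:
  assumes "exp_growth F"
  shows "integrable gauss F"
proof -
  from assms obtain A c where 1: "0 \<le> A" "0 \<le> c" "\<And>x. \<bar>F x\<bar> \<le> A * exp (c * \<bar>x\<bar>)"
    unfolding exp_growth_def by metis
  show ?thesis
  proof (rule Bochner_Integration.integrable_bound)
    show "integrable gauss (\<lambda>z. A * (exp (c * z) + exp ((-c) * z)))"
      by (intro integrable_mult_right Bochner_Integration.integrable_add integrable_gauss_exp)
    show "F \<in> borel_measurable gauss" using assms by (auto dest: exp_growth_measurable)
    have "norm (F z) \<le> norm (A * (exp (c * z) + exp ((-c) * z)))" for z
    proof -
      have "exp (c * \<bar>z\<bar>) \<le> exp (c * z) + exp ((-c) * z)"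
        by (cases "0 \<le> z") auto
      from mult_left_mono[OF this 1(1)] show ?thesis
        using 1(3)[of z] 1(1) by simp
    qed
    then show "AE z in gauss. norm (F z) \<le> norm (A * (exp (c * z) + exp ((-c) * z)))"
      by simp
  qed
qed

lemma integral_gauss_ident: "(LINT z|gauss. z) = 0"
  using integral_std_normal_moment_odd[of 0] by (subst integral_density) auto

lemma integral_gauss_square: "(LINT z|gauss. z\<^sup>2) = 1"
  using std_normal_distribution_even_moments(1)[of 1] by simp

lemma gauss_mean_mono:
  assumes "exp_growth F" "exp_growth G" "\<And>z. F z \<le> G z"
  shows "(LINT z|gauss. F z) \<le> (LINT z|gauss. G z)"
  using assms by (intro integral_mono integrable_gauss) auto

lemma gauss_mean_abs_le:
  assumes "exp_growth F" "exp_growth G" "\<And>z. \<bar>F z\<bar> \<le> G z"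
  shows "\<bar>LINT z|gauss. F z\<bar> \<le> (LINT z|gauss. G z)"
proof -
  have "(LINT z|gauss. \<bar>F z\<bar>) \<le> (LINT z|gauss. G z)"
    using assms by (intro integral_mono) (auto intro: integrable_gauss integrable_abs)
  then show ?thesis using integral_abs_bound[of gauss F] by linarith
qed

lemma gauss_mean_pos:
  assumes "exp_growth F" "\<And>z. 0 < F z"
  shows "0 < (LINT z|gauss. F z)"
proof -
  have "0 \<le> (LINT z|gauss. F z)"
    using assms by (intro integral_nonneg_AE) (auto intro: less_imp_le)
  moreover have "(LINT z|gauss. F z) \<noteq> 0"
  proof
    assume "(LINT z|gauss. F z) = 0"
    then have "AE z in gauss. F z = 0"
      using integral_nonneg_eq_0_iff_AE[of gauss F] integrable_gauss[OF assms(1)] assms(2)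
      by (auto intro: less_imp_le)
    then have "AE z in gauss. False" using assms(2) by (auto elim!: eventually_mono simp: less_le)
    then show False by simp
  qed
  ultimately show ?thesis by simp
qed

text \<open>Dominated convergence for the difference quotients along sequences; the mean value
  theorem bounds the quotients by the derivative on a unit neighbourhood of
  \<open>x\<close>.\<close>

lemma gauss_mean_deriv:
  assumes F: "exp_growth F" and F': "exp_growth F'"
    and d: "\<And>x. (F has_real_derivative F' x) (at x)"
  shows "((\<lambda>x. LINT z|gauss. F (x + z * s)) has_real_derivative (LINT z|gauss. F' (x + z * s))) (at x)"
proof -
  note [measurable] = exp_growth_measurable[OF F] exp_growth_measurable[OF F']
  from F' obtain A c where 1: "0 \<le> A" "0 \<le> c" "\<And>x. \<bar>F' x\<bar> \<le> A * exp (c * \<bar>x\<bar>)"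
    unfolding exp_growth_def by metis
  \<comment> \<open>Bounds \<open>F'\<close> at all points \<open>y + z * s\<close> with
    \<open>y\<close> within distance 1 of \<open>x\<close>, simultaneously; this is why the sequence
    is later shifted by \<open>N\<close>, until its terms are below 1.\<close>
  let ?D = "\<lambda>z. A * exp (c * (\<bar>x\<bar> + 1)) * exp ((c * \<bar>s\<bar>) * \<bar>z\<bar>)"
  have bound: "\<bar>F' (y + z * s)\<bar> \<le> ?D z" if "\<bar>y - x\<bar> \<le> 1" for y z
  proof -
    have "\<bar>y + z * s\<bar> \<le> (\<bar>x\<bar> + 1) + \<bar>s\<bar> * \<bar>z\<bar>"
      using that abs_triangle_ineq[of y "z * s"] by (simp add: abs_mult mult.commute)
    then have "c * \<bar>y + z * s\<bar> \<le> c * ((\<bar>x\<bar> + 1) + \<bar>s\<bar> * \<bar>z\<bar>)"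
      using 1(2) by (intro mult_left_mono)
    then have "A * exp (c * \<bar>y + z * s\<bar>) \<le> A * exp (c * ((\<bar>x\<bar> + 1) + \<bar>s\<bar> * \<bar>z\<bar>))"
      using 1 by (intro mult_left_mono) auto
    also have "\<dots> = ?D z"
      by (simp add: exp_add[symmetric] distrib_left mult.assoc)
    finally show ?thesis using 1(3)[of "y + z * s"] by linarith
  qed
  have "((\<lambda>h. LINT z|gauss. (F (x + h + z * s) - F (x + z * s)) / h) \<longlongrightarrow> (LINT z|gauss. F' (x + z * s))) (at 0)"
    unfolding tendsto_at_iff_sequentially comp_def
  proof (intro allI impI)
    fix X :: "nat \<Rightarrow> real"
    assume X: "\<forall>i. X i \<in> UNIV - {0}" "X \<longlonglongrightarrow> 0"
    then have "\<forall>\<^sub>F i in sequentially. \<bar>X i\<bar> < 1"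
      by (auto simp: tendsto_iff)
    then obtain N where N: "\<And>i. \<bar>X (i + N)\<bar> < 1"
      unfolding eventually_sequentially by (metis le_add2)
    have "(\<lambda>i. LINT z|gauss. (F (x + X (i + N) + z * s) - F (x + z * s)) / X (i + N)) \<longlonglongrightarrow> (LINT z|gauss. F' (x + z * s))"
    proof (rule integral_dominated_convergence[where w="?D"])
      show "(\<lambda>z. F' (x + z * s)) \<in> borel_measurable gauss"
        by simp
      show "\<And>i. (\<lambda>z. (F (x + X (i + N) + z * s) - F (x + z * s)) / X (i + N)) \<in> borel_measurable gauss"
        by simp
      show "integrable gauss ?D"
        by (intro integrable_gauss exp_growth_mult exp_growth_abs_exp) auto
      have "(\<lambda>i. (F (x + X (i + N) + z * s) - F (x + z * s)) / X (i + N)) \<longlonglongrightarrow> F' (x + z * s)" for z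
      proof -
        have "((\<lambda>h. (F (x + z * s + h) - F (x + z * s)) / h) \<longlongrightarrow> F' (x + z * s)) (at 0)"
          using d[of "x + z * s"] by (simp add: DERIV_def)
        then have "(\<lambda>i. (F (x + z * s + X (i + N)) - F (x + z * s)) / X (i + N)) \<longlonglongrightarrow> F' (x + z * s)"
          unfolding tendsto_at_iff_sequentially comp_def
          using X LIMSEQ_ignore_initial_segment[OF X(2), of N] by (auto dest!: spec[of _ "\<lambda>i. X (i + N)"])
        then show ?thesis by (simp add: add_ac)
      qed
      then show "AE z in gauss. (\<lambda>i. (F (x + X (i + N) + z * s) - F (x + z * s)) / X (i + N)) \<longlonglongrightarrow> F' (x + z * s)"
        by simp
      have "norm ((F (x + X (i + N) + z * s) - F (x + z * s)) / X (i + N)) \<le> ?D z" for i z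
      proof -
        have nz: "X (i + N) \<noteq> 0" using X by auto
        have "norm (F (x + X (i + N) + z * s) - F (x + z * s)) \<le> ?D z * norm (x + X (i + N) - x)"
        proof (rule field_differentiable_bound[where S="cball x 1" and f="\<lambda>y. F (y + z * s)" and f'="\<lambda>y. F' (y + z * s)"])
          show "\<And>y. y \<in> cball x 1 \<Longrightarrow> ((\<lambda>y. F (y + z * s)) has_field_derivative F' (y + z * s)) (at y within cball x 1)"
            by (rule has_field_derivative_at_within) (use d DERIV_shift in blast)
          show "\<And>y. y \<in> cball x 1 \<Longrightarrow> norm (F' (y + z * s)) \<le> ?D z"
            using bound by (simp add: dist_real_def abs_minus_commute)
          have "\<bar>X (i + N)\<bar> \<le> 1" using N[of i] by linarith
          then show "x + X (i + N) \<in> cball x 1" by (simp add: dist_real_def)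
        qed simp_all
        then show ?thesis using nz by (simp add: divide_le_eq)
      qed
      then show "\<And>i. AE z in gauss. norm ((F (x + X (i + N) + z * s) - F (x + z * s)) / X (i + N)) \<le> ?D z"
        by simp
    qed
    then show "(\<lambda>i. LINT z|gauss. (F (x + X i + z * s) - F (x + z * s)) / X i) \<longlonglongrightarrow> (LINT z|gauss. F' (x + z * s))"
      by (rule LIMSEQ_offset)
  qed
  moreover have "(LINT z|gauss. (F (x + h + z * s) - F (x + z * s)) / h)
      = ((LINT z|gauss. F (x + h + z * s)) - (LINT z|gauss. F (x + z * s))) / h" for h
    using integrable_gauss[OF exp_growth_affine[OF F]] by simp
  ultimately show ?thesis unfolding DERIV_def by (simp only:)
qed

text \<open>A derivative is the pointwise limit of the difference quotients with step
  \<open>1 / Suc i\<close>, even where it is not continuous.\<close>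

lemma borel_measurable_derivative:
  fixes f :: "real \<Rightarrow> real"
  assumes "\<And>x. (f has_real_derivative f' x) (at x)"
  shows "f' \<in> borel_measurable borel"
proof (rule borel_measurable_LIMSEQ_real)
  have [measurable]: "f \<in> borel_measurable borel"
    using assms by (intro borel_measurable_continuous_onI continuous_at_imp_continuous_on)
      (auto dest: DERIV_isCont)
  show "(\<lambda>x. (f (x + 1 / real (Suc i)) - f x) / (1 / real (Suc i))) \<in> borel_measurable borel" for i
    by measurable
  show "(\<lambda>i. (f (x + 1 / real (Suc i)) - f x) / (1 / real (Suc i))) \<longlonglongrightarrow> f' x" for x
  proof -
    have "((\<lambda>h. (f (x + h) - f x) / h) \<longlongrightarrow> f' x) (at 0)"
      using assms[of x] by (simp add: DERIV_def)
    moreover have "(\<lambda>i. 1 / real (Suc i)) \<longlonglongrightarrow> 0"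
      using LIMSEQ_inverse_real_of_nat by (simp add: inverse_eq_divide)
    ultimately show ?thesis
      unfolding tendsto_at_iff_sequentially comp_def
      by (auto dest!: spec[of _ "\<lambda>i. 1 / real (Suc i)"] simp del: of_nat_Suc)
  qed
qed

section \<open>The Gaussian step\<close>

text \<open>The mean of \<open>F\<close> under the Gibbs measure with density proportional to
  \<open>exp (m * g)\<close>; for \<open>m = 0\<close> it is the plain Gaussian mean.\<close>

definition tilted_mean :: "real \<Rightarrow> real \<Rightarrow> (real \<Rightarrow> real) \<Rightarrow> (real \<Rightarrow> real) \<Rightarrow> real \<Rightarrow> real" where
  "tilted_mean m v g F x = (LINT z|gauss. F (x + z * sqrt v) * exp (m * g (x + z * sqrt v)))
     / (LINT z|gauss. exp (m * g (x + z * sqrt v)))"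

lemma gauss_prob_UNIV: "measure gauss UNIV = 1"
  using gauss.prob_space by simp

text \<open>Derivatives are carried as an explicit family rather than by iterating
  \<open>deriv\<close>, so that a Gaussian step can produce the next family by formula. No bound is
  put on \<open>D 0\<close>, since the recursion starts from \<open>ln (cosh x)\<close>.\<close>

definition jet :: "(nat \<Rightarrow> real \<Rightarrow> real) \<Rightarrow> bool" where
  "jet D \<longleftrightarrow> (\<forall>j<4. \<forall>x. (D j has_real_derivative D (Suc j) x) (at x)) \<and>
     (\<forall>j\<in>{1..4}. \<exists>K. \<forall>x. \<bar>D j x\<bar> \<le> K)"

lemma jet_has_derivative: "jet D \<Longrightarrow> j < 4 \<Longrightarrow> (D j has_real_derivative D (Suc j) x) (at x)"
  by (simp add: jet_def)

lemma jet_bounded: "jet D \<Longrightarrow> 1 \<le> j \<Longrightarrow> j \<le> 4 \<Longrightarrow> \<exists>K. \<forall>x. \<bar>D j x\<bar> \<le> K"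
  by (simp add: jet_def)

text \<open>Hence \<open>D 0\<close> determines the family up to order 4, so families obtained in
  different ways can be identified.\<close>

lemma jet_deriv:
  assumes "jet D" "j \<le> 4"
  shows "(deriv ^^ j) (D 0) = D j"
  using assms(2)
proof (induction j)
  case (Suc j)
  then have "deriv (D j) = D (Suc j)"
    using jet_has_derivative[OF assms(1), of j] by (intro ext DERIV_imp_deriv) auto
  then show ?case using Suc by simp
qed simp

lemma jet_measurable:
  assumes "jet D" "j \<le> 4"
  shows "D j \<in> borel_measurable borel"
proof (cases j)
  case 0
  have "\<And>x. isCont (D 0) x" using jet_has_derivative[OF assms(1), of 0] by (auto dest: DERIV_isCont)
  then show ?thesis using 0
    by (auto intro!: borel_measurable_continuous_onI continuous_at_imp_continuous_on)
next
  case (Suc i)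
  then show ?thesis using assms
    by (auto intro!: borel_measurable_derivative[of "D i"] jet_has_derivative)
qed

lemma lipschitz_from_derivative:
  fixes f :: "real \<Rightarrow> real"
  assumes "\<And>x. (f has_real_derivative f' x) (at x)" "\<And>x. \<bar>f' x\<bar> \<le> K"
  shows "\<bar>f x - f y\<bar> \<le> K * \<bar>x - y\<bar>"
proof -
  have "norm (f x - f y) \<le> K * norm (x - y)"
    by (rule field_differentiable_bound[where S=UNIV and f'=f']) (use assms in auto)
  then show ?thesis by simp
qed

lemma jet_lipschitz:
  assumes "jet D" "j < 4" "\<And>x. \<bar>D (Suc j) x\<bar> \<le> K"
  shows "\<bar>D j x - D j y\<bar> \<le> K * \<bar>x - y\<bar>"
  by (rule lipschitz_from_derivative[of "D j" "D (Suc j)"]) (use assms in \<open>auto intro: jet_has_derivative\<close>)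

lemma jet_linear_growth:
  assumes "jet D"
  obtains a b where "\<And>x. \<bar>D 0 x\<bar> \<le> a + b * \<bar>x\<bar>"
proof -
  obtain K where K: "\<And>x. \<bar>D 1 x\<bar> \<le> K" using jet_bounded[OF assms, of 1] by auto
  have "\<bar>D 0 x\<bar> \<le> \<bar>D 0 0\<bar> + K * \<bar>x\<bar>" for x
    using jet_lipschitz[OF assms, of 0 K x 0] K by auto
  then show ?thesis using that by blast
qed

lemma exp_growth_of_linear_growth:
  assumes "F \<in> borel_measurable borel" "\<And>x. \<bar>F x\<bar> \<le> a + b * \<bar>x\<bar>"
  shows "exp_growth F"
proof -
  have "exp_growth (\<lambda>x. a + b * \<bar>x\<bar>)"
    by (intro exp_growth_add exp_growth_mult exp_growth_const)
      (rule exp_growthI[of _ 1 1], auto simp: order_trans[OF _ exp_ge_add_one_self])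
  then obtain A c where "\<And>x. \<bar>a + b * \<bar>x\<bar>\<bar> \<le> A * exp (c * \<bar>x\<bar>)" unfolding exp_growth_def by blast
  then have "\<bar>F x\<bar> \<le> A * exp (c * \<bar>x\<bar>)" for x
    using order_trans[OF assms(2)[of x] order_trans[OF abs_ge_self]] by blast
  then show ?thesis using assms(1) by (intro exp_growthI)
qed

lemma jet_exp_growth:
  assumes "jet D" "j \<le> 4"
  shows "exp_growth (D j)"
proof (cases "j = 0")
  case True
  then show ?thesis using jet_linear_growth[OF assms(1)] jet_measurable[OF assms]
    by (metis exp_growth_of_linear_growth)
next
  case False
  then show ?thesis
    using jet_bounded[OF assms(1), of j] jet_measurable[OF assms] assms(2) exp_growth_bounded
    by (metis Suc_leI neq0_conv One_nat_def)
qed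

lemma jet_exp_growth_exp:
  assumes "jet D"
  shows "exp_growth (\<lambda>y. exp (m * D 0 y))"
  using jet_linear_growth[OF assms] jet_exp_growth[OF assms, of 0] exp_growth_exp by (metis zero_le)

locale gaussian_layer =
  fixes m v :: real and D :: "nat \<Rightarrow> real \<Rightarrow> real"
  assumes jet: "jet D"
begin

abbreviation E :: "(real \<Rightarrow> real) \<Rightarrow> real \<Rightarrow> real" where
  "E \<equiv> tilted_mean m v (D 0)"

definition partition :: "real \<Rightarrow> real" where
  "partition x = (LINT z|gauss. exp (m * D 0 (x + z * sqrt v)))"

lemma exp_growth_weight: "exp_growth (\<lambda>z. exp (m * D 0 (x + z * sqrt v)))"
  by (rule exp_growth_affine[OF jet_exp_growth_exp[OF jet]])

lemma exp_growth_weighted: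
  "exp_growth F \<Longrightarrow> exp_growth (\<lambda>z. F (x + z * sqrt v) * exp (m * D 0 (x + z * sqrt v)))"
  by (rule exp_growth_affine[OF exp_growth_mult[OF _ jet_exp_growth_exp[OF jet]]])

lemma partition_pos: "0 < partition x"
  unfolding partition_def by (intro gauss_mean_pos exp_growth_weight) auto

lemma E_eq: "E F x = (LINT z|gauss. F (x + z * sqrt v) * exp (m * D 0 (x + z * sqrt v))) / partition x"
  by (simp add: tilted_mean_def partition_def)

lemma E_const [simp]: "E (\<lambda>_. a) x = a"
  using partition_pos[of x] unfolding E_eq by (simp add: partition_def)

lemma E_add:
  assumes "exp_growth F" "exp_growth G"
  shows "E (\<lambda>y. F y + G y) x = E F x + E G x"
  unfolding E_eq using integrable_gauss[OF exp_growth_weighted[OF assms(1)]]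
    integrable_gauss[OF exp_growth_weighted[OF assms(2)]]
  by (simp add: distrib_right add_divide_distrib)

lemma E_cmult: "E (\<lambda>y. a * F y) x = a * E F x"
  unfolding E_eq by (simp add: mult.assoc)

lemma E_diff:
  assumes "exp_growth F" "exp_growth G"
  shows "E (\<lambda>y. F y - G y) x = E F x - E G x"
  using E_add[OF assms(1) exp_growth_uminus[OF assms(2)]] E_cmult[of "-1" G x] by simp

lemma E_mono:
  assumes "exp_growth F" "exp_growth G" "\<And>y. F y \<le> G y"
  shows "E F x \<le> E G x"
  unfolding E_eq using partition_pos[of x] assms
  by (intro divide_right_mono gauss_mean_mono exp_growth_weighted mult_right_mono) auto

lemma E_abs_le:
  assumes "exp_growth F" "\<And>y. \<bar>F y\<bar> \<le> K"
  shows "\<bar>E F x\<bar> \<le> K"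
proof -
  have "E F x \<le> E (\<lambda>_. K) x" "E (\<lambda>_. - K) x \<le> E F x"
    using assms by (auto intro!: E_mono simp: abs_le_iff minus_le_iff simp del: E_const)
  then show ?thesis by simp
qed

text \<open>Differentiating \<open>F * exp (m * D 0)\<close> reproduces the weight, so the
  derivative of an unnormalized mean is again a tilted mean times \<open>partition\<close>.\<close>

lemma weighted_deriv:
  assumes "exp_growth F" "exp_growth F'" "\<And>x. (F has_real_derivative F' x) (at x)"
  shows "((\<lambda>x. LINT z|gauss. F (x + z * sqrt v) * exp (m * D 0 (x + z * sqrt v))) has_real_derivative
     E (\<lambda>y. F' y + m * F y * D 1 y) x * partition x) (at x)"
proof -
  have g: "exp_growth (\<lambda>y. F' y + m * F y * D 1 y)"
    by (intro exp_growth_add exp_growth_mult exp_growth_const assms jet_exp_growth[OF jet]) auto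
  have "((\<lambda>y. F y * exp (m * D 0 y)) has_real_derivative (F' x + m * F x * D 1 x) * exp (m * D 0 x)) (at x)" for x
    by (auto intro!: derivative_eq_intros assms jet_has_derivative[OF jet] simp: algebra_simps)
  from gauss_mean_deriv[OF exp_growth_mult[OF assms(1) jet_exp_growth_exp[OF jet]]
      exp_growth_mult[OF g jet_exp_growth_exp[OF jet]] this]
  show ?thesis unfolding E_eq using partition_pos[of x] by simp
qed

lemma partition_deriv: "(partition has_real_derivative m * E (D 1) x * partition x) (at x)"
  using weighted_deriv[of "\<lambda>_. 1" "\<lambda>_. 0" x] by (simp add: partition_def[abs_def] E_cmult)

text \<open>Quotient rule: the derivative of a tilted mean is the tilted mean of the derivative plus
  \<open>m\<close> times the tilted covariance of \<open>F\<close> and \<open>D 1\<close>.\<close>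

lemma E_deriv:
  assumes "exp_growth F" "exp_growth F'" "\<And>x. (F has_real_derivative F' x) (at x)"
  shows "(E F has_real_derivative E (\<lambda>y. F' y + m * F y * D 1 y) x - m * E F x * E (D 1) x) (at x)"
proof -
  have p: "partition x \<noteq> 0" using partition_pos[of x] by simp
  have *: "(LINT z|gauss. F (x + z * sqrt v) * exp (m * D 0 (x + z * sqrt v))) = E F x * partition x" for x
    using partition_pos[of x] by (simp add: E_eq)
  define R where "R = E (\<lambda>y. F' y + m * F y * D 1 y) x - m * E F x * E (D 1) x"
  have "((\<lambda>x. (LINT z|gauss. F (x + z * sqrt v) * exp (m * D 0 (x + z * sqrt v))) / partition x)
    has_real_derivative R) (at x)"
    by (rule DERIV_cong[OF DERIV_divide[OF weighted_deriv[OF assms, of x] partition_deriv[of x] p]])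
      (use p in \<open>simp add: * R_def field_simps\<close>)
  moreover have "E F = (\<lambda>x. (LINT z|gauss. F (x + z * sqrt v) * exp (m * D 0 (x + z * sqrt v))) / partition x)"
    by (rule ext) (rule E_eq)
  ultimately show ?thesis unfolding R_def[symmetric] by (simp only:)
qed

lemma step_deriv: "(gaussian_step m v (D 0) has_real_derivative E (D 1) x) (at x)"
proof (cases "m = 0")
  case True
  have "((\<lambda>x. LINT z|gauss. D 0 (x + z * sqrt v)) has_real_derivative (LINT z|gauss. D 1 (x + z * sqrt v))) (at x)"
    using jet_has_derivative[OF jet, of 0] jet_exp_growth[OF jet] by (intro gauss_mean_deriv) auto
  then show ?thesis using True by (simp add: gaussian_step_def[abs_def] tilted_mean_def gauss_prob_UNIV)
next
  case False
  have "((\<lambda>x. ln (partition x) / m) has_real_derivative E (D 1) x) (at x)"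
    using partition_pos[of x] False
    by (auto intro!: derivative_eq_intros partition_deriv)
  then show ?thesis using False by (simp add: gaussian_step_def[abs_def] partition_def[abs_def])
qed

end

text \<open>If \<open>D\<close> lists the derivatives of \<open>g\<close> and \<open>m \<noteq> 0\<close>, then \<open>bell2\<close>, \<open>bell3\<close> and \<open>bell4\<close> are the
  derivatives of order \<open>2\<close>, \<open>3\<close> and \<open>4\<close> of \<open>exp (m g)\<close>, multiplied by \<open>exp (- m g) / m\<close>. The Gaussian
  step merely averages them, and they depend on \<open>m\<close> through derivatives of lower order only.\<close>

definition bell2 :: "real \<Rightarrow> (nat \<Rightarrow> real \<Rightarrow> real) \<Rightarrow> real \<Rightarrow> real" where
  "bell2 m D y = D 2 y + m * (D 1 y)\<^sup>2"

definition bell3 :: "real \<Rightarrow> (nat \<Rightarrow> real \<Rightarrow> real) \<Rightarrow> real \<Rightarrow> real" where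
  "bell3 m D y = D 3 y + 3 * m * (D 1 y * D 2 y) + m\<^sup>2 * (D 1 y) ^ 3"

definition bell4 :: "real \<Rightarrow> (nat \<Rightarrow> real \<Rightarrow> real) \<Rightarrow> real \<Rightarrow> real" where
  "bell4 m D y = D 4 y + m * (4 * (D 1 y * D 3 y) + 3 * (D 2 y)\<^sup>2) + 6 * m\<^sup>2 * ((D 1 y)\<^sup>2 * D 2 y)
     + m ^ 3 * (D 1 y) ^ 4"

lemma less_4_cases: "(\<forall>j<4. P (j::nat)) \<longleftrightarrow> P 0 \<and> P 1 \<and> P 2 \<and> P 3"
  by (auto simp: less_Suc_eq numeral_eq_Suc)

lemma interval_4_cases: "(\<forall>j\<in>{1..4}. P (j::nat)) \<longleftrightarrow> P 1 \<and> P 2 \<and> P 3 \<and> P 4"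
proof -
  have "{1..4} = {1, 2, 3, 4 :: nat}" by auto
  then show ?thesis by simp
qed

context gaussian_layer
begin

lemma exp_growth_bell:
  "exp_growth (bell2 m D)" "exp_growth (bell3 m D)" "exp_growth (bell4 m D)"
  unfolding bell2_def[abs_def] bell3_def[abs_def] bell4_def[abs_def]
  by (intro exp_growth_add exp_growth_mult exp_growth_const exp_growth_power jet_exp_growth[OF jet]; simp)+

text \<open>Each combination arises from the previous one by adding \<open>m * D 1\<close> times it
  to its derivative, with \<open>D 1\<close> as the one of order 1. By \<open>E_deriv\<close> the
  tilted means of the combinations obey the same recursion with \<open>H 1\<close> in place of
  \<open>D 1\<close>, so they are the combinations of \<open>H\<close>. The argument also covers
  \<open>m = 0\<close>.\<close>

lemma jet_step:
  obtains H where "jet H" "H 0 = gaussian_step m v (D 0)" "\<And>x. H 1 x = E (D 1) x"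
    "\<And>x. bell2 m H x = E (bell2 m D) x" "\<And>x. bell3 m H x = E (bell3 m D) x"
    "\<And>x. bell4 m H x = E (bell4 m D) x"
proof -
  define h1 where "h1 = E (D 1)"
  \<comment> \<open>The equations between \<open>bell2\<close>, \<open>bell3\<close>,
    \<open>bell4\<close> of \<open>H\<close> and the tilted means of those of \<open>D\<close> are
    solved for the derivative of highest order, which enters each of them linearly with coefficient
    1.\<close>
  define h2 where "h2 = (\<lambda>x. E (bell2 m D) x - m * (h1 x)\<^sup>2)"
  define h3 where "h3 = (\<lambda>x. E (bell3 m D) x - 3 * m * (h1 x * h2 x) - m\<^sup>2 * (h1 x) ^ 3)"
  define h4 where "h4 = (\<lambda>x. E (bell4 m D) x - m * (4 * (h1 x * h3 x) + 3 * (h2 x)\<^sup>2)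
    - 6 * m\<^sup>2 * ((h1 x)\<^sup>2 * h2 x) - m ^ 3 * (h1 x) ^ 4)"
  define H where "H = (\<lambda>j. [gaussian_step m v (D 0), h1, h2, h3, h4] ! j)"
  have H: "H 0 = gaussian_step m v (D 0)" "H 1 = h1" "H 2 = h2" "H 3 = h3" "H 4 = h4"
    by (simp_all add: H_def numeral_eq_Suc)
  note D = jet_has_derivative[OF jet, of 0] jet_has_derivative[OF jet, of 1]
    jet_has_derivative[OF jet, of 2] jet_has_derivative[OF jet, of 3]
  have D': "(D 0 has_real_derivative D 1 x) (at x)" "(D 1 has_real_derivative D 2 x) (at x)"
    "(D 2 has_real_derivative D 3 x) (at x)" "(D 3 has_real_derivative D 4 x) (at x)" for x
    using D by (simp_all add: numeral_eq_Suc)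
  have e: "exp_growth (D 1)" "exp_growth (D 2)" "exp_growth (D 3)" "exp_growth (D 4)"
    using jet_exp_growth[OF jet] by auto
  note eg = exp_growth_add exp_growth_mult exp_growth_const exp_growth_power e exp_growth_bell
  have d1: "(h1 has_real_derivative h2 x) (at x)" for x
  proof -
    have "E (\<lambda>y. D 2 y + m * D 1 y * D 1 y) x = E (bell2 m D) x"
      by (rule arg_cong[of _ _ "\<lambda>F. E F x"]) (auto simp: bell2_def power2_eq_square)
    with E_deriv[of "D 1" "D 2" x, OF e(1,2) D'(2)] show ?thesis
      by (simp add: h1_def h2_def power2_eq_square mult.assoc)
  qed
  have d2: "(h2 has_real_derivative h3 x) (at x)" for x
  proof -
    have "(bell2 m D has_real_derivative D 3 y + 2 * m * D 1 y * D 2 y) (at y)" for y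
      unfolding bell2_def[abs_def]
      by (auto intro!: derivative_eq_intros D' D'[unfolded One_nat_def])
    moreover have "exp_growth (\<lambda>y. D 3 y + 2 * m * D 1 y * D 2 y)" by (intro eg)
    ultimately have
      "(E (bell2 m D) has_real_derivative E (\<lambda>y. D 3 y + 2 * m * D 1 y * D 2 y + m * bell2 m D y * D 1 y) x
         - m * E (bell2 m D) x * h1 x) (at x)"
      unfolding h1_def by (intro E_deriv exp_growth_bell)
    moreover have "E (\<lambda>y. D 3 y + 2 * m * D 1 y * D 2 y + m * bell2 m D y * D 1 y) x = E (bell3 m D) x"
      by (rule arg_cong[of _ _ "\<lambda>F. E F x"])
        (auto simp: bell2_def bell3_def power2_eq_square power3_eq_cube algebra_simps)
    ultimately have b: "(E (bell2 m D) has_real_derivative E (bell3 m D) x - m * E (bell2 m D) x * h1 x) (at x)"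
      by simp
    have eq: "E (bell2 m D) x = h2 x + m * (h1 x)\<^sup>2" by (simp add: h2_def)
    show ?thesis unfolding h2_def
      by (auto intro!: derivative_eq_intros b d1 simp: h3_def eq power2_eq_square power3_eq_cube algebra_simps)
  qed
  have d3: "(h3 has_real_derivative h4 x) (at x)" for x
  proof -
    have "(bell3 m D has_real_derivative D 4 y + 3 * m * ((D 2 y)\<^sup>2 + D 1 y * D 3 y) + 3 * m\<^sup>2 * ((D 1 y)\<^sup>2 * D 2 y)) (at y)" for y
      unfolding bell3_def[abs_def]
      by (auto intro!: derivative_eq_intros D' D'[unfolded One_nat_def] simp: power2_eq_square algebra_simps)
    moreover have "exp_growth (\<lambda>y. D 4 y + 3 * m * ((D 2 y)\<^sup>2 + D 1 y * D 3 y) + 3 * m\<^sup>2 * ((D 1 y)\<^sup>2 * D 2 y))"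
      by (intro eg)
    ultimately have
      "(E (bell3 m D) has_real_derivative E (\<lambda>y. D 4 y + 3 * m * ((D 2 y)\<^sup>2 + D 1 y * D 3 y) + 3 * m\<^sup>2 * ((D 1 y)\<^sup>2 * D 2 y)
           + m * bell3 m D y * D 1 y) x
         - m * E (bell3 m D) x * h1 x) (at x)"
      unfolding h1_def by (intro E_deriv exp_growth_bell)
    moreover have "E (\<lambda>y. D 4 y + 3 * m * ((D 2 y)\<^sup>2 + D 1 y * D 3 y) + 3 * m\<^sup>2 * ((D 1 y)\<^sup>2 * D 2 y)
           + m * bell3 m D y * D 1 y) x = E (bell4 m D) x"
      by (rule arg_cong[of _ _ "\<lambda>F. E F x"])
        (auto simp: bell3_def bell4_def numeral_eq_Suc algebra_simps)
    ultimately have b: "(E (bell3 m D) has_real_derivative E (bell4 m D) x - m * E (bell3 m D) x * h1 x) (at x)"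
      by simp
    have eq: "E (bell3 m D) x = h3 x + 3 * m * (h1 x * h2 x) + m\<^sup>2 * (h1 x) ^ 3" by (simp add: h3_def)
    show ?thesis unfolding h3_def
      by (auto intro!: derivative_eq_intros b d1 d2 simp: h4_def eq numeral_eq_Suc algebra_simps)
  qed
  have bE: "\<exists>K. \<forall>x. \<bar>E F x\<bar> \<le> K" if "exp_growth F" "\<exists>K. \<forall>x. \<bar>F x\<bar> \<le> K" for F
    using that E_abs_le by meson
  have badd: "\<exists>K. \<forall>x. \<bar>F x + G x\<bar> \<le> K" if "\<exists>K. \<forall>x. \<bar>F x\<bar> \<le> K" "\<exists>K. \<forall>x. \<bar>G x\<bar> \<le> K" for F G :: "real \<Rightarrow> real"
    using that by (metis abs_triangle_ineq add_mono order_trans)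
  have bmult: "\<exists>K. \<forall>x. \<bar>F x * G x\<bar> \<le> K" if FG: "\<exists>K. \<forall>x. \<bar>F x\<bar> \<le> K" "\<exists>K. \<forall>x. \<bar>G x\<bar> \<le> K" for F G :: "real \<Rightarrow> real"
  proof -
    obtain K L where "\<And>x. \<bar>F x\<bar> \<le> K" "\<And>x. \<bar>G x\<bar> \<le> L" using FG by auto
    then have "\<bar>F x * G x\<bar> \<le> K * L" for x
      unfolding abs_mult by (intro mult_mono) (auto intro: order_trans[OF abs_ge_zero])
    then show ?thesis by blast
  qed
  have bpow: "\<exists>K. \<forall>x. \<bar>F x ^ n\<bar> \<le> K" if "\<exists>K. \<forall>x. \<bar>F x\<bar> \<le> K" for F :: "real \<Rightarrow> real" and n
    using that by (induction n) (auto intro!: bmult[of F])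
  have bdiff: "\<exists>K. \<forall>x. \<bar>F x - G x\<bar> \<le> K" if "\<exists>K. \<forall>x. \<bar>F x\<bar> \<le> K" "\<exists>K. \<forall>x. \<bar>G x\<bar> \<le> K" for F G :: "real \<Rightarrow> real"
    using badd[of F "\<lambda>x. - G x"] that by simp
  have bc: "\<exists>K. \<forall>x. \<bar>a\<bar> \<le> K" for a :: real by auto
  have J: "\<exists>K. \<forall>x. \<bar>D 1 x\<bar> \<le> K" "\<exists>K. \<forall>x. \<bar>D 2 x\<bar> \<le> K" "\<exists>K. \<forall>x. \<bar>D 3 x\<bar> \<le> K"
    "\<exists>K. \<forall>x. \<bar>D 4 x\<bar> \<le> K"
    by (intro jet_bounded[OF jet]; simp)+
  note b = badd bmult bdiff bpow bc J
  have b1: "\<exists>K. \<forall>x. \<bar>h1 x\<bar> \<le> K" unfolding h1_def by (intro bE e b)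
  have b2: "\<exists>K. \<forall>x. \<bar>h2 x\<bar> \<le> K" unfolding h2_def
    by (intro b bE exp_growth_bell b1) (unfold bell2_def, intro b)
  have b3: "\<exists>K. \<forall>x. \<bar>h3 x\<bar> \<le> K" unfolding h3_def
    by (intro b bE exp_growth_bell b1 b2) (unfold bell3_def, intro b)
  have b4: "\<exists>K. \<forall>x. \<bar>h4 x\<bar> \<le> K" unfolding h4_def
    by (intro b bE exp_growth_bell b1 b2 b3) (unfold bell4_def, intro b)
  have HS: "H (Suc 0) = h1" "H (Suc 1) = h2" "H (Suc 2) = h3" "H (Suc 3) = h4"
    by (simp_all add: H_def numeral_eq_Suc)
  have "jet H"
    unfolding jet_def less_4_cases interval_4_cases H HS
    using step_deriv d1 d2 d3 b1 b2 b3 b4 unfolding h1_def[symmetric] by blast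
  then show ?thesis
  proof (rule that)
    show "H 0 = gaussian_step m v (D 0)" by (simp add: H)
    show "H 1 x = E (D 1) x" for x by (simp only: H h1_def)
    show "bell2 m H x = E (bell2 m D) x" for x by (simp only: H bell2_def) (simp add: h2_def)
    show "bell3 m H x = E (bell3 m D) x" for x by (simp only: H bell3_def) (simp add: h3_def)
    show "bell4 m H x = E (bell4 m D) x" for x by (simp only: H bell4_def) (simp add: h4_def)
  qed
qed

end

section \<open>How a Gaussian step depends on its weight, its variance and its function\<close>

lemma exp_minus_one_le: "\<bar>exp y - 1\<bar> \<le> \<bar>y\<bar> * exp \<bar>y\<bar>" for y :: real
proof -
  obtain t where t: "\<bar>t\<bar> \<le> \<bar>y\<bar>" "exp y = (\<Sum>m<1. y ^ m / fact m) + exp t / fact 1 * y ^ 1"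
    using Maclaurin_exp_le[of y 1] by blast
  have "\<bar>exp y - 1\<bar> = \<bar>y\<bar> * exp t" using t(2) by (simp add: abs_mult)
  also have "\<dots> \<le> \<bar>y\<bar> * exp \<bar>y\<bar>" using t(1) by (intro mult_left_mono) auto
  finally show ?thesis .
qed

lemma exp_le_quadratic: "exp y \<le> 1 + y + y\<^sup>2 * exp \<bar>y\<bar>" for y :: real
proof -
  obtain t where t: "\<bar>t\<bar> \<le> \<bar>y\<bar>" "exp y = (\<Sum>m<2. y ^ m / fact m) + exp t / fact 2 * y ^ 2"
    using Maclaurin_exp_le[of y 2] by blast
  have "exp y = 1 + y + y\<^sup>2 * (exp t / 2)" using t(2) by (simp add: numeral_eq_Suc)
  also have "exp t / 2 \<le> exp \<bar>y\<bar>"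
  proof -
    have "exp t \<le> exp \<bar>y\<bar>" using t(1) by auto
    then show ?thesis using exp_gt_zero[of t] by linarith
  qed
  then have "1 + y + y\<^sup>2 * (exp t / 2) \<le> 1 + y + y\<^sup>2 * exp \<bar>y\<bar>"
    by (intro add_left_mono mult_left_mono) auto
  finally show ?thesis .
qed

text \<open>The mean value theorem for \<open>f y - y * f' x\<close>. A Lipschitz derivative takes
  the place of a second derivative, because in uniform limits only the Lipschitz bound on the top
  derivative survives.\<close>

lemma taylor_lipschitz:
  fixes f :: "real \<Rightarrow> real"
  assumes "\<And>x. (f has_real_derivative f' x) (at x)" "\<And>x y. \<bar>f' x - f' y\<bar> \<le> K * \<bar>x - y\<bar>"
  shows "\<bar>f (x + h) - f x - h * f' x\<bar> \<le> K * h\<^sup>2"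
proof -
  have K: "0 \<le> K" using assms(2)[of 1 0] by auto
  have "norm ((f (x + h) - (x + h) * f' x) - (f x - x * f' x)) \<le> (K * \<bar>h\<bar>) * norm (x + h - x)"
  proof (rule field_differentiable_bound[where S="cball x \<bar>h\<bar>" and f="\<lambda>y. f y - y * f' x" and f'="\<lambda>y. f' y - f' x"])
    show "((\<lambda>y. f y - y * f' x) has_real_derivative f' y - f' x) (at y within cball x \<bar>h\<bar>)" for y
      by (rule has_field_derivative_at_within) (auto intro!: derivative_eq_intros assms)
    show "norm (f' y - f' x) \<le> K * \<bar>h\<bar>" if "y \<in> cball x \<bar>h\<bar>" for y
    proof -
      have "K * \<bar>y - x\<bar> \<le> K * \<bar>h\<bar>" using that K by (intro mult_left_mono) (auto simp: dist_real_def)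
      then show ?thesis using assms(2)[of y x] by simp
    qed
  qed (auto simp: dist_real_def)
  then show ?thesis by (simp add: algebra_simps power2_eq_square)
qed

text \<open>The cumulant generating function of \<open>G\<close> divided by its argument, with its
  limit as value at 0.\<close>

definition log_moment :: "(real \<Rightarrow> real) \<Rightarrow> real \<Rightarrow> real" where
  "log_moment G m = (if m = 0 then (LINT z|gauss. G z) else ln (LINT z|gauss. exp (m * G z)) / m)"

text \<open>Jensen's inequality for the law tilted by \<open>exp (m * G)\<close>: the ratio of
  \<open>A (m + \<delta>)\<close> to \<open>A m\<close> is a tilted mean of
  \<open>exp (\<delta> * G)\<close>. The proof integrates the tangent of the exponential at
  \<open>\<delta> * b\<close>, where \<open>b\<close> is the tilted mean of
  \<open>G\<close>.\<close>

lemma log_moment_jensen: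
  assumes G: "exp_growth G" "\<And>z. \<bar>G z\<bar> \<le> s * \<bar>z\<bar>"
  defines "A \<equiv> \<lambda>m. LINT z|gauss. exp (m * G z)"
  shows "A m * exp (\<delta> * (LINT z|gauss. G z * exp (m * G z)) / A m) \<le> A (m + \<delta>)"
proof -
  have e: "exp_growth (\<lambda>z. exp (k * G z))" for k using exp_growth_exp[of G 0 s k] G by simp
  have A: "A m > 0" unfolding A_def by (intro gauss_mean_pos e) auto
  define b where "b = (LINT z|gauss. G z * exp (m * G z)) / A m"
  have "(LINT z|gauss. exp (\<delta> * b) * (exp (m * G z) + \<delta> * (G z * exp (m * G z) - b * exp (m * G z)))) \<le> A (m + \<delta>)"
    unfolding A_def
  proof (intro gauss_mean_mono exp_growth_mult exp_growth_add exp_growth_diff e G exp_growth_const)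
    fix z
    have "exp (\<delta> * b) * (1 + (\<delta> * G z - \<delta> * b)) \<le> exp (\<delta> * b) * exp (\<delta> * G z - \<delta> * b)"
      by (intro mult_left_mono exp_ge_add_one_self) auto
    also have "\<dots> = exp (\<delta> * G z)" by (simp add: exp_add[symmetric])
    finally have "exp (\<delta> * b) * (1 + (\<delta> * G z - \<delta> * b)) * exp (m * G z) \<le> exp (\<delta> * G z) * exp (m * G z)"
      by (intro mult_right_mono) auto
    then show "exp (\<delta> * b) * (exp (m * G z) + \<delta> * (G z * exp (m * G z) - b * exp (m * G z))) \<le> exp ((m + \<delta>) * G z)"
      by (simp add: algebra_simps exp_add)
  qed
  moreover have "(LINT z|gauss. exp (\<delta> * b) * (exp (m * G z) + \<delta> * (G z * exp (m * G z) - b * exp (m * G z))))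
     = exp (\<delta> * b) * (A m + \<delta> * (b * A m - b * A m))"
  proof -
    have "integrable gauss (\<lambda>z. exp (m * G z))" "integrable gauss (\<lambda>z. G z * exp (m * G z))"
      by (intro integrable_gauss exp_growth_mult e G)+
    moreover have "(LINT z|gauss. G z * exp (m * G z)) = b * A m" using A by (simp add: b_def)
    ultimately show ?thesis unfolding A_def by (simp del: mult_cancel_left)
  qed
  ultimately show ?thesis by (simp add: b_def mult.commute)
qed

text \<open>The factor \<open>s\<^sup>2\<close> is the point: with \<open>s = sqrt v\<close> a
  change of weight costs in proportion to the variance of the step, so costs of consecutive steps
  add up to an integral. The lower bound (monotonicity in the weight) is Jensen's inequality; the
  upper bound expands the exponential to second order.\<close>

lemma log_moment_lipschitz:
  assumes c: "0 \<le> c"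
  obtains C where "0 \<le> C" "\<And>G s m m'. exp_growth G \<Longrightarrow> (\<And>z. \<bar>G z\<bar> \<le> s * \<bar>z\<bar>) \<Longrightarrow> 0 \<le> s \<Longrightarrow> s \<le> c
     \<Longrightarrow> 0 \<le> m \<Longrightarrow> m \<le> m' \<Longrightarrow> m' \<le> 1 \<Longrightarrow> \<bar>log_moment G m' - log_moment G m\<bar> \<le> C * s\<^sup>2 * (m' - m)"
proof -
  have ab: "exp_growth (\<lambda>z. \<bar>z\<bar>)" by (rule exp_growth_of_linear_growth[of _ 0 1]) auto
  \<comment> \<open>\<open>M1\<close> bounds the quadratic remainder of the exponential and
    \<open>M2\<close> a covariance. \<open>a0\<close> is a lower bound for every normalization
    \<open>A m\<close> with \<open>m\<close> in the unit interval, by Jensen's inequality at weight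
    0.\<close>
  define e1 where "e1 = (LINT z|gauss. \<bar>z\<bar>)"
  define M1 where "M1 = (LINT z|gauss. z\<^sup>2 * exp (2 * c * \<bar>z\<bar>))"
  define M2 where "M2 = (LINT z|gauss. (\<bar>z\<bar> + e1) * (\<bar>z\<bar> * exp (c * \<bar>z\<bar>)))"
  define a0 where "a0 = exp (- c * e1)"
  have e1: "0 \<le> e1" unfolding e1_def by simp
  have M: "0 \<le> M1" "0 \<le> M2" unfolding M1_def M2_def using e1 by (auto intro!: integral_nonneg_AE)
  have a0: "0 < a0" "a0 \<le> 1" unfolding a0_def using c e1 by auto
  have "\<bar>log_moment G m' - log_moment G m\<bar> \<le> (M1 + M2) / a0 * s\<^sup>2 * (m' - m)"
    if G: "exp_growth G" "\<And>z. \<bar>G z\<bar> \<le> s * \<bar>z\<bar>" and s: "0 \<le> s" "s \<le> c"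
      and m: "0 \<le> m" "m \<le> m'" "m' \<le> 1" for G s m m'
  proof (cases "m = m'")
    case False
    define \<delta> where "\<delta> = m' - m"
    have d: "0 < \<delta>" "\<delta> \<le> 1" "m' = m + \<delta>" using m False by (auto simp: \<delta>_def)
    define A where "A = (\<lambda>m. LINT z|gauss. exp (m * G z))"
    define B where "B = (LINT z|gauss. G z * exp (m * G z))"
    define g where "g = (LINT z|gauss. G z)"
    have e: "exp_growth (\<lambda>z. exp (k * G z))" for k using exp_growth_exp[of G 0 s k] G by simp
    have Apos: "A k > 0" for k unfolding A_def by (intro gauss_mean_pos e) auto
    have A0: "A 0 = 1" by (simp add: A_def gauss_prob_UNIV)
    have J: "A k * exp (d * (LINT z|gauss. G z * exp (k * G z)) / A k) \<le> A (k + d)" for k d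
      using log_moment_jensen[OF G, of k d] by (simp add: A_def)
    have J0: "exp (k * g) \<le> A k" for k using J[of 0 k] A0 by (simp add: g_def)
    have gs: "\<bar>g\<bar> \<le> s * e1"
    proof -
      have "\<bar>g\<bar> \<le> (LINT z|gauss. s * \<bar>z\<bar>)" unfolding g_def
        using G(2) by (intro gauss_mean_abs_le G exp_growth_mult exp_growth_const ab)
      then show ?thesis by (simp add: e1_def)
    qed
    have Aa: "a0 \<le> A m"
    proof -
      have "m * \<bar>g\<bar> \<le> 1 * (c * e1)"
        using gs s m e1 by (intro mult_mono) (auto intro: order_trans[OF gs] mult_right_mono)
      then have "- c * e1 \<le> m * g" using m abs_le_D2[of g "\<bar>g\<bar>"] by (smt (verit, best) mult_minus_left mult_minus_right mult_left_mono)
      then show ?thesis unfolding a0_def using J0[of m] by (meson exp_le_cancel_iff order_trans)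
    qed
    \<comment> \<open>Second-order expansion of \<open>exp (\<delta> * G z)\<close> under the weight
      \<open>exp (m * G z)\<close>; the bound on \<open>G\<close> turns the remainder into a
      multiple of \<open>\<delta>\<^sup>2 * s\<^sup>2\<close>.\<close>
    have up: "A m' \<le> A m + \<delta> * B + \<delta>\<^sup>2 * s\<^sup>2 * M1"
    proof -
      have "A m' \<le> (LINT z|gauss. exp (m * G z) + \<delta> * (G z * exp (m * G z)) + (\<delta>\<^sup>2 * s\<^sup>2) * (z\<^sup>2 * exp (2 * c * \<bar>z\<bar>)))"
        unfolding A_def
      proof (intro gauss_mean_mono exp_growth_add exp_growth_mult exp_growth_power exp_growth_ident exp_growth_const e G exp_growth_abs_exp)
        fix z
        have zc: "\<bar>G z\<bar> \<le> c * \<bar>z\<bar>" using G(2)[of z] s mult_right_mono[of s c "\<bar>z\<bar>"] by simp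
        have "exp (\<delta> * G z) \<le> 1 + \<delta> * G z + (\<delta> * G z)\<^sup>2 * exp \<bar>\<delta> * G z\<bar>" by (rule exp_le_quadratic)
        then have "exp (\<delta> * G z) * exp (m * G z) \<le> (1 + \<delta> * G z + (\<delta> * G z)\<^sup>2 * exp \<bar>\<delta> * G z\<bar>) * exp (m * G z)"
          by (rule mult_right_mono) simp
        then have "exp (m' * G z) \<le> (1 + \<delta> * G z + (\<delta> * G z)\<^sup>2 * exp \<bar>\<delta> * G z\<bar>) * exp (m * G z)"
          by (simp add: d distrib_right mult_exp_exp add.commute)
        also have "\<dots> = exp (m * G z) + \<delta> * (G z * exp (m * G z)) + \<delta>\<^sup>2 * ((G z)\<^sup>2 * (exp \<bar>\<delta> * G z\<bar> * exp (m * G z)))"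
          by (simp add: algebra_simps power_mult_distrib)
        also have "(G z)\<^sup>2 * (exp \<bar>\<delta> * G z\<bar> * exp (m * G z)) \<le> (s\<^sup>2 * z\<^sup>2) * exp (2 * c * \<bar>z\<bar>)"
        proof (intro mult_mono)
          have "(G z)\<^sup>2 \<le> (s * \<bar>z\<bar>)\<^sup>2" using G(2)[of z] s
            by (subst abs_le_square_iff[symmetric]) (simp add: abs_mult)
          then show "(G z)\<^sup>2 \<le> s\<^sup>2 * z\<^sup>2" by (simp add: power_mult_distrib)
          have "\<bar>\<delta> * G z\<bar> \<le> 1 * \<bar>G z\<bar>" unfolding abs_mult using d by (intro mult_right_mono) auto
          moreover have "m * G z \<le> 1 * \<bar>G z\<bar>"
            using abs_ge_self[of "m * G z"] mult_right_mono[of m 1 "\<bar>G z\<bar>"] m by (simp add: abs_mult)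
          ultimately have "\<bar>\<delta> * G z\<bar> + m * G z \<le> 2 * c * \<bar>z\<bar>" using zc by linarith
          then show "exp \<bar>\<delta> * G z\<bar> * exp (m * G z) \<le> exp (2 * c * \<bar>z\<bar>)" by (simp add: mult_exp_exp)
        qed auto
        then have "\<delta>\<^sup>2 * ((G z)\<^sup>2 * (exp \<bar>\<delta> * G z\<bar> * exp (m * G z))) \<le> (\<delta>\<^sup>2 * s\<^sup>2) * (z\<^sup>2 * exp (2 * c * \<bar>z\<bar>))"
          using mult_left_mono[of _ _ "\<delta>\<^sup>2"] by (simp add: mult.assoc)
        finally show "exp (m' * G z) \<le> exp (m * G z) + \<delta> * (G z * exp (m * G z)) + (\<delta>\<^sup>2 * s\<^sup>2) * (z\<^sup>2 * exp (2 * c * \<bar>z\<bar>))" by simp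
      qed
      also have "\<dots> = A m + \<delta> * B + \<delta>\<^sup>2 * s\<^sup>2 * M1"
      proof -
        have "integrable gauss (\<lambda>z. exp (m * G z))" "integrable gauss (\<lambda>z. G z * exp (m * G z))"
          "integrable gauss (\<lambda>z. z\<^sup>2 * exp (2 * c * \<bar>z\<bar>))"
          by (intro integrable_gauss exp_growth_mult e G exp_growth_power exp_growth_ident exp_growth_abs_exp)+
        then show ?thesis by (simp add: A_def B_def M1_def)
      qed
      finally show ?thesis .
    qed
    \<comment> \<open>This difference is the covariance of \<open>G\<close> and
      \<open>exp (m * G)\<close>. The centred \<open>G\<close> is of order \<open>s\<close> and
      \<open>exp (m * G) - 1\<close> of order \<open>m * s\<close>, which gives both the
      \<open>s\<^sup>2\<close> and a factor \<open>m\<close>.\<close>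
    have BA: "B - A m * g \<le> m * s\<^sup>2 * M2"
    proof -
      have i: "integrable gauss (\<lambda>z. exp (m * G z))" "integrable gauss (\<lambda>z. G z * exp (m * G z))" "integrable gauss G"
        by (intro integrable_gauss exp_growth_mult e G)+
      have "B - A m * g = (LINT z|gauss. (G z - g) * (exp (m * G z) - 1))"
        using i by (simp add: A_def B_def g_def algebra_simps gauss_prob_UNIV)
      also have "\<dots> \<le> (LINT z|gauss. (m * s\<^sup>2) * ((\<bar>z\<bar> + e1) * (\<bar>z\<bar> * exp (c * \<bar>z\<bar>))))"
      proof (intro gauss_mean_mono exp_growth_mult exp_growth_diff exp_growth_add e G ab exp_growth_const exp_growth_abs_exp)
        fix z
        have zc: "\<bar>G z\<bar> \<le> c * \<bar>z\<bar>" using G(2)[of z] s mult_right_mono[of s c "\<bar>z\<bar>"] by simp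
        have mz: "\<bar>m * G z\<bar> \<le> 1 * \<bar>G z\<bar>" unfolding abs_mult using m by (intro mult_right_mono) auto
        have "(G z - g) * (exp (m * G z) - 1) \<le> \<bar>G z - g\<bar> * \<bar>exp (m * G z) - 1\<bar>" by (metis abs_ge_self abs_mult)
        also have "\<dots> \<le> (s * (\<bar>z\<bar> + e1)) * (m * (s * \<bar>z\<bar>) * exp (c * \<bar>z\<bar>))"
        proof (intro mult_mono)
          show "\<bar>G z - g\<bar> \<le> s * (\<bar>z\<bar> + e1)" using G(2)[of z] gs by (simp add: distrib_left)
          have "\<bar>m * G z\<bar> * exp \<bar>m * G z\<bar> \<le> (m * (s * \<bar>z\<bar>)) * exp (c * \<bar>z\<bar>)"
            using zc mz m G(2)[of z] by (intro mult_mono) (auto simp: abs_mult intro: mult_left_mono)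
          then show "\<bar>exp (m * G z) - 1\<bar> \<le> m * (s * \<bar>z\<bar>) * exp (c * \<bar>z\<bar>)"
            using exp_minus_one_le[of "m * G z"] by linarith
        qed (use s e1 in auto)
        also have "\<dots> = (m * s\<^sup>2) * ((\<bar>z\<bar> + e1) * (\<bar>z\<bar> * exp (c * \<bar>z\<bar>)))" by (simp add: power2_eq_square)
        finally show "(G z - g) * (exp (m * G z) - 1) \<le> (m * s\<^sup>2) * ((\<bar>z\<bar> + e1) * (\<bar>z\<bar> * exp (c * \<bar>z\<bar>)))" .
      qed
      finally show ?thesis by (simp add: M2_def)
    qed
    have M1a: "M1 \<le> M1 / a0" using M(1) a0 by (simp add: le_divide_eq mult_left_le)
    have lm': "log_moment G m' = ln (A m') / m'" using d m by (simp add: log_moment_def A_def)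
    show ?thesis
    proof (cases "m = 0")
      case True
      have m'd: "m' = \<delta>" using d True by simp
      have "\<delta> * g \<le> ln (A m')" using J0[of m'] Apos[of m'] by (simp add: m'd ln_ge_iff)
      moreover have "ln (A m') \<le> \<delta> * g + \<delta>\<^sup>2 * s\<^sup>2 * M1"
      proof -
        have "ln (A m') \<le> A m' - 1" by (rule ln_le_minus_one) (rule Apos)
        then show ?thesis using up A0 True by (simp add: B_def g_def)
      qed
      ultimately have "g \<le> ln (A m') / \<delta>" "ln (A m') / \<delta> \<le> g + \<delta> * s\<^sup>2 * M1"
        using d(1) by (simp_all add: field_simps power2_eq_square)
      then have "\<bar>ln (A m') / \<delta> - g\<bar> \<le> \<delta> * s\<^sup>2 * M1" by linarith
      also have "\<dots> \<le> \<delta> * s\<^sup>2 * ((M1 + M2) / a0)"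
        using M1a M a0 d by (intro mult_left_mono) (auto simp: add_divide_distrib add_increasing2)
      finally show ?thesis using True lm' m'd by (simp add: log_moment_def g_def mult_ac)
    next
      case False
      then have mp: "0 < m" "0 < m'" using m by auto
      have lm: "log_moment G m = ln (A m) / m" using False by (simp add: log_moment_def A_def)
      \<comment> \<open>Jensen's inequality is used three times: from weight \<open>m\<close> with
        step \<open>\<delta>\<close> for \<open>l1\<close>, from weight \<open>m\<close> back to 0
        for \<open>l2\<close>, and from weight 0 to \<open>m\<close> for \<open>l3\<close>.\<close>
      define b where "b = B / A m"
      have "A m * exp (\<delta> * b) \<le> A m'" using J[of m \<delta>] by (simp add: b_def B_def d)
      then have "ln (A m * exp (\<delta> * b)) \<le> ln (A m')" using Apos[of m] by (subst ln_le_cancel_iff) (auto simp: Apos)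
      then have l1: "ln (A m) + \<delta> * b \<le> ln (A m')" using Apos[of m] by (simp add: ln_mult)
      have "A m * exp (- m * b) \<le> A 0" using J[of m "-m"] by (simp add: b_def B_def)
      then have "ln (A m * exp (- m * b)) \<le> 0" using A0 Apos[of m] by (subst ln_le_zero_iff) auto
      then have l2: "ln (A m) \<le> m * b" using Apos[of m] by (simp add: ln_mult)
      have l3: "m * g \<le> ln (A m)" using J0[of m] Apos[of m] by (simp add: ln_ge_iff)
      have "ln (A m' / A m) \<le> A m' / A m - 1" using Apos by (intro ln_le_minus_one) auto
      also have "\<dots> \<le> \<delta> * b + \<delta>\<^sup>2 * s\<^sup>2 * M1 / A m"
      proof -
        have "A m' / A m \<le> (A m + \<delta> * B + \<delta>\<^sup>2 * s\<^sup>2 * M1) / A m"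
          using up Apos[of m] by (intro divide_right_mono) auto
        also have "\<dots> = 1 + \<delta> * b + \<delta>\<^sup>2 * s\<^sup>2 * M1 / A m"
          using Apos[of m] by (simp add: b_def add_divide_distrib)
        finally show ?thesis by simp
      qed
      also have "\<dots> \<le> \<delta> * b + \<delta>\<^sup>2 * s\<^sup>2 * M1 / a0"
        using Aa a0 M by (simp add: divide_left_mono Apos)
      finally have l4: "ln (A m') \<le> ln (A m) + \<delta> * b + \<delta>\<^sup>2 * s\<^sup>2 * M1 / a0"
        using Apos[of m] Apos[of m'] by (auto simp: ln_div)
      have l5: "b - g \<le> m * s\<^sup>2 * M2 / a0"
      proof -
        have "b - g = (B - A m * g) / A m" using Apos[of m] by (simp add: b_def diff_divide_distrib)
        also have "\<dots> \<le> m * s\<^sup>2 * M2 / A m" using BA Apos[of m] by (intro divide_right_mono) auto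
        also have "\<dots> \<le> m * s\<^sup>2 * M2 / a0" using Aa a0 M m Apos[of m] by (intro divide_left_mono) auto
        finally show ?thesis .
      qed
      have lo: "0 \<le> m * ln (A m') - m' * ln (A m)"
      proof -
        have "m * (ln (A m) + \<delta> * b) \<le> m * ln (A m')" using l1 m by (intro mult_left_mono) auto
        then have "m * ln (A m) + \<delta> * (m * b) \<le> m * ln (A m')" by (simp only: distrib_left mult.left_commute)
        moreover have "\<delta> * ln (A m) \<le> \<delta> * (m * b)" using l2 d by (intro mult_left_mono) auto
        ultimately have "m * ln (A m) + \<delta> * ln (A m) \<le> m * ln (A m')" by linarith
        then show ?thesis unfolding d(3) distrib_right by linarith
      qed
      \<comment> \<open>Every term keeps a factor \<open>m\<close> and a factor bounded by
        \<open>m'\<close>. They cancel the common denominator \<open>m * m'\<close>, so the constant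
        stays bounded as \<open>m\<close> tends to 0.\<close>
      have "m * ln (A m') - m' * ln (A m) \<le> m * \<delta> * (b - g) + m * (\<delta>\<^sup>2 * s\<^sup>2 * M1 / a0)"
      proof -
        have "m * ln (A m') \<le> m * (ln (A m) + \<delta> * b + \<delta>\<^sup>2 * s\<^sup>2 * M1 / a0)" using l4 m by (intro mult_left_mono) auto
        then have "m * ln (A m') \<le> m * ln (A m) + m * (\<delta> * b) + m * (\<delta>\<^sup>2 * s\<^sup>2 * M1 / a0)" by (simp only: distrib_left)
        moreover have "\<delta> * (m * g) \<le> \<delta> * ln (A m)" using l3 d by (intro mult_left_mono) auto
        moreover have "m * \<delta> * (b - g) = m * (\<delta> * b) - \<delta> * (m * g)" by (simp add: algebra_simps)
        moreover have "m' * ln (A m) = m * ln (A m) + \<delta> * ln (A m)" unfolding d(3) distrib_right ..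
        ultimately show ?thesis by linarith
      qed
      also have "\<dots> \<le> m * \<delta> * (m * s\<^sup>2 * M2 / a0) + m * (\<delta>\<^sup>2 * s\<^sup>2 * M1 / a0)"
        using l5 m d by (intro add_right_mono mult_left_mono) auto
      also have "\<dots> = (m * \<delta> * s\<^sup>2 / a0) * (m * M2 + \<delta> * M1)" by (simp add: algebra_simps power2_eq_square add_divide_distrib)
      also have "\<dots> \<le> (m * \<delta> * s\<^sup>2 / a0) * (m' * (M1 + M2))"
      proof (intro mult_left_mono)
        have "m * M2 \<le> m' * M2" "\<delta> * M1 \<le> m' * M1" using M m d by (auto intro!: mult_right_mono)
        then show "m * M2 + \<delta> * M1 \<le> m' * (M1 + M2)" by (simp add: distrib_left)
      qed (use m d a0 in auto)
      finally have hi: "m * ln (A m') - m' * ln (A m) \<le> (m * m') * ((M1 + M2) / a0 * s\<^sup>2 * \<delta>)"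
        by (simp add: algebra_simps)
      have eq: "ln (A m') / m' - ln (A m) / m = (m * ln (A m') - m' * ln (A m)) / (m * m')"
        using mp by (simp add: field_simps)
      have "0 \<le> ln (A m') / m' - ln (A m) / m" unfolding eq using lo mp by simp
      moreover have "ln (A m') / m' - ln (A m) / m \<le> (M1 + M2) / a0 * s\<^sup>2 * \<delta>"
        unfolding eq using hi mp by (subst divide_le_eq) (auto simp: mult.commute)
      ultimately show ?thesis unfolding lm lm' \<delta>_def[symmetric] by linarith
    qed
  qed simp
  then show ?thesis using that[of "(M1 + M2) / a0"] M a0 by simp
qed


text \<open>Subtracting the value at \<open>x\<close> leaves an increment bounded by
  \<open>sqrt v * \<bar>z\<bar>\<close> when the slope is at most 1, so the estimates for
  \<open>log_moment\<close> become uniform in \<open>x\<close>.\<close>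

lemma gaussian_step_eq_log_moment:
  assumes "jet D"
  shows "gaussian_step m v (D 0) x = D 0 x + log_moment (\<lambda>z. D 0 (x + z * sqrt v) - D 0 x) m"
proof (cases "m = 0")
  case True
  have "integrable gauss (\<lambda>z. D 0 (x + z * sqrt v))"
    by (rule integrable_gauss[OF exp_growth_affine[OF jet_exp_growth[OF assms]]]) auto
  then show ?thesis using True by (simp add: gaussian_step_def log_moment_def gauss_prob_UNIV)
next
  case False
  interpret gaussian_layer m v D by standard fact
  have "(LINT z|gauss. exp (m * (D 0 (x + z * sqrt v) - D 0 x))) = exp (- (m * D 0 x)) * partition x"
  proof -
    have "exp (m * (a - b)) = exp (- (m * b)) * exp (m * a)" for a b :: real
      by (subst exp_add[symmetric]) (simp add: right_diff_distrib)
    then show ?thesis unfolding partition_def by (simp only: integral_mult_right_zero)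
  qed
  then have "ln (LINT z|gauss. exp (m * (D 0 (x + z * sqrt v) - D 0 x))) = ln (partition x) - m * D 0 x"
    using partition_pos[of x] by (simp add: ln_mult)
  then show ?thesis using False
    by (simp add: gaussian_step_def log_moment_def partition_def diff_divide_distrib)
qed

lemma increment_growth:
  assumes "jet D" "\<And>x. \<bar>D 1 x\<bar> \<le> 1" "0 \<le> v"
  shows "exp_growth (\<lambda>z. D 0 (x + z * sqrt v) - D 0 x)"
    "\<bar>D 0 (x + z * sqrt v) - D 0 x\<bar> \<le> sqrt v * \<bar>z\<bar>"
proof -
  show "exp_growth (\<lambda>z. D 0 (x + z * sqrt v) - D 0 x)"
    using jet_exp_growth[OF assms(1), of 0] by (intro exp_growth_diff[OF exp_growth_affine exp_growth_const]) auto
  show "\<bar>D 0 (x + z * sqrt v) - D 0 x\<bar> \<le> sqrt v * \<bar>z\<bar>"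
    using jet_lipschitz[OF assms(1), of 0 1 "x + z * sqrt v" x] assms(2,3) by (simp add: abs_mult mult.commute)
qed

lemma gaussian_step_lipschitz_weight:
  assumes "0 \<le> V"
  obtains C where "0 \<le> C" "\<And>D v m m' x. jet D \<Longrightarrow> (\<And>x. \<bar>D 1 x\<bar> \<le> 1) \<Longrightarrow> 0 \<le> v \<Longrightarrow> v \<le> V
    \<Longrightarrow> m \<in> {0..1} \<Longrightarrow> m' \<in> {0..1} \<Longrightarrow> \<bar>gaussian_step m' v (D 0) x - gaussian_step m v (D 0) x\<bar> \<le> C * v * \<bar>m' - m\<bar>"
proof -
  obtain C where C: "0 \<le> C" and *: "\<And>G s m m'. exp_growth G \<Longrightarrow> (\<And>z. \<bar>G z\<bar> \<le> s * \<bar>z\<bar>) \<Longrightarrow> 0 \<le> s \<Longrightarrow> s \<le> sqrt V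
     \<Longrightarrow> 0 \<le> m \<Longrightarrow> m \<le> m' \<Longrightarrow> m' \<le> 1 \<Longrightarrow> \<bar>log_moment G m' - log_moment G m\<bar> \<le> C * s\<^sup>2 * (m' - m)"
    using log_moment_lipschitz[of "sqrt V"] assms by auto
  have 1: "\<bar>gaussian_step m' v (D 0) x - gaussian_step m v (D 0) x\<bar> \<le> C * v * (m' - m)"
    if "jet D" "\<And>x. \<bar>D 1 x\<bar> \<le> 1" "0 \<le> v" "v \<le> V" "0 \<le> m" "m \<le> m'" "m' \<le> 1" for D v m m' x
    using *[OF increment_growth(1)[OF that(1,2,3)] increment_growth(2)[OF that(1,2,3)], of m m' x] that
    by (simp add: gaussian_step_eq_log_moment[OF that(1)])
  show ?thesis
  proof (rule that[OF C])
    fix D :: "nat \<Rightarrow> real \<Rightarrow> real" and v m m' x :: real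
    assume a: "jet D" "\<And>x. \<bar>D 1 x\<bar> \<le> 1" "0 \<le> v" "v \<le> V" "m \<in> {0..1}" "m' \<in> {0..1::real}"
    show "\<bar>gaussian_step m' v (D 0) x - gaussian_step m v (D 0) x\<bar> \<le> C * v * \<bar>m' - m\<bar>"
      using 1[OF a(1-4), of m m' x] 1[OF a(1-4), of m' m x] a(5,6)
      by (cases "m \<le> m'") (auto simp: abs_minus_commute)
  qed
qed

text \<open>The step is compared with the one of weight 0, at cost \<open>C * v\<close>. For weight
  0 the linear Taylor term has mean zero, so the displacement is of order \<open>v\<close> instead
  of \<open>sqrt v\<close>.\<close>

lemma gaussian_step_near_identity:
  assumes "0 \<le> V"
  obtains C where "0 \<le> C" "\<And>D v m x K. jet D \<Longrightarrow> (\<And>x. \<bar>D 1 x\<bar> \<le> 1) \<Longrightarrow> (\<And>x. \<bar>D 2 x\<bar> \<le> K) \<Longrightarrow> 0 \<le> v \<Longrightarrow> v \<le> V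
    \<Longrightarrow> m \<in> {0..1} \<Longrightarrow> \<bar>gaussian_step m v (D 0) x - D 0 x\<bar> \<le> (C + K) * v"
proof -
  obtain C where C: "0 \<le> C" and *: "\<And>D v m m' x. jet D \<Longrightarrow> (\<And>x. \<bar>D 1 x\<bar> \<le> 1) \<Longrightarrow> 0 \<le> v \<Longrightarrow> v \<le> V
    \<Longrightarrow> m \<in> {0..1} \<Longrightarrow> m' \<in> {0..1} \<Longrightarrow> \<bar>gaussian_step m' v (D 0) x - gaussian_step m v (D 0) x\<bar> \<le> C * v * \<bar>m' - m\<bar>"
    using gaussian_step_lipschitz_weight[OF assms] by metis
  show ?thesis
  proof (rule that[OF C])
    fix D :: "nat \<Rightarrow> real \<Rightarrow> real" and v m x K :: real
    assume a: "jet D" "\<And>x. \<bar>D 1 x\<bar> \<le> 1" "\<And>x. \<bar>D 2 x\<bar> \<le> K" "0 \<le> v" "v \<le> V" "m \<in> {0..1::real}"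
    have "\<bar>gaussian_step m v (D 0) x - gaussian_step 0 v (D 0) x\<bar> \<le> C * v * \<bar>m - 0\<bar>"
      using *[OF a(1,2,4,5), of 0 m x] a(6) by simp
    also have "\<dots> \<le> C * v * 1" using a C by (intro mult_left_mono) auto
    finally have 1: "\<bar>gaussian_step m v (D 0) x - gaussian_step 0 v (D 0) x\<bar> \<le> C * v" by simp
    have e: "exp_growth (\<lambda>z. D 0 (x + z * sqrt v))" by (rule exp_growth_affine[OF jet_exp_growth[OF a(1)]]) auto
    have "gaussian_step 0 v (D 0) x - D 0 x = (LINT z|gauss. D 0 (x + z * sqrt v) - D 0 x - (z * sqrt v) * D 1 x)"
      using integrable_gauss[OF e] integrable_gauss[OF exp_growth_ident]
      by (simp add: gaussian_step_def gauss_prob_UNIV integral_gauss_ident)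
    moreover have "\<bar>\<dots>\<bar> \<le> (LINT z|gauss. (K * v) * z\<^sup>2)"
    proof (intro gauss_mean_abs_le exp_growth_diff e exp_growth_mult exp_growth_const exp_growth_ident exp_growth_power)
      fix z
      have d: "(D 0 has_real_derivative D 1 y) (at y)" for y using jet_has_derivative[OF a(1), of 0] by simp
      have l: "\<bar>D 1 y - D 1 y'\<bar> \<le> K * \<bar>y - y'\<bar>" for y y'
        using jet_lipschitz[OF a(1), of 1 K y y'] a(3) by (simp add: numeral_eq_Suc)
      show "\<bar>D 0 (x + z * sqrt v) - D 0 x - (z * sqrt v) * D 1 x\<bar> \<le> (K * v) * z\<^sup>2"
        using taylor_lipschitz[OF d l, of x "z * sqrt v"] a(4) by (simp add: power_mult_distrib mult_ac)
    qed
    ultimately have "\<bar>gaussian_step 0 v (D 0) x - D 0 x\<bar> \<le> K * v" by (simp add: integral_gauss_square)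
    then show "\<bar>gaussian_step m v (D 0) x - D 0 x\<bar> \<le> (C + K) * v"
      using 1 by (simp add: distrib_right)
  qed
qed

lemma gaussian_step_mono:
  assumes "jet D" "jet D'" "\<And>x. D 0 x \<le> D' 0 x + \<epsilon>" "0 \<le> m"
  shows "gaussian_step m v (D 0) x \<le> gaussian_step m v (D' 0) x + \<epsilon>"
proof (cases "m = 0")
  case True
  have e: "exp_growth (\<lambda>z. D 0 (x + z * sqrt v))" "exp_growth (\<lambda>z. D' 0 (x + z * sqrt v))"
    using jet_exp_growth assms by (auto intro!: exp_growth_affine)
  have "(LINT z|gauss. D 0 (x + z * sqrt v)) \<le> (LINT z|gauss. D' 0 (x + z * sqrt v) + \<epsilon>)"
    using e assms(3) by (intro gauss_mean_mono exp_growth_add) auto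
  then show ?thesis using True integrable_gauss[OF e(2)] by (simp add: gaussian_step_def gauss_prob_UNIV)
next
  case False
  then have m: "0 < m" using assms by simp
  interpret A: gaussian_layer m v D by standard fact
  interpret B: gaussian_layer m v D' by standard fact
  have "A.partition x \<le> (LINT z|gauss. exp (m * \<epsilon>) * exp (m * D' 0 (x + z * sqrt v)))"
    unfolding A.partition_def
  proof (intro gauss_mean_mono A.exp_growth_weight exp_growth_mult exp_growth_const B.exp_growth_weight)
    fix z
    have "m * D 0 (x + z * sqrt v) \<le> m * (D' 0 (x + z * sqrt v) + \<epsilon>)" using assms(3) m by (intro mult_left_mono) auto
    then show "exp (m * D 0 (x + z * sqrt v)) \<le> exp (m * \<epsilon>) * exp (m * D' 0 (x + z * sqrt v))"
      by (simp add: mult_exp_exp distrib_left add.commute)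
  qed
  then have "A.partition x \<le> exp (m * \<epsilon>) * B.partition x" by (simp add: B.partition_def)
  then have "ln (A.partition x) \<le> ln (exp (m * \<epsilon>) * B.partition x)"
    using A.partition_pos[of x] B.partition_pos[of x] by (subst ln_le_cancel_iff) auto
  then have "ln (A.partition x) \<le> m * \<epsilon> + ln (B.partition x)"
    using B.partition_pos[of x] by (simp add: ln_mult)
  then show ?thesis using m by (simp add: gaussian_step_def A.partition_def B.partition_def field_simps)
qed

text \<open>The step is monotone and commutes with adding constants, hence does not increase uniform
  distances.\<close>

lemma gaussian_step_contraction:
  assumes "jet D" "jet D'" "\<And>x. \<bar>D 0 x - D' 0 x\<bar> \<le> \<epsilon>" "0 \<le> m"
  shows "\<bar>gaussian_step m v (D 0) x - gaussian_step m v (D' 0) x\<bar> \<le> \<epsilon>"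
proof -
  have "D 0 y \<le> D' 0 y + \<epsilon>" "D' 0 y \<le> D 0 y + \<epsilon>" for y using assms(3)[of y] by linarith+
  then show ?thesis
    using gaussian_step_mono[OF assms(1,2), of \<epsilon> m v x] gaussian_step_mono[OF assms(2,1), of \<epsilon> m v x] assms(4)
    by (simp add: abs_le_iff)
qed

section \<open>Composition of Gaussian steps and the terminal function\<close>

lemma distr_gauss_scale:
  assumes "0 < s"
  shows "distr gauss borel (\<lambda>z. z * s) = density lborel (normal_density 0 s)"
proof -
  have "distributed gauss lborel (\<lambda>z. z) std_normal_density"
    unfolding distributed_def by (auto simp: distr_id2)
  from gauss.normal_density_affine[OF this, of s 0] assms
  have "distributed gauss lborel (\<lambda>z. s * z) (normal_density 0 s)" by simp
  then show ?thesis unfolding distributed_def by (simp add: mult.commute cong: distr_cong)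
qed

text \<open>Variances of independent centred normal variables add. The degenerate cases are split
  off because a normal law of variance 0 has no density.\<close>

lemma gauss_mean_convolution:
  assumes F: "exp_growth F" and v: "0 \<le> v" "0 \<le> w"
  shows "(LINT z|gauss. LINT y|gauss. F (x + z * sqrt v + y * sqrt w)) = (LINT z|gauss. F (x + z * sqrt (v + w)))"
proof -
  consider "v = 0" | "w = 0" | "0 < v" "0 < w" using v by fastforce
  then show ?thesis
  proof cases
    case 3
    note [measurable] = exp_growth_measurable[OF F]
    let ?N = "\<lambda>s. density lborel (normal_density 0 s)"
    interpret pair_sigma_finite "?N (sqrt v)" "?N (sqrt w)"
      unfolding pair_sigma_finite_def using 3
      by (intro conjI prob_space_imp_sigma_finite prob_space_normal_density) auto
    have f: "finite_measure (?N s)" if "0 < s" for s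
      using prob_space_normal_density[OF that] by (simp add: prob_space_def)
    have "convolution (?N (sqrt v)) (?N (sqrt w)) = density lborel (\<lambda>x. \<integral>\<^sup>+y. ennreal (normal_density 0 (sqrt v) (x - y)) * ennreal (normal_density 0 (sqrt w) y) \<partial>lborel)"
      using 3 by (intro convolution_density f) auto
    also have "(\<lambda>x. \<integral>\<^sup>+y. ennreal (normal_density 0 (sqrt v) (x - y)) * ennreal (normal_density 0 (sqrt w) y) \<partial>lborel)
      = normal_density 0 (sqrt (v + w))"
      using conv_normal_density_zero_mean[of "sqrt v" "sqrt w"] 3
      by (simp add: ennreal_mult')
    finally have conv: "convolution (?N (sqrt v)) (?N (sqrt w)) = ?N (sqrt (v + w))" .
    have i: "integrable (?N s) (\<lambda>y. F (x + y))" if "0 < s" for s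
      unfolding distr_gauss_scale[OF that, symmetric]
      using exp_growth_affine[OF F, of x s] by (subst integrable_distr_eq) (auto intro: integrable_gauss)
    have "integrable (convolution (?N (sqrt v)) (?N (sqrt w))) (\<lambda>y. F (x + y))"
      unfolding conv using 3 by (intro i) auto
    then have "integrable (?N (sqrt v) \<Otimes>\<^sub>M ?N (sqrt w)) (\<lambda>(a, b). F (x + (a + b)))"
      unfolding convolution_def by (subst (asm) integrable_distr_eq) (auto simp: case_prod_unfold)
    then have "(LINT a|?N (sqrt v). LINT b|?N (sqrt w). F (x + (a + b)))
      = (LINT p|(?N (sqrt v) \<Otimes>\<^sub>M ?N (sqrt w)). (case p of (a, b) \<Rightarrow> F (x + (a + b))))"
      by (subst integral_fst'[symmetric]) auto
    also have "\<dots> = (LINT y|convolution (?N (sqrt v)) (?N (sqrt w)). F (x + y))"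
      unfolding convolution_def by (subst integral_distr) (auto simp: case_prod_unfold)
    finally have conv_eq: "(LINT a|?N (sqrt v). LINT b|?N (sqrt w). F (x + (a + b))) = (LINT y|?N (sqrt (v + w)). F (x + y))"
      unfolding conv .
    have *: "(LINT a|?N s. H a) = (LINT z|gauss. H (z * s))" if "0 < s" "H \<in> borel_measurable borel" for H :: "real \<Rightarrow> real" and s
      unfolding distr_gauss_scale[OF that(1), symmetric] using that(2) by (subst integral_distr) auto
    have "(LINT a|?N (sqrt v). LINT b|?N (sqrt w). F (x + (a + b))) = (LINT z|gauss. LINT b|?N (sqrt w). F (x + (z * sqrt v + b)))"
      using 3 by (intro *) (auto intro!: borel_measurable_lebesgue_integral)
    moreover have "(LINT b|?N (sqrt w). F (x + (a + b))) = (LINT y|gauss. F (x + (a + y * sqrt w)))" for a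
      using 3 by (intro *) auto
    moreover have "(LINT y|?N (sqrt (v + w)). F (x + y)) = (LINT z|gauss. F (x + z * sqrt (v + w)))"
      using 3 by (intro *) auto
    ultimately show ?thesis using conv_eq by (simp only: add.assoc)
  qed (simp_all add: gauss_prob_UNIV)
qed

text \<open>For nonzero weight the substitution \<open>exp (m * f)\<close> (Cole-Hopf) linearizes
  the step into a Gaussian mean, and the means compose by convolution.\<close>

lemma gaussian_step_semigroup:
  assumes D: "jet D" and v: "0 \<le> v" "0 \<le> w"
  shows "gaussian_step m v (gaussian_step m w (D 0)) x = gaussian_step m (v + w) (D 0) x"
proof (cases "m = 0")
  case True
  then show ?thesis
    using gauss_mean_convolution[OF jet_exp_growth[OF D, of 0] v] by (simp add: gaussian_step_def)
next
  case False
  interpret gaussian_layer m w D by standard fact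
  have "exp (m * gaussian_step m w (D 0) y) = (LINT u|gauss. exp (m * D 0 (y + u * sqrt w)))" for y
    using False partition_pos[of y] by (simp add: gaussian_step_def partition_def)
  then show ?thesis using gauss_mean_convolution[OF jet_exp_growth_exp[OF D] v, of m x] False
    by (simp add: gaussian_step_def)
qed

lemma gauss_mean_cosh:
  assumes "0 \<le> v"
  shows "(LINT z|gauss. cosh (x + z * sqrt v)) = exp (v / 2) * cosh x"
proof -
  have "(LINT z|gauss. cosh (x + z * sqrt v)) = (LINT z|gauss. (exp x * exp (sqrt v * z) + exp (- x) * exp (- sqrt v * z)) / 2)"
    by (simp add: cosh_def mult_exp_exp mult.commute)
  also have "\<dots> = (exp x * exp (v / 2) + exp (- x) * exp (v / 2)) / 2"
    using integrable_gauss_exp[of "sqrt v"] integrable_gauss_exp[of "- sqrt v"] assms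
      integral_gauss_exp[of "sqrt v"] integral_gauss_exp[of "- sqrt v"] by simp
  finally show ?thesis by (simp add: cosh_def algebra_simps)
qed

text \<open>Shows that the explicit formula beyond the last atom is itself a Gaussian step of weight
  1, so that this region obeys the same rule as the others.\<close>

lemma gaussian_step_log_cosh:
  assumes "0 \<le> v"
  shows "gaussian_step 1 v (\<lambda>y. ln (cosh y) + a) x = ln (cosh x) + (a + v / 2)"
proof -
  have "(LINT z|gauss. exp (ln (cosh (x + z * sqrt v)) + a)) = exp a * (exp (v / 2) * cosh x)"
    using gauss_mean_cosh[OF assms, of x] by (simp add: exp_add cosh_real_pos)
  then show ?thesis by (simp add: gaussian_step_def ln_mult)
qed

text \<open>For weight 1 the exponential of \<open>D 0\<close> is a multiple of \<open>cosh\<close>,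
  whose derivatives alternate between \<open>sinh\<close> and \<open>cosh\<close>; dividing by
  \<open>cosh\<close> gives the values 1, \<open>tanh x\<close>, 1.\<close>

lemma log_cosh_jet:
  obtains D where "jet D" "D 0 = (\<lambda>x. ln (cosh x) + a)" "D 1 = tanh" "\<And>x. bell2 1 D x = 1"
    "\<And>x. bell3 1 D x = tanh x" "\<And>x. bell4 1 D x = 1"
proof -
  \<comment> \<open>Polynomials in \<open>tanh\<close>, by repeated use of
    \<open>tanh' = 1 - tanh\<^sup>2\<close>.\<close>
  define D where "D = (\<lambda>j. [\<lambda>x. ln (cosh x) + a, tanh, \<lambda>x. 1 - (tanh x)\<^sup>2, \<lambda>x. - 2 * tanh x + 2 * (tanh x) ^ 3,
     \<lambda>x. (- 2 + 6 * (tanh x)\<^sup>2) * (1 - (tanh x)\<^sup>2)] ! j :: real \<Rightarrow> real)"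
  have D: "D 0 = (\<lambda>x. ln (cosh x) + a)" "D 1 = tanh" "D 2 = (\<lambda>x. 1 - (tanh x)\<^sup>2)"
    "D 3 = (\<lambda>x. - 2 * tanh x + 2 * (tanh x) ^ 3)" "D 4 = (\<lambda>x. (- 2 + 6 * (tanh x)\<^sup>2) * (1 - (tanh x)\<^sup>2))"
    by (simp_all add: D_def numeral_eq_Suc)
  have DS: "D (Suc 0) = D 1" "D (Suc 1) = D 2" "D (Suc 2) = D 3" "D (Suc 3) = D 4"
    by (simp_all add: numeral_eq_Suc)
  have t: "\<bar>tanh x\<bar> \<le> 1" for x :: real using tanh_real_bounds[of x] by (auto simp: abs_le_iff)
  have t2: "(tanh x)\<^sup>2 \<le> 1" "\<bar>(tanh x) ^ 3\<bar> \<le> 1" for x :: real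
    using t[of x] by (simp_all add: abs_square_le_1 power_abs power_le_one)
  have dt: "(tanh has_real_derivative 1 - (tanh x)\<^sup>2) (at x)" for x :: real
    by (auto intro!: derivative_eq_intros simp: cosh_real_nonzero)
  have "jet D"
    unfolding jet_def less_4_cases interval_4_cases DS D
  proof (intro conjI allI)
    show "((\<lambda>x. ln (cosh x) + a) has_real_derivative tanh x) (at x)" for x :: real
      by (auto intro!: derivative_eq_intros simp: tanh_def)
    show "\<exists>K. \<forall>x. \<bar>tanh x :: real\<bar> \<le> K" using t by blast
    have "\<bar>1 - (tanh x)\<^sup>2\<bar> \<le> 1" for x :: real using t2[of x] by simp
    then show "\<exists>K. \<forall>x::real. \<bar>1 - (tanh x)\<^sup>2\<bar> \<le> K" by blast
    have "\<bar>- 2 * tanh x + 2 * (tanh x) ^ 3\<bar> \<le> 4" for x :: real using t[of x] t2(2)[of x] by linarith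
    then show "\<exists>K. \<forall>x::real. \<bar>- 2 * tanh x + 2 * (tanh x) ^ 3\<bar> \<le> K" by blast
    have "\<bar>(- 2 + 6 * (tanh x)\<^sup>2) * (1 - (tanh x)\<^sup>2)\<bar> \<le> 8 * 1" for x :: real
    proof -
      have "- 2 \<le> - 2 + 6 * (tanh x)\<^sup>2" by simp
      then have "\<bar>- 2 + 6 * (tanh x)\<^sup>2\<bar> \<le> 8" "\<bar>1 - (tanh x)\<^sup>2\<bar> \<le> 1"
        using t2(1)[of x] zero_le_power2[of "tanh x"] by linarith+
      then show ?thesis unfolding abs_mult by (intro mult_mono) auto
    qed
    then show "\<exists>K. \<forall>x::real. \<bar>(- 2 + 6 * (tanh x)\<^sup>2) * (1 - (tanh x)\<^sup>2)\<bar> \<le> K" by blast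
  qed (auto intro!: derivative_eq_intros dt simp: numeral_eq_Suc algebra_simps)
  moreover have "bell2 1 D x = 1" for x by (simp add: bell2_def D[unfolded One_nat_def] D)
  moreover have "bell3 1 D x = tanh x" for x
    by (simp only: bell3_def D) (simp add: numeral_eq_Suc algebra_simps)
  moreover have "bell4 1 D x = 1" for x
    by (simp only: bell4_def D) (simp add: numeral_eq_Suc algebra_simps)
  ultimately show ?thesis using that D(1,2) by blast
qed

section \<open>Small Gaussian steps\<close>

lemma exp_growth_abs: "exp_growth F \<Longrightarrow> exp_growth (\<lambda>x. \<bar>F x\<bar>)"
  unfolding exp_growth_def by auto

lemma exp_growth_weighted_abs:
  assumes "exp_growth F"
  shows "exp_growth (\<lambda>z. \<bar>F (x + z * s)\<bar> * exp (c * \<bar>z\<bar>))"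
  by (intro exp_growth_mult exp_growth_abs_exp exp_growth_affine[OF exp_growth_abs[OF assms]])

text \<open>The numerator bounds the deviation of the weight from its mean, per unit of
  \<open>sqrt v\<close> and up to a factor \<open>exp (2 * \<bar>z\<bar>)\<close>; the denominator
  is a lower bound for the mean of the weight, by Jensen's inequality.\<close>

definition tilt_const :: real where
  "tilt_const = (1 + (LINT z|gauss. \<bar>z\<bar> * exp (1 * \<bar>z\<bar>))) / exp (- (LINT z|gauss. \<bar>z\<bar>))"

lemma tilt_const_nonneg: "0 \<le> tilt_const"
  unfolding tilt_const_def by (intro divide_nonneg_pos add_nonneg_nonneg integral_nonneg_AE) auto

text \<open>Dividing the weight by its value at \<open>x\<close> does not change the tilted mean and
  leaves \<open>exp (m * G z)\<close> with an exponent of size at most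
  \<open>sqrt v * \<bar>z\<bar>\<close>. So the tilt is a perturbation of relative order
  \<open>sqrt v\<close>, at the price of an exponential factor under the integral.\<close>

lemma tilted_mean_compare:
  assumes D: "jet D" "\<And>x. \<bar>D 1 x\<bar> \<le> 1" and v: "0 \<le> v" "v \<le> 1" and m: "m \<in> {0..1}"
    and F: "exp_growth F"
  shows "\<bar>tilted_mean m v (D 0) F x - (LINT z|gauss. F (x + z * sqrt v))\<bar>
      \<le> tilt_const * sqrt v * (LINT z|gauss. \<bar>F (x + z * sqrt v)\<bar> * exp (2 * \<bar>z\<bar>))"
proof -
  define k where "k = (LINT z|gauss. \<bar>z\<bar> * exp (1 * \<bar>z\<bar>))"
  define a where "a = exp (- (LINT z|gauss. \<bar>z\<bar>))"
  have k: "0 \<le> k" unfolding k_def by (intro integral_nonneg_AE) auto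
  have a: "0 < a" by (simp add: a_def)
  have ab: "exp_growth (\<lambda>z. \<bar>z\<bar>)" by (rule exp_growth_abs[OF exp_growth_ident])
  have "\<bar>tilted_mean m v (D 0) F x - (LINT z|gauss. F (x + z * sqrt v))\<bar>
      \<le> ((1 + k) / a) * sqrt v * (LINT z|gauss. \<bar>F (x + z * sqrt v)\<bar> * exp (2 * \<bar>z\<bar>))"
  proof -
    interpret gaussian_layer m v D by standard fact
    define G where "G = (\<lambda>z. D 0 (x + z * sqrt v) - D 0 x)"
    define A where "A = (LINT z|gauss. exp (m * G z))"
    have G: "exp_growth G" "\<And>z. \<bar>G z\<bar> \<le> sqrt v * \<bar>z\<bar>"
      using increment_growth[OF D v(1)] by (auto simp: G_def)
    have e: "exp_growth (\<lambda>z. exp (m * G z))" using exp_growth_exp[of G 0 "sqrt v" m] G by simp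
    have w: "exp (m * D 0 (x + z * sqrt v)) = exp (m * D 0 x) * exp (m * G z)" for z
      by (subst exp_add[symmetric]) (simp add: G_def right_diff_distrib)
    have p: "partition x = exp (m * D 0 x) * A" unfolding partition_def A_def w by simp
    have Apos: "0 < A" unfolding A_def by (intro gauss_mean_pos e) auto
    have E: "E F x = (LINT z|gauss. F (x + z * sqrt v) * exp (m * G z)) / A"
    proof -
      have "(LINT z|gauss. F (x + z * sqrt v) * (exp (m * D 0 x) * exp (m * G z)))
        = exp (m * D 0 x) * (LINT z|gauss. F (x + z * sqrt v) * exp (m * G z))"
        unfolding integral_mult_right_zero[symmetric] by (simp add: mult.left_commute)
      then show ?thesis unfolding E_eq p w by simp
    qed
    have sv: "sqrt v \<le> 1" "0 \<le> sqrt v" using v by auto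
    have Gz: "\<bar>m * G z\<bar> \<le> sqrt v * \<bar>z\<bar>" "\<bar>m * G z\<bar> \<le> \<bar>z\<bar>" for z
    proof -
      have "\<bar>m * G z\<bar> \<le> 1 * (sqrt v * \<bar>z\<bar>)" unfolding abs_mult using m G(2) by (intro mult_mono) auto
      moreover have "sqrt v * \<bar>z\<bar> \<le> 1 * \<bar>z\<bar>" using sv by (intro mult_right_mono) auto
      ultimately show "\<bar>m * G z\<bar> \<le> sqrt v * \<bar>z\<bar>" "\<bar>m * G z\<bar> \<le> \<bar>z\<bar>" by linarith+
    qed
    have e1: "\<bar>exp (m * G z) - 1\<bar> \<le> sqrt v * (\<bar>z\<bar> * exp (1 * \<bar>z\<bar>))" for z
    proof -
      have "\<bar>m * G z\<bar> * exp \<bar>m * G z\<bar> \<le> (sqrt v * \<bar>z\<bar>) * exp \<bar>z\<bar>"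
        using Gz[of z] sv by (intro mult_mono) auto
      then show ?thesis using exp_minus_one_le[of "m * G z"] by (simp add: mult.assoc)
    qed
    have A1: "\<bar>A - 1\<bar> \<le> sqrt v * k"
    proof -
      have "A - 1 = (LINT z|gauss. exp (m * G z) - 1)"
        using integrable_gauss[OF e] by (simp add: A_def gauss_prob_UNIV)
      moreover have "\<bar>\<dots>\<bar> \<le> (LINT z|gauss. sqrt v * (\<bar>z\<bar> * exp (1 * \<bar>z\<bar>)))"
        by (intro gauss_mean_abs_le exp_growth_diff e exp_growth_const exp_growth_mult ab exp_growth_abs_exp e1)
      ultimately show ?thesis by (simp only: k_def integral_mult_right_zero)
    qed
    have Aa: "a \<le> A"
    proof -
      have "exp (m * (LINT z|gauss. G z)) \<le> A"
        using log_moment_jensen[OF G, of 0 m] by (simp add: A_def gauss_prob_UNIV)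
      moreover have "\<bar>m * (LINT z|gauss. G z)\<bar> \<le> (LINT z|gauss. \<bar>z\<bar>)"
      proof -
        have "\<bar>LINT z|gauss. m * G z\<bar> \<le> (LINT z|gauss. \<bar>z\<bar>)"
          by (intro gauss_mean_abs_le exp_growth_mult exp_growth_const G ab Gz)
        then show ?thesis by simp
      qed
      then have "a \<le> exp (m * (LINT z|gauss. G z))" by (simp add: a_def)
      ultimately show ?thesis by linarith
    qed
    have i: "integrable gauss (\<lambda>z. F (x + z * sqrt v) * exp (m * G z))" "integrable gauss (\<lambda>z. F (x + z * sqrt v))"
      by (intro integrable_gauss exp_growth_mult e exp_growth_affine[OF F])+
    have "(LINT z|gauss. F (x + z * sqrt v) * exp (m * G z)) - A * (LINT z|gauss. F (x + z * sqrt v))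
      = (LINT z|gauss. F (x + z * sqrt v) * (exp (m * G z) - A))"
      using i by (simp add: right_diff_distrib mult.commute)
    moreover have "\<bar>\<dots>\<bar> \<le> (LINT z|gauss. ((1 + k) * sqrt v) * (\<bar>F (x + z * sqrt v)\<bar> * exp (2 * \<bar>z\<bar>)))"
    proof (intro gauss_mean_abs_le exp_growth_mult[OF exp_growth_const exp_growth_weighted_abs[OF F]]
          exp_growth_mult[OF exp_growth_affine[OF F] exp_growth_diff[OF e exp_growth_const]])
      fix z
      have "\<bar>exp (m * G z) - A\<bar> \<le> sqrt v * (\<bar>z\<bar> * exp (1 * \<bar>z\<bar>)) + sqrt v * k"
        using e1[of z] A1 by linarith
      also have "\<dots> \<le> sqrt v * (exp (2 * \<bar>z\<bar>)) + sqrt v * (k * exp (2 * \<bar>z\<bar>))"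
      proof (intro add_mono mult_left_mono)
        have "\<bar>z\<bar> * exp \<bar>z\<bar> \<le> exp \<bar>z\<bar> * exp \<bar>z\<bar>" using exp_ge_add_one_self[of "\<bar>z\<bar>"] by (intro mult_right_mono) linarith+
        then show "\<bar>z\<bar> * exp (1 * \<bar>z\<bar>) \<le> exp (2 * \<bar>z\<bar>)" by (simp add: mult_exp_exp)
        show "k \<le> k * exp (2 * \<bar>z\<bar>)" using k mult_left_mono[of 1 "exp (2 * \<bar>z\<bar>)" k] by simp
      qed (use sv in auto)
      also have "\<dots> = ((1 + k) * sqrt v) * exp (2 * \<bar>z\<bar>)" by (simp add: algebra_simps)
      finally have "\<bar>F (x + z * sqrt v)\<bar> * \<bar>exp (m * G z) - A\<bar> \<le> \<bar>F (x + z * sqrt v)\<bar> * (((1 + k) * sqrt v) * exp (2 * \<bar>z\<bar>))"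
        by (intro mult_left_mono) auto
      then show "\<bar>F (x + z * sqrt v) * (exp (m * G z) - A)\<bar> \<le> ((1 + k) * sqrt v) * (\<bar>F (x + z * sqrt v)\<bar> * exp (2 * \<bar>z\<bar>))"
        by (simp add: abs_mult mult_ac)
    qed
    moreover define I where "I = (LINT z|gauss. \<bar>F (x + z * sqrt v)\<bar> * exp (2 * \<bar>z\<bar>))"
    ultimately have n: "\<bar>(LINT z|gauss. F (x + z * sqrt v) * exp (m * G z)) - A * (LINT z|gauss. F (x + z * sqrt v))\<bar>
      \<le> (1 + k) * sqrt v * I" by simp
    have I: "0 \<le> I" unfolding I_def by (intro integral_nonneg_AE) auto
    have "E F x - (LINT z|gauss. F (x + z * sqrt v)) =
      ((LINT z|gauss. F (x + z * sqrt v) * exp (m * G z)) - A * (LINT z|gauss. F (x + z * sqrt v))) / A"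
      unfolding E using Apos by (simp add: diff_divide_distrib)
    then have "\<bar>E F x - (LINT z|gauss. F (x + z * sqrt v))\<bar> =
      \<bar>(LINT z|gauss. F (x + z * sqrt v) * exp (m * G z)) - A * (LINT z|gauss. F (x + z * sqrt v))\<bar> / A"
      using Apos by simp
    also have "\<dots> \<le> (1 + k) * sqrt v * I / A" using n Apos by (intro divide_right_mono) auto
    also have "\<dots> \<le> (1 + k) * sqrt v * I / a" using Aa a k sv I Apos by (intro divide_left_mono) auto
    finally show ?thesis by (simp add: I_def)
  qed
  then show ?thesis by (simp add: tilt_const_def k_def a_def)
qed

text \<open>The first summand is the untilted mean displacement, the second the effect of the tilt
  on it.\<close>

definition tilt_lipschitz_const :: real where
  "tilt_lipschitz_const = (LINT z|gauss. \<bar>z\<bar>) + tilt_const * (LINT z|gauss. \<bar>z\<bar> * exp (2 * \<bar>z\<bar>))"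

lemma tilt_lipschitz_const_nonneg: "0 \<le> tilt_lipschitz_const"
  unfolding tilt_lipschitz_const_def
  by (intro mult_nonneg_nonneg tilt_const_nonneg add_nonneg_nonneg integral_nonneg_AE) auto

text \<open>Tilted means preserve constants, so the comparison with the Gaussian mean is applied to
  \<open>F - F x\<close>, which is of order \<open>sqrt v\<close>.\<close>

lemma tilted_mean_lipschitz:
  assumes D: "jet D" "\<And>x. \<bar>D 1 x\<bar> \<le> 1" and v: "0 \<le> v" "v \<le> 1" and m: "m \<in> {0..1}"
    and F: "exp_growth F" and L: "\<And>x y. \<bar>F x - F y\<bar> \<le> L * \<bar>x - y\<bar>"
  shows "\<bar>tilted_mean m v (D 0) F x - F x\<bar> \<le> tilt_lipschitz_const * L * sqrt v"
proof -
  note * = tilted_mean_compare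
  define c where "c = tilt_const"
  have c: "0 \<le> c" by (simp add: c_def tilt_const_nonneg)
  have ab: "exp_growth (\<lambda>z. \<bar>z\<bar>)" by (rule exp_growth_abs[OF exp_growth_ident])
  define k where "k = (LINT z|gauss. \<bar>z\<bar>)"
  define k2 where "k2 = (LINT z|gauss. \<bar>z\<bar> * exp (2 * \<bar>z\<bar>))"
  have k: "0 \<le> k" "0 \<le> k2" unfolding k_def k2_def by (auto intro!: integral_nonneg_AE)
  have "\<bar>tilted_mean m v (D 0) F x - F x\<bar> \<le> (k + c * k2) * L * sqrt v"
  proof -
    interpret gaussian_layer m v D by standard fact
    define \<psi> where "\<psi> = (\<lambda>y. F y - F x)"
    have \<psi>: "exp_growth \<psi>" unfolding \<psi>_def by (intro exp_growth_diff F exp_growth_const)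
    have L0: "0 \<le> L" using L[of 1 0] by auto
    have \<psi>L: "\<bar>\<psi> (x + z * sqrt v)\<bar> \<le> L * sqrt v * \<bar>z\<bar>" for z
      using L[of "x + z * sqrt v" x] v by (simp add: \<psi>_def abs_mult mult_ac)
    have "\<bar>LINT z|gauss. \<psi> (x + z * sqrt v)\<bar> \<le> (LINT z|gauss. (L * sqrt v) * \<bar>z\<bar>)"
      by (intro gauss_mean_abs_le exp_growth_affine[OF \<psi>] exp_growth_mult exp_growth_const ab \<psi>L)
    then have 1: "\<bar>LINT z|gauss. \<psi> (x + z * sqrt v)\<bar> \<le> L * sqrt v * k" by (simp add: k_def)
    have "(LINT z|gauss. \<bar>\<psi> (x + z * sqrt v)\<bar> * exp (2 * \<bar>z\<bar>)) \<le> (LINT z|gauss. (L * sqrt v) * (\<bar>z\<bar> * exp (2 * \<bar>z\<bar>)))"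
    proof (intro gauss_mean_mono exp_growth_weighted_abs[OF \<psi>] exp_growth_mult exp_growth_const ab exp_growth_abs_exp)
      show "\<bar>\<psi> (x + z * sqrt v)\<bar> * exp (2 * \<bar>z\<bar>) \<le> (L * sqrt v) * (\<bar>z\<bar> * exp (2 * \<bar>z\<bar>))" for z
        using mult_right_mono[OF \<psi>L[of z], of "exp (2 * \<bar>z\<bar>)"] by (simp add: mult.assoc)
    qed
    then have "(LINT z|gauss. \<bar>\<psi> (x + z * sqrt v)\<bar> * exp (2 * \<bar>z\<bar>)) \<le> L * sqrt v * k2" by (simp add: k2_def)
    then have "c * sqrt v * (LINT z|gauss. \<bar>\<psi> (x + z * sqrt v)\<bar> * exp (2 * \<bar>z\<bar>)) \<le> c * sqrt v * (L * sqrt v * k2)"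
      using c v by (intro mult_left_mono) auto
    also have "\<dots> \<le> c * 1 * (L * sqrt v * k2)" using c v L0 k by (intro mult_right_mono mult_left_mono) auto
    finally have "\<bar>E \<psi> x\<bar> \<le> L * sqrt v * k + c * (L * sqrt v * k2)"
      using *[OF D v m \<psi>, of x] 1 unfolding c_def by linarith
    moreover have "E \<psi> x = E F x - F x" unfolding \<psi>_def by (subst E_diff) (auto intro: F)
    ultimately show ?thesis by (simp add: algebra_simps)
  qed
  then show ?thesis by (simp add: tilt_lipschitz_const_def k_def k2_def c_def)
qed

text \<open>The summands come, in this order, from the change of measure in the second moment of
  \<open>\<phi> y - \<phi> x\<close>, from the Taylor remainder there, and from the square of its
  tilted mean.\<close>

definition tilt_variance_const :: real where
  "tilt_variance_const = tilt_const * (LINT z|gauss. z\<^sup>2 * exp (2 * \<bar>z\<bar>)) + 2 * (LINT z|gauss. \<bar>z\<bar> ^ 3)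
     + (1 + tilt_const * (LINT z|gauss. \<bar>z\<bar> * exp (2 * \<bar>z\<bar>)))\<^sup>2"

lemma tilt_variance_const_nonneg: "0 \<le> tilt_variance_const"
  unfolding tilt_variance_const_def
  by (intro mult_nonneg_nonneg tilt_const_nonneg add_nonneg_nonneg integral_nonneg_AE) auto

text \<open>Under the tilted law \<open>\<phi> (x + z \<surd>v)\<close> is \<open>\<phi> x + z \<surd>v \<phi>' x\<close> up to \<open>O(v)\<close>, and the tilt only changes
  the first two moments of \<open>z\<close> by \<open>O(\<surd>v)\<close>.\<close>

lemma tilted_variance:
  assumes D: "jet D" "\<And>x. \<bar>D 1 x\<bar> \<le> 1" and v: "0 \<le> v" "v \<le> 1" and m: "m \<in> {0..1}"
    and \<phi>: "exp_growth \<phi>" "\<And>x. (\<phi> has_real_derivative \<phi>' x) (at x)" "\<And>x. \<bar>\<phi>' x\<bar> \<le> K"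
      "\<And>x y. \<bar>\<phi>' x - \<phi>' y\<bar> \<le> K * \<bar>x - y\<bar>"
  shows "\<bar>tilted_mean m v (D 0) (\<lambda>y. (\<phi> y)\<^sup>2) x - (tilted_mean m v (D 0) \<phi> x)\<^sup>2 - v * (\<phi>' x)\<^sup>2\<bar>
    \<le> tilt_variance_const * K\<^sup>2 * (v * sqrt v)"
proof -
  note * = tilted_mean_compare
  define c where "c = tilt_const"
  have c: "0 \<le> c" by (simp add: c_def tilt_const_nonneg)
  have ab: "exp_growth (\<lambda>z. \<bar>z\<bar>)" by (rule exp_growth_abs[OF exp_growth_ident])
  define k1 where "k1 = (LINT z|gauss. \<bar>z\<bar> * exp (2 * \<bar>z\<bar>))"
  define k2 where "k2 = (LINT z|gauss. z\<^sup>2 * exp (2 * \<bar>z\<bar>))"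
  define k3 where "k3 = (LINT z|gauss. \<bar>z\<bar> ^ 3)"
  have k: "0 \<le> k1" "0 \<le> k2" "0 \<le> k3" unfolding k1_def k2_def k3_def by (auto intro!: integral_nonneg_AE)
  have "\<bar>tilted_mean m v (D 0) (\<lambda>y. (\<phi> y)\<^sup>2) x - (tilted_mean m v (D 0) \<phi> x)\<^sup>2 - v * (\<phi>' x)\<^sup>2\<bar>
      \<le> (c * k2 + 2 * k3 + (1 + c * k1)\<^sup>2) * K\<^sup>2 * (v * sqrt v)"
  proof -
    interpret gaussian_layer m v D by standard fact
    define s where "s = sqrt v"
    have s: "0 \<le> s" "s \<le> 1" "v = s\<^sup>2" using v by (auto simp: s_def)
    \<comment> \<open>Centring at \<open>\<phi> x\<close> leaves the variance unchanged and makes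
      both of its terms small.\<close>
    define \<psi> where "\<psi> = (\<lambda>y. \<phi> y - \<phi> x)"
    have \<psi>: "exp_growth \<psi>" "exp_growth (\<lambda>y. (\<psi> y)\<^sup>2)" unfolding \<psi>_def
      by (intro exp_growth_power exp_growth_diff \<phi> exp_growth_const)+
    note \<psi>s = exp_growth_affine[OF \<psi>(1)] exp_growth_affine[OF \<psi>(2)]
    have K: "0 \<le> K" using \<phi>(3)[of 0] by linarith
    have \<psi>K: "\<bar>\<psi> (x + z * s)\<bar> \<le> K * s * \<bar>z\<bar>" for z
      using lipschitz_from_derivative[OF \<phi>(2,3), of "x + z * s" x] s by (simp add: \<psi>_def abs_mult mult_ac)
    have r: "\<bar>\<psi> (x + z * s) - (s * \<phi>' x) * z\<bar> \<le> (K * v) * z\<^sup>2" for z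
      using taylor_lipschitz[OF \<phi>(2,4), of x "z * s"] by (simp add: \<psi>_def s(3) power_mult_distrib mult_ac)
    have \<phi>z: "\<bar>(s * \<phi>' x) * z\<bar> \<le> K * s * \<bar>z\<bar>" for z
      using mult_left_mono[OF \<phi>(3)[of x], of "s * \<bar>z\<bar>"] s by (simp add: abs_mult mult_ac)
    have E2: "\<bar>E (\<lambda>y. (\<psi> y)\<^sup>2) x - v * (\<phi>' x)\<^sup>2\<bar> \<le> (c * k2 + 2 * k3) * K\<^sup>2 * (v * s)"
    proof -
      have "(LINT z|gauss. \<bar>(\<psi> (x + z * s))\<^sup>2\<bar> * exp (2 * \<bar>z\<bar>)) \<le> (LINT z|gauss. (K\<^sup>2 * v) * (z\<^sup>2 * exp (2 * \<bar>z\<bar>)))"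
      proof (intro gauss_mean_mono exp_growth_weighted_abs[OF \<psi>(2)] exp_growth_mult exp_growth_const exp_growth_power exp_growth_ident exp_growth_abs_exp)
        fix z
        have "(\<psi> (x + z * s))\<^sup>2 \<le> (K * s * \<bar>z\<bar>)\<^sup>2"
          using \<psi>K[of z] K s by (subst abs_le_square_iff[symmetric]) simp
        then have "(\<psi> (x + z * s))\<^sup>2 \<le> (K\<^sup>2 * v) * z\<^sup>2" by (simp add: s(3) power_mult_distrib)
        from mult_right_mono[OF this, of "exp (2 * \<bar>z\<bar>)"]
        show "\<bar>(\<psi> (x + z * s))\<^sup>2\<bar> * exp (2 * \<bar>z\<bar>) \<le> (K\<^sup>2 * v) * (z\<^sup>2 * exp (2 * \<bar>z\<bar>))" by (simp add: mult.assoc)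
      qed
      then have "(LINT z|gauss. \<bar>(\<psi> (x + z * s))\<^sup>2\<bar> * exp (2 * \<bar>z\<bar>)) \<le> K\<^sup>2 * v * k2" by (simp add: k2_def)
      then have "c * s * (LINT z|gauss. \<bar>(\<psi> (x + z * s))\<^sup>2\<bar> * exp (2 * \<bar>z\<bar>)) \<le> c * s * (K\<^sup>2 * v * k2)"
        using c s by (intro mult_left_mono) auto
      then have 1: "\<bar>E (\<lambda>y. (\<psi> y)\<^sup>2) x - (LINT z|gauss. (\<psi> (x + z * s))\<^sup>2)\<bar> \<le> c * s * (K\<^sup>2 * v * k2)"
        using *[OF D v m \<psi>(2), of x] unfolding s_def c_def by linarith
      have "(LINT z|gauss. (\<psi> (x + z * s))\<^sup>2) - v * (\<phi>' x)\<^sup>2 = (LINT z|gauss. (\<psi> (x + z * s))\<^sup>2 - ((s * \<phi>' x) * z)\<^sup>2)"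
      proof -
        have "integrable gauss (\<lambda>z. ((s * \<phi>' x) * z)\<^sup>2)"
          by (intro integrable_gauss exp_growth_power exp_growth_mult exp_growth_const exp_growth_ident)
        moreover have "(LINT z|gauss. ((s * \<phi>' x) * z)\<^sup>2) = v * (\<phi>' x)\<^sup>2"
          by (simp add: power_mult_distrib integral_gauss_square s(3))
        ultimately show ?thesis using integrable_gauss[OF \<psi>s(2)] by simp
      qed
      moreover have "\<bar>\<dots>\<bar> \<le> (LINT z|gauss. (2 * K\<^sup>2 * (v * s)) * \<bar>z\<bar> ^ 3)"
      proof (intro gauss_mean_abs_le exp_growth_diff \<psi>s exp_growth_power exp_growth_mult exp_growth_const exp_growth_ident ab)
        fix z
        have "(\<psi> (x + z * s))\<^sup>2 - ((s * \<phi>' x) * z)\<^sup>2 = (\<psi> (x + z * s) - (s * \<phi>' x) * z) * (\<psi> (x + z * s) + (s * \<phi>' x) * z)"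
          by (simp add: power2_eq_square algebra_simps)
        then have "\<bar>(\<psi> (x + z * s))\<^sup>2 - ((s * \<phi>' x) * z)\<^sup>2\<bar> = \<bar>\<psi> (x + z * s) - (s * \<phi>' x) * z\<bar> * \<bar>\<psi> (x + z * s) + (s * \<phi>' x) * z\<bar>"
          by (simp add: abs_mult)
        also have "\<dots> \<le> ((K * v) * z\<^sup>2) * (2 * (K * s * \<bar>z\<bar>))"
        proof (intro mult_mono r)
          show "\<bar>\<psi> (x + z * s) + (s * \<phi>' x) * z\<bar> \<le> 2 * (K * s * \<bar>z\<bar>)" using \<psi>K[of z] \<phi>z[of z] by linarith
        qed (use K v in auto)
        also have "\<dots> = (2 * K\<^sup>2 * (v * s)) * (\<bar>z\<bar>\<^sup>2 * \<bar>z\<bar>)" by (simp add: power2_eq_square mult_ac)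
        finally show "\<bar>(\<psi> (x + z * s))\<^sup>2 - ((s * \<phi>' x) * z)\<^sup>2\<bar> \<le> (2 * K\<^sup>2 * (v * s)) * \<bar>z\<bar> ^ 3"
          by (simp add: power3_eq_cube power2_eq_square)
      qed
      ultimately have 2: "\<bar>(LINT z|gauss. (\<psi> (x + z * s))\<^sup>2) - v * (\<phi>' x)\<^sup>2\<bar> \<le> 2 * K\<^sup>2 * (v * s) * k3" by (simp add: k3_def)
      have "c * s * (K\<^sup>2 * v * k2) + 2 * K\<^sup>2 * (v * s) * k3 = (c * k2 + 2 * k3) * K\<^sup>2 * (v * s)" by (simp add: algebra_simps)
      then show ?thesis using 1 2 by linarith
    qed
    \<comment> \<open>The linear Taylor term has Gaussian mean zero and the tilt contributes
      \<open>sqrt v\<close> times something of order \<open>sqrt v\<close>. The mean is thus of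
      order \<open>v\<close>, and its square is absorbed in \<open>v * sqrt v\<close>.\<close>
    have E1: "\<bar>E \<psi> x\<bar> \<le> (1 + c * k1) * K * v"
    proof -
      have "(LINT z|gauss. \<bar>\<psi> (x + z * s)\<bar> * exp (2 * \<bar>z\<bar>)) \<le> (LINT z|gauss. (K * s) * (\<bar>z\<bar> * exp (2 * \<bar>z\<bar>)))"
      proof (intro gauss_mean_mono exp_growth_weighted_abs[OF \<psi>(1)] exp_growth_mult exp_growth_const ab exp_growth_abs_exp)
        show "\<bar>\<psi> (x + z * s)\<bar> * exp (2 * \<bar>z\<bar>) \<le> (K * s) * (\<bar>z\<bar> * exp (2 * \<bar>z\<bar>))" for z
          using mult_right_mono[OF \<psi>K[of z], of "exp (2 * \<bar>z\<bar>)"] by (simp add: mult.assoc)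
      qed
      then have "(LINT z|gauss. \<bar>\<psi> (x + z * s)\<bar> * exp (2 * \<bar>z\<bar>)) \<le> K * s * k1" by (simp add: k1_def)
      then have "c * s * (LINT z|gauss. \<bar>\<psi> (x + z * s)\<bar> * exp (2 * \<bar>z\<bar>)) \<le> c * s * (K * s * k1)"
        using c s by (intro mult_left_mono) auto
      then have 1: "\<bar>E \<psi> x - (LINT z|gauss. \<psi> (x + z * s))\<bar> \<le> c * s * (K * s * k1)"
        using *[OF D v m \<psi>(1), of x] unfolding s_def c_def by linarith
      have "(LINT z|gauss. \<psi> (x + z * s)) = (LINT z|gauss. \<psi> (x + z * s) - (s * \<phi>' x) * z)"
        using integrable_gauss[OF \<psi>s(1)] integrable_gauss[OF exp_growth_ident] by (simp add: integral_gauss_ident)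
      moreover have "\<bar>\<dots>\<bar> \<le> (LINT z|gauss. (K * v) * z\<^sup>2)"
        by (intro gauss_mean_abs_le exp_growth_diff \<psi>s exp_growth_power exp_growth_mult exp_growth_const exp_growth_ident r)
      ultimately have "\<bar>LINT z|gauss. \<psi> (x + z * s)\<bar> \<le> K * v" by (simp add: integral_gauss_square)
      moreover have "c * s * (K * s * k1) + K * v = (1 + c * k1) * K * v" by (simp add: s(3) algebra_simps power2_eq_square)
      ultimately show ?thesis using 1 by linarith
    qed
    have "(E \<psi> x)\<^sup>2 \<le> ((1 + c * k1) * K * v)\<^sup>2"
      using E1 c k K v by (subst abs_le_square_iff[symmetric]) simp
    also have "\<dots> = (1 + c * k1)\<^sup>2 * K\<^sup>2 * (v * s) * s" by (simp add: s(3) power_mult_distrib power2_eq_square mult_ac)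
    also have "\<dots> \<le> (1 + c * k1)\<^sup>2 * K\<^sup>2 * (v * s) * 1" using s v by (intro mult_left_mono) auto
    finally have E1': "(E \<psi> x)\<^sup>2 \<le> (1 + c * k1)\<^sup>2 * K\<^sup>2 * (v * s)" by simp
    have var: "E (\<lambda>y. (\<phi> y)\<^sup>2) x - (E \<phi> x)\<^sup>2 = E (\<lambda>y. (\<psi> y)\<^sup>2) x - (E \<psi> x)\<^sup>2"
    proof -
      have "E (\<lambda>y. (\<psi> y)\<^sup>2) x = E (\<lambda>y. (\<phi> y)\<^sup>2 - (2 * \<phi> x) * \<phi> y + (\<phi> x)\<^sup>2) x"
        by (rule arg_cong[of _ _ "\<lambda>F. E F x"]) (auto simp: \<psi>_def power2_diff)
      also have "\<dots> = E (\<lambda>y. (\<phi> y)\<^sup>2) x - (2 * \<phi> x) * E \<phi> x + (\<phi> x)\<^sup>2"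
        by (subst E_add E_diff | intro exp_growth_diff exp_growth_power \<phi> exp_growth_mult exp_growth_const)+ (simp add: E_cmult)
      finally have e1: "E (\<lambda>y. (\<psi> y)\<^sup>2) x = E (\<lambda>y. (\<phi> y)\<^sup>2) x - (2 * \<phi> x) * E \<phi> x + (\<phi> x)\<^sup>2" .
      have e2: "E \<psi> x = E \<phi> x - \<phi> x" unfolding \<psi>_def by (subst E_diff) (auto intro: \<phi>)
      show ?thesis unfolding e1 e2 by (simp add: power2_eq_square algebra_simps)
    qed
    have "(c * k2 + 2 * k3 + (1 + c * k1)\<^sup>2) * K\<^sup>2 * (v * s) = (c * k2 + 2 * k3) * K\<^sup>2 * (v * s) + (1 + c * k1)\<^sup>2 * K\<^sup>2 * (v * s)"
      by (simp add: distrib_right)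
    then show ?thesis unfolding var s_def[symmetric] using E2 E1' zero_le_power2[of "E \<psi> x"] by linarith
  qed
  then show ?thesis by (simp add: tilt_variance_const_def k1_def k2_def k3_def c_def)
qed

text \<open>Collects three errors: of the tilted variance of \<open>D 2\<close>, of the cross term,
  and of the squared variance of \<open>D 1\<close> when the second derivative after the step is
  squared.\<close>

definition increment_const :: "real \<Rightarrow> real" where
  "increment_const K = tilt_variance_const * K\<^sup>2
     + 2 * (K * (tilt_variance_const * K\<^sup>2) + tilt_lipschitz_const * K * K\<^sup>2) + (tilt_variance_const * K\<^sup>2 + K\<^sup>2)\<^sup>2"

lemma gaussian_step_moment_increments:
  assumes K: "1 \<le> K" and D: "jet D" "\<And>x. \<bar>D 1 x\<bar> \<le> 1" and DK: "\<And>j x. j \<in> {1..4} \<Longrightarrow> \<bar>D j x\<bar> \<le> K"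
    and v: "0 \<le> v" "v \<le> 1" and m: "m \<in> {0..1}" and H: "jet H" "H 0 = gaussian_step m v (D 0)"
  shows "\<bar>tilted_mean m v (D 0) (\<lambda>y. (D 1 y)\<^sup>2) x - (H 1 x)\<^sup>2 - v * (D 2 x)\<^sup>2\<bar> \<le> increment_const K * (v * sqrt v)"
    "\<bar>tilted_mean m v (D 0) (\<lambda>y. (D 2 y)\<^sup>2) x - (H 2 x)\<^sup>2 - v * ((D 3 x)\<^sup>2 - 2 * m * (D 2 x) ^ 3)\<bar>
      \<le> increment_const K * (v * sqrt v)"
proof -
  define c1 where "c1 = tilt_lipschitz_const"
  have c1: "0 \<le> c1" by (simp add: c1_def tilt_lipschitz_const_nonneg)
  define c where "c = tilt_variance_const * K\<^sup>2"
  define C where "C = c + 2 * (K * c + c1 * K * K\<^sup>2) + (c + K\<^sup>2)\<^sup>2"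
  have c: "0 \<le> c" by (simp add: c_def tilt_variance_const_nonneg)
  have C: "c \<le> C" "0 \<le> C" using c c1 K by (auto simp: C_def)
  have CK: "increment_const K = C" by (simp add: increment_const_def C_def c_def c1_def)
  note * = tilted_mean_lipschitz and ** = tilted_variance
  interpret gaussian_layer m v D by standard fact
  define s where "s = sqrt v"
  have s: "0 \<le> s" "s \<le> 1" "v = s\<^sup>2" using v by (auto simp: s_def)
  \<comment> \<open>\<open>H\<close> and \<open>H'\<close> both list the derivatives of the same
    function, so the formulas known for \<open>H'\<close> hold for \<open>H\<close>.\<close>
  obtain H' where H': "jet H'" "H' 0 = gaussian_step m v (D 0)" "\<And>x. H' 1 x = E (D 1) x" "\<And>x. bell2 m H' x = E (bell2 m D) x"
    using jet_step by metis
  have HH: "H j = H' j" if "j \<le> 4" for j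
    using jet_deriv[OF H(1) that] jet_deriv[OF H'(1) that] H(2) H'(2) by simp
  have H1: "H 1 x = E (D 1) x" using HH[of 1] H'(3) by simp
  have e: "exp_growth (D 1)" "exp_growth (D 2)" using jet_exp_growth[OF D(1)] by auto
  have b1: "E (bell2 m D) x = E (D 2) x + m * E (\<lambda>y. (D 1 y)\<^sup>2) x"
    unfolding bell2_def[abs_def]
    by (subst E_add | intro exp_growth_power exp_growth_mult e exp_growth_const)+ (simp add: E_cmult)
  have D': "(D 1 has_real_derivative D 2 y) (at y)" "(D 2 has_real_derivative D 3 y) (at y)" for y
    using jet_has_derivative[OF D(1), of 1 y] jet_has_derivative[OF D(1), of 2 y] by (simp_all add: numeral_eq_Suc)
  have L: "\<bar>D 2 y - D 2 y'\<bar> \<le> K * \<bar>y - y'\<bar>" "\<bar>D 3 y - D 3 y'\<bar> \<le> K * \<bar>y - y'\<bar>" for y y'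
    using jet_lipschitz[OF D(1), of 2 K y y'] jet_lipschitz[OF D(1), of 3 K y y'] DK by (simp_all add: numeral_eq_Suc)
  define b where "b = E (\<lambda>y. (D 1 y)\<^sup>2) x - (E (D 1) x)\<^sup>2"
  define a where "a = E (\<lambda>y. (D 2 y)\<^sup>2) x - (E (D 2) x)\<^sup>2"
  have vb: "\<bar>b - v * (D 2 x)\<^sup>2\<bar> \<le> c * (v * s)"
    unfolding b_def c_def s_def using ** [OF D v m e(1) D'(1), of K x] DK L(1) by auto
  have va: "\<bar>a - v * (D 3 x)\<^sup>2\<bar> \<le> c * (v * s)"
    unfolding a_def c_def s_def using ** [OF D v m e(2) D'(2), of K x] DK L(2) by auto
  have ve: "\<bar>E (D 2) x - D 2 x\<bar> \<le> c1 * K * s"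
    unfolding s_def c1_def using *[OF D v m e(2), of K x] L(1) by auto
  \<comment> \<open>Here \<open>b\<close> is the tilted variance of \<open>D 1\<close>,
    approximately \<open>v * (D 2 x)\<^sup>2\<close>; the square of this expression produces
    \<open>2 * m * v * (D 2 x) ^ 3\<close> to leading order.\<close>
  have H2: "H 2 x = E (D 2) x + m * b"
    using H'(4)[of x] b1 HH[of 1] HH[of 2] H1 by (simp add: bell2_def b_def algebra_simps)
  have d2: "(D 2 x)\<^sup>2 \<le> K\<^sup>2" using DK[of 2 x] K by (subst abs_le_square_iff[symmetric]) auto
  have eK: "\<bar>E (D 2) x\<bar> \<le> K" by (intro E_abs_le e) (use DK in auto)
  have bb: "\<bar>b\<bar> \<le> (c + K\<^sup>2) * v"
  proof -
    have "c * (v * s) \<le> c * (v * 1)" using c v s by (intro mult_left_mono) auto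
    moreover have "v * (D 2 x)\<^sup>2 \<le> v * K\<^sup>2" using d2 v by (intro mult_left_mono) auto
    moreover have "0 \<le> v * (D 2 x)\<^sup>2" using v by simp
    ultimately show ?thesis using vb by (simp add: abs_le_iff algebra_simps)
  qed
  have b2: "b\<^sup>2 \<le> (c + K\<^sup>2)\<^sup>2 * (v * s)"
  proof -
    have "b\<^sup>2 \<le> ((c + K\<^sup>2) * v)\<^sup>2" using bb c v by (subst abs_le_square_iff[symmetric]) simp
    also have "\<dots> = ((c + K\<^sup>2)\<^sup>2 * (v * s)) * s" by (simp add: s(3) power_mult_distrib power2_eq_square mult_ac)
    also have "\<dots> \<le> ((c + K\<^sup>2)\<^sup>2 * (v * s)) * 1" using s v by (intro mult_left_mono) auto
    finally show ?thesis by simp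
  qed
  have eb: "\<bar>E (D 2) x * b - v * (D 2 x) ^ 3\<bar> \<le> (K * c + c1 * K * K\<^sup>2) * (v * s)"
  proof -
    have "E (D 2) x * b - v * (D 2 x) ^ 3 = E (D 2) x * (b - v * (D 2 x)\<^sup>2) + (E (D 2) x - D 2 x) * (v * (D 2 x)\<^sup>2)"
      by (simp add: algebra_simps power3_eq_cube power2_eq_square)
    moreover have "\<bar>E (D 2) x * (b - v * (D 2 x)\<^sup>2)\<bar> \<le> K * (c * (v * s))"
      unfolding abs_mult using eK vb K by (intro mult_mono) auto
    moreover have "\<bar>(E (D 2) x - D 2 x) * (v * (D 2 x)\<^sup>2)\<bar> \<le> (c1 * K * s) * (v * K\<^sup>2)"
      unfolding abs_mult[of "E (D 2) x - D 2 x"] using ve d2 v K c1 s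
      by (intro mult_mono) (auto intro: mult_left_mono)
    moreover have "K * (c * (v * s)) + (c1 * K * s) * (v * K\<^sup>2) = (K * c + c1 * K * K\<^sup>2) * (v * s)"
      by (simp add: algebra_simps)
    ultimately show ?thesis by linarith
  qed
  have "E (\<lambda>y. (D 2 y)\<^sup>2) x - (H 2 x)\<^sup>2 - v * ((D 3 x)\<^sup>2 - 2 * m * (D 2 x) ^ 3)
    = (a - v * (D 3 x)\<^sup>2) - 2 * m * (E (D 2) x * b - v * (D 2 x) ^ 3) - m\<^sup>2 * b\<^sup>2"
    unfolding H2 a_def by (simp add: algebra_simps power2_sum power_mult_distrib)
  moreover have "\<bar>2 * m * (E (D 2) x * b - v * (D 2 x) ^ 3)\<bar> \<le> 2 * ((K * c + c1 * K * K\<^sup>2) * (v * s))"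
  proof -
    have "\<bar>(2 * m) * (E (D 2) x * b - v * (D 2 x) ^ 3)\<bar> \<le> 2 * ((K * c + c1 * K * K\<^sup>2) * (v * s))"
      unfolding abs_mult[of "2 * m"] using eb m by (intro mult_mono) auto
    then show ?thesis by simp
  qed
  moreover have "\<bar>m\<^sup>2 * b\<^sup>2\<bar> \<le> 1 * ((c + K\<^sup>2)\<^sup>2 * (v * s))"
    unfolding abs_mult using m b2 by (intro mult_mono) (auto simp: power_le_one)
  moreover have "C * (v * s) = c * (v * s) + 2 * ((K * c + c1 * K * K\<^sup>2) * (v * s)) + (c + K\<^sup>2)\<^sup>2 * (v * s)"
    unfolding C_def by (simp add: algebra_simps)
  ultimately have "\<bar>E (\<lambda>y. (D 2 y)\<^sup>2) x - (H 2 x)\<^sup>2 - v * ((D 3 x)\<^sup>2 - 2 * m * (D 2 x) ^ 3)\<bar> \<le> C * (v * s)"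
    using va by linarith
  moreover have "\<bar>E (\<lambda>y. (D 1 y)\<^sup>2) x - (H 1 x)\<^sup>2 - v * (D 2 x)\<^sup>2\<bar> \<le> C * (v * s)"
  proof -
    have "c * (v * s) \<le> C * (v * s)" using C v s by (intro mult_right_mono) auto
    then show ?thesis using vb unfolding b_def H1 by linarith
  qed
  ultimately show "\<bar>E (\<lambda>y. (D 1 y)\<^sup>2) x - (H 1 x)\<^sup>2 - v * (D 2 x)\<^sup>2\<bar> \<le> increment_const K * (v * sqrt v)"
    "\<bar>E (\<lambda>y. (D 2 y)\<^sup>2) x - (H 2 x)\<^sup>2 - v * ((D 3 x)\<^sup>2 - 2 * m * (D 2 x) ^ 3)\<bar> \<le> increment_const K * (v * sqrt v)"
    unfolding s_def CK by simp_all
qed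

section \<open>Discrete measures\<close>

lemma unit_measuresD:
  assumes "\<mu> \<in> unit_measures"
  shows "prob_space \<mu>" "sets \<mu> = sets borel" "measure \<mu> {0..1} = 1" "space \<mu> = UNIV"
  using assms sets_eq_imp_space_eq[of \<mu> borel] by (auto simp: unit_measures_def)

text \<open>The mass of a Borel set is the sum of the masses of the atoms in it. In particular the
  distribution function is constant between atoms, which is how the last claim is used.\<close>

lemma discrete_unit_measuresD:
  assumes "\<nu> \<in> discrete_unit_measures"
  shows "\<nu> \<in> unit_measures" "finite (atoms \<nu>)" "atoms \<nu> \<subseteq> {0..1}" "A \<in> sets borel \<Longrightarrow> atoms \<nu> \<inter> A = {} \<Longrightarrow> measure \<nu> A = 0"
    and discrete_measure_cong: "A \<in> sets borel \<Longrightarrow> B \<in> sets borel \<Longrightarrow> atoms \<nu> \<inter> A = atoms \<nu> \<inter> B \<Longrightarrow> measure \<nu> A = measure \<nu> B"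
proof -
  show u: "\<nu> \<in> unit_measures" using assms by (simp add: discrete_unit_measures_def)
  interpret prob_space \<nu> using unit_measuresD[OF u] by simp
  have s [measurable_cong]: "sets \<nu> = sets borel" using unit_measuresD[OF u] by simp
  obtain S where S: "finite S" "S \<subseteq> {0..1}" "measure \<nu> S = 1"
    using assms by (auto simp: discrete_unit_measures_def)
  have mS: "S \<in> sets \<nu>" using finite_imp_closed[OF S(1)] s by auto
  have null: "measure \<nu> A = 0" if "A \<in> sets borel" "S \<inter> A = {}" for A
  proof -
    have "measure \<nu> S + measure \<nu> A = measure \<nu> (S \<union> A)"
      using mS that s by (intro finite_measure_Union[symmetric]) auto
    also have "\<dots> \<le> 1" by simp
    finally show ?thesis using S(3) by (simp add: measure_le_0_iff)
  qed
  have sub: "atoms \<nu> \<subseteq> S"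
  proof
    fix q assume q: "q \<in> atoms \<nu>"
    show "q \<in> S"
    proof (rule ccontr)
      assume "q \<notin> S"
      then have "measure \<nu> {q} = 0" by (intro null) auto
      then show False using q by (simp add: atoms_def)
    qed
  qed
  show fin: "finite (atoms \<nu>)" and "atoms \<nu> \<subseteq> {0..1}" using sub S finite_subset by auto
  have split: "measure \<nu> A = (\<Sum>q\<in>atoms \<nu> \<inter> A. measure \<nu> {q})" if A: "A \<in> sets borel" for A
  proof -
    have "measure \<nu> A = measure \<nu> (S \<inter> A \<union> (A - S))" by (rule arg_cong[of _ _ "measure \<nu>"]) auto
    also have "\<dots> = measure \<nu> (S \<inter> A) + measure \<nu> (A - S)"
      using mS A s by (intro finite_measure_Union) auto
    also have "measure \<nu> (A - S) = 0" using mS A s by (intro null) auto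
    also have "measure \<nu> (S \<inter> A) = (\<Sum>q\<in>S \<inter> A. measure \<nu> {q})"
      using S(1) s by (intro finite_measure_eq_sum_singleton) auto
    also have "\<dots> = (\<Sum>q\<in>atoms \<nu> \<inter> A. measure \<nu> {q})"
      using S(1) sub by (intro sum.mono_neutral_right) (auto simp: atoms_def zero_less_measure_iff)
    finally show ?thesis by simp
  qed
  show "measure \<nu> A = 0" if "A \<in> sets borel" "atoms \<nu> \<inter> A = {}" using split[OF that(1)] that(2) by simp
  show "measure \<nu> A = measure \<nu> B" if "A \<in> sets borel" "B \<in> sets borel" "atoms \<nu> \<inter> A = atoms \<nu> \<inter> B"
    using split[OF that(1)] split[OF that(2)] that(3) by simp
qed

text \<open>Links the two ways in which atoms are addressed, by position in the sorted list and by
  counting those up to a time: the positions of elements up to \<open>s\<close> form an initial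
  segment, whose length is the count.\<close>

lemma sorted_list_of_set_nth_le_iff:
  fixes A :: "real set"
  assumes A: "finite A" and i: "i < card A"
  shows "sorted_list_of_set A ! i \<le> s \<longleftrightarrow> i < card {q \<in> A. q \<le> s}"
proof -
  define xs where "xs = sorted_list_of_set A"
  have xs: "set xs = A" "sorted xs" "distinct xs" "length xs = card A"
    using A by (auto simp: xs_def)
  define I where "I = {i. i < card A \<and> xs ! i \<le> s}"
  have fI: "finite I" by (simp add: I_def)
  have "bij_betw ((!) xs) I {q \<in> A. q \<le> s}"
    unfolding bij_betw_def
  proof
    show "inj_on ((!) xs) I" using xs by (auto simp: inj_on_def I_def nth_eq_iff_index_eq)
    show "(!) xs ` I = {q \<in> A. q \<le> s}" using xs by (force simp: I_def in_set_conv_nth image_iff)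
  qed
  then have c: "card I = card {q \<in> A. q \<le> s}" by (rule bij_betw_same_card)
  have down: "{..j} \<subseteq> I" if "j \<in> I" for j
    using that xs by (auto simp: I_def intro: order_trans[OF sorted_nth_mono])
  have "I \<subseteq> {..<card I}"
  proof
    fix j assume "j \<in> I"
    from card_mono[OF fI down[OF this]] show "j \<in> {..<card I}" by simp
  qed
  then have "I = {..<card I}" by (intro card_subset_eq) auto
  then show ?thesis using i c unfolding xs_def[symmetric] by (auto simp: I_def)
qed

text \<open>Backward induction from \<open>b\<close> on the number of breakpoints still ahead. The
  times \<open>s\<close> and \<open>t\<close> of a step may lie anywhere, so a claim is obtained at
  every time and not only at breakpoints.\<close>

lemma breakpoint_induct [consumes 3, case_names base step]:
  fixes A :: "real set"
  assumes A: "finite A" and u: "a \<le> u" "u \<le> b"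
    and base: "P b"
    and step: "\<And>s t. a \<le> s \<Longrightarrow> s < t \<Longrightarrow> t \<le> b \<Longrightarrow> A \<inter> {s<..<t} = {} \<Longrightarrow> P t \<Longrightarrow> P s"
  shows "P u"
  using u
proof (induction "card (A \<inter> {u<..<b})" arbitrary: u rule: less_induct)
  case less
  show ?case
  proof (cases "u = b")
    case False
    then have ub: "u < b" using less by simp
    show ?thesis
    proof (cases "A \<inter> {u<..<b} = {}")
      case True
      then show ?thesis using step[of u b] base less ub by simp
    next
      case ne: False
      have fin: "finite (A \<inter> {u<..<b})" using A by simp
      define t where "t = Min (A \<inter> {u<..<b})"
      have t: "t \<in> A \<inter> {u<..<b}" unfolding t_def using fin ne by (rule Min_in)
      have tmin: "t \<le> q" if "q \<in> A \<inter> {u<..<b}" for q unfolding t_def using fin that by (rule Min_le)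
      have "A \<inter> {t<..<b} \<subset> A \<inter> {u<..<b}" using t by auto
      then have "card (A \<inter> {t<..<b}) < card (A \<inter> {u<..<b})" using fin by (intro psubset_card_mono)
      then have "P t" using t less by (intro less.hyps) auto
      moreover have "A \<inter> {u<..<t} = {}" using tmin t by force
      ultimately show ?thesis using step[of u t] t less by auto
    qed
  qed (use base in simp)
qed

section \<open>The Parisi recursion as Gaussian steps between arbitrary times\<close>

locale parisi =
  fixes \<xi> :: "real \<Rightarrow> real" and L :: real
  assumes deriv_mono: "0 \<le> s \<Longrightarrow> s \<le> t \<Longrightarrow> t \<le> 1 \<Longrightarrow> deriv \<xi> s \<le> deriv \<xi> t"
    and deriv_lipschitz: "0 \<le> s \<Longrightarrow> s \<le> t \<Longrightarrow> t \<le> 1 \<Longrightarrow> deriv \<xi> t - deriv \<xi> s \<le> L * (t - s)"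
    and deriv_zero: "deriv \<xi> 0 = 0"
begin

lemma L_nonneg: "0 \<le> L"
  using deriv_mono[of 0 1] deriv_lipschitz[of 0 1] by simp

lemma deriv_diff_le:
  assumes "0 \<le> s" "s \<le> t" "t \<le> 1"
  shows "deriv \<xi> t - deriv \<xi> s \<le> L"
proof -
  have "L * (t - s) \<le> L * 1" using assms L_nonneg by (intro mult_left_mono) auto
  then show ?thesis using deriv_lipschitz[OF assms] by simp
qed

lemma parisi_layer_jet: "\<exists>D. jet D \<and> D 0 = (\<lambda>x. parisi_layer \<xi> \<mu> p x u)"
proof (induction "card (atoms \<mu>) - p" arbitrary: p u rule: less_induct)
  case less
  show ?case
  proof (cases "card (atoms \<mu>) \<le> p")
    case True
    then have "(\<lambda>x. parisi_layer \<xi> \<mu> p x u) = (\<lambda>x. ln (cosh x) + (deriv \<xi> 1 - deriv \<xi> u) / 2)"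
      by (simp add: parisi_layer.simps[of _ _ p])
    then show ?thesis using log_cosh_jet[of "(deriv \<xi> 1 - deriv \<xi> u) / 2"] by metis
  next
    case False
    have "\<exists>D. jet D \<and> D 0 = (\<lambda>x. parisi_layer \<xi> \<mu> (Suc p) x (atom \<mu> (Suc p)))"
      by (rule less) (use False in simp)
    then obtain D where D: "jet D" "D 0 = (\<lambda>x. parisi_layer \<xi> \<mu> (Suc p) x (atom \<mu> (Suc p)))"
      by blast
    have "(\<lambda>x. parisi_layer \<xi> \<mu> p x u) =
        gaussian_step (atom_cdf \<mu> p) (deriv \<xi> (atom \<mu> (Suc p)) - deriv \<xi> u) (D 0)"
      using False by (intro ext) (simp add: parisi_layer.simps[of _ _ p] D(2))
    then show ?thesis using gaussian_layer.jet_step[OF gaussian_layer.intro[OF D(1)]] by metis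
  qed
qed

lemma parisi_discrete_jet: obtains D where "jet D" "D 0 = (\<lambda>x. parisi_discrete \<xi> \<nu> (x, u))"
  using parisi_layer_jet[of \<nu> "card {q \<in> atoms \<nu>. q \<le> u}" u] by (auto simp: parisi_discrete_def)

lemma parisi_discrete_end:
  assumes "\<nu> \<in> discrete_unit_measures"
  shows "parisi_discrete \<xi> \<nu> (x, 1) = ln (cosh x)"
proof -
  have "{q \<in> atoms \<nu>. q \<le> 1} = atoms \<nu>" using discrete_unit_measuresD(3)[OF assms] by auto
  then show ?thesis by (simp add: parisi_discrete_def parisi_layer.simps)
qed

text \<open>Frees the recursion from its indexing by atoms. If \<open>t\<close> is an atom this is
  the defining formula. If \<open>t\<close> lies before the next atom \<open>q\<close>, the step
  from \<open>q\<close> to \<open>s\<close> factors through \<open>t\<close> by the semigroup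
  property. Beyond the last atom the weight is 1 and the explicit formula is a step as well.\<close>

lemma parisi_discrete_step:
  assumes \<nu>: "\<nu> \<in> discrete_unit_measures" and st: "0 \<le> s" "s < t" "t \<le> 1" and none: "atoms \<nu> \<inter> {s<..<t} = {}"
  shows "parisi_discrete \<xi> \<nu> (x, s) =
    gaussian_step (measure \<nu> {0..s}) (deriv \<xi> t - deriv \<xi> s) (\<lambda>y. parisi_discrete \<xi> \<nu> (y, t)) x"
proof -
  note D = discrete_unit_measuresD[OF \<nu>]
  define n where "n = card (atoms \<nu>)"
  define p where "p = card {q \<in> atoms \<nu>. q \<le> s}"
  have nth: "sorted_list_of_set (atoms \<nu>) ! i \<le> r \<longleftrightarrow> i < card {q \<in> atoms \<nu>. q \<le> r}" if "i < n" for i r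
    using sorted_list_of_set_nth_le_iff[OF D(2)] that by (simp add: n_def)
  have atom: "sorted_list_of_set (atoms \<nu>) ! i \<in> atoms \<nu>" if "i < n" for i
    using that D(2) unfolding n_def by (metis length_sorted_list_of_set nth_mem set_sorted_list_of_set)
  have pn: "p \<le> n" unfolding p_def n_def using D(2) by (intro card_mono) auto
  have v: "0 \<le> deriv \<xi> t - deriv \<xi> s" using deriv_mono[of s t] st by simp
  \<comment> \<open>Before the first atom both sides vanish, the left one by the convention for
    index 0; otherwise \<open>[0, s]\<close> contains the same atoms as the interval ending at the
    \<open>p\<close>-th atom.\<close>
  have cdf: "atom_cdf \<nu> p = measure \<nu> {0..s}"
  proof (cases "p = 0")
    case True
    then have "atoms \<nu> \<inter> {0..s} = {}" using D(2) by (auto simp: p_def)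
    then show ?thesis using D(4)[of "{0..s}"] True by (simp add: atom_cdf_def)
  next
    case False
    then have a: "atom \<nu> p = sorted_list_of_set (atoms \<nu>) ! (p - 1)" using pn by (simp add: atom_def n_def)
    have "q \<le> s \<longleftrightarrow> q \<le> atom \<nu> p" if q: "q \<in> atoms \<nu>" for q
    proof -
      obtain i where i: "i < n" "q = sorted_list_of_set (atoms \<nu>) ! i"
        using q D(2) unfolding n_def by (metis in_set_conv_nth length_sorted_list_of_set set_sorted_list_of_set)
      have "q \<le> s \<longleftrightarrow> i \<le> p - 1" using nth[OF i(1), of s] i(2) False by (auto simp: p_def)
      also have "i \<le> p - 1 \<longleftrightarrow> q \<le> atom \<nu> p"
      proof
        assume "i \<le> p - 1" then show "q \<le> atom \<nu> p"
          unfolding i(2) a using pn False by (intro sorted_nth_mono) (auto simp: n_def)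
      next
        assume "q \<le> atom \<nu> p"
        moreover have "atom \<nu> p \<le> s" unfolding a using nth[of "p - 1" s] pn False by (simp add: p_def[symmetric])
        ultimately have "q \<le> s" by simp
        then show "i \<le> p - 1" using nth[OF i(1), of s] i(2) False by (auto simp: p_def)
      qed
      finally show ?thesis .
    qed
    then have "atoms \<nu> \<inter> {0..atom \<nu> p} = atoms \<nu> \<inter> {0..s}" by auto
    then show ?thesis using discrete_measure_cong[OF \<nu>, of "{0..atom \<nu> p}" "{0..s}"] False
      by (simp add: atom_cdf_def)
  qed
  have \<Phi>s: "parisi_discrete \<xi> \<nu> (y, s) = parisi_layer \<xi> \<nu> p y s" for y
    by (simp add: parisi_discrete_def p_def)
  show ?thesis
  proof (cases "t \<in> atoms \<nu>")
    case True
    have eq: "{q \<in> atoms \<nu>. q \<le> t} = insert t {q \<in> atoms \<nu>. q \<le> s}" using none st True by force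
    then have pt: "card {q \<in> atoms \<nu>. q \<le> t} = Suc p" unfolding eq p_def using D(2) st by (subst card_insert_disjoint) auto
    have "card {q \<in> atoms \<nu>. q \<le> t} \<le> n" unfolding n_def using D(2) by (intro card_mono) auto
    then have pn': "p < n" using pt by simp
    have at: "atom \<nu> (Suc p) = t"
    proof -
      have a: "atom \<nu> (Suc p) = sorted_list_of_set (atoms \<nu>) ! p" using pn' by (simp add: atom_def n_def)
      have "atom \<nu> (Suc p) \<le> t" "\<not> atom \<nu> (Suc p) \<le> s"
        unfolding a using nth[OF pn', of t] nth[OF pn', of s] pt by (auto simp: p_def)
      moreover have "atom \<nu> (Suc p) \<in> atoms \<nu>" unfolding a by (rule atom[OF pn'])
      ultimately show ?thesis using none by force
    qed
    have "parisi_discrete \<xi> \<nu> (y, t) = parisi_layer \<xi> \<nu> (Suc p) y t" for y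
      by (simp add: parisi_discrete_def pt)
    then show ?thesis unfolding \<Phi>s
      using pn' by (simp add: parisi_layer.simps[of _ _ p] at cdf n_def)
  next
    case False
    have "q \<le> t \<longleftrightarrow> q \<le> s" if "q \<in> atoms \<nu>" for q
    proof -
      have "\<not> (s < q \<and> q < t)" using none that by auto
      then show ?thesis using False that st by (cases "q = t") auto
    qed
    then have "{q \<in> atoms \<nu>. q \<le> t} = {q \<in> atoms \<nu>. q \<le> s}" by auto
    then have \<Phi>t: "parisi_discrete \<xi> \<nu> (y, t) = parisi_layer \<xi> \<nu> p y t" for y
      by (simp add: parisi_discrete_def p_def)
    show ?thesis
    proof (cases "p < n")
      case True
      define q where "q = atom \<nu> (Suc p)"
      have a: "q = sorted_list_of_set (atoms \<nu>) ! p" using True by (simp add: q_def atom_def n_def)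
      have q: "q \<in> atoms \<nu>" unfolding a by (rule atom[OF True])
      have "\<not> q \<le> s" unfolding a using nth[OF True, of s] by (simp add: p_def)
      then have tq: "t \<le> q" "q \<le> 1" using none q D(3) by force+
      obtain G where G: "jet G" "G 0 = (\<lambda>x. parisi_layer \<xi> \<nu> (Suc p) x q)"
        using parisi_layer_jet by blast
      have ly: "parisi_layer \<xi> \<nu> p y u = gaussian_step (measure \<nu> {0..s}) (deriv \<xi> q - deriv \<xi> u) (G 0) y" for y u
        using True by (simp add: parisi_layer.simps[of _ _ p] q_def[symmetric] G(2) cdf n_def)
      have "0 \<le> deriv \<xi> q - deriv \<xi> t" using deriv_mono[of t q] tq st by simp
      from gaussian_step_semigroup[OF G(1) v this, of "measure \<nu> {0..s}" x]
      show ?thesis unfolding \<Phi>s \<Phi>t ly by simp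
    next
      case False
      then have "card (atoms \<nu>) \<le> p" by (simp add: n_def)
      then have ly: "parisi_layer \<xi> \<nu> p y u = ln (cosh y) + (deriv \<xi> 1 - deriv \<xi> u) / 2" for y u
        by (simp add: parisi_layer.simps[of _ _ p])
      have "{q \<in> atoms \<nu>. q \<le> s} = atoms \<nu>"
        using False pn D(2) unfolding p_def n_def by (intro card_subset_eq) auto
      then have "atoms \<nu> \<inter> {0..s} = atoms \<nu> \<inter> {0..1}" using D(3) by auto
      then have one: "measure \<nu> {0..s} = 1"
        using discrete_measure_cong[OF \<nu>, of "{0..s}" "{0..1}"] unit_measuresD(3)[OF D(1)] by simp
      show ?thesis unfolding \<Phi>s \<Phi>t ly one gaussian_step_log_cosh[OF v]
        by (simp add: field_simps)
    qed
  qed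
qed

lemma cdf_unit: "\<nu> \<in> unit_measures \<Longrightarrow> measure \<nu> {0..s} \<in> {0..1}"
  using prob_space.prob_le_1[OF unit_measuresD(1)] by auto

lemma cdf_mono: "\<nu> \<in> unit_measures \<Longrightarrow> s \<le> t \<Longrightarrow> measure \<nu> {0..s} \<le> measure \<nu> {0..t}"
  using unit_measuresD by (intro finite_measure.finite_measure_mono) (auto simp: prob_space_def)

end

section \<open>Derivative bounds independent of the number of atoms\<close>

lemma abs_diff_le_3:
  "\<bar>a\<bar> \<le> A \<Longrightarrow> \<bar>b\<bar> \<le> B \<Longrightarrow> \<bar>c\<bar> \<le> C \<Longrightarrow> A + B + C \<le> R \<Longrightarrow> \<bar>a - b - c\<bar> \<le> R" for a b c :: real
  by linarith

lemma abs_diff_le_4: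
  "\<bar>a\<bar> \<le> A \<Longrightarrow> \<bar>b\<bar> \<le> B \<Longrightarrow> \<bar>c\<bar> \<le> C \<Longrightarrow> \<bar>d\<bar> \<le> D \<Longrightarrow> A + B + C + D \<le> R \<Longrightarrow> \<bar>a - b - c - d\<bar> \<le> R"
  for a b c d :: real
  by (rule abs_diff_le_3[of "a - b" "A + B"]) auto

text \<open>The factors \<open>11\<close> and \<open>154\<close> bound the change of \<open>bell3\<close> and \<open>bell4\<close> per unit of \<open>m\<close>, given the
  bounds \<open>1\<close>, \<open>3\<close> and \<open>22\<close> on the first three derivatives.\<close>

definition bell_bounds :: "real \<Rightarrow> (nat \<Rightarrow> real \<Rightarrow> real) \<Rightarrow> bool" where
  "bell_bounds m D \<longleftrightarrow> (\<forall>x. \<bar>D 1 x\<bar> \<le> 1 \<and> \<bar>bell2 m D x\<bar> \<le> 1 + (1 - m) \<and> \<bar>bell3 m D x\<bar> \<le> 1 + 11 * (1 - m)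
     \<and> \<bar>bell4 m D x\<bar> \<le> 1 + 154 * (1 - m))"

text \<open>For weights in the unit interval the three combinations are at most 2, 12 and 155.
  Solving for the derivatives gives \<open>2 + 1 = 3\<close>, \<open>12 + 9 + 1 = 22\<close> and
  \<open>155 + 115 + 18 + 1 = 289\<close>, where \<open>115 = 4 * 22 + 3 * 9\<close>.\<close>

lemma bell_bounds_derivatives:
  assumes b: "bell_bounds m D" and m: "m \<in> {0..1}"
  shows "\<bar>D 1 x\<bar> \<le> 1" "\<bar>D 2 x\<bar> \<le> 3" "\<bar>D 3 x\<bar> \<le> 22" "\<bar>D 4 x\<bar> \<le> 289"
proof -
  have b: "\<bar>D 1 x\<bar> \<le> 1" "\<bar>bell2 m D x\<bar> \<le> 2" "\<bar>bell3 m D x\<bar> \<le> 12" "\<bar>bell4 m D x\<bar> \<le> 155"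
    using b m unfolding bell_bounds_def by (auto intro: order_trans)
  show d1: "\<bar>D 1 x\<bar> \<le> 1" by (rule b)
  have p: "\<bar>(D 1 x) ^ n\<bar> \<le> 1" for n using d1 by (simp add: power_abs power_le_one)
  have mm: "\<bar>m * y\<bar> \<le> \<bar>y\<bar>" "\<bar>m\<^sup>2 * y\<bar> \<le> \<bar>y\<bar>" "\<bar>m ^ 3 * y\<bar> \<le> \<bar>y\<bar>" for y
    using m mult_right_mono[of _ 1 "\<bar>y\<bar>"] by (auto simp: abs_mult power_le_one)
  show d2: "\<bar>D 2 x\<bar> \<le> 3" using b(2) mm(1)[of "(D 1 x)\<^sup>2"] p[of 2] unfolding bell2_def by linarith
  have d12: "\<bar>D 1 x * D 2 x\<bar> \<le> 1 * 3" unfolding abs_mult using d1 d2 by (intro mult_mono) auto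
  have d3': "\<bar>3 * (D 1 x * D 2 x)\<bar> \<le> 9" using d12 by simp
  show d3: "\<bar>D 3 x\<bar> \<le> 22"
  proof -
    have "D 3 x = bell3 m D x - m * (3 * (D 1 x * D 2 x)) - m\<^sup>2 * (D 1 x) ^ 3" by (simp add: bell3_def)
    then show ?thesis
      using abs_diff_le_3[OF b(3) order_trans[OF mm(1) d3'] order_trans[OF mm(2) p[of 3]], of 22] by simp
  qed
  have d13: "\<bar>D 1 x * D 3 x\<bar> \<le> 1 * 22" unfolding abs_mult using d1 d3 by (intro mult_mono) auto
  have d22: "\<bar>(D 2 x)\<^sup>2\<bar> \<le> 9" using power_mono[OF d2, of 2] by simp
  have d112: "\<bar>(D 1 x)\<^sup>2 * D 2 x\<bar> \<le> 1 * 3" unfolding abs_mult using p[of 2] d2 by (intro mult_mono) auto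
  have d4: "\<bar>4 * (D 1 x * D 3 x) + 3 * (D 2 x)\<^sup>2\<bar> \<le> 115" "\<bar>6 * ((D 1 x)\<^sup>2 * D 2 x)\<bar> \<le> 18"
    using d13 d22 d112 by linarith+
  show "\<bar>D 4 x\<bar> \<le> 289"
  proof -
    have "D 4 x = bell4 m D x - m * (4 * (D 1 x * D 3 x) + 3 * (D 2 x)\<^sup>2) - m\<^sup>2 * (6 * ((D 1 x)\<^sup>2 * D 2 x)) - m ^ 3 * (D 1 x) ^ 4"
      by (simp add: bell4_def)
    then show ?thesis
      using abs_diff_le_4[OF b(4) order_trans[OF mm(1) d4(1)] order_trans[OF mm(2) d4(2)] order_trans[OF mm(3) p[of 4]], of 289]
      by simp
  qed
qed

text \<open>Lowering the weight by \<open>\<delta>\<close> changes \<open>m\<^sup>2\<close> by at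
  most \<open>2 * \<delta>\<close> and \<open>m ^ 3\<close> by at most \<open>3 * \<delta>\<close>.
  So the combinations change by at most \<open>\<delta>\<close> times 1, \<open>9 + 2 = 11\<close>
  and \<open>115 + 2 * 18 + 3 = 154\<close>, which the slack gained in \<open>1 - k\<close> covers
  exactly.\<close>

lemma bell_bounds_lower_weight:
  assumes b: "bell_bounds m D" and m: "m \<in> {0..1}" "0 \<le> k" "k \<le> m"
  shows "bell_bounds k D"
  unfolding bell_bounds_def
proof (intro allI conjI)
  fix x
  note d = bell_bounds_derivatives[OF b m(1), of x]
  have b: "\<bar>bell2 m D x\<bar> \<le> 1 + (1 - m)" "\<bar>bell3 m D x\<bar> \<le> 1 + 11 * (1 - m)" "\<bar>bell4 m D x\<bar> \<le> 1 + 154 * (1 - m)"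
    using b unfolding bell_bounds_def by auto
  define \<delta> where "\<delta> = m - k"
  have \<delta>: "0 \<le> \<delta>" "1 - k = (1 - m) + \<delta>" using m by (simp_all add: \<delta>_def)
  have p: "\<bar>(D 1 x) ^ n\<bar> \<le> 1" for n using d(1) by (simp add: power_abs power_le_one)
  have d12: "\<bar>D 1 x * D 2 x\<bar> \<le> 1 * 3" unfolding abs_mult using d by (intro mult_mono) auto
  have d13: "\<bar>D 1 x * D 3 x\<bar> \<le> 1 * 22" unfolding abs_mult using d by (intro mult_mono) auto
  have d22: "\<bar>(D 2 x)\<^sup>2\<bar> \<le> 9" using power_mono[OF d(2), of 2] by simp
  have d112: "\<bar>(D 1 x)\<^sup>2 * D 2 x\<bar> \<le> 1 * 3" unfolding abs_mult using p[of 2] d by (intro mult_mono) auto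
  have sq: "0 \<le> m\<^sup>2 - k\<^sup>2" "m\<^sup>2 - k\<^sup>2 \<le> 2 * \<delta>" "0 \<le> m ^ 3 - k ^ 3" "m ^ 3 - k ^ 3 \<le> 3 * \<delta>"
  proof -
    have e: "m\<^sup>2 - k\<^sup>2 = \<delta> * (m + k)" "m ^ 3 - k ^ 3 = \<delta> * (m * m + m * k + k * k)"
      by (simp_all add: \<delta>_def algebra_simps power2_eq_square power3_eq_cube)
    have h: "m + k \<le> 2" "m * m \<le> 1" "m * k \<le> 1" "k * k \<le> 1" "0 \<le> m * m" "0 \<le> m * k" "0 \<le> k * k"
      using m by (auto intro: mult_le_one)
    show "0 \<le> m\<^sup>2 - k\<^sup>2" "m\<^sup>2 - k\<^sup>2 \<le> 2 * \<delta>" "0 \<le> m ^ 3 - k ^ 3" "m ^ 3 - k ^ 3 \<le> 3 * \<delta>"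
      unfolding e using h \<delta> m mult_left_mono[of "m + k" 2 \<delta>] mult_left_mono[of "m * m + m * k + k * k" 3 \<delta>] by auto
  qed
  have c: "\<bar>a * y\<bar> \<le> b * c" if "0 \<le> a" "a \<le> b" "\<bar>y\<bar> \<le> c" for a b c y :: real
    unfolding abs_mult using that by (intro mult_mono) auto
  show "\<bar>D 1 x\<bar> \<le> 1" by (rule d)
  have "bell2 k D x = bell2 m D x - \<delta> * (D 1 x)\<^sup>2" by (simp add: bell2_def \<delta>_def algebra_simps)
  then show "\<bar>bell2 k D x\<bar> \<le> 1 + (1 - k)"
    using b(1) c[OF \<delta>(1) order.refl p[of 2]] \<delta>(2) by linarith
  have "bell3 k D x = bell3 m D x - \<delta> * (3 * (D 1 x * D 2 x)) - (m\<^sup>2 - k\<^sup>2) * (D 1 x) ^ 3"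
    by (simp add: bell3_def \<delta>_def algebra_simps)
  moreover have b3: "\<bar>\<delta> * (3 * (D 1 x * D 2 x))\<bar> \<le> \<delta> * 9"
    by (intro c \<delta>(1) order.refl) (use d12 in simp)
  ultimately show "\<bar>bell3 k D x\<bar> \<le> 1 + 11 * (1 - k)"
    using abs_diff_le_3[OF b(2) b3 c[OF sq(1,2) p[of 3]]] \<delta>(2) by simp
  have "bell4 k D x = bell4 m D x - \<delta> * (4 * (D 1 x * D 3 x) + 3 * (D 2 x)\<^sup>2) - (m\<^sup>2 - k\<^sup>2) * (6 * ((D 1 x)\<^sup>2 * D 2 x))
      - (m ^ 3 - k ^ 3) * (D 1 x) ^ 4"
    by (simp add: bell4_def \<delta>_def algebra_simps)
  moreover have b4: "\<bar>\<delta> * (4 * (D 1 x * D 3 x) + 3 * (D 2 x)\<^sup>2)\<bar> \<le> \<delta> * 115"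
    by (intro c \<delta>(1) order.refl) (use d13 d22 in linarith)
  moreover have b4': "\<bar>(m\<^sup>2 - k\<^sup>2) * (6 * ((D 1 x)\<^sup>2 * D 2 x))\<bar> \<le> (2 * \<delta>) * 18"
    by (intro c sq) (use d112 in linarith)
  ultimately show "\<bar>bell4 k D x\<bar> \<le> 1 + 154 * (1 - k)"
    using abs_diff_le_4[OF b(3) b4 b4' c[OF sq(3,4) p[of 4]]] \<delta>(2) by simp
qed

definition regular_jet :: "(nat \<Rightarrow> real \<Rightarrow> real) \<Rightarrow> bool" where
  "regular_jet D \<longleftrightarrow> jet D \<and> (\<forall>x. \<bar>D 1 x\<bar> \<le> 1) \<and> (\<forall>x. \<forall>j\<in>{1..4}. \<bar>D j x\<bar> \<le> 289)"

lemma regular_jetD: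
  assumes "regular_jet D"
  shows "jet D" "\<bar>D 1 x\<bar> \<le> 1" "j \<in> {1..4} \<Longrightarrow> \<bar>D j x\<bar> \<le> 289"
  using assms by (auto simp: regular_jet_def)

context parisi
begin

text \<open>The slack \<open>1 - m\<close> in \<open>bell_bounds\<close> pays for the change of weight at each atom; the total change
  is at most \<open>1\<close>, so the bounds do not depend on the number of atoms.\<close>

lemma parisi_discrete_bell_bounds:
  assumes \<nu>: "\<nu> \<in> discrete_unit_measures" and u: "0 \<le> u" "u \<le> 1"
  shows "\<exists>D. jet D \<and> D 0 = (\<lambda>x. parisi_discrete \<xi> \<nu> (x, u)) \<and> bell_bounds (measure \<nu> {0..u}) D"
  using discrete_unit_measuresD(2)[OF \<nu>] u
proof (induction rule: breakpoint_induct)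
  case base
  have t: "\<bar>tanh x\<bar> \<le> 1" for x :: real using tanh_real_bounds[of x] by (auto simp: abs_le_iff)
  show ?case
  proof (rule log_cosh_jet[of 0])
    fix D assume D: "jet D" "D 0 = (\<lambda>x. ln (cosh x) + 0)" "D 1 = tanh" "\<And>x. bell2 1 D x = 1"
      "\<And>x. bell3 1 D x = tanh x" "\<And>x. bell4 1 D x = 1"
    have "bell_bounds (measure \<nu> {0..1}) D"
      using unit_measuresD(3)[OF discrete_unit_measuresD(1)[OF \<nu>]] D(4-6) t unfolding bell_bounds_def D(3) by simp
    then show ?thesis using D(1,2) parisi_discrete_end[OF \<nu>] by auto
  qed
next
  case (step s t)
  obtain D where D: "jet D" "D 0 = (\<lambda>x. parisi_discrete \<xi> \<nu> (x, t))" "bell_bounds (measure \<nu> {0..t}) D"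
    using step.IH by blast
  note \<nu>' = discrete_unit_measuresD(1)[OF \<nu>]
  interpret gaussian_layer "measure \<nu> {0..s}" "deriv \<xi> t - deriv \<xi> s" D by standard (rule D)
  have b: "bell_bounds (measure \<nu> {0..s}) D"
    using bell_bounds_lower_weight[OF D(3)] cdf_unit[OF \<nu>'] cdf_mono[OF \<nu>', of s t] step by simp
  obtain H where H: "jet H" "H 0 = gaussian_step (measure \<nu> {0..s}) (deriv \<xi> t - deriv \<xi> s) (D 0)" "\<And>x. H 1 x = E (D 1) x"
    "\<And>x. bell2 (measure \<nu> {0..s}) H x = E (bell2 (measure \<nu> {0..s}) D) x"
    "\<And>x. bell3 (measure \<nu> {0..s}) H x = E (bell3 (measure \<nu> {0..s}) D) x"
    "\<And>x. bell4 (measure \<nu> {0..s}) H x = E (bell4 (measure \<nu> {0..s}) D) x"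
    using jet_step by metis
  \<comment> \<open>A tilted mean does not exceed a uniform bound on its integrand, and
    \<open>H 1\<close> and the combinations of \<open>H\<close> are tilted means of those of
    \<open>D\<close>; the step itself costs nothing.\<close>
  have "bell_bounds (measure \<nu> {0..s}) H"
    using b unfolding bell_bounds_def H by (auto intro!: E_abs_le exp_growth_bell jet_exp_growth[OF D(1)])
  moreover have "H 0 = (\<lambda>x. parisi_discrete \<xi> \<nu> (x, s))"
    unfolding H(2) D(2) using parisi_discrete_step[OF \<nu> step(1-4)] by auto
  ultimately show ?case using H(1) by blast
qed

lemma parisi_discrete_regular:
  assumes \<nu>: "\<nu> \<in> discrete_unit_measures" and u: "0 \<le> u" "u \<le> 1"
  shows "\<exists>D. regular_jet D \<and> D 0 = (\<lambda>x. parisi_discrete \<xi> \<nu> (x, u))"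
proof -
  obtain D where D: "jet D" "D 0 = (\<lambda>x. parisi_discrete \<xi> \<nu> (x, u))" and b: "bell_bounds (measure \<nu> {0..u}) D"
    using parisi_discrete_bell_bounds[OF assms] by blast
  note d = bell_bounds_derivatives[OF b cdf_unit[OF discrete_unit_measuresD(1)[OF \<nu>]]]
  have "\<forall>j\<in>{1..4}. \<bar>D j x\<bar> \<le> 289" for x
    unfolding interval_4_cases using d[of x] by auto
  then show ?thesis using D d(1) unfolding regular_jet_def by blast
qed

text \<open>Each step moves the function by at most a constant times its variance. The constant
  depends only on the uniform second-derivative bound and on \<open>L\<close>, so the contributions
  add up along the atoms.\<close>

lemma parisi_discrete_time_lipschitz:
  obtains C where "0 \<le> C" "\<And>\<nu> s t x. \<nu> \<in> discrete_unit_measures \<Longrightarrow> s \<in> {0..1} \<Longrightarrow> t \<in> {0..1} \<Longrightarrow>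
    \<bar>parisi_discrete \<xi> \<nu> (x, s) - parisi_discrete \<xi> \<nu> (x, t)\<bar> \<le> C * \<bar>s - t\<bar>"
proof -
  obtain c where c: "0 \<le> c" and *: "\<And>D v m x K. jet D \<Longrightarrow> (\<And>x. \<bar>D 1 x\<bar> \<le> 1) \<Longrightarrow> (\<And>x. \<bar>D 2 x\<bar> \<le> K) \<Longrightarrow> 0 \<le> v \<Longrightarrow> v \<le> L
    \<Longrightarrow> m \<in> {0..1} \<Longrightarrow> \<bar>gaussian_step m v (D 0) x - D 0 x\<bar> \<le> (c + K) * v"
    using gaussian_step_near_identity[OF L_nonneg] by metis
  define C where "C = (c + 289) * L"
  have C: "0 \<le> C" using c L_nonneg by (simp add: C_def)
  have 1: "\<bar>parisi_discrete \<xi> \<nu> (x, s) - parisi_discrete \<xi> \<nu> (x, t)\<bar> \<le> C * (t - s)"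
    if \<nu>: "\<nu> \<in> discrete_unit_measures" and st: "0 \<le> s" "s \<le> t" "t \<le> 1" for \<nu> s t x
    using discrete_unit_measuresD(2)[OF \<nu>] st(1,2)
  proof (induction rule: breakpoint_induct)
    case (step r r')
    then have r: "0 \<le> r" "r < r'" "r' \<le> 1" "0 \<le> r'" using st by auto
    obtain D where DR: "regular_jet D" and D2: "D 0 = (\<lambda>x. parisi_discrete \<xi> \<nu> (x, r'))"
      using parisi_discrete_regular[OF \<nu> r(4,3)] by blast
    note D = regular_jetD[OF DR]
    have "\<bar>gaussian_step (measure \<nu> {0..r}) (deriv \<xi> r' - deriv \<xi> r) (D 0) x - D 0 x\<bar> \<le> (c + 289) * (deriv \<xi> r' - deriv \<xi> r)"
      using D deriv_mono[of r r'] deriv_diff_le[of r r'] r cdf_unit[OF discrete_unit_measuresD(1)[OF \<nu>]]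
      by (intro *) auto
    also have "\<dots> \<le> (c + 289) * (L * (r' - r))" using deriv_lipschitz[of r r'] r c by (intro mult_left_mono) auto
    finally have "\<bar>parisi_discrete \<xi> \<nu> (x, r) - parisi_discrete \<xi> \<nu> (x, r')\<bar> \<le> C * (r' - r)"
      using parisi_discrete_step[OF \<nu> r(1-3), of x] step by (simp add: C_def D2 mult.assoc)
    then show ?case using step.IH by (simp add: right_diff_distrib)
  qed simp
  show ?thesis
  proof (rule that[OF C])
    fix \<nu> and s t x :: real
    assume "\<nu> \<in> discrete_unit_measures" "s \<in> {0..1}" "t \<in> {0..1}"
    then show "\<bar>parisi_discrete \<xi> \<nu> (x, s) - parisi_discrete \<xi> \<nu> (x, t)\<bar> \<le> C * \<bar>s - t\<bar>"
      using 1[of \<nu> s t x] 1[of \<nu> t s x] by (cases "s \<le> t") (auto simp: abs_minus_commute)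
  qed
qed

lemma cdf_measurable [measurable]: "\<nu> \<in> unit_measures \<Longrightarrow> (\<lambda>u. measure \<nu> {0..u}) \<in> borel_measurable borel"
  by (intro borel_measurable_mono) (auto simp: mono_def intro: cdf_mono)

lemma cdf_difference_integrable:
  assumes "\<mu> \<in> unit_measures" "\<nu> \<in> unit_measures"
  shows "set_integrable lborel {a..b} (\<lambda>u. \<bar>measure \<mu> {0..u} - measure \<nu> {0..u}\<bar>)"
  unfolding set_integrable_def
proof (rule integrableI_bounded_set_indicator[where B=1])
  note [measurable] = cdf_measurable[OF assms(1)] cdf_measurable[OF assms(2)]
  show "(\<lambda>u. \<bar>measure \<mu> {0..u} - measure \<nu> {0..u}\<bar>) \<in> borel_measurable lborel" by measurable
  show "AE x in lborel. x \<in> {a..b} \<longrightarrow> norm \<bar>measure \<mu> {0..x} - measure \<nu> {0..x}\<bar> \<le> 1"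
  proof (intro AE_I2 impI)
    fix x show "norm \<bar>measure \<mu> {0..x} - measure \<nu> {0..x}\<bar> \<le> 1"
      using cdf_unit[OF assms(1), of x] cdf_unit[OF assms(2), of x]
      unfolding atLeastAtMost_iff real_norm_def by linarith
  qed
qed (auto simp: emeasure_lborel_Icc_eq)

text \<open>Backward induction over the atoms of both measures. A step adds an error proportional to
  its variance and to the difference of the weights, hence to the integral of that difference over
  the step; the error already present is passed on without growth by
  \<open>gaussian_step_contraction\<close>.\<close>

lemma parisi_discrete_lipschitz:
  obtains C where "0 \<le> C" "\<And>\<mu> \<nu> u x. \<mu> \<in> discrete_unit_measures \<Longrightarrow> \<nu> \<in> discrete_unit_measures \<Longrightarrow> u \<in> {0..1} \<Longrightarrow>
    \<bar>parisi_discrete \<xi> \<mu> (x, u) - parisi_discrete \<xi> \<nu> (x, u)\<bar> \<le> C * cdf_dist \<mu> \<nu>"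
proof -
  obtain c where c: "0 \<le> c" and *: "\<And>D v m m' x. jet D \<Longrightarrow> (\<And>x. \<bar>D 1 x\<bar> \<le> 1) \<Longrightarrow> 0 \<le> v \<Longrightarrow> v \<le> L
    \<Longrightarrow> m \<in> {0..1} \<Longrightarrow> m' \<in> {0..1} \<Longrightarrow> \<bar>gaussian_step m' v (D 0) x - gaussian_step m v (D 0) x\<bar> \<le> c * v * \<bar>m' - m\<bar>"
    using gaussian_step_lipschitz_weight[OF L_nonneg] by metis
  show ?thesis
  proof (rule that[of "c * L"])
    show "0 \<le> c * L" using c L_nonneg by simp
    fix \<mu> \<nu> and u x :: real
    assume \<mu>: "\<mu> \<in> discrete_unit_measures" and \<nu>: "\<nu> \<in> discrete_unit_measures" and u: "u \<in> {0..1}"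
    note \<mu>' = discrete_unit_measuresD(1)[OF \<mu>] and \<nu>' = discrete_unit_measuresD(1)[OF \<nu>]
    define d where "d = (\<lambda>u. \<bar>measure \<mu> {0..u} - measure \<nu> {0..u}\<bar>)"
    define I where "I = (\<lambda>s. LINT u:{s..1}|lborel. d u)"
    have di: "set_integrable lborel {a..b} d" for a b
      unfolding d_def by (rule cdf_difference_integrable[OF \<mu>' \<nu>'])
    have "\<forall>x. \<bar>parisi_discrete \<xi> \<mu> (x, u) - parisi_discrete \<xi> \<nu> (x, u)\<bar> \<le> (c * L) * I u" if "0 \<le> u" "u \<le> 1" for u
      using finite_UnI[OF discrete_unit_measuresD(2)[OF \<mu>] discrete_unit_measuresD(2)[OF \<nu>]] that
    proof (induction rule: breakpoint_induct)
      case base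
      have "0 \<le> I 1" unfolding I_def set_lebesgue_integral_def by (intro integral_nonneg_AE) (auto simp: d_def)
      then show ?case using parisi_discrete_end[OF \<mu>] parisi_discrete_end[OF \<nu>] c L_nonneg by simp
    next
      case (step s t)
      have none: "atoms \<mu> \<inter> {s<..<t} = {}" "atoms \<nu> \<inter> {s<..<t} = {}" using step by auto
      have t: "0 \<le> t" "t \<le> 1" using step by auto
      have v: "0 \<le> deriv \<xi> t - deriv \<xi> s" "deriv \<xi> t - deriv \<xi> s \<le> L" "deriv \<xi> t - deriv \<xi> s \<le> L * (t - s)"
        using deriv_mono[of s t] deriv_diff_le[of s t] deriv_lipschitz[of s t] step by auto
      \<comment> \<open>The interval is half-open because an atom at \<open>t\<close> makes a
        distribution function jump there; the single point does not affect the integral.\<close>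
      have const: "d u = d s" if "u \<in> {s..<t}" for u
      proof -
        have "atoms \<mu> \<inter> {0..u} = atoms \<mu> \<inter> {0..s}" "atoms \<nu> \<inter> {0..u} = atoms \<nu> \<inter> {0..s}" using none that by force+
        then have "measure \<mu> {0..u} = measure \<mu> {0..s}" "measure \<nu> {0..u} = measure \<nu> {0..s}"
          using discrete_measure_cong[OF \<mu>, of "{0..u}" "{0..s}"] discrete_measure_cong[OF \<nu>, of "{0..u}" "{0..s}"] by auto
        then show ?thesis by (simp add: d_def)
      qed
      have Is: "I s = (t - s) * d s + I t"
      proof -
        have eq: "{s..1} = {s..<t} \<union> {t..1}" using step t by auto
        have "I s = (LINT u:{s..<t}|lborel. d u) + I t"
          unfolding I_def eq using di
          by (intro set_integral_Un) (auto intro: set_integrable_subset[OF di[of s t]])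
        also have "(LINT u:{s..<t}|lborel. d u) = (LINT u:{s..<t}|lborel. d s)"
          by (intro set_lebesgue_integral_cong) (simp, use const in blast)
        also have "\<dots> = (t - s) * d s"
          using step by (simp add: set_lebesgue_integral_def measure_lborel_Ico)
        finally show ?thesis .
      qed
      obtain D where DR: "regular_jet D" and D2: "D 0 = (\<lambda>x. parisi_discrete \<xi> \<mu> (x, t))"
        using parisi_discrete_regular[OF \<mu> t] by blast
      note D = regular_jetD(1,2)[OF DR]
      obtain D' where D': "jet D'" "D' 0 = (\<lambda>x. parisi_discrete \<xi> \<nu> (x, t))"
        using parisi_discrete_jet by blast
      show ?case
      proof
        fix x
        let ?m = "measure \<mu> {0..s}" and ?n = "measure \<nu> {0..s}" and ?v = "deriv \<xi> t - deriv \<xi> s"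
        have "\<bar>gaussian_step ?m ?v (D 0) x - gaussian_step ?n ?v (D 0) x\<bar> \<le> c * ?v * \<bar>?m - ?n\<bar>"
          using cdf_unit[OF \<mu>'] cdf_unit[OF \<nu>'] by (intro * D v)
        also have "\<dots> = (c * d s) * ?v" by (simp add: d_def)
        also have "\<dots> \<le> (c * d s) * (L * (t - s))" using v c by (intro mult_left_mono) (auto simp: d_def)
        finally have 1: "\<bar>gaussian_step ?m ?v (D 0) x - gaussian_step ?n ?v (D 0) x\<bar> \<le> (c * L) * ((t - s) * d s)"
          by (simp add: mult_ac)
        have 2: "\<bar>gaussian_step ?n ?v (D 0) x - gaussian_step ?n ?v (D' 0) x\<bar> \<le> (c * L) * I t"
          using cdf_unit[OF \<nu>'] step.IH by (intro gaussian_step_contraction D D') (auto simp: D2 D'(2))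
        show "\<bar>parisi_discrete \<xi> \<mu> (x, s) - parisi_discrete \<xi> \<nu> (x, s)\<bar> \<le> (c * L) * I s"
          unfolding parisi_discrete_step[OF \<mu> step(1-3) none(1)] parisi_discrete_step[OF \<nu> step(1-3) none(2)]
            D2[symmetric] D'(2)[symmetric] Is distrib_left using 1 2 by linarith
      qed
    qed
    then have "\<bar>parisi_discrete \<xi> \<mu> (x, u) - parisi_discrete \<xi> \<nu> (x, u)\<bar> \<le> (c * L) * I u" using u by simp
    also have "I u \<le> cdf_dist \<mu> \<nu>"
      unfolding I_def cdf_dist_def d_def[symmetric] set_lebesgue_integral_def
      using di[unfolded set_integrable_def] u
      by (intro integral_mono) (auto simp: d_def split: split_indicator)
    then have "(c * L) * I u \<le> (c * L) * cdf_dist \<mu> \<nu>" using c L_nonneg by (intro mult_left_mono) auto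
    finally show "\<bar>parisi_discrete \<xi> \<mu> (x, u) - parisi_discrete \<xi> \<nu> (x, u)\<bar> \<le> c * L * cdf_dist \<mu> \<nu>" .
  qed
qed

end

section \<open>Regular fields\<close>

definition dx :: "nat \<Rightarrow> (real \<times> real \<Rightarrow> real) \<Rightarrow> real \<Rightarrow> real \<Rightarrow> real" where
  "dx j \<Phi> x u = (deriv ^^ j) (\<lambda>y. \<Phi> (y, u)) x"

text \<open>The part of the bounds that survives uniform limits: the bounded fourth derivative is
  weakened to a Lipschitz bound on the third.\<close>

definition regular_slice :: "(nat \<Rightarrow> real \<Rightarrow> real) \<Rightarrow> bool" where
  "regular_slice D \<longleftrightarrow> (\<forall>j<3. \<forall>x. (D j has_real_derivative D (Suc j) x) (at x)) \<and> (\<forall>x. \<bar>D 1 x\<bar> \<le> 1) \<and>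
     (\<forall>j\<in>{1..3}. \<forall>x. \<bar>D j x\<bar> \<le> 289) \<and> (\<forall>x y. \<bar>D 3 x - D 3 y\<bar> \<le> 289 * \<bar>x - y\<bar>)"

text \<open>Regularity in time is required of the field only. Continuity in time of its
  \<open>x\<close>-derivatives follows by interpolation, see
  \<open>uniform_limit_dx\<close>.\<close>

definition regular_field :: "real \<Rightarrow> (real \<times> real \<Rightarrow> real) \<Rightarrow> bool" where
  "regular_field C \<Phi> \<longleftrightarrow> (\<forall>u\<in>{0..1}. regular_slice (\<lambda>j x. dx j \<Phi> x u)) \<and>
     (\<forall>x. \<forall>u\<in>{0..1}. \<forall>t\<in>{0..1}. \<bar>\<Phi> (x, u) - \<Phi> (x, t)\<bar> \<le> C * \<bar>u - t\<bar>)"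

lemma regular_sliceD:
  assumes "regular_slice D"
  shows "j < 3 \<Longrightarrow> (D j has_real_derivative D (Suc j) x) (at x)" "\<bar>D 1 x\<bar> \<le> 1"
    "j \<in> {1..3} \<Longrightarrow> \<bar>D j x\<bar> \<le> 289"
  using assms by (auto simp: regular_slice_def)

lemma regular_slice_lipschitz:
  assumes D: "regular_slice D" and j: "j \<le> 3"
  shows "\<bar>D j x - D j y\<bar> \<le> 289 * \<bar>x - y\<bar>"
proof (cases "j = 3")
  case True
  then show ?thesis using D by (simp add: regular_slice_def)
next
  case False
  then have "j < 3" using j by simp
  then show ?thesis using regular_sliceD[OF D]
    by (intro lipschitz_from_derivative[of "D j" "D (Suc j)"]) auto
qed

lemma dx_eqI:
  assumes "regular_slice D" "D 0 = (\<lambda>x. \<Phi> (x, u))" "j \<le> 3"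
  shows "dx j \<Phi> x u = D j x"
proof -
  have "(deriv ^^ j) (D 0) = D j" using assms(3)
  proof (induction j)
    case (Suc j)
    then have "deriv (D j) = D (Suc j)"
      using regular_sliceD(1)[OF assms(1), of j] by (intro ext DERIV_imp_deriv) auto
    then show ?case using Suc by simp
  qed simp
  then show ?thesis using assms(2) by (simp add: dx_def)
qed

lemma regular_sliceI:
  assumes "regular_slice D" "D 0 = (\<lambda>x. \<Phi> (x, u))"
  shows "regular_slice (\<lambda>j x. dx j \<Phi> x u)"
proof -
  have "dx j \<Phi> x u = D j x" if "j \<le> 3" for j x using dx_eqI[OF assms that] .
  then show ?thesis using assms(1) unfolding regular_slice_def by simp
qed

lemma regular_fieldD:
  assumes "regular_field C \<Phi>" "u \<in> {0..1}"
  shows "regular_slice (\<lambda>j x. dx j \<Phi> x u)" "t \<in> {0..1} \<Longrightarrow> \<bar>\<Phi> (x, u) - \<Phi> (x, t)\<bar> \<le> C * \<bar>u - t\<bar>"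
    "\<bar>\<Phi> (x, u) - \<Phi> (y, u)\<bar> \<le> \<bar>x - y\<bar>"
proof -
  show 1: "regular_slice (\<lambda>j x. dx j \<Phi> x u)" using assms by (simp add: regular_field_def)
  show "t \<in> {0..1} \<Longrightarrow> \<bar>\<Phi> (x, u) - \<Phi> (x, t)\<bar> \<le> C * \<bar>u - t\<bar>" using assms by (simp add: regular_field_def)
  have "\<bar>dx 0 \<Phi> x u - dx 0 \<Phi> y u\<bar> \<le> 1 * \<bar>x - y\<bar>"
    using regular_sliceD[OF 1] by (intro lipschitz_from_derivative[of _ "\<lambda>x. dx 1 \<Phi> x u"]) auto
  then show "\<bar>\<Phi> (x, u) - \<Phi> (y, u)\<bar> \<le> \<bar>x - y\<bar>" by (simp add: dx_def)
qed

text \<open>A Landau-Kolmogorov type bound: a difference quotient with step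
  \<open>\<epsilon>\<close> has error of order \<open>\<epsilon>\<close> both from the size
  \<open>\<epsilon>\<^sup>2\<close> of \<open>g\<close> and from the Lipschitz derivative.\<close>

lemma derivative_interpolation:
  fixes g :: "real \<Rightarrow> real"
  assumes "\<And>x. (g has_real_derivative g' x) (at x)" "\<And>x y. \<bar>g' x - g' y\<bar> \<le> M * \<bar>x - y\<bar>"
    "\<And>x. \<bar>g x\<bar> \<le> \<epsilon>\<^sup>2" "0 < \<epsilon>"
  shows "\<bar>g' x\<bar> \<le> (2 + M) * \<epsilon>"
proof -
  have "\<bar>g (x + \<epsilon>) - g x - \<epsilon> * g' x\<bar> \<le> M * \<epsilon>\<^sup>2" by (rule taylor_lipschitz[OF assms(1,2)])
  then have "\<bar>\<epsilon> * g' x\<bar> \<le> (2 + M) * \<epsilon>\<^sup>2" using assms(3)[of x] assms(3)[of "x + \<epsilon>"] by (simp add: distrib_right)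
  then have "\<epsilon> * \<bar>g' x\<bar> \<le> \<epsilon> * ((2 + M) * \<epsilon>)" using assms(4) by (simp add: abs_mult power2_eq_square mult_ac)
  then show ?thesis using assms(4) by simp
qed

lemma uniform_limit_derivative_zero:
  fixes g :: "'b \<Rightarrow> real \<Rightarrow> real"
  assumes "\<And>n x. (g n has_real_derivative g' n x) (at x)" "\<And>n x y. \<bar>g' n x - g' n y\<bar> \<le> M * \<bar>x - y\<bar>"
    "uniform_limit UNIV g (\<lambda>_. 0) F"
  shows "uniform_limit UNIV g' (\<lambda>_. 0) F"
proof (rule uniform_limitI)
  fix e :: real assume e: "0 < e"
  show "\<forall>\<^sub>F n in F. \<forall>x\<in>UNIV. dist (g' n x) 0 < e"
  proof (cases "F = bot")
    case False
    have M: "0 \<le> M" using order_trans[OF abs_ge_zero assms(2)[of _ 1 0]] by simp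
    define \<epsilon> where "\<epsilon> = e / (2 * (2 + M))"
    have \<epsilon>: "0 < \<epsilon>" using e M by (simp add: \<epsilon>_def)
    have "\<forall>\<^sub>F n in F. \<forall>x\<in>UNIV. dist (g n x) 0 < \<epsilon>\<^sup>2"
      using uniform_limitD[OF assms(3), of "\<epsilon>\<^sup>2"] \<epsilon> by simp
    then show ?thesis
    proof (rule eventually_mono)
      fix n assume "\<forall>x\<in>UNIV. dist (g n x) 0 < \<epsilon>\<^sup>2"
      then have "\<bar>g' n x\<bar> \<le> (2 + M) * \<epsilon>" for x
        using assms \<epsilon> by (intro derivative_interpolation[of "g n"]) (auto intro: less_imp_le)
      moreover have "(2 + M) * \<epsilon> < e" using e M by (simp add: \<epsilon>_def field_simps add_nonneg_pos)
      ultimately show "\<forall>x\<in>UNIV. dist (g' n x) 0 < e" by (auto intro: le_less_trans)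
    qed
  qed simp
qed

lemma uniform_limit_minus_iff:
  fixes f :: "'b \<Rightarrow> real \<Rightarrow> real"
  shows "uniform_limit UNIV (\<lambda>n x. f n x - l x) (\<lambda>_. 0) F \<longleftrightarrow> uniform_limit UNIV f l F"
  by (simp add: uniform_limit_iff dist_real_def)

text \<open>Interpolation applied to the difference of the two slices, one order at a time; each
  order uses a Lipschitz bound on the derivative of that order, hence the limit at 3.\<close>

lemma uniform_limit_dx:
  assumes "\<And>n. regular_field C (\<Phi> n)" "regular_field C' \<Psi>" "\<And>n. u n \<in> {0..1}" "t \<in> {0..1}"
    and "uniform_limit UNIV (\<lambda>n x. \<Phi> n (x, u n)) (\<lambda>x. \<Psi> (x, t)) F" "j \<le> 3"
  shows "uniform_limit UNIV (\<lambda>n x. dx j (\<Phi> n) x (u n)) (\<lambda>x. dx j \<Psi> x t) F"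
  using assms(6)
proof (induction j)
  case 0
  then show ?case using assms(5) by (simp add: dx_def)
next
  case (Suc j)
  have S: "regular_slice (\<lambda>j x. dx j (\<Phi> n) x (u n))" "regular_slice (\<lambda>j x. dx j \<Psi> x t)" for n
    using regular_fieldD(1) assms(1-4) by blast+
  have l: "\<bar>dx (Suc j) (\<Phi> n) x (u n) - dx (Suc j) (\<Phi> n) y (u n)\<bar> \<le> 289 * \<bar>x - y\<bar>"
    "\<bar>dx (Suc j) \<Psi> x t - dx (Suc j) \<Psi> y t\<bar> \<le> 289 * \<bar>x - y\<bar>" for n x y
    using regular_slice_lipschitz[OF S(1), of "Suc j"] regular_slice_lipschitz[OF S(2), of "Suc j"] Suc by auto
  have "uniform_limit UNIV (\<lambda>n x. dx (Suc j) (\<Phi> n) x (u n) - dx (Suc j) \<Psi> x t) (\<lambda>_. 0) F"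
  proof (rule uniform_limit_derivative_zero[where M="2 * 289"])
    show "((\<lambda>x. dx j (\<Phi> n) x (u n) - dx j \<Psi> x t) has_real_derivative dx (Suc j) (\<Phi> n) x (u n) - dx (Suc j) \<Psi> x t) (at x)" for n x
      using Suc by (intro DERIV_diff regular_sliceD(1)[OF S(1)] regular_sliceD(1)[OF S(2)]) auto
    show "\<bar>(dx (Suc j) (\<Phi> n) x (u n) - dx (Suc j) \<Psi> x t) - (dx (Suc j) (\<Phi> n) y (u n) - dx (Suc j) \<Psi> y t)\<bar> \<le> 2 * 289 * \<bar>x - y\<bar>" for n x y
      using l(1)[of n x y] l(2)[of x y] by linarith
    show "uniform_limit UNIV (\<lambda>n x. dx j (\<Phi> n) x (u n) - dx j \<Psi> x t) (\<lambda>_. 0) F"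
      using Suc by (simp add: uniform_limit_minus_iff)
  qed
  then show ?case by (simp add: uniform_limit_minus_iff)
qed

text \<open>Field, point and time converge simultaneously. Convergence of the slices at moving times
  uses the time-Lipschitz bound of the limit field, and the passage to derivatives is
  \<open>uniform_limit_dx\<close>.\<close>

lemma tendsto_dx:
  assumes "\<And>n. regular_field C (\<Phi> n)" "regular_field C \<Psi>" "\<And>n. u n \<in> {0..1}" "t \<in> {0..1}"
    and "uniform_limit (UNIV \<times> {0..1}) \<Phi> \<Psi> F" "(x \<longlongrightarrow> y) F" "(u \<longlongrightarrow> t) F" "j \<le> 3"
  shows "((\<lambda>n. dx j (\<Phi> n) (x n) (u n)) \<longlongrightarrow> dx j \<Psi> y t) F"
proof -
  have "uniform_limit UNIV (\<lambda>n x. \<Phi> n (x, u n)) (\<lambda>x. \<Psi> (x, t)) F"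
  proof (rule uniform_limitI)
    fix e :: real assume e: "0 < e"
    have "((\<lambda>n. C * \<bar>u n - t\<bar>) \<longlongrightarrow> C * \<bar>t - t\<bar>) F" by (intro tendsto_intros assms)
    then have "((\<lambda>n. C * \<bar>u n - t\<bar>) \<longlongrightarrow> 0) F" by simp
    then have "\<forall>\<^sub>F n in F. C * \<bar>u n - t\<bar> < e / 2" using e order_tendstoD(2)[of _ 0 F "e / 2"] by simp
    moreover have "\<forall>\<^sub>F n in F. \<forall>p\<in>UNIV \<times> {0..1}. dist (\<Phi> n p) (\<Psi> p) < e / 2"
      using uniform_limitD[OF assms(5), of "e / 2"] e by simp
    ultimately show "\<forall>\<^sub>F n in F. \<forall>x\<in>UNIV. dist (\<Phi> n (x, u n)) (\<Psi> (x, t)) < e"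
    proof eventually_elim
      case (elim n)
      show ?case
      proof
        fix x
        have "dist (\<Phi> n (x, u n)) (\<Psi> (x, u n)) < e / 2" using elim assms(3)[of n] by blast
        moreover have "\<bar>\<Psi> (x, u n) - \<Psi> (x, t)\<bar> < e / 2"
          using regular_fieldD(2)[OF assms(2,3,4), of x n] elim by linarith
        ultimately show "dist (\<Phi> n (x, u n)) (\<Psi> (x, t)) < e" unfolding dist_real_def by linarith
      qed
    qed
  qed
  from uniform_limit_dx[OF assms(1-4) this assms(8)]
  have ul: "uniform_limit UNIV (\<lambda>n x. dx j (\<Phi> n) x (u n)) (\<lambda>x. dx j \<Psi> x t) F" .
  have 1: "((\<lambda>n. dx j (\<Phi> n) (x n) (u n) - dx j \<Psi> (x n) t) \<longlongrightarrow> 0) F"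
  proof (rule tendstoI)
    fix e :: real assume "0 < e"
    from uniform_limitD[OF ul this]
    show "\<forall>\<^sub>F n in F. dist (dx j (\<Phi> n) (x n) (u n) - dx j \<Psi> (x n) t) 0 < e"
      by eventually_elim (auto simp: dist_real_def)
  qed
  have 2: "((\<lambda>n. dx j \<Psi> (x n) t - dx j \<Psi> y t) \<longlongrightarrow> 0) F"
  proof (rule Lim_null_comparison)
    show "\<forall>\<^sub>F n in F. norm (dx j \<Psi> (x n) t - dx j \<Psi> y t) \<le> 289 * \<bar>x n - y\<bar>"
      using regular_slice_lipschitz[OF regular_fieldD(1)[OF assms(2,4)] assms(8)] by simp
    have "((\<lambda>n. 289 * \<bar>x n - y\<bar>) \<longlongrightarrow> 289 * \<bar>y - y\<bar>) F" by (intro tendsto_intros assms)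
    then show "((\<lambda>n. 289 * \<bar>x n - y\<bar>) \<longlongrightarrow> 0) F" by simp
  qed
  have "((\<lambda>n. (dx j (\<Phi> n) (x n) (u n) - dx j \<Psi> (x n) t) + (dx j \<Psi> (x n) t - dx j \<Psi> y t) + dx j \<Psi> y t) \<longlongrightarrow> 0 + 0 + dx j \<Psi> y t) F"
    by (intro tendsto_intros 1 2)
  then show ?thesis by simp
qed

text \<open>Interpolation for differences of members makes the derivatives uniformly Cauchy; the
  quadratic Taylor estimate then passes to the limit and identifies the limit of the derivatives as
  the derivative.\<close>

lemma derivative_of_uniform_limit:
  fixes F :: "nat \<Rightarrow> real \<Rightarrow> real"
  assumes d: "\<And>n x. (F n has_real_derivative F' n x) (at x)" and l: "\<And>n x y. \<bar>F' n x - F' n y\<bar> \<le> K * \<bar>x - y\<bar>"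
    and u: "uniform_limit UNIV F f sequentially"
  shows "\<exists>f'. (\<forall>x. (f has_real_derivative f' x) (at x)) \<and> (uniform_limit UNIV F' f' sequentially)"
proof -
  have K: "0 \<le> K" using l[of 0 1 0] by auto
  have "uniformly_Cauchy_on UNIV F'"
    unfolding uniformly_Cauchy_on_def
  proof (intro allI impI)
    fix e :: real assume e: "0 < e"
    define \<epsilon> where "\<epsilon> = e / (2 * (2 + 2 * K))"
    have \<epsilon>: "0 < \<epsilon>" using e K by (simp add: \<epsilon>_def)
    have "uniformly_Cauchy_on UNIV F"
      using u uniformly_convergent_Cauchy uniformly_convergent_on_def by blast
    then obtain N where N: "\<And>x m n. N \<le> m \<Longrightarrow> N \<le> n \<Longrightarrow> dist (F m x) (F n x) < \<epsilon>\<^sup>2"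
      unfolding uniformly_Cauchy_on_def using \<epsilon> by (metis UNIV_I zero_less_power)
    show "\<exists>M. \<forall>x\<in>UNIV. \<forall>m\<ge>M. \<forall>n\<ge>M. dist (F' m x) (F' n x) < e"
    proof (intro exI ballI allI impI)
      fix x m n assume mn: "N \<le> m" "N \<le> n"
      have "\<bar>F' m x - F' n x\<bar> \<le> (2 + 2 * K) * \<epsilon>"
      proof (rule derivative_interpolation[of "\<lambda>x. F m x - F n x" "\<lambda>x. F' m x - F' n x"])
        show "((\<lambda>x. F m x - F n x) has_real_derivative F' m x - F' n x) (at x)" for x by (intro DERIV_diff d)
        show "\<bar>F' m x - F' n x - (F' m y - F' n y)\<bar> \<le> 2 * K * \<bar>x - y\<bar>" for x y
          using l[of m x y] l[of n x y] by linarith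
        show "\<bar>F m x - F n x\<bar> \<le> \<epsilon>\<^sup>2" for x using N[OF mn, of x] by (simp add: dist_real_def)
      qed (rule \<epsilon>)
      also have "\<dots> < e" using e K by (simp add: \<epsilon>_def field_simps add_pos_nonneg)
      finally show "dist (F' m x) (F' n x) < e" by (simp add: dist_real_def)
    qed
  qed
  then have "uniformly_convergent_on UNIV F'" by (rule Cauchy_uniformly_convergent)
  then obtain f' where f': "uniform_limit UNIV F' f' sequentially" by (auto simp: uniformly_convergent_on_def)
  have t: "\<bar>f (x + h) - f x - h * f' x\<bar> \<le> K * h\<^sup>2" for x h
  proof (rule LIMSEQ_le_const2)
    show "(\<lambda>n. \<bar>F n (x + h) - F n x - h * F' n x\<bar>) \<longlonglongrightarrow> \<bar>f (x + h) - f x - h * f' x\<bar>"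
      by (intro tendsto_intros tendsto_uniform_limitI[OF u] tendsto_uniform_limitI[OF f']) auto
    show "\<exists>N. \<forall>n\<ge>N. \<bar>F n (x + h) - F n x - h * F' n x\<bar> \<le> K * h\<^sup>2"
      using taylor_lipschitz[OF d l] by blast
  qed
  have "(f has_real_derivative f' x) (at x)" for x
    unfolding DERIV_def
  proof (rule LIM_zero_cancel, rule Lim_null_comparison)
    show "\<forall>\<^sub>F h in at 0. norm ((f (x + h) - f x) / h - f' x) \<le> K * \<bar>h\<bar>"
      unfolding eventually_at_filter
    proof (intro always_eventually allI impI)
      fix h :: real assume h: "h \<noteq> 0"
      have "(f (x + h) - f x) / h - f' x = (f (x + h) - f x - h * f' x) / h" using h by (simp add: field_simps)
      then have "norm ((f (x + h) - f x) / h - f' x) = \<bar>f (x + h) - f x - h * f' x\<bar> / \<bar>h\<bar>" by simp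
      also have "\<dots> \<le> K * h\<^sup>2 / \<bar>h\<bar>" by (intro divide_right_mono t) auto
      also have "\<dots> = K * \<bar>h\<bar>" using h by (auto simp: power2_eq_square abs_if)
      finally show "norm ((f (x + h) - f x) / h - f' x) \<le> K * \<bar>h\<bar>" .
    qed
    have "((\<lambda>h. K * \<bar>h\<bar>) \<longlongrightarrow> K * \<bar>0\<bar>) (at 0)" by (intro tendsto_intros)
    then show "((\<lambda>h. K * \<bar>h\<bar>) \<longlongrightarrow> 0) (at 0)" by simp
  qed
  then show ?thesis using f' by blast
qed

lemma regular_field_limit:
  assumes R: "\<And>n. regular_field C (\<Phi> n)" and u: "uniform_limit (UNIV \<times> {0..1}) \<Phi> \<Psi> sequentially"
  shows "regular_field C \<Psi>"
  unfolding regular_field_def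
proof (intro conjI ballI allI)
  have lim: "(\<lambda>n. \<Phi> n (x, t)) \<longlonglongrightarrow> \<Psi> (x, t)" if "t \<in> {0..1}" for x t
    using that by (intro tendsto_uniform_limitI[OF u]) auto
  fix t :: real assume t: "t \<in> {0..1}"
  show "\<bar>\<Psi> (x, t) - \<Psi> (x, r)\<bar> \<le> C * \<bar>t - r\<bar>" if r: "r \<in> {0..1}" for x r
  proof (rule LIMSEQ_le_const2)
    show "(\<lambda>n. \<bar>\<Phi> n (x, t) - \<Phi> n (x, r)\<bar>) \<longlonglongrightarrow> \<bar>\<Psi> (x, t) - \<Psi> (x, r)\<bar>"
      by (intro tendsto_intros lim t r)
    show "\<exists>N. \<forall>n\<ge>N. \<bar>\<Phi> n (x, t) - \<Phi> n (x, r)\<bar> \<le> C * \<bar>t - r\<bar>"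
      using regular_fieldD(2)[OF R t r] by blast
  qed
  define D where "D = (\<lambda>n j x. dx j (\<Phi> n) x t)"
  have S: "regular_slice (D n)" for n using regular_fieldD(1)[OF R t] by (simp add: D_def)
  have st: "\<exists>f'. (\<forall>x. (f has_real_derivative f' x) (at x)) \<and> uniform_limit UNIV (\<lambda>n. D n (Suc j)) f' sequentially"
    if "uniform_limit UNIV (\<lambda>n. D n j) f sequentially" "j < 3" for f j
    using regular_sliceD(1)[OF S that(2)] regular_slice_lipschitz[OF S, of "Suc j"] that
    by (intro derivative_of_uniform_limit[where K=289]) auto
  have u0: "uniform_limit UNIV (\<lambda>n. D n 0) (\<lambda>x. \<Psi> (x, t)) sequentially"
    unfolding D_def dx_def using t u
    by (auto simp: uniform_limit_iff elim!: eventually_mono)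
  obtain f1 where f1: "\<And>x. ((\<lambda>x. \<Psi> (x, t)) has_real_derivative f1 x) (at x)" "uniform_limit UNIV (\<lambda>n. D n (Suc 0)) f1 sequentially"
    using st[OF u0] by auto
  obtain f2 where f2: "\<And>x. (f1 has_real_derivative f2 x) (at x)" "uniform_limit UNIV (\<lambda>n. D n (Suc (Suc 0))) f2 sequentially"
    using st[OF f1(2)] by auto
  obtain f3 where f3: "\<And>x. (f2 has_real_derivative f3 x) (at x)" "uniform_limit UNIV (\<lambda>n. D n (Suc (Suc (Suc 0)))) f3 sequentially"
    using st[OF f2(2)] by auto
  define f where "f = (\<lambda>j. [\<lambda>x. \<Psi> (x, t), f1, f2, f3] ! j)"
  have f: "f 0 = (\<lambda>x. \<Psi> (x, t))" "f (Suc 0) = f1" "f (Suc (Suc 0)) = f2" "f (Suc (Suc (Suc 0))) = f3"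
    by (simp_all add: f_def)
  have "\<forall>j\<le>3. uniform_limit UNIV (\<lambda>n. D n j) (f j) sequentially"
    using u0 f1(2) f2(2) f3(2) f by (auto simp: numeral_3_eq_3 le_Suc_eq)
  then have flim: "(\<lambda>n. D n j x) \<longlonglongrightarrow> f j x" if "j \<le> 3" for j x
    using that by (intro tendsto_uniform_limitI[where f="\<lambda>n. D n j" and S=UNIV]) auto
  have bnd: "\<bar>f j x\<bar> \<le> b" if "\<And>n. \<bar>D n j x\<bar> \<le> b" "j \<le> 3" for j x b
    using tendsto_rabs[OF flim[OF that(2), of x]] that(1) by (intro LIMSEQ_le_const2) auto
  have "regular_slice f"
    unfolding regular_slice_def
  proof (intro conjI allI ballI impI)
    show "(f j has_real_derivative f (Suc j) x) (at x)" if "j < 3" for j x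
      using that f1(1) f2(1) f3(1) f by (auto simp: numeral_3_eq_3 less_Suc_eq)
    show "\<bar>f 1 x\<bar> \<le> 1" for x using regular_sliceD(2)[OF S] by (intro bnd) auto
    show "\<bar>f j x\<bar> \<le> 289" if "j \<in> {1..3}" for j x using regular_sliceD(3)[OF S that] that by (intro bnd) auto
    show "\<bar>f 3 x - f 3 y\<bar> \<le> 289 * \<bar>x - y\<bar>" for x y
    proof (rule LIMSEQ_le_const2)
      show "(\<lambda>n. \<bar>D n 3 x - D n 3 y\<bar>) \<longlonglongrightarrow> \<bar>f 3 x - f 3 y\<bar>" by (intro tendsto_intros flim) auto
      show "\<exists>N. \<forall>n\<ge>N. \<bar>D n 3 x - D n 3 y\<bar> \<le> 289 * \<bar>x - y\<bar>" using regular_slice_lipschitz[OF S] by blast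
    qed
  qed
  then show "regular_slice (\<lambda>j x. dx j \<Psi> x t)" using f(1) by (rule regular_sliceI)
qed

section \<open>Discretization and the Parisi solution\<close>

definition grid_floor :: "nat \<Rightarrow> real \<Rightarrow> real" where
  "grid_floor n t = of_int \<lfloor>t * real (Suc n)\<rfloor> / real (Suc n)"

definition discretized :: "real measure \<Rightarrow> nat \<Rightarrow> real measure" where
  "discretized \<mu> n = distr \<mu> borel (grid_floor n)"

lemma grid_floor_measurable [measurable]: "grid_floor n \<in> borel_measurable borel"
  unfolding grid_floor_def by measurable

lemma grid_floor_bounds: "t - 1 / real (Suc n) \<le> grid_floor n t" "grid_floor n t \<le> t"
proof -
  have "t * real (Suc n) - 1 \<le> of_int \<lfloor>t * real (Suc n)\<rfloor>" "of_int \<lfloor>t * real (Suc n)\<rfloor> \<le> t * real (Suc n)"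
    by linarith+
  then show "t - 1 / real (Suc n) \<le> grid_floor n t" "grid_floor n t \<le> t"
    using divide_right_mono[of "t * real (Suc n) - 1" "of_int \<lfloor>t * real (Suc n)\<rfloor>" "real (Suc n)"]
      divide_right_mono[of "of_int \<lfloor>t * real (Suc n)\<rfloor>" "t * real (Suc n)" "real (Suc n)"]
    unfolding grid_floor_def by (simp_all add: diff_divide_distrib del: of_nat_Suc)
qed

lemma grid_floor_nonneg: "0 \<le> t \<Longrightarrow> 0 \<le> grid_floor n t"
  unfolding grid_floor_def by simp

lemma grid_floor_unit: "t \<in> {0..1} \<Longrightarrow> grid_floor n t \<in> {0..1}"
  using grid_floor_nonneg[of t n] grid_floor_bounds(2)[of n t] by auto

lemma grid_floor_tendsto: "(\<lambda>n. grid_floor n t) \<longlonglongrightarrow> t"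
proof (rule tendsto_sandwich[of "\<lambda>n. t - 1 / real (Suc n)" _ _ "\<lambda>_. t"])
  have "(\<lambda>n. t - inverse (real (Suc n))) \<longlonglongrightarrow> t - 0" by (intro tendsto_intros LIMSEQ_inverse_real_of_nat)
  then show "(\<lambda>n. t - 1 / real (Suc n)) \<longlonglongrightarrow> t" by (simp add: inverse_eq_divide)
qed (use grid_floor_bounds in auto)

lemma unit_measure_AE: "\<mu> \<in> unit_measures \<Longrightarrow> AE t in \<mu>. t \<in> {0..1}"
  using unit_measuresD[of \<mu>] by (intro prob_space.AE_in_set_eq_1[THEN iffD2]) auto

lemma grid_floor_image: "grid_floor n ` {0..1} \<subseteq> (\<lambda>k. of_int k / real (Suc n)) ` {0..int (Suc n)}"
proof
  fix y assume "y \<in> grid_floor n ` {0..1}"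
  then obtain t where t: "t \<in> {0..1}" "y = grid_floor n t" by auto
  have "t * real (Suc n) \<le> 1 * real (Suc n)" using t by (intro mult_right_mono) auto
  then have "\<lfloor>t * real (Suc n)\<rfloor> \<le> \<lfloor>real (Suc n)\<rfloor>" by (intro floor_mono) simp
  then have "\<lfloor>t * real (Suc n)\<rfloor> \<in> {0..int (Suc n)}" using t by (simp del: of_nat_Suc)
  then show "y \<in> (\<lambda>k. of_int k / real (Suc n)) ` {0..int (Suc n)}" using t unfolding grid_floor_def by blast
qed

lemma discretized_discrete:
  assumes \<mu>: "\<mu> \<in> unit_measures"
  shows "discretized \<mu> n \<in> discrete_unit_measures"
    and "A \<in> sets borel \<Longrightarrow> measure (discretized \<mu> n) A = measure \<mu> (grid_floor n -` A)"
proof -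
  have s [measurable_cong]: "sets \<mu> = sets borel" and sp: "space \<mu> = UNIV" using unit_measuresD[OF \<mu>] by auto
  interpret prob_space \<mu> using unit_measuresD[OF \<mu>] by simp
  have eq: "measure (discretized \<mu> n) A = measure \<mu> (grid_floor n -` A)" if "A \<in> sets borel" for A
    unfolding discretized_def using that sp by (subst measure_distr) auto
  then show "measure (discretized \<mu> n) A = measure \<mu> (grid_floor n -` A)" if "A \<in> sets borel" using that .
  have p: "prob_space (discretized \<mu> n)" unfolding discretized_def by (intro prob_space_distr) measurable
  have one: "measure (discretized \<mu> n) A = 1" if "A \<in> sets borel" "grid_floor n ` {0..1} \<subseteq> A" for A
  proof -
    have "measure \<mu> {0..1} \<le> measure \<mu> (grid_floor n -` A)"
    proof (intro finite_measure_mono)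
      show "grid_floor n -` A \<in> events" using measurable_sets[OF grid_floor_measurable that(1)] s by simp
    qed (use that in auto)
    then show ?thesis using eq[OF that(1)] unit_measuresD(3)[OF \<mu>] prob_le_1[of "grid_floor n -` A"] by simp
  qed
  have fin: "finite (grid_floor n ` {0..1})"
    by (rule finite_subset[OF grid_floor_image]) auto
  have "measure (discretized \<mu> n) {0..1} = 1" using grid_floor_unit by (intro one) auto
  moreover have "sets (discretized \<mu> n) = sets borel" by (simp add: discretized_def)
  moreover have "measure (discretized \<mu> n) (grid_floor n ` {0..1}) = 1"
    using finite_imp_closed[OF fin] by (intro one) auto
  ultimately show "discretized \<mu> n \<in> discrete_unit_measures"
    unfolding discrete_unit_measures_def unit_measures_def using p fin grid_floor_unit by auto
qed

text \<open>Convergence holds at every \<open>r\<close>, atoms of \<open>\<mu>\<close> included,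
  because rounding goes down: points of \<open>[0, r]\<close> stay there, and a point beyond
  \<open>r\<close> is eventually rounded to a point still beyond \<open>r\<close>.\<close>

lemma discretized_cdf_tendsto:
  assumes \<mu>: "\<mu> \<in> unit_measures"
  shows "(\<lambda>n. measure (discretized \<mu> n) {0..r}) \<longlonglongrightarrow> measure \<mu> {0..r}"
proof -
  have s [measurable_cong]: "sets \<mu> = sets borel" and sp: "space \<mu> = UNIV" using unit_measuresD[OF \<mu>] by auto
  interpret prob_space \<mu> using unit_measuresD[OF \<mu>] by simp
  have "(\<lambda>n. LINT t|\<mu>. indicator {0..r} (grid_floor n t) :: real) \<longlonglongrightarrow> (LINT t|\<mu>. indicator {0..r} t)"
  proof (rule integral_dominated_convergence[where w="\<lambda>_. 1"])
    show "AE t in \<mu>. (\<lambda>n. indicator {0..r} (grid_floor n t) :: real) \<longlonglongrightarrow> indicator {0..r} t"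
      using unit_measure_AE[OF \<mu>]
    proof eventually_elim
      case (elim t)
      show ?case
      proof (cases "t \<le> r")
        case True
        then have "indicator {0..r} (grid_floor n t) = (indicator {0..r} t :: real)" for n
          using elim grid_floor_nonneg[of t n] grid_floor_bounds(2)[of n t] by (auto simp: indicator_def)
        then show ?thesis by simp
      next
        case False
        then have "\<forall>\<^sub>F n in sequentially. r < grid_floor n t"
          using order_tendstoD(1)[OF grid_floor_tendsto] by auto
        then have "\<forall>\<^sub>F n in sequentially. (indicator {0..r} (grid_floor n t) :: real) = indicator {0..r} t"
          by eventually_elim (use False in auto)
        then show ?thesis by (rule tendsto_eventually)
      qed
    qed
  qed (auto split: split_indicator)
  moreover have "(LINT t|\<mu>. indicator {0..r} (grid_floor n t) :: real) = measure (discretized \<mu> n) {0..r}" for n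
  proof -
    have "(LINT t|\<mu>. indicator {0..r} (grid_floor n t) :: real) = (LINT t|\<mu>. indicator (grid_floor n -` {0..r}) t)"
      by (intro Bochner_Integration.integral_cong) (auto split: split_indicator)
    also have "\<dots> = measure \<mu> (grid_floor n -` {0..r})" by (simp add: sp)
    finally show ?thesis by (simp add: discretized_discrete(2)[OF \<mu>])
  qed
  ultimately show ?thesis by (simp add: sp)
qed

context parisi
begin

lemma cdf_dist_discretized:
  assumes \<mu>: "\<mu> \<in> unit_measures"
  shows "(\<lambda>n. cdf_dist (discretized \<mu> n) \<mu>) \<longlonglongrightarrow> 0"
proof -
  note d = discrete_unit_measuresD(1)[OF discretized_discrete(1)[OF \<mu>]]
  note [measurable] = cdf_measurable[OF \<mu>] cdf_measurable[OF d]
  have "(\<lambda>n. LINT u|lborel. indicator {0..1} u *\<^sub>R \<bar>measure (discretized \<mu> n) {0..u} - measure \<mu> {0..u}\<bar>)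
    \<longlonglongrightarrow> (LINT u|(lborel :: real measure). (0 :: real))"
  proof (rule integral_dominated_convergence[where w="\<lambda>u. indicator {0..1} u :: real"])
    show "AE u in lborel. (\<lambda>n. indicator {0..1} u *\<^sub>R \<bar>measure (discretized \<mu> n) {0..u} - measure \<mu> {0..u}\<bar>) \<longlonglongrightarrow> 0"
    proof (intro AE_I2)
      fix u :: real
      have "(\<lambda>n. indicator {0..1} u *\<^sub>R \<bar>measure (discretized \<mu> n) {0..u} - measure \<mu> {0..u}\<bar>)
        \<longlonglongrightarrow> indicator {0..1} u *\<^sub>R \<bar>measure \<mu> {0..u} - measure \<mu> {0..u}\<bar>"
        by (intro tendsto_intros discretized_cdf_tendsto \<mu>)
      then show "(\<lambda>n. indicator {0..1} u *\<^sub>R \<bar>measure (discretized \<mu> n) {0..u} - measure \<mu> {0..u}\<bar>) \<longlonglongrightarrow> 0" by simp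
    qed
    show "AE u in lborel. norm (indicator {0..1} u *\<^sub>R \<bar>measure (discretized \<mu> n) {0..u} - measure \<mu> {0..u}\<bar>) \<le> indicator {0..1} u" for n
    proof (intro AE_I2)
      fix u :: real
      have "\<bar>measure (discretized \<mu> n) {0..u} - measure \<mu> {0..u}\<bar> \<le> 1"
        using cdf_unit[OF \<mu>, of u] cdf_unit[OF d, of n u] unfolding atLeastAtMost_iff by linarith
      then show "norm (indicator {0..1} u *\<^sub>R \<bar>measure (discretized \<mu> n) {0..u} - measure \<mu> {0..u}\<bar>) \<le> indicator {0..1} u"
        by (auto split: split_indicator)
    qed
  qed auto
  then show ?thesis by (simp add: cdf_dist_def set_lebesgue_integral_def)
qed

lemma cdf_dist_triangle:
  assumes "\<mu> \<in> unit_measures" "\<nu> \<in> unit_measures" "\<rho> \<in> unit_measures"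
  shows "cdf_dist \<mu> \<nu> \<le> cdf_dist \<mu> \<rho> + cdf_dist \<nu> \<rho>"
proof -
  have i: "set_integrable lborel {0..1} (\<lambda>u. \<bar>measure \<mu> {0..u} - measure \<rho> {0..u}\<bar>)"
    "set_integrable lborel {0..1} (\<lambda>u. \<bar>measure \<nu> {0..u} - measure \<rho> {0..u}\<bar>)"
    using cdf_difference_integrable assms by auto
  have "cdf_dist \<mu> \<nu> \<le> (LINT u:{0..1}|lborel. \<bar>measure \<mu> {0..u} - measure \<rho> {0..u}\<bar> + \<bar>measure \<nu> {0..u} - measure \<rho> {0..u}\<bar>)"
    unfolding cdf_dist_def using cdf_difference_integrable[OF assms(1,2)] i
    by (intro set_integral_mono set_integral_add) auto
  also have "\<dots> = cdf_dist \<mu> \<rho> + cdf_dist \<nu> \<rho>"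
    unfolding cdf_dist_def by (rule set_integral_add(2)[OF i])
  finally show ?thesis .
qed

abbreviation discrete_near :: "real measure \<Rightarrow> real measure filter" where
  "discrete_near \<mu> \<equiv> inf (filtercomap (\<lambda>\<nu>. cdf_dist \<nu> \<mu>) (nhds 0)) (principal discrete_unit_measures)"

text \<open>A sequence converging along the filter in the definition of
  \<open>parisi_solution\<close>; it makes limits along that filter unique.\<close>

lemma discretized_discrete_near:
  assumes "\<mu> \<in> unit_measures"
  shows "filterlim (discretized \<mu>) (discrete_near \<mu>) sequentially"
  unfolding filterlim_inf filterlim_filtercomap_iff filterlim_principal
  using cdf_dist_discretized[OF assms] discretized_discrete(1)[OF assms] by (simp add: comp_def)

text \<open>Shows that the definite description defining \<open>parisi_solution\<close> denotes. The
  limit along the discretizations exists by the Lipschitz bound, is a uniform limit along the whole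
  filter by the same bound, and is the only candidate because every other one has the same limit
  along that sequence.\<close>

lemma parisi_solution_approx:
  obtains C where "0 \<le> C" "\<And>\<mu> \<nu> x u. \<mu> \<in> unit_measures \<Longrightarrow> \<nu> \<in> discrete_unit_measures \<Longrightarrow> u \<in> {0..1}
    \<Longrightarrow> \<bar>parisi_discrete \<xi> \<nu> (x, u) - parisi_solution \<xi> \<mu> (x, u)\<bar> \<le> C * cdf_dist \<nu> \<mu>"
proof (rule parisi_discrete_lipschitz)
  fix C assume C: "0 \<le> C" and lip: "\<And>\<mu> \<nu> u x. \<mu> \<in> discrete_unit_measures \<Longrightarrow> \<nu> \<in> discrete_unit_measures \<Longrightarrow> u \<in> {0..1} \<Longrightarrow>
    \<bar>parisi_discrete \<xi> \<mu> (x, u) - parisi_discrete \<xi> \<nu> (x, u)\<bar> \<le> C * cdf_dist \<mu> \<nu>"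
  show ?thesis
  proof (rule that[OF C])
    fix \<mu> \<nu> and x u :: real
    assume \<mu>: "\<mu> \<in> unit_measures" and \<nu>: "\<nu> \<in> discrete_unit_measures" and u: "u \<in> {0..1}"
    let ?\<nu> = "discretized \<mu>"
    let ?S = "UNIV \<times> {0..1} :: (real \<times> real) set"
    note d = discretized_discrete(1)[OF \<mu>]
    have lip2: "\<bar>parisi_discrete \<xi> \<nu>1 p - parisi_discrete \<xi> \<nu>2 p\<bar> \<le> C * (cdf_dist \<nu>1 \<mu> + cdf_dist \<nu>2 \<mu>)"
      if "\<nu>1 \<in> discrete_unit_measures" "\<nu>2 \<in> discrete_unit_measures" "p \<in> ?S" for \<nu>1 \<nu>2 p
    proof -
      have "C * cdf_dist \<nu>1 \<nu>2 \<le> C * (cdf_dist \<nu>1 \<mu> + cdf_dist \<nu>2 \<mu>)"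
        using C cdf_dist_triangle[OF discrete_unit_measuresD(1)[OF that(1)] discrete_unit_measuresD(1)[OF that(2)] \<mu>]
        by (intro mult_left_mono)
      then show ?thesis using lip[OF that(1,2), of "snd p" "fst p"] that(3) by auto
    qed
    \<comment> \<open>The value \<open>undefined\<close> off the strip is what membership in
      \<open>extensional\<close> demands.\<close>
    define \<Phi> where "\<Phi> = (\<lambda>p. if p \<in> ?S then lim (\<lambda>n. parisi_discrete \<xi> (?\<nu> n) p) else undefined)"
    have conv: "(\<lambda>n. parisi_discrete \<xi> (?\<nu> n) p) \<longlonglongrightarrow> \<Phi> p" if p: "p \<in> ?S" for p
    proof -
      have "Cauchy (\<lambda>n. parisi_discrete \<xi> (?\<nu> n) p)"
      proof (rule metric_CauchyI)
        fix e :: real assume e: "0 < e"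
        have "(\<lambda>n. C * cdf_dist (?\<nu> n) \<mu>) \<longlonglongrightarrow> C * 0" by (intro tendsto_intros cdf_dist_discretized \<mu>)
        then have "\<forall>\<^sub>F n in sequentially. C * cdf_dist (?\<nu> n) \<mu> < e / 2" using e order_tendstoD(2)[of _ 0 sequentially "e / 2"] by simp
        then obtain N where N: "\<And>n. N \<le> n \<Longrightarrow> C * cdf_dist (?\<nu> n) \<mu> < e / 2" by (auto simp: eventually_sequentially)
        show "\<exists>M. \<forall>m\<ge>M. \<forall>n\<ge>M. dist (parisi_discrete \<xi> (?\<nu> m) p) (parisi_discrete \<xi> (?\<nu> n) p) < e"
        proof (intro exI allI impI)
          fix m n assume "N \<le> m" "N \<le> n"
          then show "dist (parisi_discrete \<xi> (?\<nu> m) p) (parisi_discrete \<xi> (?\<nu> n) p) < e"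
            using lip2[OF d d p, of m n] N[of m] N[of n] by (simp add: dist_real_def distrib_left)
        qed
      qed
      then show ?thesis using p by (simp add: \<Phi>_def real_Cauchy_convergent convergent_LIMSEQ_iff[symmetric])
    qed
    have approx: "\<bar>parisi_discrete \<xi> \<nu> p - \<Phi> p\<bar> \<le> C * cdf_dist \<nu> \<mu>"
      if \<nu>: "\<nu> \<in> discrete_unit_measures" and p: "p \<in> ?S" for \<nu> p
    proof (rule LIMSEQ_le)
      show "(\<lambda>n. \<bar>parisi_discrete \<xi> \<nu> p - parisi_discrete \<xi> (?\<nu> n) p\<bar>) \<longlonglongrightarrow> \<bar>parisi_discrete \<xi> \<nu> p - \<Phi> p\<bar>"
        by (intro tendsto_intros conv p)
      have "(\<lambda>n. C * (cdf_dist \<nu> \<mu> + cdf_dist (?\<nu> n) \<mu>)) \<longlonglongrightarrow> C * (cdf_dist \<nu> \<mu> + 0)"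
        by (intro tendsto_intros cdf_dist_discretized \<mu>)
      then show "(\<lambda>n. C * (cdf_dist \<nu> \<mu> + cdf_dist (?\<nu> n) \<mu>)) \<longlonglongrightarrow> C * cdf_dist \<nu> \<mu>" by simp
      show "\<exists>N. \<forall>n\<ge>N. \<bar>parisi_discrete \<xi> \<nu> p - parisi_discrete \<xi> (?\<nu> n) p\<bar> \<le> C * (cdf_dist \<nu> \<mu> + cdf_dist (?\<nu> n) \<mu>)"
        using lip2[OF \<nu> d p] by blast
    qed
    have "parisi_solution \<xi> \<mu> = \<Phi>"
      unfolding parisi_solution_def
    proof (rule the_equality)
      show "\<Phi> \<in> extensional ?S \<and> uniform_limit ?S (parisi_discrete \<xi>) \<Phi> (discrete_near \<mu>)"
      proof
        show "\<Phi> \<in> extensional ?S" by (simp add: \<Phi>_def extensional_def)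
        show "uniform_limit ?S (parisi_discrete \<xi>) \<Phi> (discrete_near \<mu>)"
        proof (rule uniform_limitI)
          fix e :: real assume e: "0 < e"
          have "filterlim (\<lambda>\<nu>. cdf_dist \<nu> \<mu>) (nhds 0) (filtercomap (\<lambda>\<nu>. cdf_dist \<nu> \<mu>) (nhds 0))"
            by (rule filterlim_filtercomap)
          then have "((\<lambda>\<nu>. cdf_dist \<nu> \<mu>) \<longlongrightarrow> 0) (discrete_near \<mu>)"
            by (rule filterlim_mono) auto
          then have "((\<lambda>\<nu>. C * cdf_dist \<nu> \<mu>) \<longlongrightarrow> C * 0) (discrete_near \<mu>)" by (intro tendsto_intros)
          then have "\<forall>\<^sub>F \<nu> in discrete_near \<mu>. C * cdf_dist \<nu> \<mu> < e"
            using e order_tendstoD(2)[of _ 0 "discrete_near \<mu>" e] by simp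
          moreover have "\<forall>\<^sub>F \<nu> in discrete_near \<mu>. \<nu> \<in> discrete_unit_measures"
            by (simp add: eventually_inf_principal)
          ultimately show "\<forall>\<^sub>F \<nu> in discrete_near \<mu>. \<forall>p\<in>?S. dist (parisi_discrete \<xi> \<nu> p) (\<Phi> p) < e"
          proof eventually_elim
            case (elim \<nu>)
            show ?case
            proof
              fix p assume "p \<in> ?S"
              then show "dist (parisi_discrete \<xi> \<nu> p) (\<Phi> p) < e"
                using approx[OF elim(2), of p] elim(1) unfolding dist_real_def by linarith
            qed
          qed
        qed
      qed
      fix \<Psi> assume \<Psi>: "\<Psi> \<in> extensional ?S \<and> uniform_limit ?S (parisi_discrete \<xi>) \<Psi> (discrete_near \<mu>)"
      show "\<Psi> = \<Phi>"
      proof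
        fix p show "\<Psi> p = \<Phi> p"
        proof (cases "p \<in> ?S")
          case True
          then have "((\<lambda>\<nu>. parisi_discrete \<xi> \<nu> p) \<longlongrightarrow> \<Psi> p) (discrete_near \<mu>)"
            using \<Psi> by (intro tendsto_uniform_limitI[where S="?S"]) auto
          from filterlim_compose[OF this discretized_discrete_near[OF \<mu>]] conv[OF True]
          show ?thesis by (rule LIMSEQ_unique)
        next
          case False
          then have "\<Psi> p = undefined" using \<Psi> by (blast dest: extensional_arb)
          then show ?thesis using False by (simp only: \<Phi>_def if_False)
        qed
      qed
    qed
    then show "\<bar>parisi_discrete \<xi> \<nu> (x, u) - parisi_solution \<xi> \<mu> (x, u)\<bar> \<le> C * cdf_dist \<nu> \<mu>"
      using approx[OF \<nu>, of "(x, u)"] u by simp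
  qed
qed

lemma parisi_solution_uniform_limit:
  assumes \<mu>: "\<mu> \<in> unit_measures"
  shows "uniform_limit (UNIV \<times> {0..1}) (\<lambda>n. parisi_discrete \<xi> (discretized \<mu> n)) (parisi_solution \<xi> \<mu>) sequentially"
proof (rule parisi_solution_approx)
  fix C assume C: "0 \<le> C" and approx: "\<And>\<mu> \<nu> x u. \<mu> \<in> unit_measures \<Longrightarrow> \<nu> \<in> discrete_unit_measures \<Longrightarrow> u \<in> {0..1}
    \<Longrightarrow> \<bar>parisi_discrete \<xi> \<nu> (x, u) - parisi_solution \<xi> \<mu> (x, u)\<bar> \<le> C * cdf_dist \<nu> \<mu>"
  show ?thesis
  proof (rule uniform_limitI)
    fix e :: real assume e: "0 < e"
    have "(\<lambda>n. C * cdf_dist (discretized \<mu> n) \<mu>) \<longlonglongrightarrow> C * 0" by (intro tendsto_intros cdf_dist_discretized \<mu>)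
    then have "\<forall>\<^sub>F n in sequentially. C * cdf_dist (discretized \<mu> n) \<mu> < e" using e order_tendstoD(2)[of _ 0 sequentially e] by simp
    then show "\<forall>\<^sub>F n in sequentially. \<forall>p\<in>UNIV \<times> {0..1}. dist (parisi_discrete \<xi> (discretized \<mu> n) p) (parisi_solution \<xi> \<mu> p) < e"
    proof eventually_elim
      case (elim n)
      show ?case
      proof
        fix p :: "real \<times> real" assume "p \<in> UNIV \<times> {0..1}"
        then show "dist (parisi_discrete \<xi> (discretized \<mu> n) p) (parisi_solution \<xi> \<mu> p) < e"
          using approx[OF \<mu> discretized_discrete(1)[OF \<mu>], of "snd p" n "fst p"] elim
          by (auto simp: dist_real_def)
      qed
    qed
  qed
qed

lemma regular_jet_slice: "regular_jet D \<Longrightarrow> regular_slice D"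
  unfolding regular_slice_def using regular_jetD[of D] jet_has_derivative[of D] jet_lipschitz[of D 3 289]
  by auto

text \<open>One constant serves all measures, so the later limits involve no constant depending on
  the discretization.\<close>

lemma regular_fields:
  shows "\<exists>C. (\<forall>\<nu>\<in>discrete_unit_measures. regular_field C (parisi_discrete \<xi> \<nu>)) \<and>
    (\<forall>\<mu>\<in>unit_measures. regular_field C (parisi_solution \<xi> \<mu>))"
proof (rule parisi_discrete_time_lipschitz)
  fix C assume C: "0 \<le> C" and *: "\<And>\<nu> s t x. \<nu> \<in> discrete_unit_measures \<Longrightarrow> s \<in> {0..1} \<Longrightarrow> t \<in> {0..1} \<Longrightarrow>
    \<bar>parisi_discrete \<xi> \<nu> (x, s) - parisi_discrete \<xi> \<nu> (x, t)\<bar> \<le> C * \<bar>s - t\<bar>"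
  have 1: "regular_field C (parisi_discrete \<xi> \<nu>)" if \<nu>: "\<nu> \<in> discrete_unit_measures" for \<nu>
    unfolding regular_field_def
  proof (intro conjI ballI allI)
    show "regular_slice (\<lambda>j x. dx j (parisi_discrete \<xi> \<nu>) x u)" if u: "u \<in> {0..1}" for u
    proof -
      obtain D where D: "regular_jet D" "D 0 = (\<lambda>x. parisi_discrete \<xi> \<nu> (x, u))"
        using parisi_discrete_regular[OF \<nu>, of u] u by auto
      show ?thesis by (rule regular_sliceI[OF regular_jet_slice[OF D(1)] D(2)])
    qed
  qed (rule *[OF \<nu>])
  moreover have "regular_field C (parisi_solution \<xi> \<mu>)" if "\<mu> \<in> unit_measures" for \<mu>
    by (rule regular_field_limit[OF 1 parisi_solution_uniform_limit[OF that]]) (rule discretized_discrete(1)[OF that])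
  ultimately show ?thesis by blast
qed

end

section \<open>Convergence of moments\<close>

text \<open>The bound is stated with the nonnegative integral, which is meaningful before
  integrability is known and is the form that Fatou's lemma delivers.\<close>

lemma (in prob_space) square_integrable:
  fixes Z :: "'a \<Rightarrow> real"
  assumes "Z \<in> borel_measurable M" "(\<integral>\<^sup>+\<omega>. ennreal ((Z \<omega>)\<^sup>2) \<partial>M) \<le> ennreal K" "0 \<le> K"
  shows "integrable M (\<lambda>\<omega>. (Z \<omega>)\<^sup>2)" "expectation (\<lambda>\<omega>. (Z \<omega>)\<^sup>2) \<le> K" "integrable M Z"
proof -
  note [measurable] = assms(1)
  show i: "integrable M (\<lambda>\<omega>. (Z \<omega>)\<^sup>2)"
    using le_less_trans[OF assms(2)] by (intro integrableI_nonneg) auto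
  have "ennreal (expectation (\<lambda>\<omega>. (Z \<omega>)\<^sup>2)) = (\<integral>\<^sup>+\<omega>. ennreal ((Z \<omega>)\<^sup>2) \<partial>M)"
    using nn_integral_eq_integral[OF i] by simp
  then have "ennreal (expectation (\<lambda>\<omega>. (Z \<omega>)\<^sup>2)) \<le> ennreal K" using assms(2) by (simp only:)
  then show "expectation (\<lambda>\<omega>. (Z \<omega>)\<^sup>2) \<le> K" using ennreal_le_iff[OF assms(3)] by blast
  show "integrable M Z"
  proof (rule Bochner_Integration.integrable_bound)
    show "integrable M (\<lambda>\<omega>. 1 + (Z \<omega>)\<^sup>2)" using i by simp
    have "\<bar>z\<bar> \<le> 1 + z\<^sup>2" for z :: real
      using zero_le_power2[of "\<bar>z\<bar> - 1"] by (simp add: power2_diff)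
    then show "AE \<omega> in M. norm (Z \<omega>) \<le> norm (1 + (Z \<omega>)\<^sup>2)" by simp
  qed simp
qed

text \<open>Boundedness in \<open>L\<^sup>2\<close> replaces domination: the suprema of Brownian paths never have to be integrated.\<close>

lemma (in prob_space) expectation_tendsto_L2:
  fixes X :: "nat \<Rightarrow> 'a \<Rightarrow> real"
  assumes X: "\<And>n. X n \<in> borel_measurable M"
    and lim: "\<And>\<omega>. \<omega> \<in> space M \<Longrightarrow> (\<lambda>n. X n \<omega>) \<longlonglongrightarrow> Y \<omega>"
    and K: "\<And>n. (\<integral>\<^sup>+\<omega>. ennreal ((X n \<omega>)\<^sup>2) \<partial>M) \<le> ennreal K" "0 \<le> K"
  shows "Y \<in> borel_measurable M" "(\<integral>\<^sup>+\<omega>. ennreal ((Y \<omega>)\<^sup>2) \<partial>M) \<le> ennreal K"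
    "(\<lambda>n. expectation (X n)) \<longlonglongrightarrow> expectation Y"
proof -
  note [measurable] = X
  show Y [measurable]: "Y \<in> borel_measurable M" using lim by (rule borel_measurable_LIMSEQ_real) auto
  have "(\<integral>\<^sup>+\<omega>. ennreal ((Y \<omega>)\<^sup>2) \<partial>M) = (\<integral>\<^sup>+\<omega>. liminf (\<lambda>n. ennreal ((X n \<omega>)\<^sup>2)) \<partial>M)"
  proof (rule nn_integral_cong)
    fix \<omega> assume "\<omega> \<in> space M"
    then have "(\<lambda>n. ennreal ((X n \<omega>)\<^sup>2)) \<longlonglongrightarrow> ennreal ((Y \<omega>)\<^sup>2)"
      by (intro tendsto_ennrealI tendsto_intros lim)
    then show "ennreal ((Y \<omega>)\<^sup>2) = liminf (\<lambda>n. ennreal ((X n \<omega>)\<^sup>2))"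
      by (intro lim_imp_Liminf[symmetric]) auto
  qed
  also have "\<dots> \<le> liminf (\<lambda>n. \<integral>\<^sup>+\<omega>. ennreal ((X n \<omega>)\<^sup>2) \<partial>M)" by (rule nn_integral_liminf) measurable
  also have "\<dots> \<le> liminf (\<lambda>n. ennreal K)" by (intro Liminf_mono always_eventually allI K)
  also have "\<dots> = ennreal K" by (simp add: Liminf_const)
  finally show YK: "(\<integral>\<^sup>+\<omega>. ennreal ((Y \<omega>)\<^sup>2) \<partial>M) \<le> ennreal K" .
  \<comment> \<open>Truncation at level \<open>R\<close> allows bounded convergence. The truncation
    error is at most \<open>x\<^sup>2 / R\<close>, hence at most \<open>K / R\<close> in mean,
    uniformly in \<open>n\<close> and also for \<open>Y\<close>, which inherited the bound by
    Fatou's lemma.\<close>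
  define clip where "clip = (\<lambda>R x :: real. max (- R) (min R x))"
  have clip_m [measurable]: "clip R \<in> borel_measurable borel" for R unfolding clip_def by measurable
  have clip_le: "\<bar>x - clip R x\<bar> \<le> x\<^sup>2 / R" if "0 < R" for R x
  proof (cases "\<bar>x\<bar> \<le> R")
    case True then show ?thesis using that by (auto simp: clip_def)
  next
    case False
    then have "\<bar>x - clip R x\<bar> \<le> \<bar>x\<bar>" using that by (auto simp: clip_def)
    also have "\<bar>x\<bar> * R \<le> \<bar>x\<bar> * \<bar>x\<bar>" using False by (intro mult_left_mono) auto
    then have "\<bar>x\<bar> \<le> x\<^sup>2 / R" using that by (simp add: le_divide_eq power2_eq_square)
    finally show ?thesis .
  qed
  have clip_R: "\<bar>clip R x\<bar> \<le> R" if "0 < R" for R x using that by (auto simp: clip_def)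
  have approx: "\<bar>expectation Z - expectation (\<lambda>\<omega>. clip R (Z \<omega>))\<bar> \<le> K / R"
    if Z [measurable]: "Z \<in> borel_measurable M" and ZK: "(\<integral>\<^sup>+\<omega>. ennreal ((Z \<omega>)\<^sup>2) \<partial>M) \<le> ennreal K" and R: "0 < R" for Z R
  proof -
    note i = square_integrable[OF Z ZK K(2)]
    have ic: "integrable M (\<lambda>\<omega>. clip R (Z \<omega>))"
      using clip_R[OF R] by (intro integrable_const_bound[where B=R]) auto
    have "\<bar>expectation Z - expectation (\<lambda>\<omega>. clip R (Z \<omega>))\<bar> = \<bar>expectation (\<lambda>\<omega>. Z \<omega> - clip R (Z \<omega>))\<bar>"
      using i ic by simp
    also have "\<dots> \<le> expectation (\<lambda>\<omega>. \<bar>Z \<omega> - clip R (Z \<omega>)\<bar>)" by (rule integral_abs_bound)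
    also have "\<dots> \<le> expectation (\<lambda>\<omega>. (Z \<omega>)\<^sup>2 / R)"
      using i ic clip_le[OF R] by (intro integral_mono) auto
    also have "\<dots> = expectation (\<lambda>\<omega>. (Z \<omega>)\<^sup>2) / R" by simp
    also have "\<dots> \<le> K / R" using i R by (intro divide_right_mono) auto
    finally show ?thesis .
  qed
  show "(\<lambda>n. expectation (X n)) \<longlonglongrightarrow> expectation Y"
  proof (rule LIMSEQ_I)
    fix e :: real assume e: "0 < e"
    \<comment> \<open>Makes the two truncation errors together less than \<open>e / 2\<close>; the
      added 1 keeps \<open>R\<close> positive when \<open>K = 0\<close>.\<close>
    define R where "R = (4 * K + 1) / e"
    have R: "0 < R" using e K(2) by (simp add: R_def)
    have "2 * (K / R) = 2 * K * e / (4 * K + 1)" using e by (simp add: R_def)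
    also have "\<dots> < e / 2" using e K(2) by (simp add: field_simps)
    finally have KR: "2 * (K / R) < e / 2" .
    have "(\<lambda>n. expectation (\<lambda>\<omega>. clip R (X n \<omega>))) \<longlonglongrightarrow> expectation (\<lambda>\<omega>. clip R (Y \<omega>))"
    proof (rule integral_dominated_convergence[where w="\<lambda>_. R"])
      show "AE \<omega> in M. (\<lambda>n. clip R (X n \<omega>)) \<longlonglongrightarrow> clip R (Y \<omega>)"
        unfolding clip_def by (intro AE_I2 tendsto_intros lim)
    qed (use clip_R[OF R] in auto)
    from LIMSEQ_D[OF this, of "e / 2"] e obtain N where
      N: "\<And>n. N \<le> n \<Longrightarrow> \<bar>expectation (\<lambda>\<omega>. clip R (X n \<omega>)) - expectation (\<lambda>\<omega>. clip R (Y \<omega>))\<bar> < e / 2" by auto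
    show "\<exists>N. \<forall>n\<ge>N. norm (expectation (X n) - expectation Y) < e"
    proof (intro exI allI impI)
      fix n assume "N \<le> n"
      then show "norm (expectation (X n) - expectation Y) < e"
        using N[of n] approx[OF X K(1) R, of n] approx[OF Y YK R] KR unfolding real_norm_def by linarith
    qed
  qed
qed

locale parisi_brownian = parisi \<xi> L + brownian_motion P B
  for \<xi> :: "real \<Rightarrow> real" and L :: real and P :: "'a measure" and B :: "real \<Rightarrow> 'a \<Rightarrow> real"
begin

abbreviation M :: "real \<Rightarrow> 'a \<Rightarrow> real" where
  "M \<equiv> time_changed \<xi> B"

lemma deriv_nonneg: "u \<in> {0..1} \<Longrightarrow> 0 \<le> deriv \<xi> u"
  using deriv_mono[of 0 u] deriv_zero by simp

lemma M_measurable: "u \<in> {0..1} \<Longrightarrow> M u \<in> borel_measurable P"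
  unfolding time_changed_def[abs_def] by (intro random_variable_B deriv_nonneg)

lemma deriv_continuous: "continuous_on {0..1} (deriv \<xi>)"
proof (rule lipschitz_on_continuous_on[of L], rule lipschitz_onI)
  show "dist (deriv \<xi> s) (deriv \<xi> t) \<le> L * dist s t" if "s \<in> {0..1}" "t \<in> {0..1}" for s t
    using that deriv_mono[of s t] deriv_lipschitz[of s t] deriv_mono[of t s] deriv_lipschitz[of t s]
    by (cases "s \<le> t") (auto simp: dist_real_def)
qed (rule L_nonneg)

lemma M_continuous: "\<omega> \<in> space P \<Longrightarrow> continuous_on {0..1} (\<lambda>u. M u \<omega>)"
  unfolding time_changed_def
  by (rule continuous_on_compose2[OF continuous_paths deriv_continuous]) (use deriv_nonneg in auto)

lemma M_tendsto:
  assumes "\<omega> \<in> space P" "(s \<longlongrightarrow> r) F" "\<And>n. s n \<in> {0..1}" "r \<in> {0..1}"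
  shows "((\<lambda>n. M (s n) \<omega>) \<longlongrightarrow> M r \<omega>) F"
  using assms by (intro continuous_on_tendsto_compose[OF M_continuous]) auto

definition clamp01 :: "(real \<Rightarrow> real) \<Rightarrow> real \<Rightarrow> real \<Rightarrow> real" where
  "clamp01 \<rho> u t = max 0 (min (\<rho> t) u)"

lemma clamp01_unit: "u \<in> {0..1} \<Longrightarrow> clamp01 \<rho> u t \<in> {0..1}"
  by (auto simp: clamp01_def)

text \<open>For the image \<open>\<nu>\<close> of \<open>\<mu>\<close> under \<open>\<rho>\<close> this is \<open>W\<^sub>\<nu>\<close>: the integrand vanishes when \<open>\<rho> t \<ge> u\<close>, so the
  integral need not be restricted to \<open>[0, u]\<close>.\<close>

definition path_weight :: "(real \<times> real \<Rightarrow> real) \<Rightarrow> (real \<Rightarrow> real) \<Rightarrow> real measure \<Rightarrow> real \<Rightarrow> 'a \<Rightarrow> real" where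
  "path_weight \<Phi> \<rho> \<mu> u \<omega> = (LINT t|\<mu>. \<Phi> (M u \<omega>, u) - \<Phi> (M (clamp01 \<rho> u t) \<omega>, clamp01 \<rho> u t))"

lemma path_tendsto:
  assumes "\<And>n. regular_field C (\<Phi> n)" "regular_field C \<Psi>" "uniform_limit (UNIV \<times> {0..1}) \<Phi> \<Psi> F"
    "\<And>n. s n \<in> {0..1}" "r \<in> {0..1}" "(s \<longlongrightarrow> r) F" "\<omega> \<in> space P"
  shows "((\<lambda>n. \<Phi> n (M (s n) \<omega>, s n)) \<longlongrightarrow> \<Psi> (M r \<omega>, r)) F"
  using tendsto_dx[OF assms(1,2,4,5,3) M_tendsto[OF assms(7,6,4,5)] assms(6), of 0] by (simp add: dx_def)

lemma path_continuous:
  assumes "regular_field C \<Phi>" "\<omega> \<in> space P"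
  shows "continuous_on {0..1} (\<lambda>t. \<Phi> (M t \<omega>, t))"
  unfolding continuous_on_sequentially comp_def
proof (intro allI ballI impI)
  fix s :: "nat \<Rightarrow> real" and r assume "r \<in> {0..1}" "(\<forall>n. s n \<in> {0..1}) \<and> s \<longlonglongrightarrow> r"
  then show "(\<lambda>n. \<Phi> (M (s n) \<omega>, s n)) \<longlonglongrightarrow> \<Phi> (M r \<omega>, r)"
    using assms by (intro path_tendsto[of C "\<lambda>_. \<Phi>"]) (auto intro!: uniform_limit_const)
qed

lemma path_measurable:
  assumes \<Phi>: "regular_field C \<Phi>" "\<omega> \<in> space P" and \<rho> [measurable]: "\<rho> \<in> borel_measurable borel"
    and \<mu> [measurable_cong]: "sets \<mu> = sets borel" and u: "u \<in> {0..1}"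
  shows "(\<lambda>t. \<Phi> (M (clamp01 \<rho> u t) \<omega>, clamp01 \<rho> u t)) \<in> borel_measurable \<mu>"
proof -
  define \<psi> where "\<psi> = (\<lambda>x. \<Phi> (M (max 0 (min x 1)) \<omega>, max 0 (min x 1)))"
  have "continuous_on UNIV \<psi>"
    unfolding \<psi>_def by (rule continuous_on_compose2[OF path_continuous[OF \<Phi>]]) (auto intro!: continuous_intros)
  then have [measurable]: "\<psi> \<in> borel_measurable borel" by (rule borel_measurable_continuous_onI)
  have "(\<lambda>t. \<Phi> (M (clamp01 \<rho> u t) \<omega>, clamp01 \<rho> u t)) = (\<lambda>t. \<psi> (clamp01 \<rho> u t))"
    using clamp01_unit[OF u, of \<rho>] by (simp add: \<psi>_def)
  also have "\<dots> \<in> borel_measurable \<mu>" unfolding clamp01_def[abs_def] by measurable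
  finally show ?thesis .
qed

lemma path_increment_le:
  assumes \<Phi>: "regular_field C \<Phi>" "0 \<le> C" and u: "u \<in> {0..1}" "s \<in> {0..1}"
  shows "\<bar>\<Phi> (M u \<omega>, u) - \<Phi> (M s \<omega>, s)\<bar> \<le> \<bar>M u \<omega> - M s \<omega>\<bar> + C"
proof -
  have "C * \<bar>u - s\<bar> \<le> C * 1" using u \<Phi> by (intro mult_left_mono) auto
  then show ?thesis
    using regular_fieldD(2)[OF \<Phi>(1) u, of "M s \<omega>"] regular_fieldD(3)[OF \<Phi>(1) u(1), of "M u \<omega>" "M s \<omega>"] by linarith
qed

lemma M_bounded: "\<omega> \<in> space P \<Longrightarrow> \<exists>b. \<forall>u\<in>{0..1}. \<bar>M u \<omega>\<bar> \<le> b"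
  using compact_imp_bounded[OF compact_continuous_image[OF M_continuous]] by (auto simp: bounded_iff)

text \<open>Dominated convergence under \<open>\<mu>\<close> for one fixed path. The dominating
  constant contains a bound \<open>b\<close> of that path, which depends on \<open>\<omega>\<close>
  and is used only inside this pathwise limit.\<close>

lemma path_weight_tendsto:
  fixes \<Phi> :: "nat \<Rightarrow> real \<times> real \<Rightarrow> real"
  assumes R: "\<And>n. regular_field C (\<Phi> n)" "regular_field C \<Psi>" "0 \<le> C"
    and u: "uniform_limit (UNIV \<times> {0..1}) \<Phi> \<Psi> sequentially"
    and s: "\<And>n. s n \<in> {0..1}" "r \<in> {0..1}" "s \<longlonglongrightarrow> r"
    and \<rho>: "\<And>n. \<rho> n \<in> borel_measurable borel" "\<sigma> \<in> borel_measurable borel" "\<And>t. (\<lambda>n. \<rho> n t) \<longlonglongrightarrow> \<sigma> t"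
    and \<omega>: "\<omega> \<in> space P" and \<mu>: "\<mu> \<in> unit_measures"
  shows "(\<lambda>n. path_weight (\<Phi> n) (\<rho> n) \<mu> (s n) \<omega>) \<longlonglongrightarrow> path_weight \<Psi> \<sigma> \<mu> r \<omega>"
proof -
  interpret \<mu>: prob_space \<mu> using unit_measuresD[OF \<mu>] by simp
  note sets = unit_measuresD(2)[OF \<mu>]
  obtain b where b: "\<And>u. u \<in> {0..1} \<Longrightarrow> \<bar>M u \<omega>\<bar> \<le> b" using M_bounded[OF \<omega>] by blast
  show ?thesis
    unfolding path_weight_def
  proof (rule integral_dominated_convergence[where w="\<lambda>_. 2 * b + C"])
    show "(\<lambda>t. \<Psi> (M r \<omega>, r) - \<Psi> (M (clamp01 \<sigma> r t) \<omega>, clamp01 \<sigma> r t)) \<in> borel_measurable \<mu>"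
      by (intro borel_measurable_diff borel_measurable_const path_measurable[OF R(2) \<omega> \<rho>(2) sets s(2)])
    show "(\<lambda>t. \<Phi> n (M (s n) \<omega>, s n) - \<Phi> n (M (clamp01 (\<rho> n) (s n) t) \<omega>, clamp01 (\<rho> n) (s n) t)) \<in> borel_measurable \<mu>" for n
      by (intro borel_measurable_diff borel_measurable_const path_measurable[OF R(1) \<omega> \<rho>(1) sets s(1)])
    show "AE t in \<mu>. (\<lambda>n. \<Phi> n (M (s n) \<omega>, s n) - \<Phi> n (M (clamp01 (\<rho> n) (s n) t) \<omega>, clamp01 (\<rho> n) (s n) t))
        \<longlonglongrightarrow> \<Psi> (M r \<omega>, r) - \<Psi> (M (clamp01 \<sigma> r t) \<omega>, clamp01 \<sigma> r t)"
    proof (intro AE_I2 tendsto_diff)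
      show "(\<lambda>n. \<Phi> n (M (s n) \<omega>, s n)) \<longlonglongrightarrow> \<Psi> (M r \<omega>, r)" by (intro path_tendsto[OF R(1,2) u s(1,2,3) \<omega>])
      fix t
      have "(\<lambda>n. clamp01 (\<rho> n) (s n) t) \<longlonglongrightarrow> clamp01 \<sigma> r t" unfolding clamp01_def by (intro tendsto_intros \<rho> s)
      then show "(\<lambda>n. \<Phi> n (M (clamp01 (\<rho> n) (s n) t) \<omega>, clamp01 (\<rho> n) (s n) t)) \<longlonglongrightarrow> \<Psi> (M (clamp01 \<sigma> r t) \<omega>, clamp01 \<sigma> r t)"
        by (intro path_tendsto[OF R(1,2) u _ _ _ \<omega>] clamp01_unit s)
    qed
    show "AE t in \<mu>. norm (\<Phi> n (M (s n) \<omega>, s n) - \<Phi> n (M (clamp01 (\<rho> n) (s n) t) \<omega>, clamp01 (\<rho> n) (s n) t)) \<le> 2 * b + C" for n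
    proof (intro AE_I2)
      fix t
      have c: "clamp01 (\<rho> n) (s n) t \<in> {0..1}" by (intro clamp01_unit s)
      show "norm (\<Phi> n (M (s n) \<omega>, s n) - \<Phi> n (M (clamp01 (\<rho> n) (s n) t) \<omega>, clamp01 (\<rho> n) (s n) t)) \<le> 2 * b + C"
        using path_increment_le[OF R(1,3) s(1) c, of n n \<omega>] b[OF s(1), of n] b[OF c] unfolding real_norm_def by linarith
    qed
  qed simp
qed

section \<open>Exponential moments of the path weight\<close>

lemma distr_increment:
  assumes "0 \<le> s" "s \<le> t" "t \<le> 1"
  shows "distr P borel (\<lambda>\<omega>. M t \<omega> - M s \<omega>) = distr gauss borel (\<lambda>z. z * sqrt (deriv \<xi> t - deriv \<xi> s))"
proof (cases "deriv \<xi> s = deriv \<xi> t")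
  case True
  have "distr P borel (\<lambda>_. 0 :: real) = distr gauss borel (\<lambda>_. 0)"
    by (intro measure_eqI) (auto simp: emeasure_distr emeasure_space_1 gauss.emeasure_space_1[simplified])
  then show ?thesis using True by (simp add: time_changed_def)
next
  case False
  then have v: "0 \<le> deriv \<xi> s" "deriv \<xi> s < deriv \<xi> t" using deriv_mono[of s t] deriv_nonneg[of s] assms by auto
  have "distr P lborel (\<lambda>\<omega>. B (deriv \<xi> t) \<omega> - B (deriv \<xi> s) \<omega>) = density lborel (normal_density 0 (sqrt (deriv \<xi> t - deriv \<xi> s)))"
    using normal_increments[OF v] by (simp add: distributed_def)
  then show ?thesis
    using distr_gauss_scale[of "sqrt (deriv \<xi> t - deriv \<xi> s)"] v
    by (simp add: time_changed_def cong: distr_cong)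
qed

lemma exp_increment_bound:
  assumes "s \<in> {0..1}" "t \<in> {0..1}"
  shows "(\<integral>\<^sup>+\<omega>. ennreal (exp (2 * \<bar>M t \<omega> - M s \<omega>\<bar>)) \<partial>P) \<le> ennreal (2 * exp (2 * L))"
proof -
  have 1: "(\<integral>\<^sup>+\<omega>. ennreal (exp (2 * \<bar>M t \<omega> - M s \<omega>\<bar>)) \<partial>P) \<le> ennreal (2 * exp (2 * L))"
    if "0 \<le> s" "s \<le> t" "t \<le> 1" for s t
  proof -
    define v where "v = deriv \<xi> t - deriv \<xi> s"
    have v: "0 \<le> v" "v \<le> L" using deriv_mono[OF that] deriv_diff_le[OF that] by (auto simp: v_def)
    have [measurable]: "M t \<in> borel_measurable P" "M s \<in> borel_measurable P" using that by (auto intro: M_measurable)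
    have "(\<integral>\<^sup>+\<omega>. ennreal (exp (2 * \<bar>M t \<omega> - M s \<omega>\<bar>)) \<partial>P) = (\<integral>\<^sup>+y. ennreal (exp (2 * \<bar>y\<bar>)) \<partial>distr P borel (\<lambda>\<omega>. M t \<omega> - M s \<omega>))"
      by (subst nn_integral_distr) auto
    also have "\<dots> = (\<integral>\<^sup>+z. ennreal (exp (2 * \<bar>z * sqrt v\<bar>)) \<partial>gauss)"
      unfolding distr_increment[OF that] v_def[symmetric] by (subst nn_integral_distr) auto
    also have "\<dots> \<le> (\<integral>\<^sup>+z. ennreal (exp ((2 * sqrt v) * z) + exp ((- 2 * sqrt v) * z)) \<partial>gauss)"
    proof (intro nn_integral_mono ennreal_leI)
      fix z
      have "exp \<bar>a\<bar> \<le> exp a + exp (- a)" for a :: real by (cases "0 \<le> a") auto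
      from this[of "2 * (z * sqrt v)"]
      show "exp (2 * \<bar>z * sqrt v\<bar>) \<le> exp ((2 * sqrt v) * z) + exp ((- 2 * sqrt v) * z)" by (simp add: abs_mult mult_ac)
    qed
    also have "\<dots> = ennreal (LINT z|gauss. exp ((2 * sqrt v) * z) + exp ((- 2 * sqrt v) * z))"
      by (intro nn_integral_eq_integral Bochner_Integration.integrable_add integrable_gauss_exp) auto
    also have "(LINT z|gauss. exp ((2 * sqrt v) * z) + exp ((- 2 * sqrt v) * z)) = 2 * exp (2 * v)"
      using v by (subst Bochner_Integration.integral_add) (auto simp: integrable_gauss_exp[of "2 * sqrt v"]
        integrable_gauss_exp[of "- 2 * sqrt v", simplified] integral_gauss_exp[of "2 * sqrt v"]
        integral_gauss_exp[of "- 2 * sqrt v", simplified] power_mult_distrib)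
    also have "ennreal (2 * exp (2 * v)) \<le> ennreal (2 * exp (2 * L))" using v by (intro ennreal_leI) auto
    finally show ?thesis .
  qed
  show ?thesis using 1[of s t] 1[of t s] assms by (cases "s \<le> t") (auto simp: abs_minus_commute)
qed

definition grid :: "nat \<Rightarrow> real set" where
  "grid n = (\<lambda>k. of_int k / real (Suc n)) ` {0..int (Suc n)}"

lemma grid: "finite (grid n)" "q \<in> grid n \<Longrightarrow> q \<in> {0..1}" "t \<in> {0..1} \<Longrightarrow> grid_floor n t \<in> grid n"
proof -
  show "finite (grid n)" by (simp add: grid_def)
  show "q \<in> grid n \<Longrightarrow> q \<in> {0..1}" by (auto simp: grid_def divide_le_eq simp del: of_nat_Suc)
  show "t \<in> {0..1} \<Longrightarrow> grid_floor n t \<in> grid n" using grid_floor_image[of n] unfolding grid_def by blast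
qed

definition grid_mass :: "real measure \<Rightarrow> nat \<Rightarrow> real \<Rightarrow> real" where
  "grid_mass \<mu> n q = measure \<mu> (grid_floor n -` {q})"

lemma integral_grid_floor:
  fixes g :: "real \<Rightarrow> real"
  assumes \<mu>: "\<mu> \<in> unit_measures" and g: "(\<lambda>t. g (grid_floor n t)) \<in> borel_measurable \<mu>"
  shows "(LINT t|\<mu>. g (grid_floor n t)) = (\<Sum>q\<in>grid n. grid_mass \<mu> n q * g q)"
proof -
  interpret \<mu>: prob_space \<mu> using unit_measuresD[OF \<mu>] by simp
  note [measurable_cong] = unit_measuresD(2)[OF \<mu>]
  have sp: "space \<mu> = UNIV" using unit_measuresD[OF \<mu>] by simp
  have m: "grid_floor n -` {q} \<in> sets \<mu>" for q
    using measurable_sets[OF grid_floor_measurable, of "{q}" n] unit_measuresD(2)[OF \<mu>] by simp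
  have "(LINT t|\<mu>. g (grid_floor n t)) = (LINT t|\<mu>. (\<Sum>q\<in>grid n. indicator (grid_floor n -` {q}) t * g q))"
  proof (rule integral_cong_AE)
    show "AE t in \<mu>. g (grid_floor n t) = (\<Sum>q\<in>grid n. indicator (grid_floor n -` {q}) t * g q)"
      using unit_measure_AE[OF \<mu>]
    proof eventually_elim
      case (elim t)
      have "(\<Sum>q\<in>grid n. indicator (grid_floor n -` {q}) t * g q) = (\<Sum>q\<in>grid n. if q = grid_floor n t then g q else 0)"
        by (intro sum.cong) (auto simp: indicator_def)
      then show ?case using grid(1) grid(3)[OF elim] by simp
    qed
    show "(\<lambda>t. \<Sum>q\<in>grid n. indicator (grid_floor n -` {q}) t * g q) \<in> borel_measurable \<mu>"
      using m by (intro borel_measurable_sum borel_measurable_times borel_measurable_indicator) auto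
  qed (rule g)
  also have "\<dots> = (\<Sum>q\<in>grid n. grid_mass \<mu> n q * g q)"
    using m by (subst Bochner_Integration.integral_sum) (auto simp: grid_mass_def sp less_top[symmetric] intro!: integrable_mult_left)
  finally show ?thesis .
qed

lemma grid_mass: "\<mu> \<in> unit_measures \<Longrightarrow> (\<Sum>q\<in>grid n. grid_mass \<mu> n q) = 1" "0 \<le> grid_mass \<mu> n q"
  using integral_grid_floor[of \<mu> "\<lambda>_. 1" n] prob_space.prob_space[OF unit_measuresD(1), of \<mu>]
  by (auto simp: grid_mass_def)

text \<open>For a rounded measure the weight is a finite combination of path values. From this come
  its measurability in \<open>\<omega>\<close> and, later, its independence of future
  increments.\<close>

lemma path_weight_grid:
  assumes \<Phi>: "regular_field C \<Phi>" "\<omega> \<in> space P" and \<mu>: "\<mu> \<in> unit_measures" and u: "u \<in> {0..1}"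
  shows "path_weight \<Phi> (grid_floor n) \<mu> u \<omega> =
    (\<Sum>q\<in>grid n. grid_mass \<mu> n q * (\<Phi> (M u \<omega>, u) - \<Phi> (M (clamp01 (\<lambda>q. q) u q) \<omega>, clamp01 (\<lambda>q. q) u q)))"
proof -
  have c: "clamp01 (grid_floor n) u t = clamp01 (\<lambda>q. q) u (grid_floor n t)" for t by (simp add: clamp01_def)
  have "(\<lambda>t. \<Phi> (M u \<omega>, u) - \<Phi> (M (clamp01 (grid_floor n) u t) \<omega>, clamp01 (grid_floor n) u t)) \<in> borel_measurable \<mu>"
    by (intro borel_measurable_diff borel_measurable_const path_measurable[OF \<Phi> grid_floor_measurable unit_measuresD(2)[OF \<mu>] u])
  then show ?thesis unfolding path_weight_def c
    by (intro integral_grid_floor[OF \<mu>, where g="\<lambda>q. \<Phi> (M u \<omega>, u) - \<Phi> (M (clamp01 (\<lambda>q. q) u q) \<omega>, clamp01 (\<lambda>q. q) u q)"])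
qed

lemma field_measurable:
  assumes \<Phi>: "regular_field C \<Phi>" and u: "u \<in> {0..1}" and j: "j \<le> 3"
  shows "(\<lambda>x. dx j \<Phi> x u) \<in> borel_measurable borel"
proof -
  have "289-lipschitz_on UNIV (\<lambda>x. dx j \<Phi> x u)"
    using regular_slice_lipschitz[OF regular_fieldD(1)[OF \<Phi> u] j] by (intro lipschitz_onI) (auto simp: dist_real_def)
  then show ?thesis by (intro borel_measurable_continuous_onI lipschitz_on_continuous_on)
qed

lemma path_value_measurable:
  assumes "regular_field C \<Phi>" "u \<in> {0..1}"
  shows "(\<lambda>\<omega>. \<Phi> (M u \<omega>, u)) \<in> borel_measurable P"
proof -
  have "(\<lambda>x. \<Phi> (x, u)) \<in> borel_measurable borel" using field_measurable[OF assms, of 0] by (simp add: dx_def)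
  from measurable_compose[OF M_measurable[OF assms(2)] this] show ?thesis .
qed

text \<open>The first factor comes from the time-Lipschitz bound of the field, the second from the
  exponential moment of one path increment.\<close>

definition L2_const :: "real \<Rightarrow> real" where
  "L2_const C = exp (2 * C) * (2 * exp (2 * L))"

lemma L2_const_nonneg: "0 \<le> L2_const C"
  by (simp add: L2_const_def)

text \<open>The weight is a convex combination of increments of the field, with coefficients
  \<open>grid_mass\<close>. By convexity of the exponential only exponential moments of single
  Gaussian increments are needed, and the bound does not depend on \<open>n\<close>.\<close>

lemma path_weight_grid_L2:
  assumes \<Phi>: "regular_field C \<Phi>" "0 \<le> C" and \<mu>: "\<mu> \<in> unit_measures" and u: "u \<in> {0..1}"
  shows "(\<lambda>\<omega>. path_weight \<Phi> (grid_floor n) \<mu> u \<omega>) \<in> borel_measurable P"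
    "(\<integral>\<^sup>+\<omega>. ennreal ((exp (path_weight \<Phi> (grid_floor n) \<mu> u \<omega>))\<^sup>2) \<partial>P) \<le> ennreal (L2_const C)"
proof -
  define c where "c = (\<lambda>q. clamp01 (\<lambda>q. q) u q)"
  have c: "c q \<in> {0..1}" for q unfolding c_def by (rule clamp01_unit[OF u])
  define y where "y = (\<lambda>q \<omega>. \<Phi> (M u \<omega>, u) - \<Phi> (M (c q) \<omega>, c q))"
  define a where "a = grid_mass \<mu> n"
  have a: "sum a (grid n) = 1" "\<And>q. 0 \<le> a q" using grid_mass(1)[OF \<mu>] grid_mass(2) by (auto simp: a_def)
  have W: "path_weight \<Phi> (grid_floor n) \<mu> u \<omega> = (\<Sum>q\<in>grid n. a q * y q \<omega>)" if "\<omega> \<in> space P" for \<omega>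
    using path_weight_grid[OF \<Phi>(1) that \<mu> u] by (simp add: y_def c_def a_def)
  have y [measurable]: "y q \<in> borel_measurable P" for q
    unfolding y_def by (intro borel_measurable_diff path_value_measurable[OF \<Phi>(1)] u c)
  show "(\<lambda>\<omega>. path_weight \<Phi> (grid_floor n) \<mu> u \<omega>) \<in> borel_measurable P"
    by (subst measurable_cong[OF W]) auto
  have "(\<integral>\<^sup>+\<omega>. ennreal ((exp (path_weight \<Phi> (grid_floor n) \<mu> u \<omega>))\<^sup>2) \<partial>P)
    \<le> (\<integral>\<^sup>+\<omega>. (\<Sum>q\<in>grid n. ennreal (a q) * (ennreal (exp (2 * C)) * ennreal (exp (2 * \<bar>M u \<omega> - M (c q) \<omega>\<bar>)))) \<partial>P)"
  proof (rule nn_integral_mono)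
    fix \<omega> assume \<omega>: "\<omega> \<in> space P"
    have "exp (\<Sum>q\<in>grid n. a q *\<^sub>R (2 * y q \<omega>)) \<le> (\<Sum>q\<in>grid n. a q * exp (2 * y q \<omega>))"
      using grid(1) a by (intro convex_on_sum[where C=UNIV] exp_convex) auto
    also have "\<dots> \<le> (\<Sum>q\<in>grid n. a q * (exp (2 * C) * exp (2 * \<bar>M u \<omega> - M (c q) \<omega>\<bar>)))"
    proof (intro sum_mono mult_left_mono a)
      fix q
      have "y q \<omega> \<le> \<bar>M u \<omega> - M (c q) \<omega>\<bar> + C"
        using abs_le_D1[OF path_increment_le[OF \<Phi> u c, of \<omega> q]] by (simp only: y_def)
      then have "2 * y q \<omega> \<le> 2 * (\<bar>M u \<omega> - M (c q) \<omega>\<bar> + C)" by (intro mult_left_mono) auto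
      also have "\<dots> = 2 * C + 2 * \<bar>M u \<omega> - M (c q) \<omega>\<bar>" by (simp add: distrib_left)
      finally have "2 * y q \<omega> \<le> 2 * C + 2 * \<bar>M u \<omega> - M (c q) \<omega>\<bar>" .
      then show "exp (2 * y q \<omega>) \<le> exp (2 * C) * exp (2 * \<bar>M u \<omega> - M (c q) \<omega>\<bar>)" by (simp add: mult_exp_exp)
    qed
    also have "(\<Sum>q\<in>grid n. a q *\<^sub>R (2 * y q \<omega>)) = 2 * path_weight \<Phi> (grid_floor n) \<mu> u \<omega>"
      unfolding W[OF \<omega>] sum_distrib_left by (simp add: mult_ac)
    finally have "(exp (path_weight \<Phi> (grid_floor n) \<mu> u \<omega>))\<^sup>2 \<le> (\<Sum>q\<in>grid n. a q * (exp (2 * C) * exp (2 * \<bar>M u \<omega> - M (c q) \<omega>\<bar>)))"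
      by (simp add: exp_double)
    then have "ennreal ((exp (path_weight \<Phi> (grid_floor n) \<mu> u \<omega>))\<^sup>2) \<le> ennreal (\<Sum>q\<in>grid n. a q * (exp (2 * C) * exp (2 * \<bar>M u \<omega> - M (c q) \<omega>\<bar>)))"
      by (rule ennreal_leI)
    then show "ennreal ((exp (path_weight \<Phi> (grid_floor n) \<mu> u \<omega>))\<^sup>2)
        \<le> (\<Sum>q\<in>grid n. ennreal (a q) * (ennreal (exp (2 * C)) * ennreal (exp (2 * \<bar>M u \<omega> - M (c q) \<omega>\<bar>))))"
      using a by (subst (asm) sum_ennreal[symmetric]) (auto simp: ennreal_mult)
  qed
  also have "\<dots> = (\<Sum>q\<in>grid n. ennreal (a q) * (ennreal (exp (2 * C)) * (\<integral>\<^sup>+\<omega>. ennreal (exp (2 * \<bar>M u \<omega> - M (c q) \<omega>\<bar>)) \<partial>P)))"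
  proof -
    have [measurable]: "M u \<in> borel_measurable P" "M (c q) \<in> borel_measurable P" for q using M_measurable u c by blast+
    show ?thesis by (subst nn_integral_sum) (auto simp: nn_integral_cmult)
  qed
  also have "\<dots> \<le> (\<Sum>q\<in>grid n. ennreal (a q) * (ennreal (exp (2 * C)) * ennreal (2 * exp (2 * L))))"
    by (intro sum_mono mult_left_mono exp_increment_bound u c) auto
  also have "\<dots> = (\<Sum>q\<in>grid n. ennreal (a q)) * ennreal (L2_const C)"
    by (simp add: sum_distrib_right L2_const_def ennreal_mult[symmetric])
  also have "\<dots> = ennreal (L2_const C)" using a by (simp add: sum_ennreal)
  finally show "(\<integral>\<^sup>+\<omega>. ennreal ((exp (path_weight \<Phi> (grid_floor n) \<mu> u \<omega>))\<^sup>2) \<partial>P) \<le> ennreal (L2_const C)" .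
qed

text \<open>The two cases are the measure itself and its discretizations; through
  \<open>path_weight\<close> both are treated as integrals over the same
  \<open>\<mu>\<close>.\<close>

definition rounding :: "(real \<Rightarrow> real) \<Rightarrow> bool" where
  "rounding \<rho> \<longleftrightarrow> \<rho> = (\<lambda>t. t) \<or> (\<exists>n. \<rho> = grid_floor n)"

lemma rounding_measurable: "rounding \<rho> \<Longrightarrow> \<rho> \<in> borel_measurable borel"
  by (auto simp: rounding_def)

lemma path_weight_L2:
  assumes \<Phi>: "regular_field C \<Phi>" "0 \<le> C" and \<mu>: "\<mu> \<in> unit_measures" and u: "u \<in> {0..1}" and \<rho>: "rounding \<rho>"
  shows "(\<lambda>\<omega>. path_weight \<Phi> \<rho> \<mu> u \<omega>) \<in> borel_measurable P"
    "(\<integral>\<^sup>+\<omega>. ennreal ((exp (path_weight \<Phi> \<rho> \<mu> u \<omega>))\<^sup>2) \<partial>P) \<le> ennreal (L2_const C)"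
proof -
  have "(\<lambda>\<omega>. path_weight \<Phi> \<rho> \<mu> u \<omega>) \<in> borel_measurable P \<and>
    (\<integral>\<^sup>+\<omega>. ennreal ((exp (path_weight \<Phi> \<rho> \<mu> u \<omega>))\<^sup>2) \<partial>P) \<le> ennreal (L2_const C)"
  proof (cases "\<rho> = (\<lambda>t. t)")
    case True
    \<comment> \<open>The unrounded weight is a pathwise limit of the rounded ones, so measurability
      and, by Fatou's lemma, the bound carry over.\<close>
    have l: "(\<lambda>n. path_weight \<Phi> (grid_floor n) \<mu> u \<omega>) \<longlonglongrightarrow> path_weight \<Phi> \<rho> \<mu> u \<omega>" if "\<omega> \<in> space P" for \<omega>
      unfolding True using that \<Phi> \<mu> u grid_floor_tendsto
      by (intro path_weight_tendsto[of C "\<lambda>_. \<Phi>"]) (auto intro!: uniform_limit_const)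
    note g = path_weight_grid_L2[OF \<Phi> \<mu> u]
    show ?thesis
    proof
      show "(\<lambda>\<omega>. path_weight \<Phi> \<rho> \<mu> u \<omega>) \<in> borel_measurable P" using l g(1) by (rule borel_measurable_LIMSEQ_real)
      show "(\<integral>\<^sup>+\<omega>. ennreal ((exp (path_weight \<Phi> \<rho> \<mu> u \<omega>))\<^sup>2) \<partial>P) \<le> ennreal (L2_const C)"
        by (rule expectation_tendsto_L2(2)[of "\<lambda>n \<omega>. exp (path_weight \<Phi> (grid_floor n) \<mu> u \<omega>)"])
          (auto intro!: tendsto_exp l g L2_const_nonneg borel_measurable_exp[THEN measurable_compose[rotated]] measurable_compose[OF g(1)])
    qed
  next
    case False
    then show ?thesis using \<rho> path_weight_grid_L2[OF \<Phi> \<mu> u] by (auto simp: rounding_def)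
  qed
  then show "(\<lambda>\<omega>. path_weight \<Phi> \<rho> \<mu> u \<omega>) \<in> borel_measurable P"
    "(\<integral>\<^sup>+\<omega>. ennreal ((exp (path_weight \<Phi> \<rho> \<mu> u \<omega>))\<^sup>2) \<partial>P) \<le> ennreal (L2_const C)" by auto
qed

text \<open>The path and the field are taken at different times: a step from \<open>s\<close> to \<open>u\<close> is estimated by derivatives
  of the field at time \<open>u\<close> along the path at time \<open>s\<close>, so time derivatives of the field never occur.\<close>

definition mixed_moment :: "nat \<Rightarrow> nat \<Rightarrow> (real \<times> real \<Rightarrow> real) \<Rightarrow> (real \<Rightarrow> real) \<Rightarrow> real measure \<Rightarrow> real \<Rightarrow> real \<Rightarrow> real" where
  "mixed_moment j k \<Phi> \<rho> \<mu> s u = expectation (\<lambda>\<omega>. (dx j \<Phi> (M s \<omega>) u) ^ k * exp (path_weight \<Phi> \<rho> \<mu> s \<omega>))"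

lemma weighted_L2:
  assumes \<Phi>: "regular_field C \<Phi>" "0 \<le> C" and \<mu>: "\<mu> \<in> unit_measures" and s: "s \<in> {0..1}" and \<rho>: "rounding \<rho>"
    and F [measurable]: "F \<in> borel_measurable borel" and K: "\<And>x. \<bar>F x\<bar> \<le> K"
  shows "(\<lambda>\<omega>. F (M s \<omega>) * exp (path_weight \<Phi> \<rho> \<mu> s \<omega>)) \<in> borel_measurable P"
    "(\<integral>\<^sup>+\<omega>. ennreal ((F (M s \<omega>) * exp (path_weight \<Phi> \<rho> \<mu> s \<omega>))\<^sup>2) \<partial>P) \<le> ennreal (K\<^sup>2 * L2_const C)"
    "integrable P (\<lambda>\<omega>. F (M s \<omega>) * exp (path_weight \<Phi> \<rho> \<mu> s \<omega>))"
    "\<bar>expectation (\<lambda>\<omega>. F (M s \<omega>) * exp (path_weight \<Phi> \<rho> \<mu> s \<omega>))\<bar> \<le> K * (1 + L2_const C)"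
proof -
  note W = path_weight_L2[OF \<Phi> \<mu> s \<rho>]
  note [measurable] = W(1) M_measurable[OF s]
  have K0: "0 \<le> K" using K[of 0] by simp
  show m: "(\<lambda>\<omega>. F (M s \<omega>) * exp (path_weight \<Phi> \<rho> \<mu> s \<omega>)) \<in> borel_measurable P" by measurable
  have "(\<integral>\<^sup>+\<omega>. ennreal ((F (M s \<omega>) * exp (path_weight \<Phi> \<rho> \<mu> s \<omega>))\<^sup>2) \<partial>P)
    \<le> (\<integral>\<^sup>+\<omega>. ennreal (K\<^sup>2) * ennreal ((exp (path_weight \<Phi> \<rho> \<mu> s \<omega>))\<^sup>2) \<partial>P)"
  proof (intro nn_integral_mono)
    fix \<omega>
    have "(F (M s \<omega>))\<^sup>2 \<le> K\<^sup>2" using K K0 by (subst abs_le_square_iff[symmetric]) simp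
    then show "ennreal ((F (M s \<omega>) * exp (path_weight \<Phi> \<rho> \<mu> s \<omega>))\<^sup>2) \<le> ennreal (K\<^sup>2) * ennreal ((exp (path_weight \<Phi> \<rho> \<mu> s \<omega>))\<^sup>2)"
      unfolding power_mult_distrib by (subst ennreal_mult[symmetric]) (auto intro!: ennreal_leI mult_right_mono)
  qed
  also have "\<dots> = ennreal (K\<^sup>2) * (\<integral>\<^sup>+\<omega>. ennreal ((exp (path_weight \<Phi> \<rho> \<mu> s \<omega>))\<^sup>2) \<partial>P)" by (rule nn_integral_cmult) measurable
  also have "\<dots> \<le> ennreal (K\<^sup>2) * ennreal (L2_const C)" by (intro mult_left_mono W) auto
  finally show "(\<integral>\<^sup>+\<omega>. ennreal ((F (M s \<omega>) * exp (path_weight \<Phi> \<rho> \<mu> s \<omega>))\<^sup>2) \<partial>P) \<le> ennreal (K\<^sup>2 * L2_const C)"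
    by (simp add: ennreal_mult L2_const_nonneg)
  from square_integrable(3)[OF m this] show i: "integrable P (\<lambda>\<omega>. F (M s \<omega>) * exp (path_weight \<Phi> \<rho> \<mu> s \<omega>))"
    by (simp add: L2_const_nonneg)
  have e: "(\<lambda>\<omega>. exp (path_weight \<Phi> \<rho> \<mu> s \<omega>)) \<in> borel_measurable P" by measurable
  note e = square_integrable[OF e W(2) L2_const_nonneg]
  have "\<bar>expectation (\<lambda>\<omega>. F (M s \<omega>) * exp (path_weight \<Phi> \<rho> \<mu> s \<omega>))\<bar> \<le> expectation (\<lambda>\<omega>. \<bar>F (M s \<omega>) * exp (path_weight \<Phi> \<rho> \<mu> s \<omega>)\<bar>)"
    by (rule integral_abs_bound)
  also have "\<dots> \<le> expectation (\<lambda>\<omega>. K * (1 + (exp (path_weight \<Phi> \<rho> \<mu> s \<omega>))\<^sup>2))"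
  proof (intro integral_mono)
    fix \<omega>
    have "x \<le> 1 + x\<^sup>2" for x :: real using zero_le_power2[of "x - 1"] zero_le_power2[of x] unfolding power2_diff one_power2 mult_1_right by linarith
    then show "\<bar>F (M s \<omega>) * exp (path_weight \<Phi> \<rho> \<mu> s \<omega>)\<bar> \<le> K * (1 + (exp (path_weight \<Phi> \<rho> \<mu> s \<omega>))\<^sup>2)"
      unfolding abs_mult using K K0 by (intro mult_mono) auto
  qed (use i e in auto)
  also have "\<dots> = K * (1 + expectation (\<lambda>\<omega>. (exp (path_weight \<Phi> \<rho> \<mu> s \<omega>))\<^sup>2))" using e by (simp add: prob_space)
  also have "\<dots> \<le> K * (1 + L2_const C)" using e K0 by (intro mult_left_mono) auto
  finally show "\<bar>expectation (\<lambda>\<omega>. F (M s \<omega>) * exp (path_weight \<Phi> \<rho> \<mu> s \<omega>))\<bar> \<le> K * (1 + L2_const C)" .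
qed

lemma dx_power_bounded:
  assumes "regular_field C \<Phi>" "u \<in> {0..1}" "j \<in> {1..3}"
  shows "(\<lambda>x. (dx j \<Phi> x u) ^ k) \<in> borel_measurable borel" "\<bar>(dx j \<Phi> x u) ^ k\<bar> \<le> 289 ^ k"
proof -
  show "(\<lambda>x. (dx j \<Phi> x u) ^ k) \<in> borel_measurable borel"
    using assms by (intro borel_measurable_power field_measurable) auto
  show "\<bar>(dx j \<Phi> x u) ^ k\<bar> \<le> 289 ^ k"
    unfolding power_abs using regular_sliceD(3)[OF regular_fieldD(1)[OF assms(1,2)] assms(3)] by (intro power_mono) auto
qed

lemma mixed_moment_bound:
  assumes "regular_field C \<Phi>" "0 \<le> C" "\<mu> \<in> unit_measures" "s \<in> {0..1}" "rounding \<rho>" "u \<in> {0..1}" "j \<in> {1..3}"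
  shows "\<bar>mixed_moment j k \<Phi> \<rho> \<mu> s u\<bar> \<le> 289 ^ k * (1 + L2_const C)"
  unfolding mixed_moment_def
  by (rule weighted_L2(4)[OF assms(1-5) dx_power_bounded[OF assms(1,6,7)]])

text \<open>Field, rounding and both times vary together, so that this one statement yields
  continuity of the discrete moments, continuity of the moments for \<open>\<mu>\<close>, and
  convergence of the former to the latter.\<close>

lemma mixed_moment_tendsto:
  fixes \<Phi> :: "nat \<Rightarrow> real \<times> real \<Rightarrow> real"
  assumes R: "\<And>n. regular_field C (\<Phi> n)" "regular_field C \<Psi>" "0 \<le> C"
    and lim: "uniform_limit (UNIV \<times> {0..1}) \<Phi> \<Psi> sequentially"
    and s: "\<And>n. s n \<in> {0..1}" "r \<in> {0..1}" "s \<longlonglongrightarrow> r"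
    and u: "\<And>n. u n \<in> {0..1}" "t \<in> {0..1}" "u \<longlonglongrightarrow> t"
    and \<rho>: "\<And>n. rounding (\<rho> n)" "rounding \<sigma>" "\<And>t. (\<lambda>n. \<rho> n t) \<longlonglongrightarrow> \<sigma> t"
    and \<mu>: "\<mu> \<in> unit_measures" and j: "j \<in> {1..3}"
  shows "(\<lambda>n. mixed_moment j k (\<Phi> n) (\<rho> n) \<mu> (s n) (u n)) \<longlonglongrightarrow> mixed_moment j k \<Psi> \<sigma> \<mu> r t"
  unfolding mixed_moment_def
proof (rule expectation_tendsto_L2(3)[where K="(289 ^ k)\<^sup>2 * L2_const C"])
  note w = weighted_L2(1,2)[OF R(1,3) \<mu> s(1) \<rho>(1) dx_power_bounded[OF R(1) u(1) j]]
  show "(\<lambda>\<omega>. dx j (\<Phi> n) (M (s n) \<omega>) (u n) ^ k * exp (path_weight (\<Phi> n) (\<rho> n) \<mu> (s n) \<omega>)) \<in> borel_measurable P" for n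
    by (rule w)
  show "(\<integral>\<^sup>+\<omega>. ennreal ((dx j (\<Phi> n) (M (s n) \<omega>) (u n) ^ k * exp (path_weight (\<Phi> n) (\<rho> n) \<mu> (s n) \<omega>))\<^sup>2) \<partial>P)
      \<le> ennreal ((289 ^ k)\<^sup>2 * L2_const C)" for n by (rule w)
  fix \<omega> assume \<omega>: "\<omega> \<in> space P"
  show "(\<lambda>n. dx j (\<Phi> n) (M (s n) \<omega>) (u n) ^ k * exp (path_weight (\<Phi> n) (\<rho> n) \<mu> (s n) \<omega>))
      \<longlonglongrightarrow> dx j \<Psi> (M r \<omega>) t ^ k * exp (path_weight \<Psi> \<sigma> \<mu> r \<omega>)"
  proof (intro tendsto_mult tendsto_power tendsto_exp)
    show "(\<lambda>n. dx j (\<Phi> n) (M (s n) \<omega>) (u n)) \<longlonglongrightarrow> dx j \<Psi> (M r \<omega>) t"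
      by (rule tendsto_dx[OF R(1,2) u(1,2) lim M_tendsto[OF \<omega> s(3,1,2)] u(3)]) (use j in auto)
    show "(\<lambda>n. path_weight (\<Phi> n) (\<rho> n) \<mu> (s n) \<omega>) \<longlonglongrightarrow> path_weight \<Psi> \<sigma> \<mu> r \<omega>"
      by (rule path_weight_tendsto[OF R lim s rounding_measurable[OF \<rho>(1)] rounding_measurable[OF \<rho>(2)] \<rho>(3) \<omega> \<mu>])
  qed
qed (simp add: L2_const_nonneg)

end

section \<open>The tilted semigroup\<close>

text \<open>Fubini's theorem for the product law: the first variable is frozen and the second
  integrated against its own distribution.\<close>

lemma (in prob_space) expectation_indep_pair:
  fixes H :: "'b \<times> 'b \<Rightarrow> real"
  assumes ind: "indep_var N X K Y" and H [measurable]: "H \<in> borel_measurable (N \<Otimes>\<^sub>M K)"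
    and int: "integrable M (\<lambda>\<omega>. H (X \<omega>, Y \<omega>))"
  shows "expectation (\<lambda>\<omega>. H (X \<omega>, Y \<omega>)) = expectation (\<lambda>\<omega>. LINT y|distr M K Y. H (X \<omega>, y))"
proof -
  have X [measurable]: "random_variable N X" and Y [measurable]: "random_variable K Y"
    using ind by (auto simp: indep_var_eq)
  have pr: "distr M N X \<Otimes>\<^sub>M distr M K Y = distr M (N \<Otimes>\<^sub>M K) (\<lambda>\<omega>. (X \<omega>, Y \<omega>))"
    using ind by (simp add: indep_var_distribution_eq)
  interpret DX: prob_space "distr M N X" by (rule prob_space_distr) simp
  interpret DY: prob_space "distr M K Y" by (rule prob_space_distr) simp
  interpret pair_sigma_finite "distr M N X" "distr M K Y" ..
  have i: "integrable (distr M N X \<Otimes>\<^sub>M distr M K Y) H"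
    unfolding pr using int by (subst integrable_distr_eq) auto
  have "expectation (\<lambda>\<omega>. H (X \<omega>, Y \<omega>)) = (LINT p|(distr M N X \<Otimes>\<^sub>M distr M K Y). H p)"
    unfolding pr by (subst integral_distr) auto
  also have "\<dots> = (LINT x|distr M N X. LINT y|distr M K Y. H (x, y))"
    using integral_fst'[OF i] by simp
  also have "\<dots> = expectation (\<lambda>\<omega>. LINT y|distr M K Y. H (X \<omega>, y))"
    by (subst integral_distr) (auto intro!: borel_measurable_lebesgue_integral)
  finally show ?thesis .
qed

context parisi_brownian
begin

lemma increments_indep:
  assumes "0 \<le> \<tau> 0" "\<And>i. i \<le> n \<Longrightarrow> \<tau> i \<le> \<tau> (Suc i)"
  shows "indep_var (PiM {..<n} (\<lambda>_. borel)) (\<lambda>\<omega>. \<lambda>i\<in>{..<n}. B (\<tau> (Suc i)) \<omega> - B (\<tau> i) \<omega>)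
    (PiM {n} (\<lambda>_. borel)) (\<lambda>\<omega>. \<lambda>i\<in>{n}. B (\<tau> (Suc i)) \<omega> - B (\<tau> i) \<omega>)"
proof -
  have "indep_vars (\<lambda>_. borel) (\<lambda>i \<omega>. B (\<tau> (Suc i)) \<omega> - B (\<tau> i) \<omega>) {..<Suc n}"
    using assms by (intro indep_increments) auto
  from indep_var_restrict[OF this, of "{..<n}" "{n}"] show ?thesis by auto
qed

lemma grid_mass_eq_0:
  assumes \<mu>: "\<mu> \<in> unit_measures" and q: "q \<notin> grid n"
  shows "grid_mass \<mu> n q = 0"
proof -
  interpret \<mu>: prob_space \<mu> using unit_measuresD[OF \<mu>] by simp
  note s = unit_measuresD(2,4)[OF \<mu>]
  have m: "grid_floor n -` {q} \<in> sets \<mu>"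
    using measurable_sets[OF grid_floor_measurable, of "{q}" n] s by simp
  have "measure \<mu> {0..1} + measure \<mu> (grid_floor n -` {q}) = measure \<mu> ({0..1} \<union> grid_floor n -` {q})"
    using m s q grid(3) by (intro \<mu>.finite_measure_Union[symmetric]) auto
  also have "\<dots> \<le> 1" by (rule \<mu>.prob_le_1)
  finally show ?thesis using unit_measuresD(3)[OF \<mu>] by (simp add: grid_mass_def measure_le_0_iff)
qed

lemma atoms_discretized:
  assumes \<mu>: "\<mu> \<in> unit_measures"
  shows "atoms (discretized \<mu> n) \<subseteq> grid n"
  using grid_mass_eq_0[OF \<mu>] discretized_discrete(2)[OF \<mu>] by (fastforce simp: atoms_def grid_mass_def)

lemma discretized_cdf_eq:
  assumes \<mu>: "\<mu> \<in> unit_measures"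
  shows "measure (discretized \<mu> n) {0..s} = (\<Sum>q\<in>grid n. if q \<le> s then grid_mass \<mu> n q else 0)"
proof -
  note [measurable_cong] = unit_measuresD(2)[OF \<mu>]
  have "measure (discretized \<mu> n) {0..s} = (LINT x|discretized \<mu> n. indicator {0..s} x)"
    by (simp add: discretized_def)
  also have "\<dots> = (LINT t|\<mu>. indicator {0..s} (grid_floor n t))"
    unfolding discretized_def by (subst integral_distr) auto
  also have "\<dots> = (\<Sum>q\<in>grid n. grid_mass \<mu> n q * indicator {0..s} q)"
    by (rule integral_grid_floor[OF \<mu>]) measurable
  also have "\<dots> = (\<Sum>q\<in>grid n. if q \<le> s then grid_mass \<mu> n q else 0)"
    using grid(2)[of _ n] by (intro sum.cong) (auto simp: indicator_def)
  finally show ?thesis .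
qed

text \<open>A grid point up to \<open>s\<close> contributes its mass times the full increment of the
  field. A grid point beyond \<open>t\<close> is clamped to the current time at both
  \<open>s\<close> and \<open>t\<close> and contributes nothing.\<close>

lemma path_weight_increment:
  assumes \<Phi>: "regular_field C \<Phi>" "\<omega> \<in> space P" and \<mu>: "\<mu> \<in> unit_measures"
    and st: "0 \<le> s" "s < t" "t \<le> 1" "grid n \<inter> {s<..t} = {}"
  shows "path_weight \<Phi> (grid_floor n) \<mu> t \<omega> = path_weight \<Phi> (grid_floor n) \<mu> s \<omega>
    + measure (discretized \<mu> n) {0..s} * (\<Phi> (M t \<omega>, t) - \<Phi> (M s \<omega>, s))"
proof -
  have "path_weight \<Phi> (grid_floor n) \<mu> t \<omega> - path_weight \<Phi> (grid_floor n) \<mu> s \<omega>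
    = (\<Sum>q\<in>grid n. grid_mass \<mu> n q * ((\<Phi> (M t \<omega>, t) - \<Phi> (M (clamp01 (\<lambda>q. q) t q) \<omega>, clamp01 (\<lambda>q. q) t q))
       - (\<Phi> (M s \<omega>, s) - \<Phi> (M (clamp01 (\<lambda>q. q) s q) \<omega>, clamp01 (\<lambda>q. q) s q))))"
    using path_weight_grid[OF \<Phi> \<mu>, of t n] path_weight_grid[OF \<Phi> \<mu>, of s n] st
    by (simp add: sum_subtractf right_diff_distrib)
  also have "\<dots> = (\<Sum>q\<in>grid n. (if q \<le> s then grid_mass \<mu> n q else 0) * (\<Phi> (M t \<omega>, t) - \<Phi> (M s \<omega>, s)))"
  proof (rule sum.cong)
    fix q assume q: "q \<in> grid n"
    show "grid_mass \<mu> n q * ((\<Phi> (M t \<omega>, t) - \<Phi> (M (clamp01 (\<lambda>q. q) t q) \<omega>, clamp01 (\<lambda>q. q) t q))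
       - (\<Phi> (M s \<omega>, s) - \<Phi> (M (clamp01 (\<lambda>q. q) s q) \<omega>, clamp01 (\<lambda>q. q) s q)))
      = (if q \<le> s then grid_mass \<mu> n q else 0) * (\<Phi> (M t \<omega>, t) - \<Phi> (M s \<omega>, s))"
    proof (cases "q \<le> s")
      case True
      then have "clamp01 (\<lambda>q. q) t q = q" "clamp01 (\<lambda>q. q) s q = q" using st grid(2)[OF q] by (auto simp: clamp01_def)
      then show ?thesis using True by simp
    next
      case False
      then have "t < q" using q st by force
      then have "clamp01 (\<lambda>q. q) t q = t" "clamp01 (\<lambda>q. q) s q = s" using st False by (auto simp: clamp01_def)
      then show ?thesis using False by simp
    qed
  qed simp
  also have "\<dots> = measure (discretized \<mu> n) {0..s} * (\<Phi> (M t \<omega>, t) - \<Phi> (M s \<omega>, s))"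
    unfolding discretized_cdf_eq[OF \<mu>] sum_distrib_right ..
  finally show ?thesis by simp
qed

text \<open>Up to time \<open>s\<close> the weight is a function of the increments of the path between grid points, and these
  are independent of the last increment, from \<open>s\<close> to \<open>t\<close>.\<close>

lemma expectation_independent_increment:
  assumes \<Phi>: "regular_field C \<Phi>" and \<mu>: "\<mu> \<in> unit_measures" and st: "0 \<le> s" "s < t" "t \<le> 1"
    and G [measurable]: "case_prod G \<in> borel_measurable (borel \<Otimes>\<^sub>M borel)"
    and int: "integrable P (\<lambda>\<omega>. G (M s \<omega>) (M t \<omega> - M s \<omega>) * exp (path_weight \<Phi> (grid_floor n) \<mu> s \<omega>))"
  shows "expectation (\<lambda>\<omega>. G (M s \<omega>) (M t \<omega> - M s \<omega>) * exp (path_weight \<Phi> (grid_floor n) \<mu> s \<omega>))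
    = expectation (\<lambda>\<omega>. (LINT z|gauss. G (M s \<omega>) (z * sqrt (deriv \<xi> t - deriv \<xi> s))) * exp (path_weight \<Phi> (grid_floor n) \<mu> s \<omega>))"
proof -
  define N where "N = Suc n"
  \<comment> \<open>The grid times stopped at \<open>s\<close>, where \<open>N = Suc n\<close> is
    the denominator of the grid; every clamped grid point is one of them, and the last one is
    \<open>s\<close>.\<close>
  define r where "r = (\<lambda>i. min (real i / real N) s)"
  have r: "r i \<in> {0..1}" "r i \<le> r (Suc i)" "r N = s" "r 0 = 0" for i
  proof -
    show "r i \<in> {0..1}" using st by (auto simp: r_def)
    have "real i / real N \<le> real (Suc i) / real N" by (intro divide_right_mono) auto
    then show "r i \<le> r (Suc i)" unfolding r_def by (intro min.mono) auto
    have "real N / real N = 1" by (simp add: N_def del: of_nat_Suc)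
    then show "r N = s" using st by (simp add: r_def)
    show "r 0 = 0" using st by (simp add: r_def)
  qed
  \<comment> \<open>The corresponding times of the Brownian motion, followed by one more for
    \<open>t\<close>: the increment number \<open>N\<close> is the future one.\<close>
  define \<tau> where "\<tau> = (\<lambda>i. if i \<le> N then deriv \<xi> (r i) else deriv \<xi> t)"
  have \<tau>: "\<tau> 0 = 0" "\<tau> N = deriv \<xi> s" "\<tau> (Suc N) = deriv \<xi> t" "\<And>i. i \<le> N \<Longrightarrow> \<tau> i = deriv \<xi> (r i)"
    using r deriv_zero by (auto simp: \<tau>_def)
  have \<tau>_mono: "\<tau> i \<le> \<tau> (Suc i)" if "i \<le> N" for i
  proof (cases "i = N")
    case True then show ?thesis using \<tau> deriv_mono[of s t] st by simp
  next
    case False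
    then show ?thesis using that \<tau> deriv_mono[of "r i" "r (Suc i)"] r(1)[of i] r(1)[of "Suc i"] r(2)[of i] by simp
  qed
  define PN where "PN = PiM {..<N} (\<lambda>_. borel :: real measure)"
  define X where "X = (\<lambda>\<omega>. \<lambda>i\<in>{..<N}. B (\<tau> (Suc i)) \<omega> - B (\<tau> i) \<omega>)"
  define Y where "Y = (\<lambda>\<omega>. B (\<tau> (Suc N)) \<omega> - B (\<tau> N) \<omega>)"
  define P1 where "P1 = PiM {N} (\<lambda>_. borel :: real measure)"
  \<comment> \<open>The future increment as a family over a one-element index set, the form in which
    independence of groups of increments is available.\<close>
  define Y' where "Y' = (\<lambda>\<omega>. \<lambda>i\<in>{N}. B (\<tau> (Suc i)) \<omega> - B (\<tau> i) \<omega>)"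
  have Y'N: "Y' \<omega> N = Y \<omega>" for \<omega> by (simp add: Y'_def Y_def)
  have ind: "indep_var PN X P1 Y'"
    unfolding PN_def P1_def X_def Y'_def using \<tau> \<tau>_mono by (intro increments_indep) auto
  have Y: "Y = (\<lambda>\<omega>. M t \<omega> - M s \<omega>)" by (simp add: Y_def \<tau> time_changed_def)
  define S where "S = (\<lambda>k (x :: nat \<Rightarrow> real). \<Sum>j<k. x j)"
  have S_m: "S k \<in> borel_measurable PN" if "k \<le> N" for k
    unfolding S_def PN_def using that by (intro borel_measurable_sum measurable_component_singleton) auto
  note [measurable] = S_m[OF order.refl]
  define kk where "kk = (\<lambda>q. nat \<lfloor>q * real N\<rfloor>)"
  have kk: "kk q \<le> N" "clamp01 (\<lambda>q. q) s q = r (kk q)" if q: "q \<in> grid n" for q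
  proof -
    obtain k where k: "k \<in> {0..int N}" "q = of_int k / real N" using q unfolding grid_def N_def by blast
    then have k: "q = of_int k / real N" "0 \<le> k" "k \<le> int N" by auto
    have N0: "real N \<noteq> 0" by (simp add: N_def)
    have e: "q * real N = of_int k" using N0 by (simp add: k(1))
    then have kq: "kk q = nat k" by (simp add: kk_def)
    show "kk q \<le> N" using k kq by simp
    have "real (kk q) / real N = q" using k kq by simp
    then have "r (kk q) = min q s" by (simp only: r_def)
    then show "clamp01 (\<lambda>q. q) s q = r (kk q)" using grid(2)[OF q] st by (simp add: clamp01_def)
  qed
  \<comment> \<open>Path values are sums of increments only almost surely, because the Brownian
    motion is required to start at 0 only almost surely.\<close>
  have BS: "AE \<omega> in P. \<forall>k\<le>N. M (r k) \<omega> = S k (X \<omega>)"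
    using start_zero
  proof eventually_elim
    case (elim \<omega>)
    show ?case
    proof (intro allI impI)
      fix k assume k: "k \<le> N"
      have "S k (X \<omega>) = (\<Sum>j<k. B (\<tau> (Suc j)) \<omega> - B (\<tau> j) \<omega>)"
        unfolding S_def X_def using k by (intro sum.cong) auto
      also have "\<dots> = B (\<tau> k) \<omega> - B (\<tau> 0) \<omega>" by (rule sum_lessThan_telescope)
      also have "\<dots> = M (r k) \<omega>" using elim k \<tau> by (simp add: time_changed_def)
      finally show "M (r k) \<omega> = S k (X \<omega>)" by simp
    qed
  qed
  define V where "V = (\<lambda>x. exp (\<Sum>q\<in>grid n. grid_mass \<mu> n q * (\<Phi> (S N x, s) - \<Phi> (S (kk q) x, r (kk q)))))"
  have \<Phi>m: "(\<lambda>x. \<Phi> (x, u)) \<in> borel_measurable borel" if "u \<in> {0..1}" for u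
    using field_measurable[OF \<Phi> that, of 0] by (simp add: dx_def)
  have V_m [measurable]: "V \<in> borel_measurable PN"
    unfolding V_def
    by (intro borel_measurable_exp[THEN measurable_compose[rotated]] borel_measurable_sum borel_measurable_times
        borel_measurable_const borel_measurable_diff measurable_compose[OF S_m \<Phi>m] kk r) (use st in auto)
  have VW: "AE \<omega> in P. exp (path_weight \<Phi> (grid_floor n) \<mu> s \<omega>) = V (X \<omega>) \<and> M s \<omega> = S N (X \<omega>)"
    using BS AE_space
  proof eventually_elim
    case (elim \<omega>)
    have Ms: "M s \<omega> = S N (X \<omega>)" using elim(1) r(3) by (metis order.refl)
    have "path_weight \<Phi> (grid_floor n) \<mu> s \<omega> =
      (\<Sum>q\<in>grid n. grid_mass \<mu> n q * (\<Phi> (M s \<omega>, s) - \<Phi> (M (clamp01 (\<lambda>q. q) s q) \<omega>, clamp01 (\<lambda>q. q) s q)))"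
      using st by (intro path_weight_grid[OF \<Phi> elim(2) \<mu>]) auto
    also have "\<dots> = (\<Sum>q\<in>grid n. grid_mass \<mu> n q * (\<Phi> (S N (X \<omega>), s) - \<Phi> (S (kk q) (X \<omega>), r (kk q))))"
      using kk elim(1) Ms by (intro sum.cong) auto
    finally show ?case using Ms by (simp add: V_def)
  qed
  have W_m [measurable]: "(\<lambda>\<omega>. path_weight \<Phi> (grid_floor n) \<mu> s \<omega>) \<in> borel_measurable P"
  proof -
    have "(\<lambda>\<omega>. path_weight \<Phi> (grid_floor n) \<mu> s \<omega>) \<in> borel_measurable P \<longleftrightarrow>
      (\<lambda>\<omega>. \<Sum>q\<in>grid n. grid_mass \<mu> n q * (\<Phi> (M s \<omega>, s) - \<Phi> (M (clamp01 (\<lambda>q. q) s q) \<omega>, clamp01 (\<lambda>q. q) s q))) \<in> borel_measurable P"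
      using st by (intro measurable_cong path_weight_grid[OF \<Phi> _ \<mu>]) auto
    moreover have "\<dots>" using st by (intro borel_measurable_sum borel_measurable_times borel_measurable_const
        borel_measurable_diff path_value_measurable[OF \<Phi>] clamp01_unit) auto
    ultimately show ?thesis by blast
  qed
  have Ms_m [measurable]: "M s \<in> borel_measurable P" and Mt_m [measurable]: "M t \<in> borel_measurable P"
    using st by (auto intro: M_measurable)
  have X_m [measurable]: "X \<in> measurable P PN" using ind by (auto simp: indep_var_eq)
  have Y'_m [measurable]: "Y' \<in> measurable P P1" using ind by (auto simp: indep_var_eq)
  have N_m [measurable]: "(\<lambda>f. f N) \<in> borel_measurable P1" unfolding P1_def by measurable
  define H where "H = (\<lambda>(x, y). G (S N x) (y N) * V x)"
  have H_m [measurable]: "H \<in> borel_measurable (PN \<Otimes>\<^sub>M P1)" unfolding H_def by measurable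
  have AE1: "AE \<omega> in P. G (M s \<omega>) (M t \<omega> - M s \<omega>) * exp (path_weight \<Phi> (grid_floor n) \<mu> s \<omega>) = H (X \<omega>, Y' \<omega>)"
    using VW by eventually_elim (simp add: H_def Y'N Y)
  have Y_m [measurable]: "Y \<in> borel_measurable P" unfolding Y by measurable
  have "expectation (\<lambda>\<omega>. G (M s \<omega>) (M t \<omega> - M s \<omega>) * exp (path_weight \<Phi> (grid_floor n) \<mu> s \<omega>)) = expectation (\<lambda>\<omega>. H (X \<omega>, Y' \<omega>))"
    by (rule integral_cong_AE[OF _ _ AE1]) measurable
  also have "\<dots> = expectation (\<lambda>\<omega>. LINT y|distr P P1 Y'. H (X \<omega>, y))"
  proof (rule expectation_indep_pair[OF ind H_m])
    show "integrable P (\<lambda>\<omega>. H (X \<omega>, Y' \<omega>))"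
      by (subst integrable_cong_AE[OF _ _ AE1, symmetric]) (use int in \<open>auto\<close>)
  qed
  also have "\<dots> = expectation (\<lambda>\<omega>. (LINT z|gauss. G (M s \<omega>) (z * sqrt (deriv \<xi> t - deriv \<xi> s))) * exp (path_weight \<Phi> (grid_floor n) \<mu> s \<omega>))"
  proof (rule integral_cong_AE)
    have HL: "(LINT y|distr P P1 Y'. H (x, y)) = (LINT z|gauss. G (S N x) (z * sqrt (deriv \<xi> t - deriv \<xi> s))) * V x" for x
    proof -
      have [measurable]: "G a \<in> borel_measurable borel" for a by measurable
      have "(LINT y|distr P P1 Y'. H (x, y)) = (LINT y|distr P P1 Y'. G (S N x) (y N)) * V x" by (simp add: H_def)
      also have "(LINT y|distr P P1 Y'. G (S N x) (y N)) = (LINT y|distr P borel Y. G (S N x) y)"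
        by (simp add: integral_distr Y'N)
      also have "(LINT y|distr P borel Y. G (S N x) y) = (LINT z|gauss. G (S N x) (z * sqrt (deriv \<xi> t - deriv \<xi> s)))"
        unfolding Y using distr_increment[of s t] st by (simp add: integral_distr)
      finally show ?thesis .
    qed
    show "AE \<omega> in P. (LINT y|distr P P1 Y'. H (X \<omega>, y)) =
      (LINT z|gauss. G (M s \<omega>) (z * sqrt (deriv \<xi> t - deriv \<xi> s))) * exp (path_weight \<Phi> (grid_floor n) \<mu> s \<omega>)"
      using VW by eventually_elim (simp add: HL)
    interpret DY: prob_space "distr P P1 Y'" by (rule prob_space_distr) measurable
    show "(\<lambda>\<omega>. LINT y|distr P P1 Y'. H (X \<omega>, y)) \<in> borel_measurable P" by measurable
    show "(\<lambda>\<omega>. (LINT z|gauss. G (M s \<omega>) (z * sqrt (deriv \<xi> t - deriv \<xi> s))) * exp (path_weight \<Phi> (grid_floor n) \<mu> s \<omega>)) \<in> borel_measurable P"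
      by measurable
  qed
  finally show ?thesis .
qed

text \<open>Given the past, the factor by which the weight grows is
  \<open>exp (m * (\<Phi> (x + y, t) - \<Phi> (x, s)))\<close> with \<open>x\<close> the position at
  \<open>s\<close> and \<open>y\<close> the increment. The Gaussian step identifies
  \<open>exp (m * \<Phi> (x, s))\<close> with the normalization of the tilted mean.\<close>

lemma expectation_tilted:
  assumes R: "regular_field C (parisi_discrete \<xi> (discretized \<mu> n))" "0 \<le> C" and \<mu>: "\<mu> \<in> unit_measures"
    and st: "0 \<le> s" "s < t" "t \<le> 1" "grid n \<inter> {s<..t} = {}"
    and F [measurable]: "F \<in> borel_measurable borel" and K: "\<And>x. \<bar>F x\<bar> \<le> K"
  shows "expectation (\<lambda>\<omega>. F (M t \<omega>) * exp (path_weight (parisi_discrete \<xi> (discretized \<mu> n)) (grid_floor n) \<mu> t \<omega>))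
    = expectation (\<lambda>\<omega>. tilted_mean (measure (discretized \<mu> n) {0..s}) (deriv \<xi> t - deriv \<xi> s)
        (\<lambda>x. parisi_discrete \<xi> (discretized \<mu> n) (x, t)) F (M s \<omega>)
      * exp (path_weight (parisi_discrete \<xi> (discretized \<mu> n)) (grid_floor n) \<mu> s \<omega>))"
proof -
  define \<Phi> where "\<Phi> = parisi_discrete \<xi> (discretized \<mu> n)"
  define m where "m = measure (discretized \<mu> n) {0..s}"
  define v where "v = deriv \<xi> t - deriv \<xi> s"
  note R = R[folded \<Phi>_def]
  have [measurable]: "(\<lambda>x. \<Phi> (x, u)) \<in> borel_measurable borel" if "u \<in> {0..1}" for u
    using field_measurable[OF R(1) that, of 0] by (simp add: dx_def)
  have \<Phi>m [measurable]: "(\<lambda>x. \<Phi> (x, s)) \<in> borel_measurable borel" "(\<lambda>x. \<Phi> (x, t)) \<in> borel_measurable borel" using st by auto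
  define G where "G = (\<lambda>x y. F (x + y) * exp (m * (\<Phi> (x + y, t) - \<Phi> (x, s))))"
  have G [measurable]: "case_prod G \<in> borel_measurable (borel \<Otimes>\<^sub>M borel)"
    unfolding G_def case_prod_unfold
    by (intro borel_measurable_times borel_measurable_exp[THEN measurable_compose[rotated]] borel_measurable_diff borel_measurable_const
        measurable_compose[OF _ F] measurable_compose[OF _ \<Phi>m(1)] measurable_compose[OF _ \<Phi>m(2)]) measurable
  have eq: "F (M t \<omega>) * exp (path_weight \<Phi> (grid_floor n) \<mu> t \<omega>)
    = G (M s \<omega>) (M t \<omega> - M s \<omega>) * exp (path_weight \<Phi> (grid_floor n) \<mu> s \<omega>)" if "\<omega> \<in> space P" for \<omega>
    using path_weight_increment[OF R(1) that \<mu> st] by (simp add: G_def m_def exp_add mult_ac)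
  have int: "integrable P (\<lambda>\<omega>. F (M t \<omega>) * exp (path_weight \<Phi> (grid_floor n) \<mu> t \<omega>))"
    using st by (intro weighted_L2(3)[OF R \<mu> _ _ F K]) (auto simp: rounding_def)
  have "expectation (\<lambda>\<omega>. F (M t \<omega>) * exp (path_weight \<Phi> (grid_floor n) \<mu> t \<omega>))
    = expectation (\<lambda>\<omega>. G (M s \<omega>) (M t \<omega> - M s \<omega>) * exp (path_weight \<Phi> (grid_floor n) \<mu> s \<omega>))"
    by (intro Bochner_Integration.integral_cong eq) auto
  also have "\<dots> = expectation (\<lambda>\<omega>. (LINT z|gauss. G (M s \<omega>) (z * sqrt v)) * exp (path_weight \<Phi> (grid_floor n) \<mu> s \<omega>))"
    unfolding v_def
  proof (rule expectation_independent_increment[OF R(1) \<mu> st(1-3) G])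
    show "integrable P (\<lambda>\<omega>. G (M s \<omega>) (M t \<omega> - M s \<omega>) * exp (path_weight \<Phi> (grid_floor n) \<mu> s \<omega>))"
      using int by (subst Bochner_Integration.integrable_cong[OF refl eq[symmetric]]) auto
  qed
  finally have main: "expectation (\<lambda>\<omega>. F (M t \<omega>) * exp (path_weight \<Phi> (grid_floor n) \<mu> t \<omega>))
    = expectation (\<lambda>\<omega>. (LINT z|gauss. G (M s \<omega>) (z * sqrt v)) * exp (path_weight \<Phi> (grid_floor n) \<mu> s \<omega>))" .
  have tm: "(LINT z|gauss. G x (z * sqrt v)) = tilted_mean m v (\<lambda>x. \<Phi> (x, t)) F x" for x
  proof -
    obtain D where D: "jet D" "D 0 = (\<lambda>x. \<Phi> (x, t))" unfolding \<Phi>_def using parisi_discrete_jet by blast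
    interpret gaussian_layer m v D by standard (rule D)
    have "atoms (discretized \<mu> n) \<inter> {s<..<t} = {}" using atoms_discretized[OF \<mu>, of n] st(4) by force
    then have step: "\<Phi> (x, s) = gaussian_step m v (D 0) x"
      unfolding \<Phi>_def m_def v_def D(2) by (intro parisi_discrete_step discretized_discrete(1) \<mu> st)
    \<comment> \<open>For \<open>m = 0\<close> both sides are 1; otherwise this is the defining
      formula of the step, exponentiated.\<close>
    have "exp (m * \<Phi> (x, s)) = partition x"
    proof (cases "m = 0")
      case True then show ?thesis unfolding partition_def by (simp add: gauss_prob_UNIV)
    next
      case False
      then have "m * \<Phi> (x, s) = ln (partition x)" unfolding step by (simp add: gaussian_step_def partition_def)
      then show ?thesis using partition_pos[of x] by simp
    qed
    then have e: "exp (m * (y - \<Phi> (x, s))) = exp (m * y) / partition x" for y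
      by (simp add: right_diff_distrib exp_diff)
    have "(LINT z|gauss. G x (z * sqrt v)) = (LINT z|gauss. F (x + z * sqrt v) * exp (m * D 0 (x + z * sqrt v)) / partition x)"
      unfolding G_def e by (simp add: D(2))
    also have "\<dots> = E F x" unfolding E_eq by simp
    finally show ?thesis by (simp add: D(2))
  qed
  show ?thesis using main unfolding tm unfolding \<Phi>_def m_def v_def .
qed

lemma dx_jet:
  assumes "jet D" "D 0 = (\<lambda>x. \<Phi> (x, u))" "j \<le> 4"
  shows "dx j \<Phi> x u = D j x"
  using jet_deriv[OF assms(1,3)] assms(2) by (simp add: dx_def)

text \<open>\<open>expectation_tilted\<close> writes the moments at time \<open>t\<close> under the
  weight at time \<open>s\<close>. The pointwise estimates for one Gaussian step are then
  integrated; \<open>1 + L2_const C\<close> bounds the mean of the weight.\<close>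

lemma moment_increments:
  fixes n :: nat and \<mu> :: "real measure"
  defines "\<Phi> \<equiv> parisi_discrete \<xi> (discretized \<mu> n)"
  defines "mm \<equiv> \<lambda>j k. mixed_moment j k \<Phi> (grid_floor n) \<mu>"
  assumes R: "regular_field C \<Phi>" "0 \<le> C" and \<mu>: "\<mu> \<in> unit_measures"
    and st: "0 \<le> s" "s < t" "t \<le> 1" "grid n \<inter> {s<..t} = {}" and v1: "deriv \<xi> t - deriv \<xi> s \<le> 1"
  defines "v \<equiv> deriv \<xi> t - deriv \<xi> s"
  defines "K \<equiv> increment_const 289 * (1 + L2_const C)"
  shows "\<bar>mm 1 2 t t - mm 1 2 s s - v * mm 2 2 s t\<bar> \<le> K * (v * sqrt v)"
    "\<bar>mm 2 2 t t - mm 2 2 s s - v * (mm 3 2 s t - 2 * measure (discretized \<mu> n) {0..s} * mm 2 3 s t)\<bar> \<le> K * (v * sqrt v)"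
proof -
  define m where "m = measure (discretized \<mu> n) {0..s}"
  define e where "e = (\<lambda>\<omega>. exp (path_weight \<Phi> (grid_floor n) \<mu> s \<omega>))"
  have u: "s \<in> {0..1}" "t \<in> {0..1}" using st by auto
  have v: "0 \<le> v" "v \<le> 1" using deriv_mono[of s t] st v1 by (auto simp: v_def)
  have \<nu>: "discretized \<mu> n \<in> discrete_unit_measures" by (rule discretized_discrete(1)[OF \<mu>])
  have m: "m \<in> {0..1}" unfolding m_def by (rule cdf_unit[OF discrete_unit_measuresD(1)[OF \<nu>]])
  obtain D where DR: "regular_jet D" and D0: "D 0 = (\<lambda>x. \<Phi> (x, t))"
    unfolding \<Phi>_def using parisi_discrete_regular[OF \<nu>, of t] u by auto
  obtain H where HR: "regular_jet H" and H0: "H 0 = (\<lambda>x. \<Phi> (x, s))"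
    unfolding \<Phi>_def using parisi_discrete_regular[OF \<nu>, of s] u by auto
  note D = regular_jetD[OF DR] and H = regular_jetD[OF HR]
  have Dj: "dx j \<Phi> x t = D j x" "dx j \<Phi> x s = H j x" if "j \<le> 4" for j x
    using dx_jet[OF D(1) D0 that] dx_jet[OF H(1) H0 that] by auto
  interpret gaussian_layer m v D by standard (rule D)
  have "atoms (discretized \<mu> n) \<inter> {s<..<t} = {}" using atoms_discretized[OF \<mu>, of n] st(4) by force
  then have step: "H 0 = gaussian_step m v (D 0)"
    unfolding H0 D0 \<Phi>_def m_def v_def by (intro ext parisi_discrete_step \<nu> st)
  have inc: "\<bar>E (\<lambda>y. (D 1 y)\<^sup>2) x - (H 1 x)\<^sup>2 - v * (D 2 x)\<^sup>2\<bar> \<le> increment_const 289 * (v * sqrt v)"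
    "\<bar>E (\<lambda>y. (D 2 y)\<^sup>2) x - (H 2 x)\<^sup>2 - v * ((D 3 x)\<^sup>2 - 2 * m * (D 2 x) ^ 3)\<bar> \<le> increment_const 289 * (v * sqrt v)" for x
    by (intro gaussian_step_moment_increments D v m H step; simp)+
  have Dm [measurable]: "D j \<in> borel_measurable borel" "H j \<in> borel_measurable borel" if "j \<le> 4" for j
    using jet_measurable[OF D(1) that] jet_measurable[OF H(1) that] by auto
  have D123 [measurable]: "D 1 \<in> borel_measurable borel" "D 2 \<in> borel_measurable borel" "D 3 \<in> borel_measurable borel"
    "H 1 \<in> borel_measurable borel" "H 2 \<in> borel_measurable borel"
    by (intro Dm; simp)+
  have b: "\<bar>D j x ^ k\<bar> \<le> 289 ^ k" "\<bar>H j x ^ k\<bar> \<le> 289 ^ k" if "j \<in> {1..4}" for j k x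
    unfolding power_abs using D(3)[OF that] H(3)[OF that] by (auto intro: power_mono)
  have bs: "\<bar>(D 1 x)\<^sup>2\<bar> \<le> 289\<^sup>2" "\<bar>(D 2 x)\<^sup>2\<bar> \<le> 289\<^sup>2" "\<bar>(D 3 x)\<^sup>2\<bar> \<le> 289\<^sup>2" "\<bar>(D 2 x) ^ 3\<bar> \<le> 289 ^ 3"
    "\<bar>(H 1 x)\<^sup>2\<bar> \<le> 289\<^sup>2" "\<bar>(H 2 x)\<^sup>2\<bar> \<le> 289\<^sup>2" for x
    by (intro b; simp)+
  have D': "(D 1 has_real_derivative D 2 y) (at y)" "(D 2 has_real_derivative D 3 y) (at y)" for y
    using jet_has_derivative[OF D(1), of 1 y] jet_has_derivative[OF D(1), of 2 y] by (simp_all add: numeral_eq_Suc)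
  have eg: "exp_growth (D 1)" "exp_growth (D 2)" "exp_growth (D 3)" using jet_exp_growth[OF D(1)] by auto
  \<comment> \<open>Measurability of the tilted means is read off from their differentiability in
    \<open>x\<close>.\<close>
  have Em [measurable]: "E (\<lambda>y. (D 1 y)\<^sup>2) \<in> borel_measurable borel" "E (\<lambda>y. (D 2 y)\<^sup>2) \<in> borel_measurable borel"
  proof -
    have d: "((\<lambda>y. (D 1 y)\<^sup>2) has_real_derivative 2 * (D 1 y * D 2 y)) (at y)"
      "((\<lambda>y. (D 2 y)\<^sup>2) has_real_derivative 2 * (D 2 y * D 3 y)) (at y)" for y
      by (auto intro!: derivative_eq_intros D' D'[unfolded One_nat_def])
    have "isCont (E (\<lambda>y. (D 1 y)\<^sup>2)) x" "isCont (E (\<lambda>y. (D 2 y)\<^sup>2)) x" for x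
      by (rule DERIV_isCont[OF E_deriv[OF _ _ d(1)]] DERIV_isCont[OF E_deriv[OF _ _ d(2)]];
          intro exp_growth_power exp_growth_mult exp_growth_const eg)+
    then show "E (\<lambda>y. (D 1 y)\<^sup>2) \<in> borel_measurable borel" "E (\<lambda>y. (D 2 y)\<^sup>2) \<in> borel_measurable borel"
      by (auto intro!: borel_measurable_continuous_onI continuous_at_imp_continuous_on)
  qed
  have bE: "\<bar>E (\<lambda>y. (D 1 y)\<^sup>2) x\<bar> \<le> 289\<^sup>2" "\<bar>E (\<lambda>y. (D 2 y)\<^sup>2) x\<bar> \<le> 289\<^sup>2" for x
    by (intro E_abs_le exp_growth_power eg bs)+
  have wi: "integrable P (\<lambda>\<omega>. F (M s \<omega>) * e \<omega>)" if "F \<in> borel_measurable borel" "\<And>x. \<bar>F x\<bar> \<le> K" for F K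
    unfolding e_def by (rule weighted_L2(3)[OF R \<mu> u(1) _ that]) (auto simp: rounding_def)
  have wb: "\<bar>expectation (\<lambda>\<omega>. F (M s \<omega>) * e \<omega>)\<bar> \<le> k * (1 + L2_const C)" if "F \<in> borel_measurable borel" "\<And>x. \<bar>F x\<bar> \<le> k" for F k
    unfolding e_def by (rule weighted_L2(4)[OF R \<mu> u(1) _ that]) (auto simp: rounding_def)
  have mt: "mm 1 2 t t = expectation (\<lambda>\<omega>. E (\<lambda>y. (D 1 y)\<^sup>2) (M s \<omega>) * e \<omega>)"
    "mm 2 2 t t = expectation (\<lambda>\<omega>. E (\<lambda>y. (D 2 y)\<^sup>2) (M s \<omega>) * e \<omega>)"
    using expectation_tilted[OF R[unfolded \<Phi>_def] \<mu> st, of "\<lambda>y. (D 1 y)\<^sup>2" "289\<^sup>2"]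
      expectation_tilted[OF R[unfolded \<Phi>_def] \<mu> st, of "\<lambda>y. (D 2 y)\<^sup>2" "289\<^sup>2"] bs D123
    unfolding mm_def mixed_moment_def e_def D0 \<Phi>_def[symmetric] m_def v_def by (simp_all add: Dj)
  have ms: "mm 1 2 s s = expectation (\<lambda>\<omega>. (H 1 (M s \<omega>))\<^sup>2 * e \<omega>)" "mm 2 2 s s = expectation (\<lambda>\<omega>. (H 2 (M s \<omega>))\<^sup>2 * e \<omega>)"
    "mm 2 2 s t = expectation (\<lambda>\<omega>. (D 2 (M s \<omega>))\<^sup>2 * e \<omega>)" "mm 3 2 s t = expectation (\<lambda>\<omega>. (D 3 (M s \<omega>))\<^sup>2 * e \<omega>)"
    "mm 2 3 s t = expectation (\<lambda>\<omega>. (D 2 (M s \<omega>)) ^ 3 * e \<omega>)"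
    unfolding mm_def mixed_moment_def e_def by (simp_all add: Dj)
  have i: "integrable P (\<lambda>\<omega>. E (\<lambda>y. (D 1 y)\<^sup>2) (M s \<omega>) * e \<omega>)" "integrable P (\<lambda>\<omega>. E (\<lambda>y. (D 2 y)\<^sup>2) (M s \<omega>) * e \<omega>)"
    "integrable P (\<lambda>\<omega>. (H 1 (M s \<omega>))\<^sup>2 * e \<omega>)" "integrable P (\<lambda>\<omega>. (H 2 (M s \<omega>))\<^sup>2 * e \<omega>)"
    "integrable P (\<lambda>\<omega>. (D 2 (M s \<omega>))\<^sup>2 * e \<omega>)" "integrable P (\<lambda>\<omega>. (D 3 (M s \<omega>))\<^sup>2 * e \<omega>)"
    "integrable P (\<lambda>\<omega>. (D 2 (M s \<omega>)) ^ 3 * e \<omega>)"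
    using wi[OF Em(1) bE(1)] wi[OF Em(2) bE(2)] wi[of "\<lambda>x. (H 1 x)\<^sup>2", OF _ bs(5)] wi[of "\<lambda>x. (H 2 x)\<^sup>2", OF _ bs(6)]
      wi[of "\<lambda>x. (D 2 x)\<^sup>2", OF _ bs(2)] wi[of "\<lambda>x. (D 3 x)\<^sup>2", OF _ bs(3)] wi[of "\<lambda>x. (D 2 x) ^ 3", OF _ bs(4)]
    by simp_all
  have "mm 1 2 t t - mm 1 2 s s - v * mm 2 2 s t
    = expectation (\<lambda>\<omega>. (E (\<lambda>y. (D 1 y)\<^sup>2) (M s \<omega>) - (H 1 (M s \<omega>))\<^sup>2 - v * (D 2 (M s \<omega>))\<^sup>2) * e \<omega>)"
    unfolding mt ms using i by (simp add: left_diff_distrib mult.assoc)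
  also have "\<bar>\<dots>\<bar> \<le> increment_const 289 * (v * sqrt v) * (1 + L2_const C)"
    by (rule wb[OF _ inc(1)]) measurable
  finally show "\<bar>mm 1 2 t t - mm 1 2 s s - v * mm 2 2 s t\<bar> \<le> K * (v * sqrt v)" by (simp add: K_def mult_ac)
  have "mm 2 2 t t - mm 2 2 s s - v * (mm 3 2 s t - 2 * m * mm 2 3 s t)
    = expectation (\<lambda>\<omega>. (E (\<lambda>y. (D 2 y)\<^sup>2) (M s \<omega>) - (H 2 (M s \<omega>))\<^sup>2 - v * ((D 3 (M s \<omega>))\<^sup>2 - 2 * m * (D 2 (M s \<omega>)) ^ 3)) * e \<omega>)"
    unfolding mt ms using i by (simp add: left_diff_distrib right_diff_distrib mult.assoc)
  also have "\<bar>\<dots>\<bar> \<le> increment_const 289 * (v * sqrt v) * (1 + L2_const C)"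
    by (rule wb[OF _ inc(2)]) measurable
  finally show "\<bar>mm 2 2 t t - mm 2 2 s s - v * (mm 3 2 s t - 2 * measure (discretized \<mu> n) {0..s} * mm 2 3 s t)\<bar> \<le> K * (v * sqrt v)"
    by (simp add: K_def m_def mult_ac)
qed

end

section \<open>Integral formulas for the moments\<close>

text \<open>After division by \<open>t - s\<close> the error is a convergent quotient of
  \<open>X\<close> times the square root of a quantity tending to 0. The increment estimate is
  available only for ordered pairs, on both sides of \<open>r\<close>, with \<open>R\<close>
  evaluated at two nearby times.\<close>

lemma derivative_from_increments:
  fixes G X :: "real \<Rightarrow> real" and R :: "real \<Rightarrow> real \<Rightarrow> real"
  assumes r: "a < r" "r < b"
    and inc: "\<And>s t. a < s \<Longrightarrow> s < t \<Longrightarrow> t < b \<Longrightarrow> \<bar>G t - G s - (X t - X s) * R s t\<bar> \<le> K * ((X t - X s) * sqrt (X t - X s))"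
    and X: "(X has_real_derivative X') (at r)"
    and R: "\<And>s t. (\<And>n :: nat. s n \<in> {a<..<b}) \<Longrightarrow> (\<And>n. t n \<in> {a<..<b}) \<Longrightarrow> s \<longlonglongrightarrow> r \<Longrightarrow> t \<longlonglongrightarrow> r \<Longrightarrow> (\<lambda>n. R (s n) (t n)) \<longlonglongrightarrow> R r r"
  shows "(G has_real_derivative X' * R r r) (at r)"
  unfolding DERIV_def tendsto_at_iff_sequentially comp_def
proof (intro allI impI)
  fix h :: "nat \<Rightarrow> real" assume h: "\<forall>n. h n \<in> UNIV - {0}" "h \<longlonglongrightarrow> 0"
  have "0 < min (r - a) (b - r)" using r by simp
  from LIMSEQ_D[OF h(2) this] obtain N where N: "\<And>n. N \<le> n \<Longrightarrow> \<bar>h n\<bar> < min (r - a) (b - r)" by auto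
  define k where "k = (\<lambda>n. h (n + N))"
  have k: "k n \<noteq> 0" "\<bar>k n\<bar> < r - a" "\<bar>k n\<bar> < b - r" for n using h(1) N[of "n + N"] by (auto simp: k_def)
  have k0: "k \<longlonglongrightarrow> 0" unfolding k_def by (rule LIMSEQ_ignore_initial_segment[OF h(2)])
  \<comment> \<open>Ordering the pair \<open>r\<close>, \<open>r + k n\<close> treats increments of
    both signs at once; the difference quotients are unaffected.\<close>
  define s where "s = (\<lambda>n. min r (r + k n))"
  define t where "t = (\<lambda>n. max r (r + k n))"
  have st: "s n \<in> {a<..<b}" "t n \<in> {a<..<b}" "s n < t n" for n
    using k[of n] r by (auto simp: s_def t_def min_def max_def)
  have "(\<lambda>n. min r (r + k n)) \<longlonglongrightarrow> min r (r + 0)" "(\<lambda>n. max r (r + k n)) \<longlonglongrightarrow> max r (r + 0)"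
    by (intro tendsto_intros k0)+
  then have lim: "s \<longlonglongrightarrow> r" "t \<longlonglongrightarrow> r" by (simp_all add: s_def t_def)
  have quot: "(f (t n) - f (s n)) / (t n - s n) = (f (r + k n) - f r) / k n" for f :: "real \<Rightarrow> real" and n
    using k(1)[of n] by (auto simp: s_def t_def min_def max_def field_simps)
  have Xq: "(\<lambda>n. (X (t n) - X (s n)) / (t n - s n)) \<longlonglongrightarrow> X'"
    unfolding quot using X k0 k(1) by (auto simp: DERIV_def tendsto_at_iff_sequentially comp_def)
  have Xc: "isCont X r" using X by (rule DERIV_isCont)
  have Xst: "(\<lambda>n. X (t n) - X (s n)) \<longlonglongrightarrow> X r - X r"
    by (intro tendsto_diff isCont_tendsto_compose[OF Xc] lim)
  have quot_diff: "a / c - x / c * y = (a - x * y) / c" for a c x y :: real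
    by (simp add: diff_divide_distrib)
  have main: "(\<lambda>n. (G (t n) - G (s n)) / (t n - s n) - (X (t n) - X (s n)) / (t n - s n) * R (s n) (t n)) \<longlonglongrightarrow> 0"
  proof (rule Lim_null_comparison)
    show "\<forall>\<^sub>F n in sequentially. norm ((G (t n) - G (s n)) / (t n - s n) - (X (t n) - X (s n)) / (t n - s n) * R (s n) (t n))
      \<le> K * ((X (t n) - X (s n)) / (t n - s n) * sqrt (X (t n) - X (s n)))"
    proof (intro always_eventually allI)
      fix n
      have p: "0 < t n - s n" using st by simp
      have "(G (t n) - G (s n)) / (t n - s n) - (X (t n) - X (s n)) / (t n - s n) * R (s n) (t n)
        = (G (t n) - G (s n) - (X (t n) - X (s n)) * R (s n) (t n)) / (t n - s n)"
        by (rule quot_diff)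
      then have "norm ((G (t n) - G (s n)) / (t n - s n) - (X (t n) - X (s n)) / (t n - s n) * R (s n) (t n))
        = \<bar>G (t n) - G (s n) - (X (t n) - X (s n)) * R (s n) (t n)\<bar> / (t n - s n)" using p by simp
      also have "\<dots> \<le> K * ((X (t n) - X (s n)) * sqrt (X (t n) - X (s n))) / (t n - s n)"
        using p st[of n] by (intro divide_right_mono inc) auto
      finally show "norm ((G (t n) - G (s n)) / (t n - s n) - (X (t n) - X (s n)) / (t n - s n) * R (s n) (t n))
        \<le> K * ((X (t n) - X (s n)) / (t n - s n) * sqrt (X (t n) - X (s n)))" by simp
    qed
    have "(\<lambda>n. K * ((X (t n) - X (s n)) / (t n - s n) * sqrt (X (t n) - X (s n)))) \<longlonglongrightarrow> K * (X' * sqrt (X r - X r))"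
      by (intro tendsto_intros Xq Xst)
    then show "(\<lambda>n. K * ((X (t n) - X (s n)) / (t n - s n) * sqrt (X (t n) - X (s n)))) \<longlonglongrightarrow> 0" by simp
  qed
  have "(\<lambda>n. ((G (t n) - G (s n)) / (t n - s n) - (X (t n) - X (s n)) / (t n - s n) * R (s n) (t n))
      + (X (t n) - X (s n)) / (t n - s n) * R (s n) (t n)) \<longlonglongrightarrow> 0 + X' * R r r"
    by (intro tendsto_intros main Xq R st lim)
  then have "(\<lambda>n. (G (t n) - G (s n)) / (t n - s n)) \<longlonglongrightarrow> X' * R r r" by simp
  then have "(\<lambda>n. (G (r + h (n + N)) - G r) / h (n + N)) \<longlonglongrightarrow> X' * R r r" unfolding quot by (simp add: k_def)
  then show "(\<lambda>n. (G (r + h n) - G r) / h n) \<longlonglongrightarrow> X' * R r r" by (rule LIMSEQ_offset)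
qed

locale parisi_smooth = parisi_brownian \<xi> L P B
  for \<xi> :: "real \<Rightarrow> real" and L :: real and P :: "'a measure" and B :: "real \<Rightarrow> 'a \<Rightarrow> real" +
  fixes \<mu> :: "real measure"
  assumes deriv2: "u \<in> {0..1} \<Longrightarrow> (deriv \<xi> has_real_derivative (deriv ^^ 2) \<xi> u) (at u)"
    and deriv3: "u \<in> {0..1} \<Longrightarrow> ((deriv ^^ 2) \<xi> has_real_derivative (deriv ^^ 3) \<xi> u) (at u)"
    and \<mu>: "\<mu> \<in> unit_measures"
begin

abbreviation "\<nu> n \<equiv> discretized \<mu> n"
abbreviation "\<xi>'' \<equiv> (deriv ^^ 2) \<xi>"

definition discrete_moment :: "nat \<Rightarrow> nat \<Rightarrow> nat \<Rightarrow> real \<Rightarrow> real" where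
  "discrete_moment n j k u = mixed_moment j k (parisi_discrete \<xi> (\<nu> n)) (grid_floor n) \<mu> u u"

definition moment :: "nat \<Rightarrow> nat \<Rightarrow> real \<Rightarrow> real" where
  "moment j k u = mixed_moment j k (parisi_solution \<xi> \<mu>) (\<lambda>t. t) \<mu> u u"

text \<open>A fixed choice of the constant from \<open>regular_fields\<close>, common to all
  discretizations and to the limit.\<close>

definition field_const :: real where
  "field_const = (SOME C. (\<forall>\<nu>\<in>discrete_unit_measures. regular_field C (parisi_discrete \<xi> \<nu>)) \<and>
    (\<forall>\<mu>\<in>unit_measures. regular_field C (parisi_solution \<xi> \<mu>)))"

lemma regular: "regular_field field_const (parisi_discrete \<xi> (\<nu> n))" "regular_field field_const (parisi_solution \<xi> \<mu>)"
  "0 \<le> field_const"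
proof -
  note f = someI_ex[OF regular_fields, folded field_const_def]
  show "regular_field field_const (parisi_discrete \<xi> (\<nu> n))" using f discretized_discrete(1)[OF \<mu>] by blast
  show R: "regular_field field_const (parisi_solution \<xi> \<mu>)" using f \<mu> by blast
  have "0 \<le> \<bar>parisi_solution \<xi> \<mu> (0, 0) - parisi_solution \<xi> \<mu> (0, 1)\<bar>" by simp
  also have "\<dots> \<le> field_const * \<bar>0 - 1\<bar>" by (rule regular_fieldD(2)[OF R]) auto
  finally show "0 \<le> field_const" by simp
qed

lemma discrete_mixed_tendsto:
  assumes "j \<in> {1..3}" "\<And>i. s i \<in> {0..1}" "r \<in> {0..1}" "s \<longlonglongrightarrow> r" "\<And>i. u i \<in> {0..1}" "u \<longlonglongrightarrow> r"
  shows "(\<lambda>i. mixed_moment j k (parisi_discrete \<xi> (\<nu> n)) (grid_floor n) \<mu> (s i) (u i)) \<longlonglongrightarrow> discrete_moment n j k r"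
  unfolding discrete_moment_def
  by (rule mixed_moment_tendsto[OF regular(1) regular(1,3)]) (use assms \<mu> in \<open>auto simp: rounding_def intro!: uniform_limit_const\<close>)

lemma discrete_moment_continuous: "j \<in> {1..3} \<Longrightarrow> continuous_on {0..1} (discrete_moment n j k)"
  unfolding continuous_on_sequentially comp_def
  using discrete_mixed_tendsto[of j] unfolding discrete_moment_def by blast

lemma moment_continuous: "j \<in> {1..3} \<Longrightarrow> continuous_on {0..1} (moment j k)"
  unfolding continuous_on_sequentially comp_def moment_def
  by (intro ballI allI impI mixed_moment_tendsto[OF regular(2) regular(2,3)])
    (use \<mu> in \<open>auto simp: rounding_def intro!: uniform_limit_const\<close>)

lemma discrete_moment_tendsto:
  assumes "j \<in> {1..3}" "u \<in> {0..1}"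
  shows "(\<lambda>n. discrete_moment n j k u) \<longlonglongrightarrow> moment j k u"
  unfolding discrete_moment_def moment_def
  by (rule mixed_moment_tendsto[OF regular parisi_solution_uniform_limit[OF \<mu>]])
    (use assms \<mu> grid_floor_tendsto in \<open>auto simp: rounding_def\<close>)

lemma discrete_moment_bound:
  assumes "j \<in> {1..3}" "u \<in> {0..1}"
  shows "\<bar>discrete_moment n j k u\<bar> \<le> 289 ^ k * (1 + L2_const field_const)"
  unfolding discrete_moment_def
  using assms \<mu> by (intro mixed_moment_bound regular) (auto simp: rounding_def)

lemma discrete_moment_derivatives:
  assumes r: "0 < r" "r < 1" "r \<notin> grid n"
  shows "(discrete_moment n 1 2 has_real_derivative \<xi>'' r * discrete_moment n 2 2 r) (at r)"
    "(discrete_moment n 2 2 has_real_derivative \<xi>'' r * (discrete_moment n 3 2 r - 2 * measure (\<nu> n) {0..r} * discrete_moment n 2 3 r)) (at r)"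
proof -
  have "open (- grid n)" using grid(1) by (simp add: finite_imp_closed open_Compl)
  then obtain d0 where d0: "0 < d0" "ball r d0 \<subseteq> - grid n" using r(3) by (meson ComplI openE)
  \<comment> \<open>The neighbourhood avoids the grid, stays in the unit interval, and is so short
    that a step inside it has variance at most 1; \<open>L + 1\<close> excludes division by
    0.\<close>
  define d where "d = min (min d0 (min r (1 - r))) (1 / (2 * (L + 1)))"
  have d: "0 < d" "d \<le> d0" "d \<le> r" "d \<le> 1 - r" "2 * d * L \<le> 1"
  proof -
    show "0 < d" "d \<le> d0" "d \<le> r" "d \<le> 1 - r" using r d0 L_nonneg by (auto simp: d_def)
    have "d \<le> 1 / (2 * (L + 1))" by (simp add: d_def)
    then have "2 * d * (L + 1) \<le> 1" using L_nonneg by (simp add: field_simps)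
    then show "2 * d * L \<le> 1" using \<open>0 < d\<close> by (simp add: algebra_simps)
  qed
  have no: "grid n \<inter> {r - d<..<r + d} = {}"
  proof -
    have "{r - d<..<r + d} \<subseteq> ball r d0" using d by (auto simp: dist_real_def)
    then show ?thesis using d0 by blast
  qed
  define mm where "mm = (\<lambda>j k. mixed_moment j k (parisi_discrete \<xi> (\<nu> n)) (grid_floor n) \<mu>)"
  define m where "m = measure (\<nu> n) {0..r}"
  define K where "K = increment_const 289 * (1 + L2_const field_const)"
  have m: "measure (\<nu> n) {0..s} = m" if "r - d < s" "s < r + d" for s
    unfolding m_def
  proof (rule discrete_measure_cong[OF discretized_discrete(1)[OF \<mu>]])
    have "q \<le> s \<longleftrightarrow> q \<le> r" if q: "q \<in> grid n" for q
    proof -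
      have "q \<le> r - d \<or> r + d \<le> q" using no q by force
      then show ?thesis using \<open>r - d < s\<close> \<open>s < r + d\<close> d by linarith
    qed
    then show "atoms (\<nu> n) \<inter> {0..s} = atoms (\<nu> n) \<inter> {0..r}" using atoms_discretized[OF \<mu>, of n] by auto
  qed auto
  have cell: "0 \<le> s" "t \<le> 1" "grid n \<inter> {s<..t} = {}" "deriv \<xi> t - deriv \<xi> s \<le> 1" if "r - d < s" "s < t" "t < r + d" for s t
  proof -
    show st: "0 \<le> s" "t \<le> 1" using that d by auto
    have "{s<..t} \<subseteq> {r - d<..<r + d}" using that by auto
    then show "grid n \<inter> {s<..t} = {}" using no by blast
    have "deriv \<xi> t - deriv \<xi> s \<le> L * (t - s)" using deriv_lipschitz[of s t] that st by simp
    also have "\<dots> \<le> L * (2 * d)" using that L_nonneg by (intro mult_left_mono) auto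
    also have "\<dots> \<le> 1" using d by (simp add: mult_ac)
    finally show "deriv \<xi> t - deriv \<xi> s \<le> 1" .
  qed
  note inc = moment_increments[OF regular(1,3) \<mu>]
  have ru: "r \<in> {0..1}" using r by simp
  have u: "x \<in> {0..1}" if "x \<in> {r - d<..<r + d}" for x using that d by auto
  have lim: "(\<lambda>i. mm j k (s i) (t i)) \<longlonglongrightarrow> mm j k r r"
    if "\<And>i. s i \<in> {r - d<..<r + d}" "\<And>i. t i \<in> {r - d<..<r + d}" "s \<longlonglongrightarrow> r" "t \<longlonglongrightarrow> r" "j \<in> {1..3}" for s t :: "nat \<Rightarrow> real" and j k
    using discrete_mixed_tendsto[OF that(5) u[OF that(1)] ru that(3) u[OF that(2)] that(4), of k n]
    unfolding mm_def discrete_moment_def .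
  have dm: "discrete_moment n j k = (\<lambda>u. mm j k u u)" for j k by (simp add: discrete_moment_def mm_def fun_eq_iff)
  have rd: "r - d < r" "r < r + d" using d by auto
  show "(discrete_moment n 1 2 has_real_derivative \<xi>'' r * discrete_moment n 2 2 r) (at r)"
    unfolding dm
  proof (rule derivative_from_increments[OF rd, where R="mm 2 2" and X="deriv \<xi>" and K=K])
    show "\<bar>mm 1 2 t t - mm 1 2 s s - (deriv \<xi> t - deriv \<xi> s) * mm 2 2 s t\<bar> \<le> K * ((deriv \<xi> t - deriv \<xi> s) * sqrt (deriv \<xi> t - deriv \<xi> s))"
      if "r - d < s" "s < t" "t < r + d" for s t
      unfolding mm_def K_def by (rule inc(1)) (use that cell[OF that] in auto)
    show "(\<lambda>i. mm 2 2 (s i) (t i)) \<longlonglongrightarrow> mm 2 2 r r"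
      if "\<And>i. s i \<in> {r - d<..<r + d}" "\<And>i. t i \<in> {r - d<..<r + d}" "s \<longlonglongrightarrow> r" "t \<longlonglongrightarrow> r" for s t :: "nat \<Rightarrow> real"
      by (rule lim[OF that]) auto
  qed (use deriv2[OF ru] in auto)
  have "(discrete_moment n 2 2 has_real_derivative \<xi>'' r * (\<lambda>s t. mm 3 2 s t - 2 * m * mm 2 3 s t) r r) (at r)"
    unfolding dm
  proof (rule derivative_from_increments[OF rd, where R="\<lambda>s t. mm 3 2 s t - 2 * m * mm 2 3 s t" and X="deriv \<xi>" and K=K])
    show "\<bar>mm 2 2 t t - mm 2 2 s s - (deriv \<xi> t - deriv \<xi> s) * (mm 3 2 s t - 2 * m * mm 2 3 s t)\<bar> \<le> K * ((deriv \<xi> t - deriv \<xi> s) * sqrt (deriv \<xi> t - deriv \<xi> s))"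
      if "r - d < s" "s < t" "t < r + d" for s t
    proof -
      have ms: "measure (\<nu> n) {0..s} = m" using that by (intro m) auto
      show ?thesis unfolding ms[symmetric] unfolding mm_def K_def by (rule inc(2)) (use that cell[OF that] in auto)
    qed
    show "(\<lambda>i. mm 3 2 (s i) (t i) - 2 * m * mm 2 3 (s i) (t i)) \<longlonglongrightarrow> mm 3 2 r r - 2 * m * mm 2 3 r r"
      if "\<And>i. s i \<in> {r - d<..<r + d}" "\<And>i. t i \<in> {r - d<..<r + d}" "s \<longlonglongrightarrow> r" "t \<longlonglongrightarrow> r" for s t :: "nat \<Rightarrow> real"
      by (intro tendsto_intros lim[OF that]) auto
  qed (use deriv2[OF ru] in auto)
  then show "(discrete_moment n 2 2 has_real_derivative \<xi>'' r * (discrete_moment n 3 2 r - 2 * measure (\<nu> n) {0..r} * discrete_moment n 2 3 r)) (at r)"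
    unfolding dm m_def .
qed

lemma \<xi>''_continuous: "continuous_on {0..1} \<xi>''"
  by (intro continuous_at_imp_continuous_on ballI DERIV_isCont[OF deriv3])

lemma \<xi>''_bounded: obtains b where "0 \<le> b" "\<And>u. u \<in> {0..1} \<Longrightarrow> \<bar>\<xi>'' u\<bar> \<le> b"
proof -
  have "bounded (\<xi>'' ` {0..1})" by (intro compact_imp_bounded compact_continuous_image \<xi>''_continuous) auto
  then obtain b where "\<forall>u\<in>{0..1}. \<bar>\<xi>'' u\<bar> \<le> b" by (auto simp: bounded_iff)
  then have b: "\<bar>\<xi>'' u\<bar> \<le> b" if "u \<in> {0..1}" for u using that by blast
  moreover have "0 \<le> b" using order_trans[OF abs_ge_zero b[of 0]] by simp
  ultimately show ?thesis using that by blast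
qed

lemma moment_integrals:
  assumes ab: "0 \<le> a" "a \<le> b" "b \<le> 1"
  shows "((\<lambda>r. \<xi>'' r * moment 2 2 r) has_integral moment 1 2 b - moment 1 2 a) {a..b}" (is ?A)
    and "((\<lambda>r. \<xi>'' r * (moment 3 2 r - 2 * measure \<mu> {0..r} * moment 2 3 r)) has_integral moment 2 2 b - moment 2 2 a) {a..b}" (is ?B)
proof -
  obtain X2 where X2: "0 \<le> X2" "\<And>u. u \<in> {0..1} \<Longrightarrow> \<bar>\<xi>'' u\<bar> \<le> X2" using \<xi>''_bounded by blast
  define K where "K = 1 + L2_const field_const"
  have K: "0 \<le> K" using L2_const_nonneg by (simp add: K_def)
  have bd: "\<bar>discrete_moment n j k u\<bar> \<le> 289 ^ k * K" if "u \<in> {0..1}" "j \<in> {1..3}" for n j k u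
    using discrete_moment_bound[OF that(2,1)] by (simp add: K_def)
  have sub: "{a..b} \<subseteq> {0..1}" using ab by auto
  have c: "continuous_on {a..b} (discrete_moment n j k)" if "j \<in> {1..3}" for n j k
    by (rule continuous_on_subset[OF discrete_moment_continuous[OF that] sub])
  \<comment> \<open>Dominated convergence from the discretizations to \<open>\<mu>\<close>, shared
    by both formulas.\<close>
  have pass: "(g has_integral moment j 2 b - moment j 2 a) {a..b}"
    if j: "j \<in> {1..3}" and hi: "\<And>n. (f n has_integral discrete_moment n j 2 b - discrete_moment n j 2 a) {a..b}"
      and fb: "\<And>n r. r \<in> {a..b} \<Longrightarrow> \<bar>f n r\<bar> \<le> C" and fl: "\<And>r. r \<in> {a..b} \<Longrightarrow> (\<lambda>n. f n r) \<longlonglongrightarrow> g r"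
    for f :: "nat \<Rightarrow> real \<Rightarrow> real" and g j C
  proof -
    have dc: "g integrable_on {a..b}" "(\<lambda>n. integral {a..b} (f n)) \<longlonglongrightarrow> integral {a..b} g"
    proof -
      have "g integrable_on {a..b} \<and> (\<lambda>n. integral {a..b} (f n)) \<longlonglongrightarrow> integral {a..b} g"
        using hi fb fl by (intro conjI dominated_convergence[of f "{a..b}" "\<lambda>_. C" g]) (auto intro: has_integral_integrable)
      then show "g integrable_on {a..b}" "(\<lambda>n. integral {a..b} (f n)) \<longlonglongrightarrow> integral {a..b} g" by auto
    qed
    have "(\<lambda>n. integral {a..b} (f n)) = (\<lambda>n. discrete_moment n j 2 b - discrete_moment n j 2 a)"
      using hi by (auto intro: integral_unique)
    moreover have "(\<lambda>n. discrete_moment n j 2 b - discrete_moment n j 2 a) \<longlonglongrightarrow> moment j 2 b - moment j 2 a"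
      using ab by (intro tendsto_diff discrete_moment_tendsto j) auto
    ultimately have "integral {a..b} g = moment j 2 b - moment j 2 a"
      using dc(2) LIMSEQ_unique by metis
    then show ?thesis using dc(1) by (metis integrable_integral)
  qed
  \<comment> \<open>The fundamental theorem of calculus tolerates the finite set of grid points,
    since the moment is continuous there.\<close>
  have ftc: "(f has_integral discrete_moment n j 2 b - discrete_moment n j 2 a) {a..b}"
    if j: "j \<in> {1..3}" and d: "\<And>r. 0 < r \<Longrightarrow> r < 1 \<Longrightarrow> r \<notin> grid n \<Longrightarrow> (discrete_moment n j 2 has_real_derivative f r) (at r)" for f n j
    using d ab
    by (intro fundamental_theorem_of_calculus_interior_strong[OF grid(1)[of n] ab(2) _ c[OF j]])
      (auto simp: has_real_derivative_iff_has_vector_derivative[symmetric])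
  have cdf: "measure \<rho> {0..r} \<in> {0..1}" if "\<rho> \<in> unit_measures" for \<rho> r by (rule cdf_unit[OF that])
  have \<nu>u: "\<nu> n \<in> unit_measures" for n by (rule discrete_unit_measuresD(1)[OF discretized_discrete(1)[OF \<mu>]])
  have "((\<lambda>r. \<xi>'' r * discrete_moment n 2 2 r) has_integral discrete_moment n 1 2 b - discrete_moment n 1 2 a) {a..b}" for n
    using discrete_moment_derivatives(1)[of _ n] by (intro ftc) auto
  moreover have "\<bar>\<xi>'' r * discrete_moment n 2 2 r\<bar> \<le> X2 * (289 ^ 2 * K)" if "r \<in> {a..b}" for n r
    unfolding abs_mult using that sub X2 bd[of r 2 n 2] by (intro mult_mono) auto
  moreover have "(\<lambda>n. \<xi>'' r * discrete_moment n 2 2 r) \<longlonglongrightarrow> \<xi>'' r * moment 2 2 r" if "r \<in> {a..b}" for r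
    using that sub by (intro tendsto_intros discrete_moment_tendsto) auto
  moreover have "1 \<in> {1..3::nat}" by simp
  ultimately show ?A by (intro pass)
  have "((\<lambda>r. \<xi>'' r * (discrete_moment n 3 2 r - 2 * measure (\<nu> n) {0..r} * discrete_moment n 2 3 r))
      has_integral discrete_moment n 2 2 b - discrete_moment n 2 2 a) {a..b}" for n
    using discrete_moment_derivatives(2)[of _ n] by (intro ftc) auto
  moreover have "\<bar>\<xi>'' r * (discrete_moment n 3 2 r - 2 * measure (\<nu> n) {0..r} * discrete_moment n 2 3 r)\<bar> \<le> X2 * (289 ^ 2 * K + 2 * (289 ^ 3 * K))"
    if r: "r \<in> {a..b}" for n r
  proof -
    have ru: "r \<in> {0..1}" using r sub by blast
    have "\<bar>2 * measure (\<nu> n) {0..r} * discrete_moment n 2 3 r\<bar> \<le> 2 * (289 ^ 3 * K)"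
      unfolding abs_mult using cdf[OF \<nu>u, of n r] bd[OF ru, of 2 n 3] by (intro mult_mono) auto
    then have "\<bar>discrete_moment n 3 2 r - 2 * measure (\<nu> n) {0..r} * discrete_moment n 2 3 r\<bar> \<le> 289 ^ 2 * K + 2 * (289 ^ 3 * K)"
      using bd[OF ru, of 3 n 2] by simp
    then show ?thesis unfolding abs_mult using X2 ru by (intro mult_mono) auto
  qed
  moreover have "(\<lambda>n. \<xi>'' r * (discrete_moment n 3 2 r - 2 * measure (\<nu> n) {0..r} * discrete_moment n 2 3 r))
      \<longlonglongrightarrow> \<xi>'' r * (moment 3 2 r - 2 * measure \<mu> {0..r} * moment 2 3 r)" if "r \<in> {a..b}" for r
    using that sub by (intro tendsto_intros discrete_moment_tendsto discretized_cdf_tendsto \<mu>) auto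
  moreover have "2 \<in> {1..3::nat}" by simp
  ultimately show ?B by (intro pass)
qed

lemma moment_derivative:
  assumes u: "u \<in> {0..1}"
  shows "(moment 1 2 has_real_derivative \<xi>'' u * moment 2 2 u) (at u within {0..1})"
proof -
  have c: "continuous_on {0..1} (\<lambda>r. \<xi>'' r * moment 2 2 r)"
    by (intro continuous_intros \<xi>''_continuous moment_continuous) auto
  have "((\<lambda>x. integral {0..x} (\<lambda>r. \<xi>'' r * moment 2 2 r)) has_real_derivative \<xi>'' u * moment 2 2 u) (at u within {0..1})"
    using integral_has_real_derivative[OF c, of u] u by simp
  then have d0: "((\<lambda>x. integral {0..x} (\<lambda>r. \<xi>'' r * moment 2 2 r) + moment 1 2 0) has_real_derivative \<xi>'' u * moment 2 2 u + 0) (at u within {0..1})"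
    by (intro DERIV_add DERIV_const)
  have eqm: "integral {0..x} (\<lambda>r. \<xi>'' r * moment 2 2 r) + moment 1 2 0 = moment 1 2 x" if "x \<in> {0..1}" for x
    using integral_unique[OF moment_integrals(1)[of 0 x]] that by simp
  show ?thesis
    by (rule has_field_derivative_transform_within[OF d0[unfolded add_0_right] zero_less_one u]) (rule eqm)
qed

section \<open>One-sided limits and one-sided derivatives\<close>

lemma cdf_tendsto:
  assumes s: "s \<longlonglongrightarrow> u" and A: "A \<in> sets borel" "A \<subseteq> {0..}"
    and ev: "\<And>t. 0 \<le> t \<Longrightarrow> \<forall>\<^sub>F n in sequentially. t \<le> s n \<longleftrightarrow> t \<in> A"
  shows "(\<lambda>n. measure \<mu> {0..s n}) \<longlonglongrightarrow> measure \<mu> A"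
proof -
  interpret \<mu>: prob_space \<mu> using unit_measuresD[OF \<mu>] by simp
  have m [measurable_cong]: "sets \<mu> = sets borel" and sp: "space \<mu> = UNIV" using unit_measuresD[OF \<mu>] by auto
  have [measurable]: "A \<in> sets borel" by (rule A)
  have "(\<lambda>n. LINT t|\<mu>. indicator {0..s n} t :: real) \<longlonglongrightarrow> (LINT t|\<mu>. indicator A t)"
  proof (rule integral_dominated_convergence[where w="\<lambda>_. 1"])
    show "AE t in \<mu>. (\<lambda>n. indicator {0..s n} t :: real) \<longlonglongrightarrow> indicator A t"
    proof (intro AE_I2)
      fix t
      have "\<forall>\<^sub>F n in sequentially. (indicator {0..s n} t :: real) = indicator A t"
      proof (cases "0 \<le> t")
        case True
        from ev[OF True] show ?thesis by eventually_elim (use True in \<open>auto simp: indicator_def\<close>)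
      next
        case False
        then have "t \<notin> A" using A by auto
        then show ?thesis using False by (intro always_eventually) auto
      qed
      then show "(\<lambda>n. indicator {0..s n} t :: real) \<longlonglongrightarrow> indicator A t" by (rule tendsto_eventually)
    qed
  qed (auto split: split_indicator)
  then show ?thesis by (simp add: sp)
qed

lemma cdf_right_limit:
  shows "((\<lambda>r. measure \<mu> {0..r}) \<longlongrightarrow> measure \<mu> {0..u}) (at_right u)"
  unfolding tendsto_at_iff_sequentially comp_def
proof (intro allI impI)
  fix s :: "nat \<Rightarrow> real" assume s: "\<forall>i. s i \<in> {u<..} - {u}" "s \<longlonglongrightarrow> u"
  show "(\<lambda>n. measure \<mu> {0..s n}) \<longlonglongrightarrow> measure \<mu> {0..u}"
  proof (rule cdf_tendsto[OF s(2)])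
    fix t :: real assume t: "0 \<le> t"
    show "\<forall>\<^sub>F n in sequentially. t \<le> s n \<longleftrightarrow> t \<in> {0..u}"
    proof (cases "t \<le> u")
      case True
      then have "t \<le> s n" for n using s(1) by (auto intro: order_trans less_imp_le)
      then show ?thesis using True t by simp
    next
      case False
      then have "\<forall>\<^sub>F n in sequentially. s n < t" using order_tendstoD(2)[OF s(2)] by simp
      then show ?thesis by eventually_elim (use False in auto)
    qed
  qed auto
qed

lemma cdf_left_limit:
  shows "((\<lambda>r. measure \<mu> {0..r}) \<longlongrightarrow> measure \<mu> {0..<u}) (at_left u)"
  unfolding tendsto_at_iff_sequentially comp_def
proof (intro allI impI)
  fix s :: "nat \<Rightarrow> real" assume s: "\<forall>i. s i \<in> {..<u} - {u}" "s \<longlonglongrightarrow> u"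
  show "(\<lambda>n. measure \<mu> {0..s n}) \<longlonglongrightarrow> measure \<mu> {0..<u}"
  proof (rule cdf_tendsto[OF s(2)])
    fix t :: real assume t: "0 \<le> t"
    show "\<forall>\<^sub>F n in sequentially. t \<le> s n \<longleftrightarrow> t \<in> {0..<u}"
    proof (cases "t < u")
      case True
      then have "\<forall>\<^sub>F n in sequentially. t < s n" using order_tendstoD(1)[OF s(2)] by simp
      then show ?thesis by eventually_elim (use True t in auto)
    next
      case False
      then have "\<not> t \<le> s n" for n using s(1) by (auto simp: not_le intro: less_le_trans)
      then show ?thesis using False t by simp
    qed
  qed auto
qed

end

text \<open>On a short interval the integrand is within \<open>e / 2\<close> of \<open>l\<close>,
  except possibly at \<open>u\<close>, whose value has no influence on the integral. The exception
  matters after reflection, where an atom at \<open>u\<close> separates the value from the one-sided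
  limit.\<close>

lemma right_average_limit:
  fixes f F :: "real \<Rightarrow> real"
  assumes ub: "u < b" and F: "\<And>c d. u \<le> c \<Longrightarrow> c \<le> d \<Longrightarrow> d \<le> b \<Longrightarrow> (f has_integral F d - F c) {c..d}"
    and l: "(f \<longlongrightarrow> l) (at_right u)"
  shows "((\<lambda>h. (F (u + h) - F u) / h) \<longlongrightarrow> l) (at_right 0)"
proof (rule tendstoI)
  fix e :: real assume e: "0 < e"
  from tendstoD[OF l, of "e / 2"] e have "\<forall>\<^sub>F x in at_right u. dist (f x) l < e / 2" by simp
  then obtain c where c: "u < c" "\<And>x. u < x \<Longrightarrow> x < c \<Longrightarrow> dist (f x) l < e / 2"
    by (auto simp: eventually_at_right_field)
  show "\<forall>\<^sub>F h in at_right 0. dist ((F (u + h) - F u) / h) l < e"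
    unfolding eventually_at_right_field
  proof (intro exI conjI allI impI)
    show "0 < min (c - u) (b - u)" using c ub by simp
    fix h assume h: "0 < h" "h < min (c - u) (b - u)"
    have hi: "((\<lambda>x. f x - l) has_integral (F (u + h) - F u) - h * l) {u..u + h}"
      using has_integral_diff[OF F[of u "u + h"] has_integral_const_real[of l u "u + h"]] h by simp
    have "norm ((F (u + h) - F u) - h * l) \<le> (e / 2) * measure lborel {u..u + h}"
    proof (rule has_integral_bound_real[OF _ _ hi])
      show "finite {u}" by simp
      show "norm (f x - l) \<le> e / 2" if "x \<in> {u..u + h} - {u}" for x
        using c(2)[of x] that h by (cases "x = u + h") (auto simp: dist_real_def intro!: less_imp_le)
    qed (use e in simp)
    then have "\<bar>(F (u + h) - F u) - h * l\<bar> \<le> (e / 2) * h" using h by simp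
    moreover have "(F (u + h) - F u) / h - l = ((F (u + h) - F u) - h * l) / h" using h by (simp add: diff_divide_distrib)
    ultimately have "\<bar>(F (u + h) - F u) / h - l\<bar> \<le> e / 2" using h by (simp add: divide_le_eq)
    then show "dist ((F (u + h) - F u) / h) l < e" using e by (simp add: dist_real_def)
  qed
qed

text \<open>The right-hand version for the reflected functions \<open>f (- x)\<close> and
  \<open>- F (- x)\<close>.\<close>

lemma left_average_limit:
  fixes f F :: "real \<Rightarrow> real"
  assumes ub: "b < u" and F: "\<And>c d. b \<le> c \<Longrightarrow> c \<le> d \<Longrightarrow> d \<le> u \<Longrightarrow> (f has_integral F d - F c) {c..d}"
    and l: "(f \<longlongrightarrow> l) (at_left u)"
  shows "((\<lambda>h. (F (u + h) - F u) / h) \<longlongrightarrow> l) (at_left 0)"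
proof -
  have "((\<lambda>h. ((\<lambda>x. - F (- x)) (- u + h) - (\<lambda>x. - F (- x)) (- u)) / h) \<longlongrightarrow> l) (at_right 0)"
  proof (rule right_average_limit[where f="\<lambda>x. f (- x)" and b="- b"])
    show "((\<lambda>x. f (- x)) has_integral - F (- d) - - F (- c)) {c..d}" if "- u \<le> c" "c \<le> d" "d \<le> - b" for c d
    proof -
      have fi: "(f has_integral F (- c) - F (- d)) {- d..- c}" using that by (intro F) auto
      have "((\<lambda>x. f (- x)) has_integral F (- c) - F (- d)) {c..d}"
        using iffD2[OF has_integral_reflect_real fi] by (simp only: minus_minus)
      then show ?thesis by simp
    qed
    show "((\<lambda>x. f (- x)) \<longlongrightarrow> l) (at_right (- u))"
      using l by (simp add: at_left_minus filterlim_filtermap)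
  qed (use ub in simp)
  then have "((\<lambda>h. (F u - F (u - h)) / h) \<longlongrightarrow> l) (at_right 0)" by (simp add: algebra_simps)
  then have "((\<lambda>h. (F u - F (u + h)) / - h) \<longlongrightarrow> l) (at_left 0)"
    by (simp add: at_left_minus[of 0] filterlim_filtermap)
  then show ?thesis by (simp add: minus_divide_right[symmetric] minus_divide_left)
qed

context parisi_smooth
begin

text \<open>In the integrand of \<open>moment_integrals\<close> all factors are continuous except
  the distribution function. Its right limit includes a possible atom at \<open>u\<close> and its
  left limit excludes it, which is the whole difference between the two formulas.\<close>

lemma second_moment_one_sided:
  shows "u \<in> {0..<1} \<Longrightarrow> ((\<lambda>h. (moment 2 2 (u + h) - moment 2 2 u) / h) \<longlongrightarrow>
      \<xi>'' u * (moment 3 2 u - 2 * measure \<mu> {0..u} * moment 2 3 u)) (at_right 0)"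
    and "u \<in> {0<..1} \<Longrightarrow> ((\<lambda>h. (moment 2 2 (u + h) - moment 2 2 u) / h) \<longlongrightarrow>
      \<xi>'' u * (moment 3 2 u - 2 * measure \<mu> {0..<u} * moment 2 3 u)) (at_left 0)"
proof -
  have c: "(f \<longlongrightarrow> f u) (at u within {0..1})" if "continuous_on {0..1} f" "u \<in> {0..1}" for f :: "real \<Rightarrow> real" and u
    using that by (simp add: continuous_on_def)
  have cont: "continuous_on {0..1} \<xi>''" "continuous_on {0..1} (moment 3 2)" "continuous_on {0..1} (moment 2 3)"
    by (intro \<xi>''_continuous moment_continuous; simp)+
  show "((\<lambda>h. (moment 2 2 (u + h) - moment 2 2 u) / h) \<longlongrightarrow>
      \<xi>'' u * (moment 3 2 u - 2 * measure \<mu> {0..u} * moment 2 3 u)) (at_right 0)" if u: "u \<in> {0..<1}"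
  proof (rule right_average_limit[of u 1])
    have "at u within {u<..<1} \<le> at u within {0..1}" using u by (intro at_le) auto
    moreover have "at u within {u<..<1} = at_right u" using u by (intro at_within_nhd[of _ "{..<1}"]) auto
    ultimately have r: "(f \<longlongrightarrow> f u) (at_right u)" if "continuous_on {0..1} f" for f :: "real \<Rightarrow> real"
      using c[OF that, of u] u tendsto_mono by fastforce
    show "((\<lambda>r. \<xi>'' r * (moment 3 2 r - 2 * measure \<mu> {0..r} * moment 2 3 r)) \<longlongrightarrow>
        \<xi>'' u * (moment 3 2 u - 2 * measure \<mu> {0..u} * moment 2 3 u)) (at_right u)"
      by (intro tendsto_intros r cont cdf_right_limit)
  qed (use u in \<open>auto intro!: moment_integrals(2)\<close>)
  show "((\<lambda>h. (moment 2 2 (u + h) - moment 2 2 u) / h) \<longlongrightarrow>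
      \<xi>'' u * (moment 3 2 u - 2 * measure \<mu> {0..<u} * moment 2 3 u)) (at_left 0)" if u: "u \<in> {0<..1}"
  proof (rule left_average_limit[of 0 u])
    have "at u within {0<..<u} \<le> at u within {0..1}" using u by (intro at_le) auto
    moreover have "at u within {0<..<u} = at_left u" using u by (intro at_within_nhd[of _ "{0<..}"]) auto
    ultimately have r: "(f \<longlongrightarrow> f u) (at_left u)" if "continuous_on {0..1} f" for f :: "real \<Rightarrow> real"
      using c[OF that, of u] u tendsto_mono by fastforce
    show "((\<lambda>r. \<xi>'' r * (moment 3 2 r - 2 * measure \<mu> {0..r} * moment 2 3 r)) \<longlongrightarrow>
        \<xi>'' u * (moment 3 2 u - 2 * measure \<mu> {0..<u} * moment 2 3 u)) (at_left u)"
      by (intro tendsto_intros r cont cdf_left_limit)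
  qed (use u in \<open>auto intro!: moment_integrals(2)\<close>)
qed

text \<open>The product rule for one-sided quotients. The \<open>\<xi>''\<close> factor has a
  two-sided derivative, so only the moment's quotient depends on the side.\<close>

lemma product_one_sided:
  assumes u: "u \<in> {0..1}" and F: "F = at_right 0 \<or> F = at_left (0 :: real)"
    and l: "((\<lambda>h. (moment 2 2 (u + h) - moment 2 2 u) / h) \<longlongrightarrow> l) F"
  shows "((\<lambda>h. (\<xi>'' (u + h) * moment 2 2 (u + h) - \<xi>'' u * moment 2 2 u) / h) \<longlongrightarrow>
    (deriv ^^ 3) \<xi> u * moment 2 2 u + \<xi>'' u * l) F"
proof -
  have FF: "F \<le> at 0" using F by (auto intro: at_le)
  have q: "((\<lambda>h. (\<xi>'' (u + h) - \<xi>'' u) / h) \<longlongrightarrow> (deriv ^^ 3) \<xi> u) F"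
    using deriv3[OF u] FF by (auto simp: DERIV_def intro: tendsto_mono)
  have "((\<lambda>h. \<xi>'' (u + h)) \<longlongrightarrow> \<xi>'' u) (at 0)"
    using DERIV_isCont[OF deriv3[OF u]] by (simp add: isCont_def LIM_offset_zero_iff)
  then have c: "((\<lambda>h. \<xi>'' (u + h)) \<longlongrightarrow> \<xi>'' u) F" using FF by (rule tendsto_mono[rotated])
  have "((\<lambda>h. (\<xi>'' (u + h) - \<xi>'' u) / h * moment 2 2 u + \<xi>'' (u + h) * ((moment 2 2 (u + h) - moment 2 2 u) / h)) \<longlongrightarrow>
    (deriv ^^ 3) \<xi> u * moment 2 2 u + \<xi>'' u * l) F"
    by (intro tendsto_intros q c l)
  moreover have "(\<xi>'' (u + h) - \<xi>'' u) / h * moment 2 2 u + \<xi>'' (u + h) * ((moment 2 2 (u + h) - moment 2 2 u) / h)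
    = (\<xi>'' (u + h) * moment 2 2 (u + h) - \<xi>'' u * moment 2 2 u) / h" for h
    by (simp add: diff_divide_distrib algebra_simps)
  ultimately show ?thesis by (simp only:)
qed

text \<open>For \<open>t\<close> beyond \<open>u\<close> the clamped integrand is zero, and
  \<open>\<mu>\<close>-almost every \<open>t\<close> lies in the unit interval, so the clamp at 0
  changes nothing.\<close>

lemma parisi_weight_eq:
  assumes \<omega>: "\<omega> \<in> space P" and u: "u \<in> {0..1}"
  shows "parisi_weight \<xi> \<mu> B u \<omega> = path_weight (parisi_solution \<xi> \<mu>) (\<lambda>t. t) \<mu> u \<omega>"
proof -
  define \<Phi> where "\<Phi> = parisi_solution \<xi> \<mu>"
  note R = regular(2)[folded \<Phi>_def]
  note sets = unit_measuresD(2)[OF \<mu>]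
  show ?thesis
    unfolding parisi_weight_def path_weight_def set_lebesgue_integral_def \<Phi>_def[symmetric]
  proof (rule integral_cong_AE)
    have "continuous_on {0..u} (\<lambda>t. \<Phi> (M u \<omega>, u) - \<Phi> (M t \<omega>, t))"
      using u by (intro continuous_intros continuous_on_subset[OF path_continuous[OF R \<omega>]]) auto
    then have "(\<lambda>t. indicator {0..u} t *\<^sub>R (\<Phi> (M u \<omega>, u) - \<Phi> (M t \<omega>, t))) \<in> borel_measurable borel"
      by (intro borel_measurable_continuous_on_indicator) auto
    then show "(\<lambda>t. indicator {0..u} t *\<^sub>R (\<Phi> (M u \<omega>, u) - \<Phi> (M t \<omega>, t))) \<in> borel_measurable \<mu>"
      using sets by (subst measurable_cong_sets[OF sets refl]) auto
    show "(\<lambda>t. \<Phi> (M u \<omega>, u) - \<Phi> (M (clamp01 (\<lambda>t. t) u t) \<omega>, clamp01 (\<lambda>t. t) u t)) \<in> borel_measurable \<mu>"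
      by (intro borel_measurable_diff borel_measurable_const path_measurable[OF R \<omega> _ sets u]) auto
    show "AE t in \<mu>. indicator {0..u} t *\<^sub>R (\<Phi> (M u \<omega>, u) - \<Phi> (M t \<omega>, t)) =
      \<Phi> (M u \<omega>, u) - \<Phi> (M (clamp01 (\<lambda>t. t) u t) \<omega>, clamp01 (\<lambda>t. t) u t)"
      using unit_measure_AE[OF \<mu>] by eventually_elim (use u in \<open>auto simp: clamp01_def indicator_def\<close>)
  qed
qed

lemma parisi_moment_eq:
  assumes "u \<in> {0..1}"
  shows "parisi_moment j k \<xi> \<mu> P B u = moment j k u"
  unfolding parisi_moment_def moment_def mixed_moment_def parisi_dx_def dx_def
  using parisi_weight_eq[OF _ assms] by (intro Bochner_Integration.integral_cong) auto

lemma parisi_Gamma_derivatives: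
  defines "\<Gamma>' \<equiv> \<lambda>u. \<xi>'' u * moment 2 2 u"
  shows "u \<in> {0..1} \<Longrightarrow> (parisi_Gamma \<xi> \<mu> P B has_real_derivative \<Gamma>' u) (at u within {0..1})"
    and "continuous_on {0..1} \<Gamma>'"
    and "u \<in> {0..1} \<Longrightarrow> \<Gamma>' u = \<xi>'' u * parisi_moment 2 2 \<xi> \<mu> P B u"
    and "u \<in> {0..<1} \<Longrightarrow> ((\<lambda>h. (\<Gamma>' (u + h) - \<Gamma>' u) / h) \<longlongrightarrow>
       parisi_gamma1 \<xi> \<mu> P B u - measure \<mu> {0..u} * parisi_gamma2 \<xi> \<mu> P B u) (at_right 0)"
    and "u \<in> {0<..1} \<Longrightarrow> ((\<lambda>h. (\<Gamma>' (u + h) - \<Gamma>' u) / h) \<longlongrightarrow>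
       parisi_gamma1 \<xi> \<mu> P B u - measure \<mu> {0..<u} * parisi_gamma2 \<xi> \<mu> P B u) (at_left 0)"
proof -
  show "(parisi_Gamma \<xi> \<mu> P B has_real_derivative \<Gamma>' u) (at u within {0..1})" if u: "u \<in> {0..1}"
    unfolding \<Gamma>'_def
    by (rule has_field_derivative_transform_within[OF moment_derivative[OF u] zero_less_one u])
      (simp add: parisi_Gamma_def parisi_moment_eq)
  show "continuous_on {0..1} \<Gamma>'" unfolding \<Gamma>'_def
    by (intro continuous_intros \<xi>''_continuous moment_continuous) auto
  show "u \<in> {0..1} \<Longrightarrow> \<Gamma>' u = \<xi>'' u * parisi_moment 2 2 \<xi> \<mu> P B u"
    by (simp add: \<Gamma>'_def parisi_moment_eq)
  have g: "parisi_gamma1 \<xi> \<mu> P B u - m * parisi_gamma2 \<xi> \<mu> P B u =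
    (deriv ^^ 3) \<xi> u * moment 2 2 u + \<xi>'' u * (\<xi>'' u * (moment 3 2 u - 2 * m * moment 2 3 u))" if "u \<in> {0..1}" for u m
    unfolding parisi_gamma1_def parisi_gamma2_def parisi_moment_eq[OF that]
    by (simp only: power2_eq_square) (simp add: algebra_simps)
  show "((\<lambda>h. (\<Gamma>' (u + h) - \<Gamma>' u) / h) \<longlongrightarrow>
       parisi_gamma1 \<xi> \<mu> P B u - measure \<mu> {0..u} * parisi_gamma2 \<xi> \<mu> P B u) (at_right 0)" if u: "u \<in> {0..<1}"
  proof -
    have u': "u \<in> {0..1}" using u by simp
    show ?thesis unfolding \<Gamma>'_def g[OF u']
      by (rule product_one_sided[OF u' _ second_moment_one_sided(1)[OF u]]) simp
  qed
  show "((\<lambda>h. (\<Gamma>' (u + h) - \<Gamma>' u) / h) \<longlongrightarrow>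
       parisi_gamma1 \<xi> \<mu> P B u - measure \<mu> {0..<u} * parisi_gamma2 \<xi> \<mu> P B u) (at_left 0)" if u: "u \<in> {0<..1}"
  proof -
    have u': "u \<in> {0..1}" using u by simp
    show ?thesis unfolding \<Gamma>'_def g[OF u']
      by (rule product_one_sided[OF u' _ second_moment_one_sided(2)[OF u]]) simp
  qed
qed

end

section \<open>The mixture\<close>

text \<open>Inside the radius 2 the series is differentiated term by term; the coefficients of the
  \<open>j\<close>-th derivative are the iterated \<open>diffs\<close>.\<close>

lemma powser_higher_deriv:
  fixes c :: "nat \<Rightarrow> real"
  assumes c: "summable (\<lambda>n. c n * 2 ^ n)"
  shows "\<bar>x\<bar> < 2 \<Longrightarrow> summable (\<lambda>n. (diffs ^^ j) c n * x ^ n)"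
    and "\<bar>x\<bar> < 2 \<Longrightarrow> ((\<lambda>x. \<Sum>n. (diffs ^^ j) c n * x ^ n) has_real_derivative (\<Sum>n. (diffs ^^ Suc j) c n * x ^ n)) (at x)"
    and "\<bar>x\<bar> < 2 \<Longrightarrow> (deriv ^^ j) (\<lambda>x. \<Sum>n. c n * x ^ n) x = (\<Sum>n. (diffs ^^ j) c n * x ^ n)"
proof -
  have s: "\<forall>x. \<bar>x\<bar> < 2 \<longrightarrow> summable (\<lambda>n. (diffs ^^ j) c n * x ^ n)" for j
  proof (induction j)
    case 0
    then show ?case using powser_inside[OF c] by auto
  next
    case (Suc j)
    show ?case
    proof (intro allI impI)
      fix x :: real assume x: "\<bar>x\<bar> < 2"
      show "summable (\<lambda>n. (diffs ^^ Suc j) c n * x ^ n)"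
        using termdiff_converges[of x 2 "(diffs ^^ j) c"] Suc x by simp
    qed
  qed
  then show "\<bar>x\<bar> < 2 \<Longrightarrow> summable (\<lambda>n. (diffs ^^ j) c n * x ^ n)" by blast
  have d: "((\<lambda>x. \<Sum>n. (diffs ^^ j) c n * x ^ n) has_real_derivative (\<Sum>n. (diffs ^^ Suc j) c n * x ^ n)) (at x)"
    if x: "\<bar>x\<bar> < 2" for x j
  proof -
    \<comment> \<open>Termwise differentiation needs convergence at a point strictly beyond
      \<open>x\<close>; the midpoint between \<open>\<bar>x\<bar>\<close> and 2 serves.\<close>
    define k where "k = (\<bar>x\<bar> + 2) / 2"
    have k: "\<bar>x\<bar> < k" "k < 2" "0 \<le> k" using x by (auto simp: k_def)
    have "summable (\<lambda>n. (diffs ^^ j) c n * k ^ n)" using s k by auto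
    from termdiffs_strong[OF this, of x] k show ?thesis by simp
  qed
  then show "\<bar>x\<bar> < 2 \<Longrightarrow> ((\<lambda>x. \<Sum>n. (diffs ^^ j) c n * x ^ n) has_real_derivative (\<Sum>n. (diffs ^^ Suc j) c n * x ^ n)) (at x)" .
  have "\<forall>x. \<bar>x\<bar> < 2 \<longrightarrow> (deriv ^^ j) (\<lambda>x. \<Sum>n. c n * x ^ n) x = (\<Sum>n. (diffs ^^ j) c n * x ^ n)" for j
  proof (induction j)
    case (Suc j)
    show ?case
    proof (intro allI impI)
      fix x :: real assume x: "\<bar>x\<bar> < 2"
      have "((deriv ^^ j) (\<lambda>x. \<Sum>n. c n * x ^ n) has_real_derivative (\<Sum>n. (diffs ^^ Suc j) c n * x ^ n)) (at x)"
      proof (rule has_field_derivative_transform_within_open[OF d[OF x]])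
        show "open {-2<..<2 :: real}" by simp
        show "x \<in> {-2<..<2}" using x by auto
        show "(\<Sum>n. (diffs ^^ j) c n * y ^ n) = (deriv ^^ j) (\<lambda>x. \<Sum>n. c n * x ^ n) y" if "y \<in> {-2<..<2}" for y
          using Suc that by auto
      qed
      then show "(deriv ^^ Suc j) (\<lambda>x. \<Sum>n. c n * x ^ n) x = (\<Sum>n. (diffs ^^ Suc j) c n * x ^ n)"
        by (simp add: DERIV_imp_deriv)
    qed
  qed simp
  then show "\<bar>x\<bar> < 2 \<Longrightarrow> (deriv ^^ j) (\<lambda>x. \<Sum>n. c n * x ^ n) x = (\<Sum>n. (diffs ^^ j) c n * x ^ n)" by blast
qed

text \<open>The series of \<open>mixture\<close> starts at exponent 2, so it is first padded with
  two zero coefficients. It agrees with the power series only for \<open>\<bar>u\<bar> < 2\<close>,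
  but derivatives depend only on values near \<open>u\<close>; signs follow from the nonnegative
  coefficients.\<close>

lemma mixture_derivatives:
  assumes "summable (\<lambda>p. 2 ^ (p + 2) * (\<beta> (p + 2))\<^sup>2)"
  shows "\<bar>u\<bar> < 2 \<Longrightarrow> ((deriv ^^ j) (mixture \<beta>) has_real_derivative (deriv ^^ Suc j) (mixture \<beta>) u) (at u)"
    and "0 \<le> u \<Longrightarrow> u < 2 \<Longrightarrow> 0 \<le> (deriv ^^ j) (mixture \<beta>) u" "deriv (mixture \<beta>) 0 = 0"
proof -
  define c where "c = (\<lambda>n. if n < 2 then 0 else (\<beta> n)\<^sup>2)"
  have c0: "0 \<le> c n" for n by (simp add: c_def)
  have "summable (\<lambda>n. c (n + 2) * 2 ^ (n + 2))" using assms by (simp add: c_def mult.commute)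
  then have c: "summable (\<lambda>n. c n * 2 ^ n)" by (subst (asm) summable_iff_shift)
  have mix: "mixture \<beta> u = (\<Sum>n. c n * u ^ n)" if "\<bar>u\<bar> < 2" for u
  proof -
    have "(\<Sum>n. c n * u ^ n) = (\<Sum>n. c (n + 2) * u ^ (n + 2)) + (\<Sum>n<2. c n * u ^ n)"
      using powser_higher_deriv(1)[OF c that, of 0] by (intro suminf_split_initial_segment) simp
    then show ?thesis by (simp add: mixture_def c_def)
  qed
  have eq: "(deriv ^^ j) (mixture \<beta>) u = (\<Sum>n. (diffs ^^ j) c n * u ^ n)" if "\<bar>u\<bar> < 2" for u j
  proof -
    have "\<forall>\<^sub>F x in nhds u. mixture \<beta> x = (\<Sum>n. c n * x ^ n)"
      unfolding eventually_nhds using mix that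
      by (intro exI[of _ "{-2<..<2}"]) auto
    then have "(deriv ^^ j) (mixture \<beta>) u = (deriv ^^ j) (\<lambda>x. \<Sum>n. c n * x ^ n) u"
      by (rule higher_deriv_cong_ev) simp
    then show ?thesis using powser_higher_deriv(3)[OF c that] by simp
  qed
  show "\<bar>u\<bar> < 2 \<Longrightarrow> ((deriv ^^ j) (mixture \<beta>) has_real_derivative (deriv ^^ Suc j) (mixture \<beta>) u) (at u)"
  proof -
    assume u: "\<bar>u\<bar> < 2"
    show ?thesis unfolding eq[OF u]
    proof (rule has_field_derivative_transform_within_open[OF powser_higher_deriv(2)[OF c u]])
      show "open {-2<..<2 :: real}" by simp
      show "u \<in> {-2<..<2}" using u by auto
      show "(\<Sum>n. (diffs ^^ j) c n * y ^ n) = (deriv ^^ j) (mixture \<beta>) y" if "y \<in> {-2<..<2}" for y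
        using eq[of y j] that by auto
    qed
  qed
  have "0 \<le> (diffs ^^ j) c n" for n
    using c0 by (induction j arbitrary: n) (auto simp: diffs_def)
  then show "0 \<le> u \<Longrightarrow> u < 2 \<Longrightarrow> 0 \<le> (deriv ^^ j) (mixture \<beta>) u"
    using eq[of u j] powser_higher_deriv(1)[OF c, of u j] by (simp add: suminf_nonneg)
  have "deriv (mixture \<beta>) 0 = (\<Sum>n. diffs c n * 0 ^ n)" using eq[of 0 1] by simp
  then show "deriv (mixture \<beta>) 0 = 0" by (simp add: diffs_def c_def)
qed

theorem proposition3:
  fixes \<beta> :: "nat \<Rightarrow> real" and \<xi> :: "real \<Rightarrow> real" and \<mu> :: "real measure"
    and P :: "'a measure" and B :: "real \<Rightarrow> 'a \<Rightarrow> real"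
  assumes "summable (\<lambda>p. 2 ^ (p + 2) * (\<beta> (p + 2))\<^sup>2)"
    and "\<xi> = mixture \<beta>"
    and "\<mu> \<in> unit_measures"
    and "brownian_motion P B"
  shows "\<exists>\<Gamma>'.
    (\<forall>u\<in>{0..1}. (parisi_Gamma \<xi> \<mu> P B has_real_derivative \<Gamma>' u) (at u within {0..1})) \<and>
    continuous_on {0..1} \<Gamma>' \<and>
    (\<forall>u\<in>{0..1}. \<Gamma>' u = (deriv ^^ 2) \<xi> u * parisi_moment 2 2 \<xi> \<mu> P B u) \<and>
    (\<forall>u\<in>{0..<1}. ((\<lambda>h. (\<Gamma>' (u + h) - \<Gamma>' u) / h) \<longlongrightarrow>
       parisi_gamma1 \<xi> \<mu> P B u - measure \<mu> {0..u} * parisi_gamma2 \<xi> \<mu> P B u) (at_right 0)) \<and>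
    (\<forall>u\<in>{0<..1}. ((\<lambda>h. (\<Gamma>' (u + h) - \<Gamma>' u) / h) \<longlongrightarrow>
       parisi_gamma1 \<xi> \<mu> P B u - measure \<mu> {0..<u} * parisi_gamma2 \<xi> \<mu> P B u) (at_left 0))"
proof -
  note d = mixture_derivatives[OF assms(1), folded assms(2)]
  have d1: "(deriv \<xi> has_real_derivative (deriv ^^ 2) \<xi> u) (at u)"
    and d2: "((deriv ^^ 2) \<xi> has_real_derivative (deriv ^^ 3) \<xi> u) (at u)" if "u \<in> {0..1}" for u
    using d(1)[of u 1] d(1)[of u 2] that by (auto simp: numeral_eq_Suc)
  have "continuous_on {0..1} ((deriv ^^ 2) \<xi>)"
    by (intro continuous_at_imp_continuous_on ballI DERIV_isCont[OF d2])
  then have "bounded ((deriv ^^ 2) \<xi> ` {0..1})" by (intro compact_imp_bounded compact_continuous_image) auto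
  \<comment> \<open>A bound on the second derivative over the unit interval serves as Lipschitz
    constant of \<open>deriv \<xi>\<close>.\<close>
  then obtain L where L: "\<forall>u\<in>{0..1}. \<bar>(deriv ^^ 2) \<xi> u\<bar> \<le> L" by (auto simp: bounded_iff)
  have P: "parisi \<xi> L"
  proof
    show "deriv \<xi> s \<le> deriv \<xi> t" if "0 \<le> s" "s \<le> t" "t \<le> 1" for s t
    proof (rule DERIV_nonneg_imp_nondecreasing[OF that(2)])
      fix x assume "s \<le> x" "x \<le> t"
      then show "\<exists>y. (deriv \<xi> has_real_derivative y) (at x) \<and> 0 \<le> y"
        using d1[of x] d(2)[of x 2] that by auto
    qed
    show "deriv \<xi> t - deriv \<xi> s \<le> L * (t - s)" if "0 \<le> s" "s \<le> t" "t \<le> 1" for s t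
    proof -
      have "norm (deriv \<xi> t - deriv \<xi> s) \<le> L * norm (t - s)"
        by (rule field_differentiable_bound[where S="{0..1}" and f'="(deriv ^^ 2) \<xi>"])
          (use that L d1 in \<open>auto intro: has_field_derivative_at_within\<close>)
      then show ?thesis using that by simp
    qed
    show "deriv \<xi> 0 = 0" by (rule d(3))
  qed
  interpret parisi_smooth \<xi> L P B \<mu>
    by (intro parisi_smooth.intro parisi_brownian.intro P assms(4) parisi_smooth_axioms.intro d1 d2 assms(3))
  show ?thesis
    using parisi_Gamma_derivatives by (intro exI[of _ "\<lambda>u. \<xi>'' u * moment 2 2 u"] conjI ballI)
qed

end
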